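(* Let $\mathbb{F}$ be an algebraically closed field with $\mathrm{char}\,\mathbb{F}\neq 2$, let $G$ be an abelian group, and let $R=\mathcal{M}(G,T,\beta,\kappa,\gamma)$. Then the $G$-graded algebra $R$ admits an involution (compatible with the grading) if and only if $T$ is an elementary $2$-group and $\gamma$ is $*$-admissible (meaning: after a simultaneous reordering of components, $\kappa$ and $\gamma$ can be written in the form (1) of the context so that $\gamma$ is $*$-admissible). If $\varphi$ is an involution on $R$ compatible with the grading, then $(R,\varphi)$ is isomorphic to some $\mathcal{M}^*(G,T,\beta,\kappa,\gamma,\tau,\delta)$ where $\delta=\mathrm{sgn}(\varphi)$ (for $\kappa,\gamma$ suitably written in the form required for $\mathcal{M}^*$). Two $G$-graded algebras with involution, $\mathcal{M}^*(G,T_1,\beta_1,\kappa_1,\gamma_1,\tau_1,\delta_1)$ and $\mathcal{M}^*(G,T_2,\beta_2,\kappa_2,\gamma_2,\tau_2,\delta_2)$, are isomorphic if and only if $T_1=T_2$, $\beta_1=\beta_2$, $(\kappa_1,\gamma_1,\tau_1)\approx(\kappa_2,\gamma_2,\tau_2)$ and $\delta_1=\delta_2$.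
   Context: **Gradings, compatibility.** A $G$-grading on an algebra $U$ is a decomposition $U=\bigoplus_{g\in G}U_g$ into subspaces with $U_gU_h\subset U_{gh}$. An anti-automorphism $\varphi$ of $U$ is compatible with the grading if $\varphi(U_g)=U_g$ for all $g$; it is an involution if $\varphi^2=\mathrm{id}$. Pairs $(U_1,\varphi_1)$, $(U_2,\varphi_2)$ are isomorphic if there is a degree-preserving algebra isomorphism $\psi:U_1\to U_2$ with $\varphi_1=\psi^{-1}\varphi_2\psi$. For an involution $\varphi$ of a matrix algebra, $\mathrm{sgn}(\varphi)=1$ if $\varphi$ is a transpose (orthogonal) involution and $-1$ if it is symplectic. **Bicharacters and standard realizations.** An alternating bicharacter $\beta:T\times T\to\mathbb{F}^\times$ on an abelian group $T$ is multiplicative in each variable with $\beta(t,t)=1$ for all $t$; it is nondegenerate if $\beta(u,t)=1$ for all $u\in T$ implies $t=e$. For finite $T$ and nondegenerate $\beta$ there is a decomposition $T=H_1'\times H_1''\times\cdots\times H_r'\times H_r''$ with $H_i'=\langle a_i\rangle$, $H_i''=\langle b_i\rangle$ cyclic of the same order $\ell_i$, $\varepsilon_i:=\beta(a_i,b_i)$ a primitive $\ell_i$-th root of unity and all other values of $\beta$ on pairs of generators from different pairs equal to $1$. Let $X_i=\mathrm{diag}(\varepsilon_i^{\ell_i-1},\ldots,\varepsilon_i,1)\in M_{\ell_i}(\mathbb{F})$ and let $Y_i\in M_{\ell_i}(\mathbb{F})$ have entries $1$ at positions $(j,j+1)$, $1\le j<\ell_i$, and $(\ell_i,1)$, and $0$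 elsewhere; $\deg X_i=a_i$, $\deg Y_i=b_i$. Then $D=M_{\ell_1}(\mathbb{F})\otimes\cdots\otimes M_{\ell_r}(\mathbb{F})$ with the tensor product grading is a standard realization for $(T,\beta)$; $D_t$ is spanned by $X_t:=X_{a_1}^{i_1}X_{b_1}^{j_1}\cdots X_{a_r}^{i_r}X_{b_r}^{j_r}$ for $t=a_1^{i_1}b_1^{j_1}\cdots a_r^{i_r}b_r^{j_r}$, where $X_{a_i}$ (resp. $X_{b_i}$) is $X_i$ (resp. $Y_i$) in the $i$-th factor and $I$ elsewhere. For each $(T,\beta)$ one standard realization is fixed. If $T$ is an elementary $2$-group, $\beta(t)\in\{\pm1\}$ denotes the scalar with ${}^tX_t=\beta(t)X_t$ (${}^t$ on matrices is transpose). **The graded algebra $\mathcal{M}(G,T,\beta,\kappa,\gamma)$.** Let $T\subset G$ be a finite subgroup with nondegenerate alternating bicharacter $\beta$ and standard realization $D$, $\kappa=(k_1,\ldots,k_s)$ positive integers, $|\kappa|=\sum k_i$, $\gamma=(g_1,\ldots,g_s)$ with $g_i\in G$, $g_i^{-1}g_j\notin T$ for $i\neq j$. Let $C=M_{|\kappa|}(\mathbb{F})$ with diagonal block idempotents $e_1,\ldots,e_s$ given by $\kappa$. Then $\mathcal{M}(G,T,\beta,\kappa,\gamma)=C\otimes D$ with $U\otimes d$ of degree $g_i^{-1}tg_j$ for $U\in e_iCe_j$, $d\in D_t$. **The form (1).** For $0\le\ell\le m\le k$: $$(1)\quad\begin{aligned}\kappa&=(q_1,\ldots,q_\ell,2q_{\ell+1},\ldots,2q_m,q_{m+1},q_{m+1},\ldots,q_k,q_k),\\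 \gamma&=(g_1,\ldots,g_m,g_{m+1}',g_{m+1}'',\ldots,g_k',g_k''),\end{aligned}$$ where $q_i$ are positive integers, $q_1,\ldots,q_\ell$ odd, and the components of $\gamma$ are pairwise distinct mod $T$. **$*$-admissible.** With $T$ an elementary $2$-group and $\kappa,\gamma$ of form (1), $\gamma$ is $*$-admissible if $g_1^2\equiv\cdots\equiv g_m^2\equiv g_{m+1}'g_{m+1}''\equiv\cdots\equiv g_k'g_k''\pmod T$ and, for some $t_1,\ldots,t_\ell\in T$, $g_1^2t_1=\cdots=g_\ell^2t_\ell$ and $\beta(t_1)=\cdots=\beta(t_\ell)$ (the latter is automatic if $\ell\le1$). **$\mathcal{M}^*(G,T,\beta,\kappa,\gamma,\tau,\delta)$.** Let $T\subset G$ be an elementary $2$-group (of even rank) with nondegenerate alternating bicharacter $\beta$, let $\kappa,\gamma$ be of form (1), and let $\tau=(t_1,\ldots,t_m)\in T^m$ (empty if $m=0$) be such that $$g_1^2t_1=\cdots=g_m^2t_m=g_{m+1}'g_{m+1}''=\cdots=g_k'g_k''\quad\text{and}\quad\beta(t_1)=\cdots=\beta(t_\ell).$$ If $\ell>0$, $\delta$ is the common value of $\beta(t_1),\ldots,\beta(t_\ell)$; if $\ell=0$, $\delta\in\{\pm1\}$ is arbitrary. Let $R=\mathcal{M}(G,T,\beta,\kappa,\gamma)$ and $$\Phi=\sum_{i=1}^\ell I_{q_i}\otimes X_{t_i}\oplus\sum_{i=\ell+1}^mS_i\otimes X_{t_i}\oplus\sum_{i=m+1}^kS_i\otimes I$$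 (block diagonal), where for $\ell<i\le m$, $S_i=I_{2q_i}$ if $\beta(t_i)=\delta$ and $S_i=\begin{pmatrix}0&I_{q_i}\\-I_{q_i}&0\end{pmatrix}$ if $\beta(t_i)=-\delta$; and for $i>m$, $S_i=\begin{pmatrix}0&I_{q_i}\\\delta I_{q_i}&0\end{pmatrix}$. Then $\varphi(X)=\Phi^{-1}({}^tX)\Phi$ is an involution of $R$ compatible with the grading, with $\mathrm{sgn}(\varphi)=\delta$, and $\mathcal{M}^*(G,T,\beta,\kappa,\gamma,\tau,\delta)$ denotes $(R,\varphi)$. **Equivalence.** $(\kappa,\gamma,\tau)\approx(\widetilde\kappa,\widetilde\gamma,\widetilde\tau)$ means that $\ell,m,k$ are the same for both and there are $g\in G$ and a permutation $\pi$ of $\{1,\ldots,k\}$ preserving $\{1,\ldots,\ell\}$, $\{\ell+1,\ldots,m\}$ and $\{m+1,\ldots,k\}$ such that $\widetilde q_i=q_{\pi(i)}$ for all $i$; $\widetilde g_i\equiv g_{\pi(i)}g\pmod T$ for $i\le m$; $\{\widetilde g_i',\widetilde g_i''\}\equiv\{g_{\pi(i)}'g,g_{\pi(i)}''g\}\pmod T$ for $i>m$ (as unordered pairs); and, if $m>0$, $\widetilde t_i=t_{\pi(i)}$ for $i\le m$, while if $m=0$, $\widetilde g_i'\widetilde g_i''=g_{\pi(i)}'g_{\pi(i)}''g^2$ for some (hence all) $i$. *)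

theory Defs
  imports
    "Jordan_Normal_Form.VS_Connect"
    "Jordan_Normal_Form.Gauss_Jordan_Elimination"
    "HOL-Algebra.Multiplicative_Group"
    "HOL-Combinatorics.Permutations"
begin

text \<open>
  The grading group is a multiplicative commutative group in the sense of HOL-Algebra, matrices
  over the field are those of Jordan_Normal_Form, and a tensor product of matrix algebras is
  identified with a matrix algebra by means of the Kronecker product.
\<close>

section \<open>Graded matrix algebras and involutions\<close>

text \<open>
  The record stands for the algebra of all square matrices of the given size over the field,
  with its homogeneous components.
\<close>

record ('g, 'f) graded_matrix_algebra =
  gsize :: nat
  gcomp :: "'g \<Rightarrow> 'f mat set"

definition linear_on_mat :: "nat \<Rightarrow> ('f::field mat \<Rightarrow> 'f mat) \<Rightarrow> bool" where
  "linear_on_mat n f \<longleftrightarrow>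
     (\<forall>A\<in>carrier_mat n n. \<forall>B\<in>carrier_mat n n. f (A + B) = f A + f B) \<and>
     (\<forall>c. \<forall>A\<in>carrier_mat n n. f (c \<cdot>\<^sub>m A) = c \<cdot>\<^sub>m f A)"

definition mat_anti_automorphism :: "nat \<Rightarrow> ('f::field mat \<Rightarrow> 'f mat) \<Rightarrow> bool" where
  "mat_anti_automorphism n \<phi> \<longleftrightarrow>
     bij_betw \<phi> (carrier_mat n n) (carrier_mat n n) \<and> linear_on_mat n \<phi> \<and>
     (\<forall>A\<in>carrier_mat n n. \<forall>B\<in>carrier_mat n n. \<phi> (A * B) = \<phi> B * \<phi> A)"

definition mat_involution :: "nat \<Rightarrow> ('f::field mat \<Rightarrow> 'f mat) \<Rightarrow> bool" where
  "mat_involution n \<phi> \<longleftrightarrow>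
     mat_anti_automorphism n \<phi> \<and> (\<forall>A\<in>carrier_mat n n. \<phi> (\<phi> A) = A)"

definition graded_involution ::
  "('g, 'x) monoid_scheme \<Rightarrow> ('g, 'f::field) graded_matrix_algebra \<Rightarrow> ('f mat \<Rightarrow> 'f mat) \<Rightarrow> bool"
  where
  "graded_involution G R \<phi> \<longleftrightarrow>
     mat_involution (gsize R) \<phi> \<and> (\<forall>g\<in>carrier G. \<phi> ` gcomp R g = gcomp R g)"

definition graded_inv_isomorphic ::
  "('g, 'x) monoid_scheme \<Rightarrow>
   ('g, 'f::field) graded_matrix_algebra \<times> ('f mat \<Rightarrow> 'f mat) \<Rightarrow>
   ('g, 'f) graded_matrix_algebra \<times> ('f mat \<Rightarrow> 'f mat) \<Rightarrow> bool" where
  "graded_inv_isomorphic G U1 U2 \<longleftrightarrow>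
     (let R1 = fst U1; \<phi>1 = snd U1; R2 = fst U2; \<phi>2 = snd U2;
          C1 = carrier_mat (gsize R1) (gsize R1); C2 = carrier_mat (gsize R2) (gsize R2)
      in \<exists>\<psi>. bij_betw \<psi> C1 C2 \<and> linear_on_mat (gsize R1) \<psi> \<and>
           (\<forall>A\<in>C1. \<forall>B\<in>C1. \<psi> (A * B) = \<psi> A * \<psi> B) \<and>
           (\<forall>g\<in>carrier G. \<psi> ` gcomp R1 g = gcomp R2 g) \<and>
           (\<forall>A\<in>C1. \<phi>1 A = inv_into C1 \<psi> (\<phi>2 (\<psi> A))))"

definition adjoint_map :: "'f::field mat \<Rightarrow> 'f mat \<Rightarrow> 'f mat" where
  "adjoint_map \<Phi> A = the (mat_inverse \<Phi>) * transpose_mat A * \<Phi>"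

definition orthogonal_involution :: "nat \<Rightarrow> ('f::field mat \<Rightarrow> 'f mat) \<Rightarrow> bool" where
  "orthogonal_involution n \<phi> \<longleftrightarrow>
     (\<exists>\<Phi>\<in>carrier_mat n n. invertible_mat \<Phi> \<and> transpose_mat \<Phi> = \<Phi> \<and>
        (\<forall>A\<in>carrier_mat n n. \<phi> A = adjoint_map \<Phi> A))"

definition symplectic_involution :: "nat \<Rightarrow> ('f::field mat \<Rightarrow> 'f mat) \<Rightarrow> bool" where
  "symplectic_involution n \<phi> \<longleftrightarrow>
     (\<exists>\<Phi>\<in>carrier_mat n n. invertible_mat \<Phi> \<and> transpose_mat \<Phi> = - \<Phi> \<and>
        (\<forall>A\<in>carrier_mat n n. \<phi> A = adjoint_map \<Phi> A))"

text \<open>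
  The sign is an element of the field. The value 0 is never taken on an involution, since over
  a field of characteristic other than 2 each involution of a matrix algebra of positive size is
  of exactly one of the two kinds.
\<close>

definition inv_sgn :: "nat \<Rightarrow> ('f::field mat \<Rightarrow> 'f mat) \<Rightarrow> 'f" where
  "inv_sgn n \<phi> =
     (if orthogonal_involution n \<phi> then 1 else if symplectic_involution n \<phi> then - 1 else 0)"

section \<open>Bicharacters and standard realizations\<close>

text \<open>
  A bicharacter on \<open>T\<close> is an extensional function on \<open>T \<times> T\<close>, so that equality
  of bicharacters is equality of HOL functions.
\<close>

definition alternating_bicharacter ::
  "('g, 'x) monoid_scheme \<Rightarrow> 'g set \<Rightarrow> ('g \<times> 'g \<Rightarrow> 'f::field) \<Rightarrow> bool" where
  "alternating_bicharacter G T \<beta> \<longleftrightarrow>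
     \<beta> \<in> T \<times> T \<rightarrow>\<^sub>E - {0} \<and>
     (\<forall>u\<in>T. \<forall>v\<in>T. \<forall>t\<in>T. \<beta> (u \<otimes>\<^bsub>G\<^esub> v, t) = \<beta> (u, t) * \<beta> (v, t) \<and>
                          \<beta> (t, u \<otimes>\<^bsub>G\<^esub> v) = \<beta> (t, u) * \<beta> (t, v)) \<and>
     (\<forall>t\<in>T. \<beta> (t, t) = 1)"

definition nondegenerate_on ::
  "('g, 'x) monoid_scheme \<Rightarrow> 'g set \<Rightarrow> ('g \<times> 'g \<Rightarrow> 'f::field) \<Rightarrow> bool" where
  "nondegenerate_on G T \<beta> \<longleftrightarrow> (\<forall>t\<in>T. (\<forall>u\<in>T. \<beta> (u, t) = 1) \<longrightarrow> t = \<one>\<^bsub>G\<^esub>)"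

definition finite_bichar_pair ::
  "('g, 'x) monoid_scheme \<Rightarrow> 'g set \<Rightarrow> ('g \<times> 'g \<Rightarrow> 'f::field) \<Rightarrow> bool" where
  "finite_bichar_pair G T \<beta> \<longleftrightarrow>
     subgroup T G \<and> finite T \<and> alternating_bicharacter G T \<beta> \<and> nondegenerate_on G T \<beta>"

definition elementary_2_group :: "('g, 'x) monoid_scheme \<Rightarrow> 'g set \<Rightarrow> bool" where
  "elementary_2_group G T \<longleftrightarrow> (\<forall>t\<in>T. t \<otimes>\<^bsub>G\<^esub> t = \<one>\<^bsub>G\<^esub>)"

text \<open>
  A standard realization is given by the list of the generator pairs \<open>(a\<^sub>i, b\<^sub>i)\<close>, and elements
  of \<open>T\<close> are written with lists of exponent pairs \<open>(i, j)\<close>, the word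
  being the product of all \<open>a\<^sup>i b\<^sup>j\<close>. That
  every element of \<open>T\<close> is uniquely a word with exponents below the orders says that
  \<open>T\<close> is the internal direct product of the cyclic groups generated by the
  \<open>a\<^sub>i\<close> and \<open>b\<^sub>i\<close>.
\<close>

definition exponents ::
  "('g, 'x) monoid_scheme \<Rightarrow> ('g \<times> 'g) list \<Rightarrow> (nat \<times> nat) list set" where
  "exponents G ab =
     {es. list_all2 (\<lambda>(a, b) (i, j). i < group.ord G a \<and> j < group.ord G b) ab es}"

definition gen_word ::
  "('g, 'x) monoid_scheme \<Rightarrow> ('g \<times> 'g) list \<Rightarrow> (nat \<times> nat) list \<Rightarrow> 'g" where
  "gen_word G ab es =
     foldr (\<lambda>x y. x \<otimes>\<^bsub>G\<^esub> y)
       (map2 (\<lambda>(a, b) (i, j). a [^]\<^bsub>G\<^esub> i \<otimes>\<^bsub>G\<^esub> b [^]\<^bsub>G\<^esub> j) ab es) \<one>\<^bsub>G\<^esub>"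

definition primitive_root_of_unity :: "nat \<Rightarrow> 'f::field \<Rightarrow> bool" where
  "primitive_root_of_unity l \<epsilon> \<longleftrightarrow> 0 < l \<and> \<epsilon> ^ l = 1 \<and> (\<forall>j. 0 < j \<and> j < l \<longrightarrow> \<epsilon> ^ j \<noteq> 1)"

definition standard_generators ::
  "('g, 'x) monoid_scheme \<Rightarrow> 'g set \<Rightarrow> ('g \<times> 'g \<Rightarrow> 'f::field) \<Rightarrow> ('g \<times> 'g) list \<Rightarrow> bool"
  where
  "standard_generators G T \<beta> ab \<longleftrightarrow>
     (\<forall>(a, b)\<in>set ab. a \<in> T \<and> b \<in> T \<and> group.ord G a = group.ord G b \<and>
        primitive_root_of_unity (group.ord G a) (\<beta> (a, b))) \<and>
     (\<forall>i<length ab. \<forall>j<length ab. i \<noteq> j \<longrightarrow>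
        (\<forall>x\<in>{fst (ab ! i), snd (ab ! i)}. \<forall>y\<in>{fst (ab ! j), snd (ab ! j)}. \<beta> (x, y) = 1)) \<and>
     bij_betw (gen_word G ab) (exponents G ab) T"

definition kron :: "'f::times mat \<Rightarrow> 'f mat \<Rightarrow> 'f mat" where
  "kron A B = mat (dim_row A * dim_row B) (dim_col A * dim_col B)
     (\<lambda>(i, j). A $$ (i div dim_row B, j div dim_col B) * B $$ (i mod dim_row B, j mod dim_col B))"

definition X_mat :: "nat \<Rightarrow> 'f::field \<Rightarrow> 'f mat" where
  "X_mat l \<epsilon> = mat l l (\<lambda>(i, j). if i = j then \<epsilon> ^ (l - 1 - i) else 0)"

definition Y_mat :: "nat \<Rightarrow> 'f::field mat" where
  "Y_mat l = mat l l (\<lambda>(i, j). if j = i + 1 \<or> (i = l - 1 \<and> j = 0) then 1 else 0)"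

definition D_size :: "('g, 'x) monoid_scheme \<Rightarrow> ('g \<times> 'g) list \<Rightarrow> nat" where
  "D_size G ab = prod_list (map (\<lambda>(a, b). group.ord G a) ab)"

definition X_elt ::
  "('g, 'x) monoid_scheme \<Rightarrow> ('g \<times> 'g \<Rightarrow> 'f::field) \<Rightarrow> ('g \<times> 'g) list \<Rightarrow> 'g \<Rightarrow> 'f mat" where
  "X_elt G \<beta> ab t =
     foldr kron
       (map2 (\<lambda>(a, b) (i, j). X_mat (group.ord G a) (\<beta> (a, b)) ^\<^sub>m i * Y_mat (group.ord G b) ^\<^sub>m j)
          ab (inv_into (exponents G ab) (gen_word G ab) t))
       (1\<^sub>m 1)"

definition beta_sign ::
  "('g, 'x) monoid_scheme \<Rightarrow> ('g \<times> 'g \<Rightarrow> 'f::field) \<Rightarrow> ('g \<times> 'g) list \<Rightarrow> 'g \<Rightarrow> 'f" where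
  "beta_sign G \<beta> ab t = (THE c. transpose_mat (X_elt G \<beta> ab t) = c \<cdot>\<^sub>m X_elt G \<beta> ab t)"

section \<open>The graded algebras \<open>\<M>(G,T,\<beta>,\<kappa>,\<gamma>)\<close>\<close>

definition M_data ::
  "('g, 'x) monoid_scheme \<Rightarrow> 'g set \<Rightarrow> ('g \<times> 'g \<Rightarrow> 'f::field) \<Rightarrow> nat list \<Rightarrow> 'g list \<Rightarrow> bool"
  where
  "M_data G T \<beta> \<kappa> \<gamma> \<longleftrightarrow>
     finite_bichar_pair G T \<beta> \<and> \<kappa> \<noteq> [] \<and> (\<forall>n\<in>set \<kappa>. 0 < n) \<and>
     length \<gamma> = length \<kappa> \<and> set \<gamma> \<subseteq> carrier G \<and>
     (\<forall>i<length \<gamma>. \<forall>j<length \<gamma>. i \<noteq> j \<longrightarrow> inv\<^bsub>G\<^esub> (\<gamma> ! i) \<otimes>\<^bsub>G\<^esub> (\<gamma> ! j) \<notin> T)"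

definition block_idem :: "nat list \<Rightarrow> nat \<Rightarrow> 'f::field mat" where
  "block_idem \<kappa> i =
     diag_block_mat
       (map (\<lambda>j. if j = i then 1\<^sub>m (\<kappa> ! j) else 0\<^sub>m (\<kappa> ! j) (\<kappa> ! j)) [0..<length \<kappa>])"

definition mat_span :: "nat \<Rightarrow> 'f::field mat set \<Rightarrow> 'f mat set" where
  "mat_span n S = LinearCombinations.module.span class_ring (module_mat TYPE('f) n n) S"

definition M_alg ::
  "('g, 'x) monoid_scheme \<Rightarrow> 'g set \<Rightarrow> ('g \<times> 'g \<Rightarrow> 'f::field) \<Rightarrow> ('g \<times> 'g) list \<Rightarrow>
   nat list \<Rightarrow> 'g list \<Rightarrow> ('g, 'f) graded_matrix_algebra" where
  "M_alg G T \<beta> ab \<kappa> \<gamma> =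
     (let c = sum_list \<kappa>; n = c * D_size G ab in
      \<lparr> gsize = n,
        gcomp = (\<lambda>g. mat_span n
          {kron (block_idem \<kappa> i * A * block_idem \<kappa> j) (X_elt G \<beta> ab t) | A i j t.
             A \<in> carrier_mat c c \<and> i < length \<kappa> \<and> j < length \<kappa> \<and> t \<in> T \<and>
             inv\<^bsub>G\<^esub> (\<gamma> ! i) \<otimes>\<^bsub>G\<^esub> t \<otimes>\<^bsub>G\<^esub> (\<gamma> ! j) = g}) \<rparr>)"

section \<open>Paired data, admissibility and the algebras with involution\<close>

text \<open>
  Such data encode
  \<open>\<kappa> = (q\<^sub>1, \<dots>, q\<^sub>\<ell>, 2q\<^sub>\<ell>\<^sub>+\<^sub>1, \<dots>, 2q\<^sub>m, q\<^sub>m\<^sub>+\<^sub>1, q\<^sub>m\<^sub>+\<^sub>1, \<dots>, q\<^sub>k, q\<^sub>k)\<close> and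
  \<open>\<gamma> = (g\<^sub>1, \<dots>, g\<^sub>m, g\<^sub>m\<^sub>+\<^sub>1', g\<^sub>m\<^sub>+\<^sub>1'', \<dots>, g\<^sub>k', g\<^sub>k'')\<close>.
  The fields are \<open>\<ell>, m, k\<close>, the multiplicities \<open>q\<^sub>i\<close>
  (\<open>1 \<le> i \<le> k\<close>), the elements \<open>g\<^sub>i\<close> (\<open>1 \<le> i \<le> m\<close>) and the pairs
  \<open>g\<^sub>i', g\<^sub>i''\<close> (\<open>m < i \<le> k\<close>). Indices start at 1, and values of the functions
  outside these ranges play no role.
\<close>

record 'g form1 =
  f_l :: nat
  f_m :: nat
  f_k :: nat
  f_q :: "nat \<Rightarrow> nat"
  f_g :: "nat \<Rightarrow> 'g"
  f_g' :: "nat \<Rightarrow> 'g"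
  f_g'' :: "nat \<Rightarrow> 'g"

definition form_kappa :: "'g form1 \<Rightarrow> nat list" where
  "form_kappa F =
     map (f_q F) [1..<Suc (f_l F)] @
     map (\<lambda>i. 2 * f_q F i) [Suc (f_l F)..<Suc (f_m F)] @
     concat (map (\<lambda>i. [f_q F i, f_q F i]) [Suc (f_m F)..<Suc (f_k F)])"

definition form_gamma :: "'g form1 \<Rightarrow> 'g list" where
  "form_gamma F =
     map (f_g F) [1..<Suc (f_m F)] @
     concat (map (\<lambda>i. [f_g' F i, f_g'' F i]) [Suc (f_m F)..<Suc (f_k F)])"

definition is_form1 ::
  "('g, 'x) monoid_scheme \<Rightarrow> 'g set \<Rightarrow> ('g \<times> 'g \<Rightarrow> 'f::field) \<Rightarrow> 'g form1 \<Rightarrow> bool" where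
  "is_form1 G T \<beta> F \<longleftrightarrow>
     f_l F \<le> f_m F \<and> f_m F \<le> f_k F \<and>
     (\<forall>i\<in>{1..f_k F}. 0 < f_q F i) \<and> (\<forall>i\<in>{1..f_l F}. odd (f_q F i)) \<and>
     M_data G T \<beta> (form_kappa F) (form_gamma F)"

definition star_admissible ::
  "('g, 'x) monoid_scheme \<Rightarrow> 'g set \<Rightarrow> ('g \<times> 'g \<Rightarrow> 'f::field) \<Rightarrow> ('g \<times> 'g) list \<Rightarrow>
   'g form1 \<Rightarrow> bool" where
  "star_admissible G T \<beta> ab F \<longleftrightarrow>
     (let p = (\<lambda>i. if i \<le> f_m F then f_g F i \<otimes>\<^bsub>G\<^esub> f_g F i else f_g' F i \<otimes>\<^bsub>G\<^esub> f_g'' F i) in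
      (\<forall>i\<in>{1..f_k F}. \<forall>j\<in>{1..f_k F}. (p i, p j) \<in> rcong\<^bsub>G\<^esub> T)) \<and>
     (\<exists>t. (\<forall>i\<in>{1..f_l F}. t i \<in> T) \<and>
        (\<forall>i\<in>{1..f_l F}. \<forall>j\<in>{1..f_l F}.
           f_g F i \<otimes>\<^bsub>G\<^esub> f_g F i \<otimes>\<^bsub>G\<^esub> t i = f_g F j \<otimes>\<^bsub>G\<^esub> f_g F j \<otimes>\<^bsub>G\<^esub> t j \<and>
           beta_sign G \<beta> ab (t i) = beta_sign G \<beta> ab (t j)))"

text \<open>\<open>\<tau> = (t\<^sub>1, \<dots>, t\<^sub>m)\<close> is a function of which only the values on \<open>{1..m}\<close> matter.\<close>

definition M_star_data ::
  "('g, 'x) monoid_scheme \<Rightarrow> 'g set \<Rightarrow> ('g \<times> 'g \<Rightarrow> 'f::field) \<Rightarrow> ('g \<times> 'g) list \<Rightarrow>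
   'g form1 \<Rightarrow> (nat \<Rightarrow> 'g) \<Rightarrow> 'f \<Rightarrow> bool" where
  "M_star_data G T \<beta> ab F \<tau> \<delta> \<longleftrightarrow>
     elementary_2_group G T \<and> is_form1 G T \<beta> F \<and> (\<forall>i\<in>{1..f_m F}. \<tau> i \<in> T) \<and>
     (let p = (\<lambda>i. if i \<le> f_m F then f_g F i \<otimes>\<^bsub>G\<^esub> f_g F i \<otimes>\<^bsub>G\<^esub> \<tau> i
                   else f_g' F i \<otimes>\<^bsub>G\<^esub> f_g'' F i) in
      (\<forall>i\<in>{1..f_k F}. \<forall>j\<in>{1..f_k F}. p i = p j)) \<and>
     \<delta> \<in> {1, - 1} \<and> (\<forall>i\<in>{1..f_l F}. beta_sign G \<beta> ab (\<tau> i) = \<delta>)"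

definition S_mat :: "nat \<Rightarrow> 'f::field \<Rightarrow> 'f mat" where
  "S_mat q c = four_block_mat (0\<^sub>m q q) (1\<^sub>m q) (c \<cdot>\<^sub>m 1\<^sub>m q) (0\<^sub>m q q)"

definition Phi_block ::
  "('g, 'x) monoid_scheme \<Rightarrow> ('g \<times> 'g \<Rightarrow> 'f::field) \<Rightarrow> ('g \<times> 'g) list \<Rightarrow>
   'g form1 \<Rightarrow> (nat \<Rightarrow> 'g) \<Rightarrow> 'f \<Rightarrow> nat \<Rightarrow> 'f mat" where
  "Phi_block G \<beta> ab F \<tau> \<delta> i =
     (if i \<le> f_l F then kron (1\<^sub>m (f_q F i)) (X_elt G \<beta> ab (\<tau> i))
      else if i \<le> f_m F then
        kron (if beta_sign G \<beta> ab (\<tau> i) = \<delta> then 1\<^sub>m (2 * f_q F i) else S_mat (f_q F i) (- 1))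
          (X_elt G \<beta> ab (\<tau> i))
      else kron (S_mat (f_q F i) \<delta>) (1\<^sub>m (D_size G ab)))"

definition Phi_mat ::
  "('g, 'x) monoid_scheme \<Rightarrow> ('g \<times> 'g \<Rightarrow> 'f::field) \<Rightarrow> ('g \<times> 'g) list \<Rightarrow>
   'g form1 \<Rightarrow> (nat \<Rightarrow> 'g) \<Rightarrow> 'f \<Rightarrow> 'f mat" where
  "Phi_mat G \<beta> ab F \<tau> \<delta> = diag_block_mat (map (Phi_block G \<beta> ab F \<tau> \<delta>) [1..<Suc (f_k F)])"

definition M_star ::
  "('g, 'x) monoid_scheme \<Rightarrow> 'g set \<Rightarrow> ('g \<times> 'g \<Rightarrow> 'f::field) \<Rightarrow> ('g \<times> 'g) list \<Rightarrow>
   'g form1 \<Rightarrow> (nat \<Rightarrow> 'g) \<Rightarrow> 'f \<Rightarrow>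
   ('g, 'f) graded_matrix_algebra \<times> ('f mat \<Rightarrow> 'f mat)" where
  "M_star G T \<beta> ab F \<tau> \<delta> =
     (M_alg G T \<beta> ab (form_kappa F) (form_gamma F), adjoint_map (Phi_mat G \<beta> ab F \<tau> \<delta>))"

definition form1_equiv ::
  "('g, 'x) monoid_scheme \<Rightarrow> 'g set \<Rightarrow> 'g form1 \<Rightarrow> (nat \<Rightarrow> 'g) \<Rightarrow>
   'g form1 \<Rightarrow> (nat \<Rightarrow> 'g) \<Rightarrow> bool" where
  "form1_equiv G T F \<tau> F' \<tau>' \<longleftrightarrow>
     f_l F = f_l F' \<and> f_m F = f_m F' \<and> f_k F = f_k F' \<and>
     (\<exists>g\<in>carrier G. \<exists>\<pi>. \<pi> permutes {1..f_k F} \<and>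
        \<pi> ` {1..f_l F} = {1..f_l F} \<and>
        \<pi> ` {Suc (f_l F)..f_m F} = {Suc (f_l F)..f_m F} \<and>
        \<pi> ` {Suc (f_m F)..f_k F} = {Suc (f_m F)..f_k F} \<and>
        (\<forall>i\<in>{1..f_k F}. f_q F' i = f_q F (\<pi> i)) \<and>
        (\<forall>i\<in>{1..f_m F}. (f_g F' i, f_g F (\<pi> i) \<otimes>\<^bsub>G\<^esub> g) \<in> rcong\<^bsub>G\<^esub> T) \<and>
        (\<forall>i\<in>{Suc (f_m F)..f_k F}.
           (f_g' F' i, f_g' F (\<pi> i) \<otimes>\<^bsub>G\<^esub> g) \<in> rcong\<^bsub>G\<^esub> T \<and>
           (f_g'' F' i, f_g'' F (\<pi> i) \<otimes>\<^bsub>G\<^esub> g) \<in> rcong\<^bsub>G\<^esub> T \<or>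
           (f_g' F' i, f_g'' F (\<pi> i) \<otimes>\<^bsub>G\<^esub> g) \<in> rcong\<^bsub>G\<^esub> T \<and>
           (f_g'' F' i, f_g' F (\<pi> i) \<otimes>\<^bsub>G\<^esub> g) \<in> rcong\<^bsub>G\<^esub> T) \<and>
        (if 0 < f_m F then \<forall>i\<in>{1..f_m F}. \<tau>' i = \<tau> (\<pi> i)
         else \<exists>i\<in>{1..f_k F}. f_g' F' i \<otimes>\<^bsub>G\<^esub> f_g'' F' i =
                f_g' F (\<pi> i) \<otimes>\<^bsub>G\<^esub> f_g'' F (\<pi> i) \<otimes>\<^bsub>G\<^esub> (g \<otimes>\<^bsub>G\<^esub> g)))"

definition reordering_of :: "'g form1 \<Rightarrow> nat list \<Rightarrow> 'g list \<Rightarrow> bool" where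
  "reordering_of F \<kappa> \<gamma> \<longleftrightarrow>
     (\<exists>\<sigma>. \<sigma> permutes {..<length \<kappa>} \<and>
        form_kappa F = permute_list \<sigma> \<kappa> \<and> form_gamma F = permute_list \<sigma> \<gamma>)"

text \<open>
  The equations imposed on \<open>\<gamma>\<close> in \<open>M_star_data\<close> hold only after the
  components of \<open>\<gamma>\<close> are replaced by suitable representatives of their cosets
  modulo \<open>T\<close>, which does not change the isomorphism class of the graded algebra.
\<close>

definition reordering_mod ::
  "('g, 'x) monoid_scheme \<Rightarrow> 'g set \<Rightarrow> 'g form1 \<Rightarrow> nat list \<Rightarrow> 'g list \<Rightarrow> bool" where
  "reordering_mod G T F \<kappa> \<gamma> \<longleftrightarrow>
     (\<exists>\<sigma>. \<sigma> permutes {..<length \<kappa>} \<and> form_kappa F = permute_list \<sigma> \<kappa> \<and>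
        list_all2 (\<lambda>x y. (x, y) \<in> rcong\<^bsub>G\<^esub> T) (form_gamma F) (permute_list \<sigma> \<gamma>))"

end

theory Submission imports Defs begin

text \<open>
  The centralizer of the identity component of \<open>R\<close> is graded, its support is \<open>T\<close> and the
  commutation factors of its homogeneous elements are the values of \<open>\<beta>\<close>. Hence \<open>T\<close> and \<open>\<beta>\<close> are
  invariants of \<open>R\<close>, and an anti-automorphism forces \<open>\<beta>\<close> to be symmetric, so that \<open>T\<close> is an
  elementary 2-group. Then \<open>X \<mapsto> \<^sup>tX\<close> preserves the support of the standard realization, and by
  Skolem--Noether a graded involution is the adjoint of a matrix \<open>\<Phi>\<close>, symmetric or skew. The
  homogeneous components of an intertwining matrix intertwine as well, so \<open>\<Phi>\<close> is homogeneous of some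
  degree \<open>h\<close>. It pairs the component of \<open>g\<close> with the component of \<open>h g\<^sup>-\<^sup>1\<close> modulo \<open>T\<close>; sorting
  the components into self-paired ones and pairs gives the form (1) and the equations for \<open>\<tau>\<close>.

  Two such matrices of the same degree and sign are congruent by a matrix of degree 1: after a monomial
  base change both have the same shape, \<open>B = \<Phi>\<^sup>-\<^sup>1 \<Phi>'\<close> has degree 1, and a square root of \<open>B\<close> that is a
  polynomial in \<open>B\<close> is homogeneous of degree 1 and carries \<open>\<Phi>\<close> to \<open>\<Phi>'\<close>. So the isomorphism class
  depends only on \<open>T\<close>, \<open>\<beta>\<close>, the sign, the degree \<open>h\<close> and the multiplicities of the cosets of
  the components, up to a common translation, which is what the equivalence of the data records.
\<close>

section \<open>Block indices and Kronecker products\<close>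

text \<open>The elements \<open>X t\<close> are shown to be independent by a trace pairing whose
  diagonal value is \<open>d\<close>, and \<open>d\<close> is shown to be nonzero in the field by
  way of \<open>T\<close> being an elementary 2-group, when \<open>d\<close> is a power of 2. Hence
  the invariance of \<open>T\<close> and \<beta> and the elementarity of \<open>T\<close> are
  obtained from commutation factors alone, before a basis is available. This is the reason for the
  split into \<open>std_realization\<close> and \<open>elementary_realization\<close>;
  \<open>closed_realization\<close> adds what the square roots need. Graded modules do not appear:
  \<kappa> and \<gamma> are kept as a list of row degrees, and a nonzero term in the Leibniz
  expansion of a determinant matches rows with columns. A base change of degree \<open>k\<close>
  multiplies the degree of a form by \<open>k^2\<close>. In an elementary 2-group squares are
  trivial, so \<open>g_i^2\<close> depends only on the coset of \<open>g_i\<close>, and one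
  self-paired component with its \<open>t_i\<close> fixes the degree exactly. With pairs only, the
  product \<open>g' g''\<close> depends on the representatives, so the equivalence has to record it
  separately.\<close>

lemma index_mult_mat_sum:
  fixes A B :: "'f::comm_semiring_0 mat"
  assumes "A \<in> carrier_mat n m" "B \<in> carrier_mat m k" "i < n" "j < k"
  shows "(A * B) $$ (i, j) = (\<Sum>l<m. A $$ (i, l) * B $$ (l, j))"
  using assms by (auto simp: scalar_prod_def atLeast0LessThan intro!: sum.cong)

lemma sum_lessThan_mult:
  fixes f :: "nat \<Rightarrow> 'a::comm_monoid_add"
  shows "(\<Sum>l<c * d. f l) = (\<Sum>r<c. \<Sum>p<d. f (r * d + p))"
proof -
  have "(\<Sum>l<c * d. f l) = (\<Sum>r<c. sum f {r * d..<r * d + d})"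
    by (rule sum.nat_group[symmetric])
  also have "\<dots> = (\<Sum>r<c. \<Sum>p<d. f (r * d + p))"
    by (rule sum.cong[OF refl]) (simp add: sum.atLeastLessThan_shift_0 atLeast0LessThan)
  finally show ?thesis .
qed

lemma block_index_less: "r < c \<Longrightarrow> p < d \<Longrightarrow> r * d + p < c * (d::nat)"
proof -
  assume "r < c" "p < d"
  then have "r * d + p < Suc r * d" by simp
  also have "\<dots> \<le> c * d" using \<open>r < c\<close> by (intro mult_le_mono1) simp
  finally show ?thesis .
qed

lemma block_indexE:
  assumes "I < c * (d::nat)"
  obtains r p where "r < c" "p < d" "I = r * d + p"
proof (rule that)
  have "0 < d" using assms by (cases d) auto
  then show "I div d < c" "I mod d < d" using assms by (auto simp: less_mult_imp_div_less)
qed simp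

lemma block_div_mod: "p < (d::nat) \<Longrightarrow> (r * d + p) div d = r" "p < d \<Longrightarrow> (r * d + p) mod d = p"
  by auto

text \<open>Rows of a Kronecker product are numbered \<open>r * c + p\<close>: block
  \<open>r\<close>, position \<open>p\<close> inside it. Comparing matrices in this addressing keeps
  \<open>div\<close> and \<open>mod\<close> out of the computations with a tensor factor
  \<open>D\<close>.\<close>

lemma mat_eq_blockI:
  assumes "M \<in> carrier_mat (a * c) (b * e)" "N \<in> carrier_mat (a * c) (b * e)"
    and "\<And>r p s q. r < a \<Longrightarrow> p < c \<Longrightarrow> s < b \<Longrightarrow> q < e \<Longrightarrow>
      M $$ (r * c + p, s * e + q) = N $$ (r * c + p, s * e + q)"
  shows "M = N"
proof (rule eq_matI)
  fix i j assume "i < dim_row N" "j < dim_col N"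
  then have "i < a * c" "j < b * e" using assms by auto
  then show "M $$ (i, j) = N $$ (i, j)" by (metis block_indexE assms(3))
qed (use assms in auto)

lemma kron_carrier [simp]:
  "A \<in> carrier_mat a b \<Longrightarrow> B \<in> carrier_mat c e \<Longrightarrow> kron A B \<in> carrier_mat (a * c) (b * e)"
  by (auto simp: kron_def)

lemma kron_index:
  assumes "A \<in> carrier_mat a b" "B \<in> carrier_mat c e" "r < a" "p < c" "s < b" "q < e"
  shows "kron A B $$ (r * c + p, s * e + q) = A $$ (r, s) * B $$ (p, q)"
  using assms block_index_less[of r a p c] block_index_less[of s b q e] by (auto simp: kron_def)

lemma kron_mult:
  fixes A B :: "'f::field mat"
  assumes "A \<in> carrier_mat a b" "A' \<in> carrier_mat b b'"
    "B \<in> carrier_mat c e" "B' \<in> carrier_mat e e'"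
  shows "kron A B * kron A' B' = kron (A * A') (B * B')"
proof (rule mat_eq_blockI[of _ a c b' e'])
  show "kron A B * kron A' B' \<in> carrier_mat (a * c) (b' * e')"
    using assms by (intro mult_carrier_mat[of _ _ "b * e"] kron_carrier)
  show "kron (A * A') (B * B') \<in> carrier_mat (a * c) (b' * e')"
    using assms by (intro mult_carrier_mat[of _ _ b] mult_carrier_mat[of _ _ e] kron_carrier)
next
  fix r p s q assume x: "r < a" "p < c" "s < b'" "q < e'"
  have "(kron A B * kron A' B') $$ (r * c + p, s * e' + q) =
     (\<Sum>l<b * e. kron A B $$ (r * c + p, l) * kron A' B' $$ (l, s * e' + q))"
    by (rule index_mult_mat_sum[OF kron_carrier[OF assms(1,3)] kron_carrier[OF assms(2,4)]])
      (use x in \<open>simp_all add: block_index_less\<close>)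
  also have "\<dots> = (\<Sum>k<b. \<Sum>l<e. A $$ (r, k) * B $$ (p, l) * (A' $$ (k, s) * B' $$ (l, q)))"
    unfolding sum_lessThan_mult
    by (intro sum.cong refl)
      (simp add: kron_index[OF assms(1,3)] kron_index[OF assms(2,4)] x)
  also have "\<dots> = (\<Sum>k<b. A $$ (r, k) * A' $$ (k, s)) * (\<Sum>l<e. B $$ (p, l) * B' $$ (l, q))"
    by (simp add: sum_product mult_ac)
  also have "\<dots> = (A * A') $$ (r, s) * (B * B') $$ (p, q)"
    using index_mult_mat_sum[OF assms(1,2), of r s] index_mult_mat_sum[OF assms(3,4), of p q] x
    by simp
  also have "\<dots> = kron (A * A') (B * B') $$ (r * c + p, s * e' + q)"
    by (rule kron_index[symmetric]) (use assms x in auto)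
  finally show "(kron A B * kron A' B') $$ (r * c + p, s * e' + q) =
    kron (A * A') (B * B') $$ (r * c + p, s * e' + q)" .
qed

lemma kron_one [simp]: "kron (1\<^sub>m a) (1\<^sub>m c) = (1\<^sub>m (a * c) :: 'f::field mat)"
proof (rule mat_eq_blockI[of _ a c a c])
  fix r p s q assume x: "r < a" "p < c" "s < a" "q < c"
  have "r * c + p = s * c + q \<longleftrightarrow> r = s \<and> p = q"
    using x by (metis block_div_mod)
  moreover have "kron (1\<^sub>m a) (1\<^sub>m c :: 'f mat) $$ (r * c + p, s * c + q) = 1\<^sub>m a $$ (r, s) * 1\<^sub>m c $$ (p, q)"
    by (rule kron_index) (use x in auto)
  ultimately show "kron (1\<^sub>m a) (1\<^sub>m c :: 'f mat) $$ (r * c + p, s * c + q) = 1\<^sub>m (a * c) $$ (r * c + p, s * c + q)"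
    using x block_index_less[of r a p c] block_index_less[of s a q c] by auto
qed auto

lemma mod_less_of_less_mult: "i < a * (b::nat) \<Longrightarrow> i mod b < b"
  by (cases b) auto

lemma kron_transpose: "transpose_mat (kron A B) = kron (transpose_mat A) (transpose_mat B)"
  by (rule eq_matI) (auto simp: kron_def less_mult_imp_div_less mod_less_of_less_mult)

lemma kron_smult:
  fixes A B :: "'f::field mat"
  shows "kron (x \<cdot>\<^sub>m A) B = x \<cdot>\<^sub>m kron A B" "kron A (x \<cdot>\<^sub>m B) = x \<cdot>\<^sub>m kron A B"
  by (rule eq_matI;
      simp add: kron_def less_mult_imp_div_less mod_less_of_less_mult mult_ac)+

section \<open>Inverses and matrix units\<close>

lemma smult_smult_mat: "(a::'f::field) \<cdot>\<^sub>m (b \<cdot>\<^sub>m A) = (a * b) \<cdot>\<^sub>m A"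
  by (rule eq_matI) auto

lemma one_smult_mat' [simp]: "(1::'f::field) \<cdot>\<^sub>m A = A"
  by (rule eq_matI) auto

lemma transpose_smult: "transpose_mat ((a::'f::field) \<cdot>\<^sub>m A) = a \<cdot>\<^sub>m transpose_mat A"
  by (rule eq_matI) auto

lemma smult_zero_mat: "A \<in> carrier_mat n m \<Longrightarrow> (0::'f::field) \<cdot>\<^sub>m A = 0\<^sub>m n m"
  by (rule eq_matI) auto

lemma square_mat_simps:
  fixes A B C :: "'f::field mat"
  shows "A \<in> carrier_mat n n \<Longrightarrow> B \<in> carrier_mat n n \<Longrightarrow> A * B \<in> carrier_mat n n"
    and "A \<in> carrier_mat n n \<Longrightarrow> B \<in> carrier_mat n n \<Longrightarrow> C \<in> carrier_mat n n \<Longrightarrow> (A + B) * C = A * C + B * C"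
    and "A \<in> carrier_mat n n \<Longrightarrow> B \<in> carrier_mat n n \<Longrightarrow> C \<in> carrier_mat n n \<Longrightarrow> A * (B + C) = A * B + A * C"
    and "A \<in> carrier_mat n n \<Longrightarrow> B \<in> carrier_mat n n \<Longrightarrow> C \<in> carrier_mat n n \<Longrightarrow> A * B * C = A * (B * C)"
    and "A \<in> carrier_mat n n \<Longrightarrow> B \<in> carrier_mat n n \<Longrightarrow> (c \<cdot>\<^sub>m A) * B = c \<cdot>\<^sub>m (A * B)"
    and "A \<in> carrier_mat n n \<Longrightarrow> B \<in> carrier_mat n n \<Longrightarrow> A * (c \<cdot>\<^sub>m B) = c \<cdot>\<^sub>m (A * B)"
    and "A \<in> carrier_mat n n \<Longrightarrow> 0\<^sub>m n n * A = 0\<^sub>m n n"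
    and "A \<in> carrier_mat n n \<Longrightarrow> A * 0\<^sub>m n n = 0\<^sub>m n n"
    and "A \<in> carrier_mat n n \<Longrightarrow> 0 \<cdot>\<^sub>m A = 0\<^sub>m n n"
    and "A \<in> carrier_mat n n \<Longrightarrow> 1\<^sub>m n * A = A"
    and "A \<in> carrier_mat n n \<Longrightarrow> A * 1\<^sub>m n = A"
    and "A \<in> carrier_mat n n \<Longrightarrow> 0\<^sub>m n n + A = A"
    and "A \<in> carrier_mat n n \<Longrightarrow> A + 0\<^sub>m n n = A"
  by (auto simp: add_mult_distrib_mat[of _ n n _ _ n] mult_add_distrib_mat[of _ n n _ n]
      assoc_mult_mat[of _ n n _ n _ n] mult_smult_distrib[of _ n n _ n] mult_smult_assoc_mat[of _ n n _ n]
      smult_zero_mat)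

lemma invertible_mat_iff_det:
  fixes A :: "'f::field mat"
  assumes "A \<in> carrier_mat n n"
  shows "invertible_mat A \<longleftrightarrow> det A \<noteq> 0"
proof
  assume "invertible_mat A"
  then obtain B where B: "A * B = 1\<^sub>m (dim_row A)" "B * A = 1\<^sub>m (dim_row B)"
    unfolding invertible_mat_def inverts_mat_def by auto
  have "dim_col B = n" using arg_cong[OF B(1), of dim_col] assms by auto
  moreover have "dim_row B = n" using arg_cong[OF B(2), of dim_col] assms by auto
  ultimately have "B \<in> carrier_mat n n" by auto
  then have "det A * det B = 1" using det_mult[OF assms, of B] B assms by simp
  then show "det A \<noteq> 0" by auto
next
  assume "det A \<noteq> 0"
  then have "A \<in> Units (ring_mat TYPE('f) n ())"
    by (rule det_non_zero_imp_unit[OF assms])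
  then obtain B where "B \<in> carrier_mat n n" "A * B = 1\<^sub>m n" "B * A = 1\<^sub>m n"
    by (auto simp: Units_def ring_mat_def)
  then show "invertible_mat A"
    using assms unfolding invertible_mat_def inverts_mat_def by auto
qed

text \<open>This is the inverse that occurs in \<open>adjoint_map\<close>; a nonzero determinant
  guarantees that \<open>the\<close> is not applied to \<open>None\<close>.\<close>

abbreviation minv :: "'f::field mat \<Rightarrow> 'f mat" where
  "minv A \<equiv> the (mat_inverse A)"

lemma minv:
  fixes A :: "'f::field mat"
  assumes "A \<in> carrier_mat n n" "det A \<noteq> 0"
  shows "minv A \<in> carrier_mat n n" "A * minv A = 1\<^sub>m n" "minv A * A = 1\<^sub>m n"
proof -
  have "mat_inverse A \<noteq> None"
    using mat_inverse(1)[OF assms(1), where b = "()"] det_non_zero_imp_unit[OF assms, where b = "()"]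
    by blast
  then have "A * minv A = 1\<^sub>m n \<and> minv A * A = 1\<^sub>m n \<and> minv A \<in> carrier_mat n n"
    by (intro mat_inverse(2)[OF assms(1)]) auto
  then show "minv A \<in> carrier_mat n n" "A * minv A = 1\<^sub>m n" "minv A * A = 1\<^sub>m n" by auto
qed

lemma det_nonzeroI:
  fixes A :: "'f::field mat"
  assumes "A \<in> carrier_mat n n" "B \<in> carrier_mat n n" "A * B = 1\<^sub>m n"
  shows "det A \<noteq> 0" "det B \<noteq> 0"
proof -
  have "det A * det B = 1" using det_mult[OF assms(1,2)] assms(3) by simp
  then show "det A \<noteq> 0" "det B \<noteq> 0" by auto
qed

text \<open>Zero rows are appended to make the matrix square. Its last row is then zero, so it has
  no inverse, and a kernel vector of this singular matrix serves the original one.\<close>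

lemma wide_mat_kernel:
  fixes A :: "'f::field mat"
  assumes A: "A \<in> carrier_mat m n" and "m < n"
  obtains v where "v \<in> carrier_vec n" "v \<noteq> 0\<^sub>v n" "A *\<^sub>v v = 0\<^sub>v m"
proof -
  define A' where "A' = mat n n (\<lambda>(i, j). if i < m then A $$ (i, j) else 0)"
  have A': "A' \<in> carrier_mat n n" by (simp add: A'_def)
  have "det A' = 0"
  proof (rule ccontr)
    assume "det A' \<noteq> 0"
    note B = minv[OF A' this]
    have "(A' * minv A') $$ (n - 1, n - 1) = (\<Sum>l<n. A' $$ (n - 1, l) * minv A' $$ (l, n - 1))"
      by (rule index_mult_mat_sum[OF A' B(1)]) (use \<open>m < n\<close> in auto)
    also have "\<dots> = 0" using \<open>m < n\<close> by (intro sum.neutral) (auto simp: A'_def)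
    finally show False using B(2) \<open>m < n\<close> by simp
  qed
  then obtain v where v: "v \<in> carrier_vec n" "v \<noteq> 0\<^sub>v n" "A' *\<^sub>v v = 0\<^sub>v n"
    using det_0_iff_vec_prod_zero_field[OF A'] by auto
  have "A *\<^sub>v v = 0\<^sub>v m"
  proof (rule eq_vecI)
    fix i assume "i < dim_vec (0\<^sub>v m :: 'f vec)"
    then have i: "i < m" by simp
    have "row A i = row A' i" using A i \<open>m < n\<close> by (intro eq_vecI) (auto simp: A'_def)
    then have "(A *\<^sub>v v) $ i = (A' *\<^sub>v v) $ i" using A A' i \<open>m < n\<close> by simp
    then show "(A *\<^sub>v v) $ i = 0\<^sub>v m $ i" using v(3) i \<open>m < n\<close> by simp
  qed (use A in auto)
  with v show thesis using that by blast
qed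

definition unit_mat :: "nat \<Rightarrow> nat \<Rightarrow> nat \<Rightarrow> nat \<Rightarrow> 'f::field mat" where
  "unit_mat n m i j = mat n m (\<lambda>(a, b). if a = i \<and> b = j then 1 else 0)"

lemma unit_mat_carrier [simp]: "unit_mat n m i j \<in> carrier_mat n m"
  by (simp add: unit_mat_def)

lemma mult_unit_mat_index:
  fixes X :: "'f::field mat"
  assumes "X \<in> carrier_mat k n" "a < k" "b < m" "i < n"
  shows "(X * unit_mat n m i j) $$ (a, b) = (if b = j then X $$ (a, i) else 0)"
proof -
  have "(X * unit_mat n m i j) $$ (a, b) = (\<Sum>l<n. X $$ (a, l) * unit_mat n m i j $$ (l, b))"
    by (rule index_mult_mat_sum) (use assms in auto)
  also have "\<dots> = (\<Sum>l<n. if l = i then (if b = j then X $$ (a, i) else 0) else 0)"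
    by (rule sum.cong) (use assms in \<open>auto simp: unit_mat_def\<close>)
  finally show ?thesis using assms by simp
qed

lemma unit_mat_mult_index:
  fixes X :: "'f::field mat"
  assumes "X \<in> carrier_mat m k" "a < n" "b < k" "j < m"
  shows "(unit_mat n m i j * X) $$ (a, b) = (if a = i then X $$ (j, b) else 0)"
proof -
  have "(unit_mat n m i j * X) $$ (a, b) = (\<Sum>l<m. unit_mat n m i j $$ (a, l) * X $$ (l, b))"
    by (rule index_mult_mat_sum) (use assms in auto)
  also have "\<dots> = (\<Sum>l<m. if l = j then (if a = i then X $$ (j, b) else 0) else 0)"
    by (rule sum.cong) (use assms in \<open>auto simp: unit_mat_def\<close>)
  finally show ?thesis using assms by simp
qed

lemma unit_mat_mult:
  assumes "j < m" "k < m"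
  shows "unit_mat n m i j * unit_mat m l k b = (if j = k then unit_mat n l i b else (0\<^sub>m n l :: 'f::field mat))"
proof (rule eq_matI)
  fix a c
  assume "a < dim_row (if j = k then unit_mat n l i b else (0\<^sub>m n l :: 'f mat))"
    "c < dim_col (if j = k then unit_mat n l i b else (0\<^sub>m n l :: 'f mat))"
  then have "a < n" "c < l" by (auto simp: unit_mat_def split: if_splits)
  then show "(unit_mat n m i j * unit_mat m l k b) $$ (a, c) =
      (if j = k then unit_mat n l i b else (0\<^sub>m n l :: 'f mat)) $$ (a, c)"
    using mult_unit_mat_index[of "unit_mat n m i j :: 'f mat" n m a c l k b] assms
    by (auto simp: unit_mat_def)
qed (auto simp: unit_mat_def)

text \<open>The zero matrix depends on the size, so a finite sum carries its dimensions and adds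
  entrywise.\<close>

definition matsum :: "nat \<Rightarrow> nat \<Rightarrow> 'i set \<Rightarrow> ('i \<Rightarrow> 'f::field mat) \<Rightarrow> 'f mat" where
  "matsum n m S F = mat n m (\<lambda>ij. \<Sum>h\<in>S. F h $$ ij)"

lemma matsum_carrier [simp]: "matsum n m S F \<in> carrier_mat n m"
  by (simp add: matsum_def)

lemma matsum_index: "i < n \<Longrightarrow> j < m \<Longrightarrow> matsum n m S F $$ (i, j) = (\<Sum>h\<in>S. F h $$ (i, j))"
  by (simp add: matsum_def)

lemma matsum_induct [consumes 1, case_names zero add mem]:
  assumes "finite S"
    and "P (0\<^sub>m n m)"
    and "\<And>A B. A \<in> carrier_mat n m \<Longrightarrow> B \<in> carrier_mat n m \<Longrightarrow> P A \<Longrightarrow> P B \<Longrightarrow> P (A + B)"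
    and "\<And>h. h \<in> S \<Longrightarrow> F h \<in> carrier_mat n m \<and> P (F h)"
  shows "P (matsum n m S F)"
  using assms(1,4)
proof (induction S rule: finite_induct)
  case empty
  have "matsum n m {} F = 0\<^sub>m n m" by (rule eq_matI) (auto simp: matsum_def)
  then show ?case using assms(2) by simp
next
  case (insert x S)
  have "matsum n m (insert x S) F = F x + matsum n m S F"
    using insert by (intro eq_matI) (auto simp: matsum_def)
  then show ?case using insert assms(3) by simp
qed

lemma unit_mat_decomp:
  assumes "M \<in> carrier_mat n m"
  shows "M = matsum n m ({..<n} \<times> {..<m}) (\<lambda>(i, j). M $$ (i, j) \<cdot>\<^sub>m unit_mat n m i j)"
proof (rule eq_matI)
  fix i j
  assume "i < dim_row (matsum n m ({..<n} \<times> {..<m}) (\<lambda>(i, j). M $$ (i, j) \<cdot>\<^sub>m unit_mat n m i j))"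
    "j < dim_col (matsum n m ({..<n} \<times> {..<m}) (\<lambda>(i, j). M $$ (i, j) \<cdot>\<^sub>m unit_mat n m i j))"
  then have ij: "i < n" "j < m" by (auto simp: matsum_def)
  have "(\<Sum>h\<in>{..<n} \<times> {..<m}. (case h of (a, b) \<Rightarrow> M $$ (a, b) \<cdot>\<^sub>m unit_mat n m a b) $$ (i, j))
      = (\<Sum>h\<in>{..<n} \<times> {..<m}. if h = (i, j) then M $$ (i, j) else 0)"
    using ij by (intro sum.cong) (auto simp: unit_mat_def split: if_splits)
  also have "\<dots> = M $$ (i, j)" using ij by (subst sum.delta) auto
  finally show "M $$ (i, j) = matsum n m ({..<n} \<times> {..<m}) (\<lambda>(i, j). M $$ (i, j) \<cdot>\<^sub>m unit_mat n m i j) $$ (i, j)"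
    using ij by (simp add: matsum_index)
qed (use assms in \<open>auto simp: matsum_def\<close>)

lemma mat_unit_induct [consumes 1, case_names zero add smult unit]:
  fixes M :: "'f::field mat"
  assumes "M \<in> carrier_mat n m"
    and "P (0\<^sub>m n m)"
    and "\<And>A B. A \<in> carrier_mat n m \<Longrightarrow> B \<in> carrier_mat n m \<Longrightarrow> P A \<Longrightarrow> P B \<Longrightarrow> P (A + B)"
    and "\<And>c A. A \<in> carrier_mat n m \<Longrightarrow> P A \<Longrightarrow> P (c \<cdot>\<^sub>m A)"
    and "\<And>i j. i < n \<Longrightarrow> j < m \<Longrightarrow> P (unit_mat n m i j)"
  shows "P M"
proof -
  have "P (matsum n m ({..<n} \<times> {..<m}) (\<lambda>(i, j). M $$ (i, j) \<cdot>\<^sub>m unit_mat n m i j))"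
    by (rule matsum_induct) (use assms in auto)
  then show ?thesis using unit_mat_decomp[OF assms(1)] by simp
qed

lemma commuting_mat_scalar:
  fixes M :: "'f::field mat"
  assumes M: "M \<in> carrier_mat n n"
    and comm: "\<And>W. W \<in> carrier_mat n n \<Longrightarrow> M * W = W * M"
  obtains c where "M = c \<cdot>\<^sub>m 1\<^sub>m n"
proof -
  have e: "(if b = j then M $$ (a, i) else 0) = (if a = i then M $$ (j, b) else 0)"
    if "a < n" "b < n" "i < n" "j < n" for a b i j
    using arg_cong[OF comm[of "unit_mat n n i j"], of "\<lambda>X. X $$ (a, b)"]
      mult_unit_mat_index[OF M, of a b n i j] unit_mat_mult_index[OF M, of a n b j i] that by simp
  have "M = M $$ (0, 0) \<cdot>\<^sub>m 1\<^sub>m n"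
  proof (rule eq_matI)
    fix i j assume "i < dim_row (M $$ (0, 0) \<cdot>\<^sub>m 1\<^sub>m n)" "j < dim_col (M $$ (0, 0) \<cdot>\<^sub>m 1\<^sub>m n)"
    then have ij: "i < n" "j < n" by auto
    \<comment> \<open>Commuting with the unit at \<open>(j, j)\<close> kills the entry
      \<open>(i, j)\<close> off the diagonal; commuting with the unit at \<open>(i, 0)\<close>
      equates the diagonal entries \<open>i\<close> and \<open>0\<close>.\<close>
    then show "M $$ (i, j) = (M $$ (0, 0) \<cdot>\<^sub>m 1\<^sub>m n) $$ (i, j)"
      using e[of i j j j] e[of i 0 i 0] by auto
  qed (use M in auto)
  then show thesis using that by blast
qed

section \<open>Skolem--Noether\<close>

lemma linear_on_matD:
  assumes "linear_on_mat n f"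
  shows "A \<in> carrier_mat n n \<Longrightarrow> B \<in> carrier_mat n n \<Longrightarrow> f (A + B) = f A + f B"
    and "A \<in> carrier_mat n n \<Longrightarrow> f (c \<cdot>\<^sub>m A) = c \<cdot>\<^sub>m f A"
  using assms by (auto simp: linear_on_mat_def)

lemma linear_on_mat_zero:
  assumes "linear_on_mat n f" "f ` carrier_mat n n \<subseteq> carrier_mat m m"
  shows "f (0\<^sub>m n n) = 0\<^sub>m m m"
proof -
  have "f (0 \<cdot>\<^sub>m 0\<^sub>m n n) = 0 \<cdot>\<^sub>m f (0\<^sub>m n n)" by (rule linear_on_matD(2)[OF assms(1)]) simp
  moreover have "f (0\<^sub>m n n) \<in> carrier_mat m m" using assms(2) by auto
  ultimately show ?thesis by (simp add: smult_zero_mat)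
qed

definition alg_iso :: "nat \<Rightarrow> nat \<Rightarrow> ('f::field mat \<Rightarrow> 'f mat) \<Rightarrow> bool" where
  "alg_iso n m f \<longleftrightarrow> bij_betw f (carrier_mat n n) (carrier_mat m m) \<and> linear_on_mat n f \<and>
     (\<forall>A\<in>carrier_mat n n. \<forall>B\<in>carrier_mat n n. f (A * B) = f A * f B)"

lemma alg_isoD:
  assumes "alg_iso n m f"
  shows "linear_on_mat n f" "bij_betw f (carrier_mat n n) (carrier_mat m m)"
    "A \<in> carrier_mat n n \<Longrightarrow> f A \<in> carrier_mat m m"
    "A \<in> carrier_mat n n \<Longrightarrow> B \<in> carrier_mat n n \<Longrightarrow> f (A * B) = f A * f B"
    "f (0\<^sub>m n n) = 0\<^sub>m m m"
  using assms linear_on_mat_zero[of n f m] by (auto simp: alg_iso_def bij_betw_def)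

text \<open>With \<open>E_ij\<close> the matrix units, choose \<open>z\<close> such that
  \<open>f E_00 z\<close> is nonzero and let column \<open>i\<close> of \<Psi> be
  \<open>f E_i0 z\<close>. The multiplication rule of the units gives the intertwining relation. A
  kernel vector \<open>v\<close> with \<open>v_j\<close> nonzero is sent by \<open>E_0j\<close> to a
  nonzero multiple of the first unit vector, whose image under \<Psi> is not zero. The sizes
  \<open>n\<close> and \<open>m\<close> are kept apart because their equality is a
  consequence.\<close>

lemma intertwiner_exists:
  fixes f :: "'f::field mat \<Rightarrow> 'f mat"
  assumes f: "alg_iso n m f" and "0 < n"
  obtains \<Psi> where "\<Psi> \<in> carrier_mat m n" "\<And>W. W \<in> carrier_mat n n \<Longrightarrow> f W * \<Psi> = \<Psi> * W"
    "\<And>v. v \<in> carrier_vec n \<Longrightarrow> \<Psi> *\<^sub>v v = 0\<^sub>v m \<Longrightarrow> v = 0\<^sub>v n"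
proof -
  let ?E = "unit_mat n n :: nat \<Rightarrow> nat \<Rightarrow> 'f mat"
  have fE: "f (?E i j) \<in> carrier_mat m m" for i j by (rule alg_isoD(3)[OF f]) simp
  have "inj_on f (carrier_mat n n)" using f by (auto simp: alg_iso_def bij_betw_def)
  moreover have "?E 0 0 \<noteq> 0\<^sub>m n n"
  proof
    assume "?E 0 0 = 0\<^sub>m n n"
    then have "?E 0 0 $$ (0, 0) = 0\<^sub>m n n $$ (0, 0)" by simp
    then show False using \<open>0 < n\<close> by (simp add: unit_mat_def)
  qed
  ultimately have "f (?E 0 0) \<noteq> 0\<^sub>m m m"
    using alg_isoD(5)[OF f] by (metis inj_onD unit_mat_carrier zero_carrier_mat)
  then obtain a b where ab: "a < m" "b < m" "f (?E 0 0) $$ (a, b) \<noteq> 0"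
    using fE[of 0 0] by (metis (no_types, lifting) carrier_matD eq_matI index_zero_mat)
  define z where "z = (unit_vec m b :: 'f vec)"
  have z: "z \<in> carrier_vec m" by (simp add: z_def)
  define \<Psi> where "\<Psi> = mat m n (\<lambda>(a, i). (f (?E i 0) *\<^sub>v z) $ a)"
  have \<Psi>: "\<Psi> \<in> carrier_mat m n" by (simp add: \<Psi>_def)
  have col: "col \<Psi> i = f (?E i 0) *\<^sub>v z" if "i < n" for i
    using that fE[of i 0] by (intro eq_vecI) (auto simp: \<Psi>_def)
  have inter: "f W * \<Psi> = \<Psi> * W" if "W \<in> carrier_mat n n" for W
    using that
  proof (induction W rule: mat_unit_induct)
    case zero
    then show ?case using alg_isoD(5)[OF f] \<Psi> by simp
  next
    case (add A B)
    then show ?case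
      using linear_on_matD(1)[OF alg_isoD(1)[OF f], of A B] alg_isoD(3)[OF f, of A] alg_isoD(3)[OF f, of B] \<Psi>
      by (simp add: add_mult_distrib_mat[of _ m m] mult_add_distrib_mat[of _ m n])
  next
    case (smult c A)
    then show ?case
      using linear_on_matD(2)[OF alg_isoD(1)[OF f], of A c] alg_isoD(3)[OF f, of A] \<Psi>
      by (simp add: mult_smult_distrib[of \<Psi> m n A n c] mult_smult_assoc_mat[of "f A" m m \<Psi> n c])
  next
    case (unit a b)
    show ?case
    proof (rule eq_matI)
      fix i j assume "i < dim_row (\<Psi> * ?E a b)" "j < dim_col (\<Psi> * ?E a b)"
      then have ij: "i < m" "j < n" using \<Psi> by (auto simp: unit_mat_def)
      have "(f (?E a b) * \<Psi>) $$ (i, j) = col (f (?E a b) * \<Psi>) j $ i"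
        using ij \<Psi> fE[of a b] by auto
      also have "col (f (?E a b) * \<Psi>) j = f (?E a b) *\<^sub>v col \<Psi> j"
        by (rule col_mult2) (use fE \<Psi> ij in auto)
      also have "\<dots> = (f (?E a b) * f (?E j 0)) *\<^sub>v z"
        unfolding col[OF ij(2)] by (rule assoc_mult_mat_vec[symmetric, OF fE fE z])
      also have "f (?E a b) * f (?E j 0) = f (?E a b * ?E j 0)"
        by (rule alg_isoD(4)[OF f, symmetric]) auto
      also have "?E a b * ?E j 0 = (if b = j then ?E a 0 else 0\<^sub>m n n)"
        by (rule unit_mat_mult) (use unit ij in auto)
      finally have "(f (?E a b) * \<Psi>) $$ (i, j) = ((if b = j then f (?E a 0) else 0\<^sub>m m m) *\<^sub>v z) $ i"
        using alg_isoD(5)[OF f] by (simp split: if_splits)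
      also have "\<dots> = (if j = b then \<Psi> $$ (i, a) else 0)"
        using col[OF unit(1)] ij unit \<Psi> z by (auto simp flip: col[OF unit(1)])
      also have "\<dots> = (\<Psi> * ?E a b) $$ (i, j)"
        by (rule mult_unit_mat_index[symmetric]) (use \<Psi> ij unit in auto)
      finally show "(f (?E a b) * \<Psi>) $$ (i, j) = (\<Psi> * ?E a b) $$ (i, j)" .
    qed (use fE[of a b] \<Psi> in \<open>auto simp: unit_mat_def\<close>)
  qed
  have nz: "\<Psi> $$ (a, 0) \<noteq> 0"
  proof -
    have "\<Psi> $$ (a, 0) = (f (?E 0 0) *\<^sub>v unit_vec m b) $ a" using ab \<open>0 < n\<close> by (simp add: \<Psi>_def z_def)
    also have "\<dots> = f (?E 0 0) $$ (a, b)"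
      using ab fE[of 0 0] by (simp add: scalar_prod_right_unit)
    finally show ?thesis using ab by simp
  qed
  have ker: "v = 0\<^sub>v n" if v: "v \<in> carrier_vec n" "\<Psi> *\<^sub>v v = 0\<^sub>v m" for v
  proof (rule ccontr)
    assume "v \<noteq> 0\<^sub>v n"
    then obtain j where j: "j < n" "v $ j \<noteq> 0" using v by (metis carrier_vecD eq_vecI index_zero_vec)
    have Ev: "?E 0 j *\<^sub>v v = v $ j \<cdot>\<^sub>v unit_vec n 0"
    proof (rule eq_vecI)
      fix i assume "i < dim_vec (v $ j \<cdot>\<^sub>v unit_vec n 0)"
      then have i: "i < n" by simp
      have "row (?E 0 j) i = (if i = 0 then unit_vec n j else 0\<^sub>v n)"
        using i by (intro eq_vecI) (auto simp: unit_mat_def unit_vec_def)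
      then show "(?E 0 j *\<^sub>v v) $ i = (v $ j \<cdot>\<^sub>v unit_vec n 0) $ i"
        using i j v by (auto simp: unit_mat_def)
    qed (auto simp: unit_mat_def)
    have "\<Psi> *\<^sub>v (?E 0 j *\<^sub>v v) = (\<Psi> * ?E 0 j) *\<^sub>v v"
      by (rule assoc_mult_mat_vec[symmetric]) (use \<Psi> v in auto)
    also have "\<dots> = (f (?E 0 j) * \<Psi>) *\<^sub>v v" using inter[of "?E 0 j"] by simp
    also have "\<dots> = f (?E 0 j) *\<^sub>v (\<Psi> *\<^sub>v v)" by (rule assoc_mult_mat_vec) (use \<Psi> v fE in auto)
    also have "\<dots> = 0\<^sub>v m" using v fE[of 0 j] by (auto intro!: eq_vecI)
    finally have "(\<Psi> *\<^sub>v (v $ j \<cdot>\<^sub>v unit_vec n 0)) $ a = 0" using ab Ev by simp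
    moreover have "(\<Psi> *\<^sub>v (v $ j \<cdot>\<^sub>v unit_vec n 0)) $ a = v $ j * \<Psi> $$ (a, 0)"
      using ab \<Psi> \<open>0 < n\<close> by (simp add: mult_mat_vec[of \<Psi> m n] scalar_prod_right_unit)
    ultimately show False using nz j by simp
  qed
  show thesis using that[OF \<Psi> inter ker] by blast
qed

text \<open>The intertwiner is an injective linear map from dimension \<open>n\<close> to dimension
  \<open>m\<close>. Together with the inverse isomorphism this gives equal sizes, which the
  definition of an isomorphism does not include.\<close>

lemma intertwiner_le:
  fixes f :: "'f::field mat \<Rightarrow> 'f mat"
  assumes "alg_iso n m f"
  shows "n \<le> m"
proof (rule ccontr)
  assume "\<not> n \<le> m"
  then have "0 < n" "m < n" by auto
  then show False using intertwiner_exists[OF assms \<open>0 < n\<close>] wide_mat_kernel by metis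
qed

lemma alg_iso_inv:
  fixes f :: "'f::field mat \<Rightarrow> 'f mat"
  assumes f: "alg_iso n m f"
  shows "alg_iso m n (inv_into (carrier_mat n n) f)"
proof -
  let ?g = "inv_into (carrier_mat n n) f"
  have b: "bij_betw f (carrier_mat n n) (carrier_mat m m)" by (rule alg_isoD(2)[OF f])
  then have inj: "inj_on f (carrier_mat n n)" by (simp add: bij_betw_def)
  have bg: "bij_betw ?g (carrier_mat m m) (carrier_mat n n)" by (rule bij_betw_inv_into[OF b])
  have g: "?g A \<in> carrier_mat n n" "f (?g A) = A" if "A \<in> carrier_mat m m" for A
    using that bg b by (auto simp: bij_betw_def f_inv_into_f)
  have eqI: "?g B = A" if "A \<in> carrier_mat n n" "f A = B" for A B
    using inj that by auto
  show ?thesis unfolding alg_iso_def linear_on_mat_def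
  proof (intro conjI ballI allI bg)
    fix A B :: "'f mat" assume AB: "A \<in> carrier_mat m m" "B \<in> carrier_mat m m"
    show "?g (A + B) = ?g A + ?g B"
      by (rule eqI) (use g AB linear_on_matD(1)[OF alg_isoD(1)[OF f]] in auto)
    show "?g (A * B) = ?g A * ?g B"
      by (rule eqI) (use g AB alg_isoD(4)[OF f] in \<open>auto intro: mult_carrier_mat[of _ n n]\<close>)
  next
    fix c and A :: "'f mat" assume A: "A \<in> carrier_mat m m"
    show "?g (c \<cdot>\<^sub>m A) = c \<cdot>\<^sub>m ?g A"
      by (rule eqI) (use g A linear_on_matD(2)[OF alg_isoD(1)[OF f]] in auto)
  qed
qed

lemma alg_iso_size: "alg_iso n m f \<Longrightarrow> n = m"
  using intertwiner_le alg_iso_inv by (metis le_antisym)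

theorem skolem_noether:
  fixes f :: "'f::field mat \<Rightarrow> 'f mat"
  assumes f: "alg_iso n n f" and "0 < n"
  obtains \<Psi> where "\<Psi> \<in> carrier_mat n n" "det \<Psi> \<noteq> 0"
    "\<And>W. W \<in> carrier_mat n n \<Longrightarrow> f W * \<Psi> = \<Psi> * W"
proof -
  obtain \<Psi> where \<Psi>: "\<Psi> \<in> carrier_mat n n" "\<And>W. W \<in> carrier_mat n n \<Longrightarrow> f W * \<Psi> = \<Psi> * W"
    "\<And>v. v \<in> carrier_vec n \<Longrightarrow> \<Psi> *\<^sub>v v = 0\<^sub>v n \<Longrightarrow> v = 0\<^sub>v n"
    using intertwiner_exists[OF assms] by metis
  have "det \<Psi> \<noteq> 0" using det_0_iff_vec_prod_zero_field[OF \<Psi>(1)] \<Psi>(3) by auto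
  with \<Psi> that show thesis by blast
qed

section \<open>Polynomials in a matrix and square roots\<close>

text \<open>Horner evaluation of \<open>p\<close> at \<open>B\<close>, constants being read as
  multiples of the identity of size \<open>n\<close>.\<close>

definition peval :: "nat \<Rightarrow> 'f::field mat \<Rightarrow> 'f poly \<Rightarrow> 'f mat" where
  "peval n B p = fold_coeffs (\<lambda>a M. a \<cdot>\<^sub>m 1\<^sub>m n + M * B) p (0\<^sub>m n n)"

context
  fixes n :: nat and B :: "'f::field mat"
  assumes B: "B \<in> carrier_mat n n"
begin

lemma peval_0 [simp]: "peval n B 0 = 0\<^sub>m n n"
  by (simp add: peval_def)

lemma peval_pCons: "peval n B (pCons a p) = a \<cdot>\<^sub>m 1\<^sub>m n + peval n B p * B"
proof (cases "p = 0 \<and> a = 0")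
  case True
  then show ?thesis using B by (simp add: smult_zero_mat[of "1\<^sub>m n" n n])
next
  case False
  then show ?thesis
    by (cases "p = 0") (auto simp: peval_def fold_coeffs_pCons_coeff_not_0_eq fold_coeffs_pCons_not_0_0_eq)
qed

lemma peval_carrier [simp]: "peval n B p \<in> carrier_mat n n"
  by (induction p) (use B in \<open>auto simp: peval_pCons\<close>)

lemma dim_peval [simp]: "dim_row (peval n B p) = n" "dim_col (peval n B p) = n"
  using carrier_matD[OF peval_carrier] by auto

lemma peval_commute: "peval n B p * B = B * peval n B p"
proof (induction p)
  case 0
  then show ?case using B by simp
next
  case (pCons a p)
  let ?M = "peval n B p"
  have M: "?M * B \<in> carrier_mat n n" using B by (intro mult_carrier_mat[of _ n n]) auto
  have "(a \<cdot>\<^sub>m 1\<^sub>m n + ?M * B) * B = (a \<cdot>\<^sub>m 1\<^sub>m n) * B + ?M * B * B"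
    by (rule add_mult_distrib_mat[OF _ M B]) simp
  also have "(a \<cdot>\<^sub>m 1\<^sub>m n) * B = B * (a \<cdot>\<^sub>m 1\<^sub>m n)"
    using B by (simp add: square_mat_simps[where n = n])
  also have "?M * B * B = B * (?M * B)"
    using assoc_mult_mat[OF B peval_carrier B, of p] pCons by simp
  also have "B * (a \<cdot>\<^sub>m 1\<^sub>m n) + B * (?M * B) = B * (a \<cdot>\<^sub>m 1\<^sub>m n + ?M * B)"
    by (rule mult_add_distrib_mat[symmetric, OF B _ M]) simp
  finally show ?case by (simp add: peval_pCons)
qed

text \<open>A Horner step multiplies by \<open>B\<close> itself, so only products with
  \<open>B\<close> have to be handled, and the other factor may be assumed to commute with
  \<open>B\<close>. This is how selfadjointness and homogeneity pass to polynomials in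
  \<open>B\<close>.\<close>

lemma peval_induct [case_names zero one add smult mult]:
  assumes "P (0\<^sub>m n n)" "P (1\<^sub>m n)"
    and "\<And>A C. A \<in> carrier_mat n n \<Longrightarrow> C \<in> carrier_mat n n \<Longrightarrow> P A \<Longrightarrow> P C \<Longrightarrow> P (A + C)"
    and "\<And>c A. A \<in> carrier_mat n n \<Longrightarrow> P A \<Longrightarrow> P (c \<cdot>\<^sub>m A)"
    and "\<And>A. A \<in> carrier_mat n n \<Longrightarrow> A * B = B * A \<Longrightarrow> P A \<Longrightarrow> P (A * B)"
  shows "P (peval n B p)"
proof (induction p)
  case 0
  show ?case using assms(1) by simp
next
  case (pCons a p)
  show ?case unfolding peval_pCons
    by (rule assms(3)[OF _ _ assms(4)[OF _ assms(2)] assms(5)[OF peval_carrier peval_commute pCons.IH]])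
      (auto intro!: mult_carrier_mat[OF peval_carrier B])
qed

lemma peval_add: "peval n B (p + q) = peval n B p + peval n B q"
proof (induction p arbitrary: q)
  case 0
  then show ?case by simp
next
  case (pCons a p)
  obtain b q' where q: "q = pCons b q'" by (cases q)
  have "peval n B (pCons a p + q) = (a + b) \<cdot>\<^sub>m 1\<^sub>m n + (peval n B p + peval n B q') * B"
    by (simp add: q peval_pCons pCons.IH)
  also have "\<dots> = (a \<cdot>\<^sub>m 1\<^sub>m n + b \<cdot>\<^sub>m 1\<^sub>m n) + (peval n B p * B + peval n B q' * B)"
    using B by (simp add: add_smult_distrib_right_mat[of _ n n] square_mat_simps[where n = n])
  also have "\<dots> = peval n B (pCons a p) + peval n B q"
    unfolding q peval_pCons using B by (intro eq_matI) auto
  finally show ?case .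
qed

lemma peval_smult: "peval n B (Polynomial.smult c p) = c \<cdot>\<^sub>m peval n B p"
proof (induction p)
  case 0
  then show ?case by simp
next
  case (pCons a p)
  have "c \<cdot>\<^sub>m peval n B p * B = c \<cdot>\<^sub>m (peval n B p * B)"
    using B by (simp add: square_mat_simps[where n = n])
  then have "peval n B (Polynomial.smult c (pCons a p)) = (c * a) \<cdot>\<^sub>m 1\<^sub>m n + c \<cdot>\<^sub>m (peval n B p * B)"
    by (simp add: peval_pCons pCons.IH)
  also have "\<dots> = c \<cdot>\<^sub>m (a \<cdot>\<^sub>m 1\<^sub>m n + peval n B p * B)"
    using B by (subst add_smult_distrib_left_mat[of _ n n]) (auto simp: smult_smult_mat square_mat_simps[where n = n])
  finally show ?case by (simp add: peval_pCons)
qed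

lemma peval_mult: "peval n B (p * q) = peval n B p * peval n B q"
proof (induction p)
  case 0
  then show ?case by (simp add: square_mat_simps[where n = n])
next
  case (pCons a p)
  have "peval n B (pCons a p * q) = a \<cdot>\<^sub>m peval n B q + (peval n B p * peval n B q) * B"
    using B by (simp add: peval_add peval_smult peval_pCons pCons.IH)
      (simp add: square_mat_simps[where n = n])
  also have "(peval n B p * peval n B q) * B = peval n B p * (B * peval n B q)"
    using B by (simp add: assoc_mult_mat[of _ n n _ n _ n] peval_commute)
  also have "\<dots> = peval n B p * B * peval n B q"
    using B by (simp add: assoc_mult_mat[of _ n n _ n _ n])
  also have "a \<cdot>\<^sub>m peval n B q = (a \<cdot>\<^sub>m 1\<^sub>m n) * peval n B q"
    by (simp add: mult_smult_assoc_mat[of _ n n _ n])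
  also have "\<dots> + peval n B p * B * peval n B q = (a \<cdot>\<^sub>m 1\<^sub>m n + peval n B p * B) * peval n B q"
    using B by (intro add_mult_distrib_mat[symmetric, of _ n n _ _ n]) auto
  finally show ?case by (simp add: peval_pCons)
qed

lemma peval_X: "peval n B [:0, 1:] = B"
  using B by (simp add: peval_pCons square_mat_simps[where n = n])

text \<open>Turns the vanishing of a polynomial at \<open>B\<close> into linear equations for its
  coefficients.\<close>

lemma peval_index:
  assumes "i < n" "j < n"
  shows "peval n B (Poly as) $$ (i, j) = (\<Sum>k<length as. as ! k * (B ^\<^sub>m k) $$ (i, j))"
  using assms
proof (induction as arbitrary: i j)
  case Nil
  then show ?case by simp
next
  case (Cons a as)
  have pow: "B ^\<^sub>m k \<in> carrier_mat n n" for k using B by simp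
  have "peval n B (Poly (a # as)) $$ (i, j) = a * 1\<^sub>m n $$ (i, j) + (peval n B (Poly as) * B) $$ (i, j)"
    using B Cons.prems by (simp add: peval_pCons del: index_mult_mat(1))
  also have "(peval n B (Poly as) * B) $$ (i, j) = (\<Sum>l<n. peval n B (Poly as) $$ (i, l) * B $$ (l, j))"
    by (rule index_mult_mat_sum[OF peval_carrier B]) (use Cons.prems in auto)
  also have "\<dots> = (\<Sum>l<n. \<Sum>k<length as. as ! k * (B ^\<^sub>m k) $$ (i, l) * B $$ (l, j))"
    using Cons by (intro sum.cong) (auto simp: sum_distrib_right)
  also have "\<dots> = (\<Sum>k<length as. as ! k * (\<Sum>l<n. (B ^\<^sub>m k) $$ (i, l) * B $$ (l, j)))"
    by (subst sum.swap) (simp add: sum_distrib_left mult_ac)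
  also have "\<dots> = (\<Sum>k<length as. as ! k * (B ^\<^sub>m Suc k) $$ (i, j))"
    using index_mult_mat_sum[OF pow B] Cons.prems by simp
  finally show ?case using B Cons.prems
    by (subst length_Cons, subst sum.lessThan_Suc_shift) (simp del: pow_mat.simps(2))
qed

text \<open>The \<open>n * n + 1\<close> powers of \<open>B\<close> up to exponent
  \<open>n * n\<close> lie in a space of dimension \<open>n * n\<close> and are dependent. Flattened
  row by row they are the columns of \<open>K\<close>, and a kernel vector of \<open>K\<close> is
  read as a coefficient list.\<close>

lemma annihilating_poly:
  obtains f where "f \<noteq> 0" "peval n B f = 0\<^sub>m n n"
proof -
  define K where "K = mat (n * n) (Suc (n * n)) (\<lambda>(I, k). (B ^\<^sub>m k) $$ (I div n, I mod n))"
  have K: "K \<in> carrier_mat (n * n) (Suc (n * n))" by (simp add: K_def)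
  obtain v where v: "v \<in> carrier_vec (Suc (n * n))" "v \<noteq> 0\<^sub>v (Suc (n * n))" "K *\<^sub>v v = 0\<^sub>v (n * n)"
    using wide_mat_kernel[OF K lessI] by metis
  define as where "as = list_of_vec v"
  have as: "length as = Suc (n * n)" "\<And>k. k < Suc (n * n) \<Longrightarrow> as ! k = v $ k"
    using v(1) by (auto simp: as_def list_of_vec_index)
  show thesis
  proof (rule that)
    obtain k where k: "k < Suc (n * n)" "v $ k \<noteq> 0"
      using v by (metis carrier_vecD eq_vecI index_zero_vec)
    then have "Polynomial.coeff (Poly as) k \<noteq> 0" using as by (simp add: coeff_Poly_eq nth_default_def)
    then show "Poly as \<noteq> 0" by (metis Polynomial.coeff_0)
    show "peval n B (Poly as) = 0\<^sub>m n n"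
    proof (rule eq_matI)
      fix i j assume "i < dim_row (0\<^sub>m n n)" "j < dim_col (0\<^sub>m n n)"
      then have ij: "i < n" "j < n" by auto
      have I: "i * n + j < n * n" by (rule block_index_less[OF ij])
      have "0 = (K *\<^sub>v v) $ (i * n + j)" using v(3) I by simp
      also have "\<dots> = (\<Sum>k<Suc (n * n). K $$ (i * n + j, k) * v $ k)"
        using K v(1) I by (simp add: scalar_prod_def atLeast0LessThan)
      also have "\<dots> = (\<Sum>k<Suc (n * n). as ! k * (B ^\<^sub>m k) $$ (i, j))"
        using I ij as by (intro sum.cong) (auto simp: K_def block_div_mod)
      also have "\<dots> = peval n B (Poly as) $$ (i, j)"
        using peval_index[OF ij, of as] as by simp
      finally show "peval n B (Poly as) $$ (i, j) = 0\<^sub>m n n $$ (i, j)" using ij by simp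
    qed (use carrier_matD[OF peval_carrier[of "Poly as"]] in auto)
  qed
qed

text \<open>Modulo a polynomial with \<open>0\<close> as a multiple root, \<open>x\<close> has no
  square root. So the factors \<open>x\<close> are split off; each of them becomes \<open>B\<close>
  under evaluation and is cancelled by the inverse.\<close>

lemma annihilating_poly_nonzero_const:
  assumes "det B \<noteq> 0"
  obtains f where "poly f 0 \<noteq> 0" "peval n B f = 0\<^sub>m n n"
proof -
  obtain f where f: "f \<noteq> 0" "peval n B f = 0\<^sub>m n n" by (rule annihilating_poly)
  obtain g where g: "f = [:0, 1:] ^ Polynomial.order 0 f * g" "\<not> [:0, 1:] dvd g"
    using order_decomp[OF f(1), of 0] by auto
  have "peval n B ([:0, 1:] ^ k * g) = 0\<^sub>m n n \<Longrightarrow> peval n B g = 0\<^sub>m n n" for k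
  proof (induction k)
    case (Suc k)
    let ?M = "peval n B ([:0, 1:] ^ k * g)"
    have "[:0, 1:] ^ Suc k * g = [:0, 1:] * ([:0, 1:] ^ k * g)" by (simp add: mult_ac)
    then have "B * ?M = 0\<^sub>m n n" using Suc.prems by (simp only: peval_mult[of "[:0,1:]"] peval_X)
    then have "minv B * (B * ?M) = 0\<^sub>m n n" using minv(1)[OF B assms] by simp
    moreover have "minv B * (B * ?M) = minv B * B * ?M"
      by (rule assoc_mult_mat[symmetric, OF minv(1)[OF B assms] B peval_carrier])
    ultimately have "?M = 0\<^sub>m n n" using minv(3)[OF B assms] by (simp add: square_mat_simps[where n = n])
    then show ?case by (rule Suc.IH)
  qed simp
  then have "peval n B g = 0\<^sub>m n n" using f g by metis
  moreover have "poly g 0 \<noteq> 0" using g(2) poly_eq_0_iff_dvd[of g 0] by simp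
  ultimately show thesis using that by blast
qed

end

lemma quadratic_root:
  fixes a b c :: "'f::alg_closed_field"
  assumes "a \<noteq> 0 \<or> b \<noteq> 0"
  obtains z where "a * z\<^sup>2 + b * z + c = 0"
proof -
  have "0 < degree [:c, b, a:]" using assms by auto
  then obtain z where "poly [:c, b, a:] z = 0" using alg_closed_imp_poly_has_root by blast
  then show thesis by (intro that[of z]) (simp add: algebra_simps power2_eq_square)
qed

text \<open>The square root of \<open>x\<close> is lifted from \<open>g\<close> to \<open>(x - a) * g\<close> by adding a multiple of \<open>g\<close>.\<close>

lemma sqrt_X_mod_poly:
  fixes f :: "'f::alg_closed_field poly"
  assumes two: "(2::'f) \<noteq> 0" and "poly f 0 \<noteq> 0"
  shows "\<exists>p. f dvd p * p - [:0, 1:]"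
  using assms(2)
proof (induction "degree f" arbitrary: f)
  case 0
  then have "is_unit f" by (metis is_unit_iff_degree poly_0)
  then show ?case using unit_imp_dvd by blast
next
  case (Suc n)
  then obtain a where a: "poly f a = 0" using alg_closed_imp_poly_has_root[of f] by auto
  then obtain g where g: "f = [:- a, 1:] * g" by (auto simp: poly_eq_0_iff_dvd dvd_def)
  have "a \<noteq> 0" using a Suc.prems by auto
  have "g \<noteq> 0" using g Suc.prems by auto
  then have "degree f = Suc (degree g)"
    unfolding g by (subst degree_mult_eq) auto
  then have "n = degree g" using Suc.hyps(2) by simp
  moreover have "poly g 0 \<noteq> 0" using Suc.prems g by auto
  ultimately obtain p k where p: "p * p - [:0, 1:] = g * k"
    using Suc.hyps(1)[of g] by (auto simp: dvd_def)
  \<comment> \<open>Replacing \<open>p\<close> by \<open>p + c g\<close> turns the remainder into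
    \<open>g * ?q\<close> with \<open>?q\<close> as below, and \<open>c\<close> is to be chosen such
    that \<open>?q\<close> vanishes at \<open>a\<close>. The equation is quadratic in
    \<open>c\<close> if \<open>g\<close> does not vanish at \<open>a\<close>. At a multiple root,
    \<open>p(a)^2 = a\<close> is nonzero, so the linear coefficient \<open>2 p(a)\<close> is nonzero
    in characteristic other than 2.\<close>
  have "poly g a \<noteq> 0 \<or> 2 * poly p a \<noteq> 0"
  proof (rule ccontr)
    assume c: "\<not> ?thesis"
    have "poly (p * p - [:0, 1:]) a = 0" using c p by simp
    then show False using c \<open>a \<noteq> 0\<close> two by simp
  qed
  then obtain c where c: "poly g a * c\<^sup>2 + 2 * poly p a * c + poly k a = 0"
    using quadratic_root by blast
  let ?q = "k + Polynomial.smult (2 * c) p + Polynomial.smult (c * c) g"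
  have "poly ?q a = 0" using c by (simp add: algebra_simps power2_eq_square)
  then have "[:- a, 1:] dvd ?q" by (simp only: poly_eq_0_iff_dvd)
  then obtain r where r: "?q = [:- a, 1:] * r" by (rule dvdE)
  have d2: "Polynomial.smult (2 * c) p = Polynomial.smult c p + Polynomial.smult c p"
    by (metis mult_2 smult_add_left)
  have "(p + Polynomial.smult c g) * (p + Polynomial.smult c g) - [:0, 1:]
      = (p * p - [:0, 1:]) + g * (Polynomial.smult (2 * c) p + Polynomial.smult (c * c) g)"
    unfolding d2 by (simp add: algebra_simps)
  also have "\<dots> = g * ?q" unfolding p by (simp add: algebra_simps)
  also have "\<dots> = f * r" unfolding r g by (simp only: mult_ac)
  finally show ?case by (metis dvd_triv_left)
qed

lemma mat_sqrt:
  fixes B :: "'f::alg_closed_field mat"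
  assumes "(2::'f) \<noteq> 0" and B: "B \<in> carrier_mat n n" and "det B \<noteq> 0"
  obtains p where "peval n B p * peval n B p = B"
proof -
  obtain f where f: "poly f 0 \<noteq> 0" "peval n B f = 0\<^sub>m n n"
    using annihilating_poly_nonzero_const[OF B assms(3)] .
  then obtain p k where p: "p * p - [:0, 1:] = f * k"
    using sqrt_X_mod_poly[OF assms(1) f(1)] by (auto simp: dvd_def)
  have "p * p = f * k + [:0, 1:]" using p by (simp add: algebra_simps)
  then have "peval n B p * peval n B p = peval n B (f * k + [:0, 1:])"
    by (simp add: peval_mult[OF B, symmetric])
  also have "\<dots> = B" using B f(2) by (simp add: peval_add[OF B] peval_mult[OF B] peval_X[OF B] square_mat_simps[where n = n] peval_carrier[OF B])
  finally show thesis by (rule that)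
qed

text \<open>
  The matrix \<open>B = \<Phi>\<^sup>-\<^sup>1 \<Phi>'\<close> is selfadjoint for the form of \<open>\<Phi>\<close>, hence so is a square root of \<open>B\<close>
  that is a polynomial in \<open>B\<close>, and this square root is the base change.
\<close>

lemma congruent_via_sqrt:
  fixes \<Phi> \<Phi>' :: "'f::alg_closed_field mat"
  assumes two: "(2::'f) \<noteq> 0" and \<Phi>: "\<Phi> \<in> carrier_mat n n" "det \<Phi> \<noteq> 0" "transpose_mat \<Phi> = \<delta> \<cdot>\<^sub>m \<Phi>"
    and \<Phi>': "\<Phi>' \<in> carrier_mat n n" "det \<Phi>' \<noteq> 0" "transpose_mat \<Phi>' = \<delta> \<cdot>\<^sub>m \<Phi>'"
    and "\<delta> * \<delta> = 1" and B: "B \<in> carrier_mat n n" "\<Phi> * B = \<Phi>'"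
  obtains p where "transpose_mat (peval n B p) * \<Phi> * peval n B p = \<Phi>'"
proof -
  have "det B \<noteq> 0" using det_mult[OF \<Phi>(1) B(1)] B \<Phi>' by auto
  then obtain p where p: "peval n B p * peval n B p = B" by (rule mat_sqrt[OF two B(1)])
  have "transpose_mat B * transpose_mat \<Phi> = transpose_mat \<Phi>'"
    using transpose_mult[OF \<Phi>(1) B(1)] B by simp
  then have "\<delta> \<cdot>\<^sub>m (transpose_mat B * \<Phi>) = \<delta> \<cdot>\<^sub>m \<Phi>'"
    using \<Phi> \<Phi>' B by (simp add: mult_smult_distrib[of _ n n _ n])
  then have "(\<delta> * \<delta>) \<cdot>\<^sub>m (transpose_mat B * \<Phi>) = (\<delta> * \<delta>) \<cdot>\<^sub>m \<Phi>'"
    by (simp flip: smult_smult_mat)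
  then have BT: "transpose_mat B * \<Phi> = \<Phi> * B" using assms(8) B by (simp add: one_smult_mat')
  have adj: "transpose_mat (peval n B p) * \<Phi> = \<Phi> * peval n B p"
  \<comment> \<open>Selfadjoint matrices are not closed under products. The product case works
    because the factors commute: transposing \<open>A * B\<close> leads to
    \<open>\<Phi> * (B * A)\<close>.\<close>
  proof (rule peval_induct[OF B(1), where P = "\<lambda>X. transpose_mat X * \<Phi> = \<Phi> * X"])
    fix A C :: "'f mat" assume "A \<in> carrier_mat n n" "C \<in> carrier_mat n n"
      "transpose_mat A * \<Phi> = \<Phi> * A" "transpose_mat C * \<Phi> = \<Phi> * C"
    then show "transpose_mat (A + C) * \<Phi> = \<Phi> * (A + C)"
      using \<Phi>(1) by (simp add: transpose_add[of _ n n] add_mult_distrib_mat[of _ n n] mult_add_distrib_mat[of _ n n])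
  next
    fix c and A :: "'f mat" assume "A \<in> carrier_mat n n" "transpose_mat A * \<Phi> = \<Phi> * A"
    moreover have "transpose_mat (c \<cdot>\<^sub>m A) = c \<cdot>\<^sub>m transpose_mat A" by (rule eq_matI) auto
    ultimately show "transpose_mat (c \<cdot>\<^sub>m A) * \<Phi> = \<Phi> * (c \<cdot>\<^sub>m A)"
      using \<Phi>(1) by (simp add: mult_smult_distrib[of _ n n] mult_smult_assoc_mat[of _ n n])
  next
    fix A :: "'f mat" assume A: "A \<in> carrier_mat n n" and e: "transpose_mat A * \<Phi> = \<Phi> * A" and AB: "A * B = B * A"
    have "transpose_mat (A * B) * \<Phi> = transpose_mat B * (transpose_mat A * \<Phi>)"
      using transpose_mult[OF A B(1)] assoc_mult_mat[of "transpose_mat B" n n "transpose_mat A" n \<Phi> n] A B \<Phi>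
      by simp
    also have "\<dots> = transpose_mat B * \<Phi> * A"
      unfolding e using assoc_mult_mat[of "transpose_mat B" n n \<Phi> n A n] A B \<Phi> by simp
    also have "\<dots> = \<Phi> * (B * A)" unfolding BT using assoc_mult_mat[of \<Phi> n n B n A n] A B \<Phi> by simp
    finally show "transpose_mat (A * B) * \<Phi> = \<Phi> * (A * B)" by (simp only: AB)
  qed (use \<Phi>(1) in \<open>auto simp: transpose_one\<close>)
  have "transpose_mat (peval n B p) * \<Phi> * peval n B p = \<Phi> * (peval n B p * peval n B p)"
    unfolding adj using assoc_mult_mat[of \<Phi> n n "peval n B p" n "peval n B p" n] \<Phi> B by simp
  then show thesis using p B that by simp
qed

section \<open>The standard realization\<close>

text \<open>Commutation factors multiply in each argument just as the values of a bicharacter do, so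
  \<beta> can be matched generator by generator, without reordering words.\<close>

definition qcomm :: "'f::field \<Rightarrow> 'f mat \<Rightarrow> 'f mat \<Rightarrow> bool" where
  "qcomm c A B \<longleftrightarrow> A * B = c \<cdot>\<^sub>m (B * A)"

context
  fixes n :: nat and A A' B B' :: "'f::field mat"
  assumes car: "A \<in> carrier_mat n n" "A' \<in> carrier_mat n n" "B \<in> carrier_mat n n" "B' \<in> carrier_mat n n"
begin

lemma qcomm_mult_right:
  assumes "qcomm c A B" "qcomm c' A B'"
  shows "qcomm (c * c') A (B * B')"
proof -
  have "A * (B * B') = A * B * B'" using car by (simp add: assoc_mult_mat[of _ n n _ n _ n])
  also have "\<dots> = c \<cdot>\<^sub>m (B * A * B')" using car assms(1)
    by (simp add: qcomm_def mult_smult_assoc_mat[of _ n n _ n])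
  also have "B * A * B' = B * (A * B')" using car by (simp add: assoc_mult_mat[of _ n n _ n _ n])
  also have "\<dots> = c' \<cdot>\<^sub>m (B * (B' * A))" using car assms(2)
    by (simp add: qcomm_def mult_smult_distrib[of _ n n _ n])
  also have "B * (B' * A) = B * B' * A" using car by (simp add: assoc_mult_mat[of _ n n _ n _ n])
  finally show ?thesis by (simp add: qcomm_def smult_smult_mat)
qed

lemma qcomm_mult_left:
  assumes "qcomm c A B" "qcomm c' A' B"
  shows "qcomm (c * c') (A * A') B"
proof -
  have "A * A' * B = A * (A' * B)" using car by (simp add: assoc_mult_mat[of _ n n _ n _ n])
  also have "\<dots> = c' \<cdot>\<^sub>m (A * (B * A'))" using car assms(2)
    by (simp add: qcomm_def mult_smult_distrib[of _ n n _ n])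
  also have "A * (B * A') = A * B * A'" using car by (simp add: assoc_mult_mat[of _ n n _ n _ n])
  also have "\<dots> = c \<cdot>\<^sub>m (B * A * A')" using car assms(1)
    by (simp add: qcomm_def mult_smult_assoc_mat[of _ n n _ n])
  also have "B * A * A' = B * (A * A')" using car by (simp add: assoc_mult_mat[of _ n n _ n _ n])
  finally show ?thesis by (simp add: qcomm_def smult_smult_mat mult.commute)
qed

lemma qcomm_sym:
  assumes "qcomm c A B" "c * c' = 1"
  shows "qcomm c' B A"
  using assms by (simp add: qcomm_def smult_smult_mat mult.commute[of c'])

end

lemma qcomm_pow_right:
  fixes A B :: "'f::field mat"
  assumes "A \<in> carrier_mat n n" "B \<in> carrier_mat n n" "qcomm c A B"
  shows "qcomm (c ^ k) A (B ^\<^sub>m k)"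
proof (induction k)
  case (Suc k)
  then show ?case
    using qcomm_mult_right[OF assms(1,1) pow_carrier_mat[OF assms(2)] assms(2) Suc assms(3)]
    by (simp add: mult.commute)
qed (use assms in \<open>simp add: qcomm_def\<close>)

lemma qcomm_pow_left:
  fixes A B :: "'f::field mat"
  assumes "A \<in> carrier_mat n n" "B \<in> carrier_mat n n" "qcomm c A B"
  shows "qcomm (c ^ k) (A ^\<^sub>m k) B"
proof (induction k)
  case (Suc k)
  then show ?case
    using qcomm_mult_left[OF pow_carrier_mat[OF assms(1)] assms(1) assms(2,2) Suc assms(3)]
    by (simp add: mult.commute)
qed (use assms in \<open>simp add: qcomm_def\<close>)

lemma qcomm_kron:
  fixes A B :: "'f::field mat"
  assumes "A \<in> carrier_mat n n" "A' \<in> carrier_mat n n" "B \<in> carrier_mat m m" "B' \<in> carrier_mat m m"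
    "qcomm c A A'" "qcomm c' B B'"
  shows "qcomm (c * c') (kron A B) (kron A' B')"
  using assms by (simp add: qcomm_def kron_mult[of _ n n _ n _ m m _ m] kron_smult smult_smult_mat mult.commute)

lemma X_mat_carrier [simp]: "X_mat l \<epsilon> \<in> carrier_mat l l" by (simp add: X_mat_def)
lemma Y_mat_carrier [simp]: "Y_mat l \<in> carrier_mat l l" by (simp add: Y_mat_def)

text \<open>Along the superdiagonal of \<open>Y\<close> the exponents in \<open>X\<close> drop by
  one from row to column, which produces one factor \<epsilon>. At the corner entry the exponent
  jumps from \<open>0\<close> in the last row to \<open>l - 1\<close> in the first column, and
  \<open>\<epsilon> ^ l = 1\<close> closes the cycle.\<close>

lemma X_Y_qcomm:
  fixes \<epsilon> :: "'f::field"
  assumes "\<epsilon> ^ l = 1" "0 < l"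
  shows "qcomm \<epsilon> (X_mat l \<epsilon>) (Y_mat l)"
  unfolding qcomm_def
proof (rule eq_matI)
  fix i j assume "i < dim_row (\<epsilon> \<cdot>\<^sub>m (Y_mat l * X_mat l \<epsilon>))" "j < dim_col (\<epsilon> \<cdot>\<^sub>m (Y_mat l * X_mat l \<epsilon>))"
  then have ij: "i < l" "j < l" by (auto simp: X_mat_def Y_mat_def)
  have "(X_mat l \<epsilon> * Y_mat l) $$ (i, j) = (\<Sum>k<l. X_mat l \<epsilon> $$ (i, k) * Y_mat l $$ (k, j))"
    by (rule index_mult_mat_sum) (use ij in auto)
  also have "\<dots> = (\<Sum>k<l. if k = i then \<epsilon> ^ (l - 1 - i) * Y_mat l $$ (i, j) else 0)"
    using ij by (intro sum.cong) (auto simp: X_mat_def)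
  also have "\<dots> = \<epsilon> ^ (l - 1 - i) * Y_mat l $$ (i, j)" using ij by simp
  also have "\<dots> = \<epsilon> * (Y_mat l $$ (i, j) * \<epsilon> ^ (l - 1 - j))"
  proof (cases "j = i + 1")
    case True
    then have "l - 1 - i = Suc (l - 1 - j)" using ij by simp
    then show ?thesis by (metis mult.commute mult.left_commute power_Suc)
  next
    case False
    moreover have "\<epsilon> * \<epsilon> ^ (l - 1) = 1" using assms by (simp flip: power_Suc)
    ultimately show ?thesis using ij by (auto simp: Y_mat_def)
  qed
  also have "Y_mat l $$ (i, j) * \<epsilon> ^ (l - 1 - j) = (\<Sum>k<l. if k = j then Y_mat l $$ (i, j) * \<epsilon> ^ (l - 1 - j) else 0)"
    using ij by simp
  also have "\<dots> = (\<Sum>k<l. Y_mat l $$ (i, k) * X_mat l \<epsilon> $$ (k, j))"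
    using ij by (intro sum.cong) (auto simp: X_mat_def)
  also have "\<dots> = (Y_mat l * X_mat l \<epsilon>) $$ (i, j)"
    by (rule index_mult_mat_sum[symmetric]) (use ij in auto)
  finally show "(X_mat l \<epsilon> * Y_mat l) $$ (i, j) = (\<epsilon> \<cdot>\<^sub>m (Y_mat l * X_mat l \<epsilon>)) $$ (i, j)"
    using ij by (simp add: carrier_matD[OF X_mat_carrier] carrier_matD[OF Y_mat_carrier])
qed (auto simp: X_mat_def Y_mat_def)

text \<open>An existential right inverse passes through products, powers and Kronecker products, so
  determinants of Kronecker products need no formula; \<open>rinv_det\<close> converts at the
  end.\<close>

definition rinv :: "nat \<Rightarrow> 'f::field mat \<Rightarrow> bool" where
  "rinv n A \<longleftrightarrow> A \<in> carrier_mat n n \<and> (\<exists>B\<in>carrier_mat n n. A * B = 1\<^sub>m n)"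

lemma rinv_carrier: "rinv n A \<Longrightarrow> A \<in> carrier_mat n n" by (simp add: rinv_def)

lemma rinv_one [simp]: "rinv n (1\<^sub>m n)"
  unfolding rinv_def by (auto intro!: bexI[of _ "1\<^sub>m n"])

lemma rinv_mult:
  assumes "rinv n A" "rinv n B"
  shows "rinv n (A * B)"
proof -
  obtain A' B' where *: "A' \<in> carrier_mat n n" "A * A' = 1\<^sub>m n" "B' \<in> carrier_mat n n" "B * B' = 1\<^sub>m n"
    using assms by (auto simp: rinv_def)
  note car = rinv_carrier[OF assms(1)] rinv_carrier[OF assms(2)]
  have BA: "B * (B' * A') = A'"
    using car * assoc_mult_mat[of B n n B' n A' n] by simp
  have "A * B * (B' * A') = A * (B * (B' * A'))"
    using * car by (intro square_mat_simps(4)[where n = n] square_mat_simps(1)[where n = n])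
  then show ?thesis using * car BA unfolding rinv_def
    by (metis mult_carrier_mat)
qed

lemma rinv_pow: "rinv n A \<Longrightarrow> rinv n (A ^\<^sub>m k)"
  by (induction k) (auto intro: rinv_mult simp: rinv_carrier[THEN carrier_matD(1)])

lemma rinv_kron:
  assumes "rinv n A" "rinv m B"
  shows "rinv (n * m) (kron A B)"
proof -
  obtain A' B' where *: "A' \<in> carrier_mat n n" "A * A' = 1\<^sub>m n" "B' \<in> carrier_mat m m" "B * B' = 1\<^sub>m m"
    using assms by (auto simp: rinv_def)
  note car = rinv_carrier[OF assms(1)] rinv_carrier[OF assms(2)]
  have "kron A B * kron A' B' = 1\<^sub>m (n * m)"
    using * by (simp add: kron_mult[OF car(1) *(1) car(2) *(3)])
  then show ?thesis using * car unfolding rinv_def by (auto intro!: bexI[of _ "kron A' B'"])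
qed

lemma rinv_X_mat:
  fixes \<epsilon> :: "'f::field"
  assumes "\<epsilon> \<noteq> 0" shows "rinv l (X_mat l \<epsilon>)"
  unfolding rinv_def
proof (intro conjI bexI[of _ "X_mat l (inverse \<epsilon>)"])
  show "X_mat l \<epsilon> * X_mat l (inverse \<epsilon>) = 1\<^sub>m l"
  proof (rule eq_matI)
    fix i j assume "i < dim_row (1\<^sub>m l :: 'f mat)" "j < dim_col (1\<^sub>m l :: 'f mat)"
    then have ij: "i < l" "j < l" by auto
    have "(X_mat l \<epsilon> * X_mat l (inverse \<epsilon>)) $$ (i, j)
        = (\<Sum>k<l. X_mat l \<epsilon> $$ (i, k) * X_mat l (inverse \<epsilon>) $$ (k, j))"
      by (rule index_mult_mat_sum) (use ij in auto)
    also have "\<dots> = (\<Sum>k<l. if k = i then (if i = j then 1 else 0) else 0)"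
      using ij assms by (intro sum.cong) (auto simp: X_mat_def power_inverse)
    finally show "(X_mat l \<epsilon> * X_mat l (inverse \<epsilon>)) $$ (i, j) = 1\<^sub>m l $$ (i, j)" using ij by simp
  qed (auto simp: X_mat_def)
qed auto

lemma Y_mat_index: "i < l \<Longrightarrow> j < l \<Longrightarrow> Y_mat l $$ (i, j) = (if j = Suc i mod l then 1 else 0)"
  by (cases "Suc i = l") (auto simp: Y_mat_def)

lemma rinv_Y_mat: "rinv l (Y_mat l :: 'f::field mat)"
  unfolding rinv_def
proof (intro conjI bexI[of _ "transpose_mat (Y_mat l)"])
  show "Y_mat l * transpose_mat (Y_mat l) = (1\<^sub>m l :: 'f mat)"
  proof (rule eq_matI)
    fix i j assume "i < dim_row (1\<^sub>m l :: 'f mat)" "j < dim_col (1\<^sub>m l :: 'f mat)"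
    then have ij: "i < l" "j < l" by auto
    have m: "Suc i mod l < l" using ij by simp
    have "(Y_mat l * transpose_mat (Y_mat l)) $$ (i, j)
        = (\<Sum>k<l. Y_mat l $$ (i, k) * transpose_mat (Y_mat l :: 'f mat) $$ (k, j))"
      by (rule index_mult_mat_sum) (use ij in auto)
    also have "\<dots> = (\<Sum>k<l. Y_mat l $$ (i, k) * Y_mat l $$ (j, k))"
      using ij by (intro sum.cong) (auto simp: carrier_matD[OF Y_mat_carrier])
    also have "\<dots> = (\<Sum>k<l. if k = Suc i mod l then (if Suc i mod l = Suc j mod l then 1 else 0) else 0)"
      using ij by (intro sum.cong) (auto simp: Y_mat_index)
    also have "\<dots> = (if Suc i mod l = Suc j mod l then 1 else 0)" using m by simp
    also have "Suc i mod l = Suc j mod l \<longleftrightarrow> i = j"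
      using ij by (auto simp: mod_Suc split: if_splits)
    finally show "(Y_mat l * transpose_mat (Y_mat l)) $$ (i, j) = (1\<^sub>m l :: 'f mat) $$ (i, j)" using ij by simp
  qed (auto simp: Y_mat_def)
qed auto

section \<open>The bicharacter and words in its generators\<close>

locale bichar = comm_group G for G (structure) +
  fixes T :: "'a set" and \<beta> :: "'a \<times> 'a \<Rightarrow> 'f::field"
  assumes pair: "finite_bichar_pair G T \<beta>"
begin

lemma T_subgroup: "subgroup T G" and T_finite: "finite T" and T_nondeg: "nondegenerate_on G T \<beta>"
  and T_alt: "alternating_bicharacter G T \<beta>"
  using pair by (auto simp: finite_bichar_pair_def)

lemma T_mult [simp]: "u \<in> T \<Longrightarrow> v \<in> T \<Longrightarrow> u \<otimes> v \<in> T"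
  and T_inv [simp]: "u \<in> T \<Longrightarrow> inv u \<in> T"
  and T_one [simp]: "\<one> \<in> T"
  and T_carrier [simp]: "u \<in> T \<Longrightarrow> u \<in> carrier G"
  using T_subgroup by (auto dest: subgroup.m_closed subgroup.m_inv_closed subgroup.one_closed subgroup.mem_carrier)

lemma T_pow [simp]: "u \<in> T \<Longrightarrow> u [^] (k::nat) \<in> T"
  by (induction k) auto

lemma \<beta>_nonzero: "u \<in> T \<Longrightarrow> v \<in> T \<Longrightarrow> \<beta> (u, v) \<noteq> 0"
  and \<beta>_mult_left: "u \<in> T \<Longrightarrow> v \<in> T \<Longrightarrow> t \<in> T \<Longrightarrow> \<beta> (u \<otimes> v, t) = \<beta> (u, t) * \<beta> (v, t)"
  and \<beta>_mult_right: "u \<in> T \<Longrightarrow> v \<in> T \<Longrightarrow> t \<in> T \<Longrightarrow> \<beta> (t, u \<otimes> v) = \<beta> (t, u) * \<beta> (t, v)"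
  and \<beta>_alt: "t \<in> T \<Longrightarrow> \<beta> (t, t) = 1"
  using T_alt unfolding alternating_bicharacter_def by (auto simp: PiE_def Pi_def)

lemma \<beta>_one [simp]: "t \<in> T \<Longrightarrow> \<beta> (\<one>, t) = 1" "t \<in> T \<Longrightarrow> \<beta> (t, \<one>) = 1"
  using \<beta>_mult_left[of \<one> \<one> t] \<beta>_nonzero[of \<one> t] \<beta>_mult_right[of \<one> \<one> t] \<beta>_nonzero[of t \<one>] by auto

lemma \<beta>_pow: "u \<in> T \<Longrightarrow> t \<in> T \<Longrightarrow> \<beta> (u [^] (k::nat), t) = \<beta> (u, t) ^ k"
   "u \<in> T \<Longrightarrow> t \<in> T \<Longrightarrow> \<beta> (t, u [^] (k::nat)) = \<beta> (t, u) ^ k"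
  by (induction k) (auto simp: \<beta>_mult_left \<beta>_mult_right)

lemma \<beta>_swap: "u \<in> T \<Longrightarrow> v \<in> T \<Longrightarrow> \<beta> (u, v) * \<beta> (v, u) = 1"
proof -
  assume uv: "u \<in> T" "v \<in> T"
  then have "\<beta> (u \<otimes> v, u \<otimes> v) = \<beta> (u, v) * \<beta> (v, u)"
    by (subst \<beta>_mult_left) (simp_all add: \<beta>_mult_right \<beta>_alt)
  then show ?thesis using \<beta>_alt[of "u \<otimes> v"] uv by simp
qed

definition factor :: "'a \<times> 'a \<Rightarrow> nat \<times> nat \<Rightarrow> 'f mat" where
  "factor = (\<lambda>(a, b) (i, j). X_mat (ord a) (\<beta> (a, b)) ^\<^sub>m i * Y_mat (ord b) ^\<^sub>m j)"

text \<open>The list of pairs is an arbitrary \<open>xs\<close> because the proofs are inductions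
  over it: \<open>gen_pair\<close> and \<open>orth_pairs\<close> are inherited by tails, while the
  bijectivity demanded in \<open>standard_generators\<close> is not.\<close>

definition word_mat :: "('a \<times> 'a) list \<Rightarrow> (nat \<times> nat) list \<Rightarrow> 'f mat" where
  "word_mat xs es = foldr kron (map2 factor xs es) (1\<^sub>m 1)"

definition gen_pair :: "'a \<times> 'a \<Rightarrow> bool" where
  "gen_pair = (\<lambda>(a, b). a \<in> T \<and> b \<in> T \<and> ord a = ord b \<and> primitive_root_of_unity (ord a) (\<beta> (a, b)))"

definition orth_pairs :: "'a \<times> 'a \<Rightarrow> 'a \<times> 'a \<Rightarrow> bool" where
  "orth_pairs = (\<lambda>(a, b) (c, e). \<beta> (a, c) = 1 \<and> \<beta> (a, e) = 1 \<and> \<beta> (b, c) = 1 \<and> \<beta> (b, e) = 1)"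

lemma factor_rinv: "gen_pair (a, b) \<Longrightarrow> rinv (ord a) (factor (a, b) ij)"
  using rinv_X_mat[of "\<beta> (a, b)" "ord a"] rinv_Y_mat[of "ord b"] \<beta>_nonzero
  by (auto simp: factor_def gen_pair_def split: prod.splits intro!: rinv_mult rinv_pow)

text \<open>Multiplicativity in both arguments reduces the claim to the commutation factors of
  \<open>X\<close> and \<open>Y\<close> with themselves and with each other. The factor for
  \<open>Y\<close> against \<open>X\<close> is the inverse of that in \<open>X_Y_qcomm\<close>, as
  \<open>\<beta>_swap\<close> demands.\<close>

lemma factor_qcomm:
  assumes "gen_pair (a, b)"
  shows "qcomm (\<beta> (a [^] i \<otimes> b [^] j, a [^] i' \<otimes> b [^] j')) (factor (a, b) (i, j)) (factor (a, b) (i', j'))"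
proof -
  let ?X = "X_mat (ord a) (\<beta> (a, b))" and ?Y = "Y_mat (ord a) :: 'f mat"
  have ab: "a \<in> T" "b \<in> T" "ord b = ord a" "\<beta> (a, b) ^ ord a = 1" "0 < ord a"
    using assms by (auto simp: gen_pair_def primitive_root_of_unity_def)
  have XY: "qcomm (\<beta> (a, b)) ?X ?Y" using X_Y_qcomm ab by blast
  have YX: "qcomm (\<beta> (b, a)) ?Y ?X"
    by (rule qcomm_sym[where n = "ord a" and c = "\<beta> (a, b)"]) (use XY ab \<beta>_swap in auto)
  have XX: "qcomm (\<beta> (a, a)) ?X ?X" and YY: "qcomm (\<beta> (b, b)) ?Y ?Y"
    using ab by (auto simp: qcomm_def \<beta>_alt one_smult_mat')
  note car = pow_carrier_mat[OF X_mat_carrier[of "ord a" "\<beta> (a, b)"]] pow_carrier_mat[OF Y_mat_carrier[of "ord a"]]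
  have right: "qcomm (\<beta> (x, a [^] i' \<otimes> b [^] j')) Z (?X ^\<^sub>m i' * ?Y ^\<^sub>m j')"
    if "Z \<in> carrier_mat (ord a) (ord a)" "qcomm (\<beta> (x, a)) Z ?X" "qcomm (\<beta> (x, b)) Z ?Y" "x \<in> T" for x Z
    using qcomm_mult_right[OF that(1,1) car qcomm_pow_right[OF that(1) _ that(2)] qcomm_pow_right[OF that(1) _ that(3)]]
      that(4) ab by (simp add: \<beta>_mult_right \<beta>_pow)
  have c2: "?X ^\<^sub>m i' * ?Y ^\<^sub>m j' \<in> carrier_mat (ord a) (ord a)" by (rule mult_carrier_mat[OF car])
  have "qcomm (\<beta> (a [^] i \<otimes> b [^] j, a [^] i' \<otimes> b [^] j')) (?X ^\<^sub>m i * ?Y ^\<^sub>m j) (?X ^\<^sub>m i' * ?Y ^\<^sub>m j')"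
    using qcomm_mult_left[OF car c2 c2 qcomm_pow_left[OF _ c2 right[OF _ XX XY]] qcomm_pow_left[OF _ c2 right[OF _ YX YY]], of i j]
      ab by (simp add: \<beta>_mult_left \<beta>_pow)
  then show ?thesis using ab by (simp add: factor_def)
qed

lemma word_mat_simps [simp]:
  "word_mat [] es = 1\<^sub>m 1"
  "word_mat (x # xs) (e # es) = kron (factor x e) (word_mat xs es)"
  by (auto simp: word_mat_def)

lemma D_size_simps [simp]: "D_size G [] = 1" "D_size G ((a, b) # xs) = ord a * D_size G xs"
  by (auto simp: D_size_def)

lemma gen_word_simps [simp]: "gen_word G [] es = \<one>"
  "gen_word G ((a, b) # xs) ((i, j) # es) = a [^] i \<otimes> b [^] j \<otimes> gen_word G xs es"
  by (auto simp: gen_word_def)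

lemma word_mat_rinv:
  assumes "list_all gen_pair xs" "length es = length xs"
  shows "rinv (D_size G xs) (word_mat xs es)"
  using assms(2,1) by (induction es xs rule: list_induct2) (auto intro!: rinv_kron factor_rinv)

lemma gen_word_T:
  assumes "list_all gen_pair xs" "length es = length xs"
  shows "gen_word G xs es \<in> T"
  using assms(2,1) by (induction es xs rule: list_induct2) (auto simp: gen_pair_def)

lemma \<beta>_gen_word_orth:
  assumes "length es = length xs" "list_all gen_pair xs" "x \<in> T" "\<forall>(c, e)\<in>set xs. \<beta> (x, c) = 1 \<and> \<beta> (x, e) = 1"
  shows "\<beta> (x, gen_word G xs es) = 1"
  using assms by (induction es xs rule: list_induct2) (auto simp: gen_pair_def \<beta>_mult_right \<beta>_pow gen_word_T)

text \<open>The head generators pair trivially with every word in the tail, so \<beta> of two words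
  is its value on the heads times its value on the tails. Kronecker products multiply commutation
  factors in the same way.\<close>

lemma word_mat_qcomm:
  assumes "list_all gen_pair xs" "sorted_wrt orth_pairs xs" "length es = length xs" "length fs = length xs"
  shows "qcomm (\<beta> (gen_word G xs es, gen_word G xs fs)) (word_mat xs es) (word_mat xs fs)"
  using assms
proof (induction xs arbitrary: es fs)
  case Nil
  then show ?case by (simp add: qcomm_def one_smult_mat')
next
  case (Cons x xs)
  obtain a b i j es' i' j' fs' where eq: "x = (a, b)" "es = (i, j) # es'" "fs = (i', j') # fs'"
    using Cons.prems by (cases x; cases es; cases fs) auto
  have g: "gen_pair (a, b)" "list_all gen_pair xs" and len: "length es' = length xs" "length fs' = length xs"
    using Cons.prems eq by auto
  have ab: "a \<in> T" "b \<in> T" using g by (auto simp: gen_pair_def)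
  let ?u = "a [^] i \<otimes> b [^] j" and ?v = "a [^] i' \<otimes> b [^] j'"
  let ?w = "gen_word G xs es'" and ?z = "gen_word G xs fs'"
  have w: "?w \<in> T" "?z \<in> T" using gen_word_T g len by auto
  have o: "\<forall>(c, e)\<in>set xs. \<beta> (a, c) = 1 \<and> \<beta> (a, e) = 1" "\<forall>(c, e)\<in>set xs. \<beta> (b, c) = 1 \<and> \<beta> (b, e) = 1"
    using Cons.prems(2) eq by (auto simp: orth_pairs_def)
  have "\<beta> (a, ?w) = 1" "\<beta> (b, ?w) = 1" "\<beta> (a, ?z) = 1" "\<beta> (b, ?z) = 1"
    using \<beta>_gen_word_orth[OF _ g(2)] o len ab by auto
  moreover have "\<beta> (?w, a) = 1" "\<beta> (?w, b) = 1"
    using \<beta>_swap[of a ?w] \<beta>_swap[of b ?w] calculation w ab by auto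
  ultimately have "\<beta> (?u \<otimes> ?w, ?v \<otimes> ?z) = \<beta> (?u, ?v) * \<beta> (?w, ?z)"
    using ab w by (simp add: \<beta>_mult_left \<beta>_mult_right \<beta>_pow)
  moreover have "qcomm (\<beta> (?u, ?v) * \<beta> (?w, ?z)) (kron (factor (a, b) (i, j)) (word_mat xs es'))
      (kron (factor (a, b) (i', j')) (word_mat xs fs'))"
    by (rule qcomm_kron[where n = "ord a" and m = "D_size G xs"])
      (use factor_rinv[OF g(1)] word_mat_rinv[OF g(2)] len factor_qcomm[OF g(1)] Cons.IH[OF g(2) _ len]
        Cons.prems(2) in \<open>auto intro!: rinv_carrier\<close>)
  ultimately show ?case unfolding eq by simp
qed

lemma exponents_Cons:
  "exponents G ((a, b) # xs) = (\<lambda>(e, es). e # es) ` (({..<ord a} \<times> {..<ord b}) \<times> exponents G xs)"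
  by (auto simp: exponents_def list_all2_Cons1 image_iff)

text \<open>Each pair contributes \<open>ord a * ord b\<close>, a square. The outcome
  \<open>card T = d * d\<close> is the dimension of the matrices of size \<open>d\<close> and makes
  the coefficient matrix in \<open>X_span\<close> square.\<close>

lemma card_exponents:
  assumes "list_all gen_pair xs"
  shows "card (exponents G xs) = D_size G xs * D_size G xs"
  using assms
proof (induction xs)
  case Nil
  then show ?case by (simp add: exponents_def)
next
  case (Cons x xs)
  obtain a b where x: "x = (a, b)" by (cases x)
  have "inj_on (\<lambda>(e, es). e # es) (({..<ord a} \<times> {..<ord b}) \<times> exponents G xs)"
    by (auto simp: inj_on_def)
  then show ?case using Cons unfolding x exponents_Cons
    by (simp add: card_image card_cartesian_product gen_pair_def)
qed

text \<open>The order of \<open>a\<close> is 1 or 2. For order 2 the root of unity is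
  \<open>-1\<close>, both \<open>X\<close> and \<open>Y\<close> are symmetric and they anticommute,
  so among the four products only \<open>X * Y\<close> is skew.\<close>

lemma factor_transpose:
  assumes g: "gen_pair (a, b)" and a: "a \<otimes> a = \<one>" and ij: "i < ord a" "j < ord b"
  obtains c where "c \<in> {1, - 1}" "transpose_mat (factor (a, b) (i, j)) = c \<cdot>\<^sub>m factor (a, b) (i, j)"
proof -
  have aT: "a \<in> T" "b \<in> T" "ord b = ord a" and pr: "primitive_root_of_unity (ord a) (\<beta> (a, b))"
    using g by (auto simp: gen_pair_def)
  have "a [^] (2::nat) = \<one>" using a aT by (simp add: numeral_2_eq_2)
  then have "ord a dvd 2" using pow_eq_id aT by simp
  then have "ord a \<le> 2" by (rule dvd_imp_le) simp
  with pr consider "ord a = 1" | "ord a = 2" unfolding primitive_root_of_unity_def by linarith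
  then show thesis
  proof cases
    case 1
    then have "i = 0" "j = 0" using ij aT by auto
    then have "factor (a, b) (i, j) = 1\<^sub>m 1" using 1 aT
      by (simp add: factor_def carrier_matD[OF X_mat_carrier] carrier_matD[OF Y_mat_carrier])
    then show thesis by (intro that[of 1]) (auto simp: one_smult_mat' transpose_one)
  next
    case 2
    have "\<beta> (a, b) ^ 2 = 1" "\<beta> (a, b) ^ 1 \<noteq> 1"
      using pr unfolding primitive_root_of_unity_def 2 by auto
    then have \<epsilon>: "\<beta> (a, b) = - 1" by (simp add: power2_eq_1_iff)
    have "i \<in> {0, 1}" "j \<in> {0, 1}" using ij aT 2 by auto
    moreover have "factor (a, b) (0, 0) = 1\<^sub>m 2" "factor (a, b) (1, 0) = X_mat 2 (- 1)"
      "factor (a, b) (0, 1) = Y_mat 2" "factor (a, b) (1, 1) = X_mat 2 (- 1) * Y_mat 2"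
      using 2 aT \<epsilon> by (auto simp: factor_def carrier_matD[OF X_mat_carrier] carrier_matD[OF Y_mat_carrier]
          right_mult_one_mat[OF X_mat_carrier] left_mult_one_mat[OF X_mat_carrier]
          left_mult_one_mat[OF Y_mat_carrier])
    moreover have "transpose_mat (X_mat 2 (- 1)) = (X_mat 2 (- 1) :: 'f mat)" "transpose_mat (Y_mat 2) = (Y_mat 2 :: 'f mat)"
      by (rule eq_matI; auto simp: X_mat_def Y_mat_def less_2_cases_iff)+
    moreover from this have "transpose_mat (X_mat 2 (- 1) * Y_mat 2) = (- 1) \<cdot>\<^sub>m (X_mat 2 (- 1) * Y_mat 2 :: 'f mat)"
      using X_Y_qcomm[of "- 1 :: 'f" 2] transpose_mult[OF X_mat_carrier Y_mat_carrier, of 2 "- 1 :: 'f"]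
      by (simp add: qcomm_def smult_smult_mat one_smult_mat')
    ultimately show thesis
      using that[of 1] that[of "- 1"] by (auto simp: one_smult_mat' transpose_one)
  qed
qed

lemma word_mat_transpose:
  assumes "list_all gen_pair xs" "elementary_2_group G T" "es \<in> exponents G xs"
  shows "\<exists>c\<in>{1, - 1}. transpose_mat (word_mat xs es) = c \<cdot>\<^sub>m word_mat xs es"
  using assms
proof (induction xs arbitrary: es)
  case Nil
  then show ?case by (simp add: transpose_one one_smult_mat')
next
  case (Cons x xs)
  obtain a b where x: "x = (a, b)" by (cases x)
  obtain i j es' where es: "es = (i, j) # es'" "i < ord a" "j < ord b" "es' \<in> exponents G xs"
    using Cons.prems(3) unfolding x exponents_Cons by auto
  have g: "gen_pair (a, b)" using Cons.prems x by auto
  moreover have "a \<otimes> a = \<one>" using g Cons.prems(2) by (auto simp: elementary_2_group_def gen_pair_def)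
  ultimately obtain c where c: "c \<in> {1, - 1}" "transpose_mat (factor (a, b) (i, j)) = c \<cdot>\<^sub>m factor (a, b) (i, j)"
    using factor_transpose es by metis
  have "list_all gen_pair xs" using Cons.prems by simp
  then obtain c' where c': "c' \<in> {1, - 1}" "transpose_mat (word_mat xs es') = c' \<cdot>\<^sub>m word_mat xs es'"
    using Cons.IH[OF _ Cons.prems(2) es(4)] by blast
  have "transpose_mat (word_mat (x # xs) es) = (c * c') \<cdot>\<^sub>m word_mat (x # xs) es"
    unfolding x es using c c' by (simp add: kron_transpose kron_smult smult_smult_mat mult.commute)
  moreover have "c * c' \<in> {1, - 1}" using c c' by auto
  ultimately show ?case by blast
qed

text \<open>All orders are 1 or 2, so the size is a power of 2, which is nonzero when 2 is. The
  trace pairing divides by it.\<close>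

lemma D_size_nonzero:
  assumes "list_all gen_pair xs" "elementary_2_group G T" "(2::'f) \<noteq> 0"
  shows "of_nat (D_size G xs) \<noteq> (0::'f)"
  using assms(1)
proof (induction xs)
  case (Cons x xs)
  obtain a b where x: "x = (a, b)" by (cases x)
  have aT: "a \<in> T" and pr: "primitive_root_of_unity (ord a) (\<beta> (a, b))"
    using Cons.prems x by (auto simp: gen_pair_def)
  have "a [^] (2::nat) = \<one>" using assms(2) aT by (simp add: elementary_2_group_def numeral_2_eq_2)
  then have "ord a dvd 2" using pow_eq_id aT by simp
  then have "ord a \<le> 2" by (rule dvd_imp_le) simp
  with pr have "ord a = 1 \<or> ord a = 2" unfolding primitive_root_of_unity_def by linarith
  then show ?case using Cons assms(3) by (auto simp: x)
qed simp

end

section \<open>The elements \<open>X t\<close> of a standard realization\<close>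

locale std_realization = bichar G T \<beta> for G (structure) and T :: "'a set" and \<beta> :: "'a \<times> 'a \<Rightarrow> 'f::field" +
  fixes ab :: "('a \<times> 'a) list"
  assumes std: "standard_generators G T \<beta> ab"
begin

abbreviation d :: nat where "d \<equiv> D_size G ab"
abbreviation X :: "'a \<Rightarrow> 'f mat" where "X \<equiv> X_elt G \<beta> ab"

lemma gens: "list_all gen_pair ab" "sorted_wrt orth_pairs ab" "bij_betw (gen_word G ab) (exponents G ab) T"
proof -
  show "list_all gen_pair ab" using std by (auto simp: standard_generators_def gen_pair_def list_all_iff)
  show "sorted_wrt orth_pairs ab"
    unfolding sorted_wrt_iff_nth_less
  proof (intro allI impI)
    fix i j assume ij: "i < j" "j < length ab"
    then have "\<forall>x\<in>{fst (ab ! i), snd (ab ! i)}. \<forall>y\<in>{fst (ab ! j), snd (ab ! j)}. \<beta> (x, y) = 1"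
      using std unfolding standard_generators_def by auto
    then show "orth_pairs (ab ! i) (ab ! j)" by (auto simp: orth_pairs_def split: prod.splits)
  qed
  show "bij_betw (gen_word G ab) (exponents G ab) T" using std by (simp add: standard_generators_def)
qed

definition word :: "'a \<Rightarrow> (nat \<times> nat) list" where
  "word t = inv_into (exponents G ab) (gen_word G ab) t"

lemma X_word: "X t = word_mat ab (word t)"
  by (simp add: X_elt_def word_mat_def word_def factor_def case_prod_beta')

lemma word: "t \<in> T \<Longrightarrow> word t \<in> exponents G ab" "t \<in> T \<Longrightarrow> gen_word G ab (word t) = t"
  using gens(3) by (auto simp: word_def bij_betw_def inv_into_into f_inv_into_f)

lemma word_length: "t \<in> T \<Longrightarrow> length (word t) = length ab"
  using word(1)[of t] by (auto simp: exponents_def list_all2_lengthD)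

lemma X_rinv: "t \<in> T \<Longrightarrow> rinv d (X t)"
  using word_mat_rinv gens word_length by (simp add: X_word)

lemma X_carrier [simp]: "t \<in> T \<Longrightarrow> X t \<in> carrier_mat d d"
  using X_rinv rinv_carrier by blast

lemma dim_X [simp]: "t \<in> T \<Longrightarrow> dim_row (X t) = d" "t \<in> T \<Longrightarrow> dim_col (X t) = d"
  using X_carrier carrier_matD by blast+

lemma X_comm: "u \<in> T \<Longrightarrow> v \<in> T \<Longrightarrow> X u * X v = \<beta> (u, v) \<cdot>\<^sub>m (X v * X u)"
  using word_mat_qcomm[OF gens(1,2) word_length word_length, of u v] word
  by (simp add: X_word qcomm_def)

lemma d_pos: "0 < d"
proof -
  have "list_all gen_pair xs \<Longrightarrow> 0 < D_size G xs" for xs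
    by (induction xs) (auto simp: gen_pair_def primitive_root_of_unity_def)
  then show ?thesis using gens(1) by blast
qed

lemma X_one [simp]: "X \<one> = 1\<^sub>m d"
proof -
  have *: "list_all gen_pair xs \<Longrightarrow> map (\<lambda>_. (0, 0)) xs \<in> exponents G xs \<and>
     gen_word G xs (map (\<lambda>_. (0, 0)) xs) = \<one> \<and> word_mat xs (map (\<lambda>_. (0, 0)) xs) = 1\<^sub>m (D_size G xs)" for xs
  proof (induction xs)
    case (Cons x xs)
    then show ?case
      by (cases x) (auto simp: exponents_def gen_pair_def primitive_root_of_unity_def factor_def
         carrier_matD[OF X_mat_carrier] carrier_matD[OF Y_mat_carrier])
  qed (auto simp: exponents_def)
  have "word \<one> = map (\<lambda>_. (0, 0)) ab"
    unfolding word_def using *[OF gens(1)] gens(3) by (intro inv_into_f_eq) (auto simp: bij_betw_def)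
  then show ?thesis using *[OF gens(1)] by (simp add: X_word)
qed

lemma card_T: "card T = d * d"
  using card_exponents[OF gens(1)] bij_betw_same_card[OF gens(3)] by simp

end

section \<open>Homogeneous matrices\<close>

lemma mult_matsum_left:
  fixes A :: "'f::field mat"
  assumes "A \<in> carrier_mat k n" "\<And>h. h \<in> S \<Longrightarrow> F h \<in> carrier_mat n m"
  shows "A * matsum n m S F = matsum k m S (\<lambda>h. A * F h)"
proof (rule eq_matI)
  fix i j assume "i < dim_row (matsum k m S (\<lambda>h. A * F h))" "j < dim_col (matsum k m S (\<lambda>h. A * F h))"
  then have ij: "i < k" "j < m" by (auto simp: matsum_def)
  have "(A * matsum n m S F) $$ (i, j) = (\<Sum>l<n. A $$ (i, l) * (\<Sum>h\<in>S. F h $$ (l, j)))"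
    using index_mult_mat_sum[OF assms(1) matsum_carrier[of n m S F] ij] ij by (simp add: matsum_index)
  also have "\<dots> = (\<Sum>h\<in>S. \<Sum>l<n. A $$ (i, l) * F h $$ (l, j))"
    by (subst sum.swap) (simp add: sum_distrib_left)
  also have "\<dots> = (\<Sum>h\<in>S. (A * F h) $$ (i, j))"
    by (intro sum.cong refl index_mult_mat_sum[symmetric]) (use assms ij in auto)
  finally show "(A * matsum n m S F) $$ (i, j) = matsum k m S (\<lambda>h. A * F h) $$ (i, j)"
    using ij by (simp add: matsum_index)
qed (use assms in \<open>auto simp: matsum_def\<close>)

lemma mult_matsum_right:
  fixes A :: "'f::field mat"
  assumes "A \<in> carrier_mat m k" "\<And>h. h \<in> S \<Longrightarrow> F h \<in> carrier_mat n m"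
  shows "matsum n m S F * A = matsum n k S (\<lambda>h. F h * A)"
proof (rule eq_matI)
  fix i j assume "i < dim_row (matsum n k S (\<lambda>h. F h * A))" "j < dim_col (matsum n k S (\<lambda>h. F h * A))"
  then have ij: "i < n" "j < k" by (auto simp: matsum_def)
  have "(matsum n m S F * A) $$ (i, j) = (\<Sum>l<m. (\<Sum>h\<in>S. F h $$ (i, l)) * A $$ (l, j))"
    using index_mult_mat_sum[OF matsum_carrier[of n m S F] assms(1) ij] ij by (simp add: matsum_index)
  also have "\<dots> = (\<Sum>h\<in>S. \<Sum>l<m. F h $$ (i, l) * A $$ (l, j))"
    by (subst sum.swap) (simp add: sum_distrib_right)
  also have "\<dots> = (\<Sum>h\<in>S. (F h * A) $$ (i, j))"
    by (intro sum.cong refl index_mult_mat_sum[symmetric]) (use assms ij in auto)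
  finally show "(matsum n m S F * A) $$ (i, j) = matsum n k S (\<lambda>h. F h * A) $$ (i, j)"
    using ij by (simp add: matsum_index)
qed (use assms in \<open>auto simp: matsum_def\<close>)

context std_realization
begin

text \<open>
  The rows and columns of the grading are indexed independently, so that base changes between
  different \<open>\<gamma>\<close> and matrices of bilinear forms (whose row degrees are inverted) are homogeneous too.
  A block \<open>(r, s)\<close> in \<open>D\<^sub>t\<close> has degree \<open>x\<^sub>r\<^sup>-\<^sup>1 t y\<^sub>s\<close>, whence \<open>t = h x\<^sub>r y\<^sub>s\<^sup>-\<^sup>1\<close>; for \<open>t \<notin> T\<close> the value
  of \<open>X t\<close> is junk and the coefficient is 0.
\<close>

definition homog :: "'a list \<Rightarrow> 'a list \<Rightarrow> 'a \<Rightarrow> 'f mat set" where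
  "homog xs ys h = {M \<in> carrier_mat (length xs * d) (length ys * d).
     \<forall>r<length xs. \<forall>s<length ys. \<exists>a. (a \<noteq> 0 \<longrightarrow> h \<otimes> xs ! r \<otimes> inv (ys ! s) \<in> T) \<and>
       (\<forall>p<d. \<forall>q<d. M $$ (r * d + p, s * d + q) = a * X (h \<otimes> xs ! r \<otimes> inv (ys ! s)) $$ (p, q))}"

lemma homog_carrier: "M \<in> homog xs ys h \<Longrightarrow> M \<in> carrier_mat (length xs * d) (length ys * d)"
  by (simp add: homog_def)

lemma homogE:
  assumes "M \<in> homog xs ys h"
  obtains a where "\<And>r s. r < length xs \<Longrightarrow> s < length ys \<Longrightarrow> a r s \<noteq> 0 \<Longrightarrow> h \<otimes> xs ! r \<otimes> inv (ys ! s) \<in> T"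
    "\<And>r s p q. r < length xs \<Longrightarrow> s < length ys \<Longrightarrow> p < d \<Longrightarrow> q < d \<Longrightarrow>
       M $$ (r * d + p, s * d + q) = a r s * X (h \<otimes> xs ! r \<otimes> inv (ys ! s)) $$ (p, q)"
proof -
  have "\<forall>r s. \<exists>a. r < length xs \<longrightarrow> s < length ys \<longrightarrow> (a \<noteq> 0 \<longrightarrow> h \<otimes> xs ! r \<otimes> inv (ys ! s) \<in> T) \<and>
       (\<forall>p<d. \<forall>q<d. M $$ (r * d + p, s * d + q) = a * X (h \<otimes> xs ! r \<otimes> inv (ys ! s)) $$ (p, q))"
    using assms by (auto simp: homog_def)
  then obtain a where "\<forall>r s. r < length xs \<longrightarrow> s < length ys \<longrightarrow> (a r s \<noteq> 0 \<longrightarrow> h \<otimes> xs ! r \<otimes> inv (ys ! s) \<in> T) \<and>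
       (\<forall>p<d. \<forall>q<d. M $$ (r * d + p, s * d + q) = a r s * X (h \<otimes> xs ! r \<otimes> inv (ys ! s)) $$ (p, q))"
    by metis
  then show thesis by (intro that[of a]) auto
qed

lemma homogI:
  assumes "M \<in> carrier_mat (length xs * d) (length ys * d)"
    "\<And>r s. r < length xs \<Longrightarrow> s < length ys \<Longrightarrow> a r s \<noteq> 0 \<Longrightarrow> h \<otimes> xs ! r \<otimes> inv (ys ! s) \<in> T"
    "\<And>r s p q. r < length xs \<Longrightarrow> s < length ys \<Longrightarrow> p < d \<Longrightarrow> q < d \<Longrightarrow>
       M $$ (r * d + p, s * d + q) = a r s * X (h \<otimes> xs ! r \<otimes> inv (ys ! s)) $$ (p, q)"
  shows "M \<in> homog xs ys h"
  unfolding homog_def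
proof (intro CollectI conjI assms(1) allI impI)
  fix r s assume "r < length xs" "s < length ys"
  then show "\<exists>a. (a \<noteq> 0 \<longrightarrow> h \<otimes> xs ! r \<otimes> inv (ys ! s) \<in> T) \<and>
       (\<forall>p<d. \<forall>q<d. M $$ (r * d + p, s * d + q) = a * X (h \<otimes> xs ! r \<otimes> inv (ys ! s)) $$ (p, q))"
    using assms(2,3) by (intro exI[of _ "a r s"]) auto
qed

lemma homog_add:
  assumes "A \<in> homog xs ys h" "B \<in> homog xs ys h"
  shows "A + B \<in> homog xs ys h"
proof -
  obtain a where a: "\<And>r s. r < length xs \<Longrightarrow> s < length ys \<Longrightarrow> a r s \<noteq> 0 \<Longrightarrow> h \<otimes> xs ! r \<otimes> inv (ys ! s) \<in> T"
    "\<And>r s p q. r < length xs \<Longrightarrow> s < length ys \<Longrightarrow> p < d \<Longrightarrow> q < d \<Longrightarrow>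
       A $$ (r * d + p, s * d + q) = a r s * X (h \<otimes> xs ! r \<otimes> inv (ys ! s)) $$ (p, q)"
    using homogE[OF assms(1)] by blast
  obtain b where b: "\<And>r s. r < length xs \<Longrightarrow> s < length ys \<Longrightarrow> b r s \<noteq> 0 \<Longrightarrow> h \<otimes> xs ! r \<otimes> inv (ys ! s) \<in> T"
    "\<And>r s p q. r < length xs \<Longrightarrow> s < length ys \<Longrightarrow> p < d \<Longrightarrow> q < d \<Longrightarrow>
       B $$ (r * d + p, s * d + q) = b r s * X (h \<otimes> xs ! r \<otimes> inv (ys ! s)) $$ (p, q)"
    using homogE[OF assms(2)] by blast
  note car = homog_carrier[OF assms(1)] homog_carrier[OF assms(2)]
  show ?thesis
  proof (rule homogI[where a = "\<lambda>r s. a r s + b r s"])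
    fix r s assume "r < length xs" "s < length ys" "a r s + b r s \<noteq> 0"
    then show "h \<otimes> xs ! r \<otimes> inv (ys ! s) \<in> T" using a(1) b(1) by (metis add.right_neutral)
  qed (use car a(2) b(2) block_index_less in \<open>auto simp: algebra_simps\<close>)
qed

lemma homog_smult:
  assumes "A \<in> homog xs ys h"
  shows "c \<cdot>\<^sub>m A \<in> homog xs ys h"
proof -
  obtain a where a: "\<And>r s. r < length xs \<Longrightarrow> s < length ys \<Longrightarrow> a r s \<noteq> 0 \<Longrightarrow> h \<otimes> xs ! r \<otimes> inv (ys ! s) \<in> T"
    "\<And>r s p q. r < length xs \<Longrightarrow> s < length ys \<Longrightarrow> p < d \<Longrightarrow> q < d \<Longrightarrow>
       A $$ (r * d + p, s * d + q) = a r s * X (h \<otimes> xs ! r \<otimes> inv (ys ! s)) $$ (p, q)"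
    using homogE[OF assms(1)] by blast
  show ?thesis
    by (rule homogI[where a = "\<lambda>r s. c * a r s"])
      (use homog_carrier[OF assms] a block_index_less in auto)
qed

lemma homog_zero: "0\<^sub>m (length xs * d) (length ys * d) \<in> homog xs ys h"
  by (rule homogI[where a = "\<lambda>_ _. 0"]) (auto simp: block_index_less)

lemma homog_one:
  assumes "set xs \<subseteq> carrier G"
  shows "1\<^sub>m (length xs * d) \<in> homog xs xs \<one>"
proof (rule homogI[where a = "\<lambda>r s. if r = s then 1 else 0"])
  have e: "\<one> \<otimes> xs ! r \<otimes> inv (xs ! r) = \<one>" if "r < length xs" for r
    using assms that nth_mem by (simp add: subset_iff)
  fix r s assume rs: "r < length xs" "s < length xs"
  show "\<one> \<otimes> xs ! r \<otimes> inv (xs ! s) \<in> T" if "(if r = s then 1 else 0 :: 'f) \<noteq> 0"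
    using e rs that by (auto split: if_splits)
  fix p q assume pq: "p < d" "q < d"
  have "r * d + p = s * d + q \<longleftrightarrow> r = s \<and> p = q"
    using pq by (metis block_div_mod)
  then show "1\<^sub>m (length xs * d) $$ (r * d + p, s * d + q) =
     (if r = s then 1 else 0) * X (\<one> \<otimes> xs ! r \<otimes> inv (xs ! s)) $$ (p, q)"
    using e rs pq block_index_less[of r "length xs" p d] block_index_less[of s "length xs" q d] by auto
qed simp

end

section \<open>The trace pairing and the basis formed by the elements \<open>X t\<close>\<close>

locale elementary_realization = std_realization G T \<beta> ab
  for G (structure) and T :: "'a set" and \<beta> :: "'a \<times> 'a \<Rightarrow> 'f::field" and ab +
  assumes elem: "elementary_2_group G T" and two: "(2::'f) \<noteq> 0"
begin

lemma d_nonzero: "of_nat d \<noteq> (0::'f)"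
  by (rule D_size_nonzero[OF gens(1) elem two])

lemma T_inv_self: "t \<in> T \<Longrightarrow> inv t = t"
  using elem unfolding elementary_2_group_def by (intro inv_equality) auto

lemma X_transpose_ex: "t \<in> T \<Longrightarrow> \<exists>c\<in>{1, - 1}. transpose_mat (X t) = c \<cdot>\<^sub>m X t"
  using word_mat_transpose[OF gens(1) elem word(1)] by (simp add: X_word)

definition Xi :: "'a \<Rightarrow> 'f mat" where "Xi t = (SOME B. B \<in> carrier_mat d d \<and> X t * B = 1\<^sub>m d)"

lemma Xi:
  assumes "t \<in> T"
  shows "Xi t \<in> carrier_mat d d" "X t * Xi t = 1\<^sub>m d" "Xi t * X t = 1\<^sub>m d"
proof -
  have "\<exists>B. B \<in> carrier_mat d d \<and> X t * B = 1\<^sub>m d" using X_rinv[OF assms] by (auto simp: rinv_def)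
  then have "Xi t \<in> carrier_mat d d \<and> X t * Xi t = 1\<^sub>m d" unfolding Xi_def by (rule someI_ex)
  then show "Xi t \<in> carrier_mat d d" "X t * Xi t = 1\<^sub>m d" "Xi t * X t = 1\<^sub>m d"
    using mat_mult_left_right_inverse[of "X t" d "Xi t"] assms by auto
qed

definition tr :: "'f mat \<Rightarrow> 'f" where "tr A = (\<Sum>i<d. A $$ (i, i))"

lemma tr_mult_commute:
  assumes "A \<in> carrier_mat d d" "B \<in> carrier_mat d d"
  shows "tr (A * B) = tr (B * A)"
proof -
  have "tr (A * B) = (\<Sum>i<d. \<Sum>l<d. A $$ (i, l) * B $$ (l, i))"
    unfolding tr_def by (intro sum.cong refl index_mult_mat_sum) (use assms in auto)
  also have "\<dots> = (\<Sum>l<d. \<Sum>i<d. B $$ (l, i) * A $$ (i, l))"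
    by (subst sum.swap) (simp add: mult.commute)
  also have "\<dots> = tr (B * A)"
    unfolding tr_def by (intro sum.cong refl index_mult_mat_sum[symmetric]) (use assms in auto)
  finally show ?thesis .
qed

lemma T_separate:
  assumes "s \<in> T" "t \<in> T" "\<And>w. w \<in> T \<Longrightarrow> \<beta> (w, s) = \<beta> (w, t)"
  shows "s = t"
proof -
  note st = assms(1,2)
  have m: "s \<otimes> inv t \<in> T" using st by simp
  have "\<beta> (w, s \<otimes> inv t) = 1" if w: "w \<in> T" for w
    using st assms(3)[OF w] w \<beta>_mult_right[of t "inv t" w] by (simp add: \<beta>_mult_right)
  then have "s \<otimes> inv t = \<one>"
    by (intro T_nondeg[unfolded nondegenerate_on_def, THEN bspec, OF m, THEN mp] ballI)
  then have "inv (inv t) = s" using st by (intro inv_equality) auto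
  then show ?thesis using st by simp
qed

text \<open>Moving \<open>X w\<close> past \<open>Xi t * X s\<close> costs
  \<open>\<beta> (w, t) * \<beta> (s, w)\<close>, while the trace does not change under conjugation.
  For distinct \<open>s\<close> and \<open>t\<close> nondegeneracy supplies a \<open>w\<close> for
  which this factor is not 1, and the trace must vanish.\<close>

lemma tr_Xi_X:
  assumes "s \<in> T" "t \<in> T"
  shows "tr (Xi t * X s) = (if s = t then of_nat d else 0)"
proof (cases "s = t")
  case True
  then show ?thesis using assms by (simp add: Xi tr_def)
next
  case False
  then obtain w where w: "w \<in> T" "\<beta> (w, s) \<noteq> \<beta> (w, t)" using T_separate assms by blast
  note car = Xi(1)[OF assms(2)] X_carrier[OF assms(1)] X_carrier[OF assms(2)] X_carrier[OF w(1)] Xi(1)[OF w(1)]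
  have "Xi t * (X w * X t) * Xi t = \<beta> (w, t) \<cdot>\<^sub>m (Xi t * (X t * X w) * Xi t)"
    using X_comm[OF w(1) assms(2)] car by (simp add: square_mat_simps[where n = d])
  moreover have "Xi t * (X w * X t) * Xi t = Xi t * X w"
    using car Xi[OF assms(2)] by (simp add: square_mat_simps[where n = d])
  moreover have "Xi t * (X t * X w) * Xi t = (Xi t * X t) * (X w * Xi t)"
    using car by (simp add: square_mat_simps[where n = d])
  ultimately have "qcomm (\<beta> (w, t)) (Xi t) (X w)"
    using car Xi[OF assms(2)] by (simp add: qcomm_def square_mat_simps[where n = d])
  moreover have "qcomm (\<beta> (s, w)) (X s) (X w)" using X_comm[OF assms(1) w(1)] by (simp add: qcomm_def)
  ultimately have "qcomm (\<beta> (w, t) * \<beta> (s, w)) (Xi t * X s) (X w)"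
    by (rule qcomm_mult_left[OF car(1,2,4,4)])
  then have e: "Xi t * X s * X w = (\<beta> (w, t) * \<beta> (s, w)) \<cdot>\<^sub>m (X w * (Xi t * X s))" by (simp add: qcomm_def)
  have m: "Xi t * X s \<in> carrier_mat d d" by (rule mult_carrier_mat[OF car(1,2)])
  have "tr (Xi t * X s) = tr (Xi t * X s * X w * Xi w)"
    using car m Xi[OF w(1)] by (simp add: square_mat_simps(4)[where n = d] square_mat_simps(1)[where n = d])
  also have "\<dots> = (\<beta> (w, t) * \<beta> (s, w)) * tr (X w * (Xi t * X s) * Xi w)"
    unfolding e using m car mult_carrier_mat[OF car(4) m]
    by (simp add: square_mat_simps(5)[where n = d] tr_def sum_distrib_left)
  also have "tr (X w * (Xi t * X s) * Xi w) = tr (Xi w * (X w * (Xi t * X s)))"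
    by (rule tr_mult_commute[OF mult_carrier_mat[OF car(4) m] car(5)])
  also have "Xi w * (X w * (Xi t * X s)) = Xi w * X w * (Xi t * X s)"
    by (rule square_mat_simps(4)[symmetric, OF car(5,4) m])
  also have "\<dots> = Xi t * X s" using Xi(3)[OF w(1)] square_mat_simps(10)[OF m] by simp
  finally have "tr (Xi t * X s) = \<beta> (w, t) * \<beta> (s, w) * tr (Xi t * X s)" .
  moreover have "\<beta> (w, t) * \<beta> (s, w) \<noteq> 1"
  proof
    assume "\<beta> (w, t) * \<beta> (s, w) = 1"
    then have "\<beta> (w, t) * (\<beta> (s, w) * \<beta> (w, s)) = \<beta> (w, s)" by (simp add: mult.assoc[symmetric])
    then show False using w assms \<beta>_swap[of s w] by simp
  qed
  ultimately show ?thesis using False by simp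
qed

lemma tr_mult_double_sum:
  assumes "A \<in> carrier_mat d d" "B \<in> carrier_mat d d"
  shows "tr (A * B) = (\<Sum>I<d * d. A $$ (I mod d, I div d) * B $$ (I div d, I mod d))"
proof -
  have "tr (A * B) = (\<Sum>i<d. \<Sum>l<d. A $$ (i, l) * B $$ (l, i))"
    unfolding tr_def by (intro sum.cong refl index_mult_mat_sum) (use assms in auto)
  also have "\<dots> = (\<Sum>r<d. \<Sum>p<d. A $$ (p, r) * B $$ (r, p))" by (rule sum.swap)
  also have "\<dots> = (\<Sum>I<d * d. A $$ (I mod d, I div d) * B $$ (I div d, I mod d))"
    unfolding sum_lessThan_mult by (intro sum.cong refl) simp
  finally show ?thesis .
qed

text \<open>Pairing the relation with \<open>Xi t\<close> isolates \<open>a t * d\<close>, and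
  \<open>d\<close> is nonzero in the field.\<close>

lemma X_independent:
  assumes "\<And>p q. p < d \<Longrightarrow> q < d \<Longrightarrow> (\<Sum>t\<in>T. a t * X t $$ (p, q)) = 0" and "t \<in> T"
  shows "a t = 0"
proof -
  have "(\<Sum>s\<in>T. a s * tr (Xi t * X s)) =
     (\<Sum>s\<in>T. \<Sum>I<d * d. Xi t $$ (I mod d, I div d) * (a s * X s $$ (I div d, I mod d)))"
    using Xi[OF \<open>t \<in> T\<close>]
    by (intro sum.cong refl) (simp add: tr_mult_double_sum sum_distrib_left mult_ac)
  also have "\<dots> = (\<Sum>I<d * d. Xi t $$ (I mod d, I div d) * (\<Sum>s\<in>T. a s * X s $$ (I div d, I mod d)))"
    by (subst sum.swap) (simp add: sum_distrib_left)
  also have "\<dots> = 0"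
    using assms(1) by (intro sum.neutral) (auto simp: less_mult_imp_div_less mod_less_of_less_mult)
  finally have "(\<Sum>s\<in>T. if s = t then a t * of_nat d else 0) = 0"
    using \<open>t \<in> T\<close> by (simp add: tr_Xi_X if_distrib cong: if_cong)
  then have "a t * of_nat d = 0" using T_finite \<open>t \<in> T\<close> by simp
  then show ?thesis using d_nonzero by simp
qed

text \<open>
  The trace pairing of the \<open>X\<^sub>t\<close> with their inverses gives a one-sided inverse of the square
  matrix of size \<open>d\<^sup>2 = |T|\<close> whose columns are the \<open>X\<^sub>t\<close>; being two-sided, it gives the coefficients.
\<close>

lemma X_span:
  assumes A: "A \<in> carrier_mat d d"
  obtains a where "\<And>p q. p < d \<Longrightarrow> q < d \<Longrightarrow> A $$ (p, q) = (\<Sum>t\<in>T. a t * X t $$ (p, q))"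
proof -
  obtain e where e: "bij_betw e {0..<d * d} T"
    using ex_bij_betw_nat_finite[OF T_finite] card_T by auto
  have eT: "e i \<in> T" if "i < d * d" for i using bij_betwE[OF e] that by simp
  define K where "K = mat (d * d) (d * d) (\<lambda>(i, I). Xi (e i) $$ (I mod d, I div d) / of_nat d)"
  define K' where "K' = mat (d * d) (d * d) (\<lambda>(I, j). X (e j) $$ (I div d, I mod d))"
  have car: "K \<in> carrier_mat (d * d) (d * d)" "K' \<in> carrier_mat (d * d) (d * d)" by (auto simp: K_def K'_def)
  have "K * K' = 1\<^sub>m (d * d)"
  proof (rule eq_matI)
    fix i j assume "i < dim_row (1\<^sub>m (d * d) :: 'f mat)" "j < dim_col (1\<^sub>m (d * d) :: 'f mat)"
    then have ij: "i < d * d" "j < d * d" by auto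
    have "(K * K') $$ (i, j) = (\<Sum>I<d * d. Xi (e i) $$ (I mod d, I div d) / of_nat d * X (e j) $$ (I div d, I mod d))"
      using index_mult_mat_sum[OF car ij] ij by (simp add: K_def K'_def)
    also have "\<dots> = tr (Xi (e i) * X (e j)) / of_nat d"
      using Xi(1)[OF eT] ij eT by (simp add: tr_mult_double_sum sum_divide_distrib)
    also have "\<dots> = (if e j = e i then 1 else 0)" using eT ij d_nonzero by (simp add: tr_Xi_X)
    also have "e j = e i \<longleftrightarrow> j = i" using ij by (simp add: inj_on_eq_iff[OF bij_betw_imp_inj_on[OF e]])
    finally show "(K * K') $$ (i, j) = 1\<^sub>m (d * d) $$ (i, j)" using ij by auto
  qed (use car in auto)
  then have KK: "K' * K = 1\<^sub>m (d * d)" by (rule mat_mult_left_right_inverse[OF car])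
  define b where "b j = (\<Sum>I<d * d. K $$ (j, I) * A $$ (I div d, I mod d))" for j
  show thesis
  proof (rule that[of "\<lambda>t. b (inv_into {0..<d * d} e t)"])
    fix p q assume pq: "p < d" "q < d"
    let ?J = "p * d + q"
    have J: "?J < d * d" by (rule block_index_less[OF pq])
    have "(\<Sum>t\<in>T. b (inv_into {0..<d * d} e t) * X t $$ (p, q)) = (\<Sum>j\<in>{0..<d * d}. b j * X (e j) $$ (p, q))"
      by (subst sum.reindex_bij_betw[OF e, symmetric])
        (simp add: inv_into_f_f[OF bij_betw_imp_inj_on[OF e]])
    also have "\<dots> = (\<Sum>j<d * d. \<Sum>I<d * d. K' $$ (?J, j) * K $$ (j, I) * A $$ (I div d, I mod d))"
      using J pq by (auto simp: b_def sum_distrib_right sum_distrib_left K'_def mult_ac atLeast0LessThan intro!: sum.cong)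
    also have "\<dots> = (\<Sum>I<d * d. (\<Sum>j<d * d. K' $$ (?J, j) * K $$ (j, I)) * A $$ (I div d, I mod d))"
      by (subst sum.swap) (simp add: sum_distrib_right)
    also have "\<dots> = (\<Sum>I<d * d. (if I = ?J then A $$ (p, q) else 0))"
    proof (rule sum.cong[OF refl])
      fix I assume I: "I \<in> {..<d * d}"
      have "(\<Sum>j<d * d. K' $$ (?J, j) * K $$ (j, I)) = (K' * K) $$ (?J, I)"
        by (rule index_mult_mat_sum[OF car(2,1) J, symmetric]) (use I in auto)
      then show "(\<Sum>j<d * d. K' $$ (?J, j) * K $$ (j, I)) * A $$ (I div d, I mod d) = (if I = ?J then A $$ (p, q) else 0)"
        using KK I J pq by auto
    qed
    also have "\<dots> = A $$ (p, q)" using J by simp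
    finally show "A $$ (p, q) = (\<Sum>t\<in>T. b (inv_into {0..<d * d} e t) * X t $$ (p, q))" ..
  qed
qed

lemma X_qcomm: "u \<in> T \<Longrightarrow> v \<in> T \<Longrightarrow> qcomm (\<beta> (u, v)) (X u) (X v)"
  unfolding qcomm_def by (rule X_comm)

text \<open>The product has commutation factor \<open>\<beta> (w, u \<otimes> v)\<close> with every
  \<open>X w\<close>. Conjugation by \<open>X w\<close> multiplies its coefficient at
  \<open>t\<close> by \<open>\<beta> (w, t)\<close>, so by independence only
  \<open>t = u \<otimes> v\<close> can occur in the expansion. The scalar is nonzero because the
  product is invertible.\<close>

lemma X_mult:
  assumes u: "u \<in> T" and v: "v \<in> T"
  obtains c where "c \<noteq> 0" "X u * X v = c \<cdot>\<^sub>m X (u \<otimes> v)"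
proof -
  let ?A = "X u * X v"
  have A: "?A \<in> carrier_mat d d" using u v by (intro mult_carrier_mat[of _ d d]) auto
  obtain a where a: "\<And>p q. p < d \<Longrightarrow> q < d \<Longrightarrow> ?A $$ (p, q) = (\<Sum>t\<in>T. a t * X t $$ (p, q))"
    using X_span[OF A] by blast
  have Aa: "?A = matsum d d T (\<lambda>t. a t \<cdot>\<^sub>m X t)"
    using A a by (intro eq_matI) (auto simp: matsum_def carrier_matD[OF X_carrier] intro!: sum.cong)
  have zero: "a t = 0" if t: "t \<in> T" "t \<noteq> u \<otimes> v" for t
  proof -
    obtain w where w: "w \<in> T" "\<beta> (w, t) \<noteq> \<beta> (w, u \<otimes> v)" using T_separate[of t "u \<otimes> v"] t u v by auto
    note cw = X_carrier[OF w(1)] Xi(1)[OF w(1)]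
    have comm: "X w * X s * Xi w = \<beta> (w, s) \<cdot>\<^sub>m X s" if "s \<in> T" for s
      using X_comm[OF w(1) that] cw X_carrier[OF that] Xi[OF w(1)]
      by (simp add: square_mat_simps[where n = d])
    have "qcomm (\<beta> (w, u) * \<beta> (w, v)) (X w) ?A"
      by (rule qcomm_mult_right[where n = d]) (use u v w X_qcomm in auto)
    then have "X w * ?A = \<beta> (w, u \<otimes> v) \<cdot>\<^sub>m (?A * X w)" using u v w by (simp add: qcomm_def \<beta>_mult_right)
    then have "X w * ?A * Xi w = \<beta> (w, u \<otimes> v) \<cdot>\<^sub>m (?A * X w * Xi w)"
      using square_mat_simps(5)[OF mult_carrier_mat[OF A cw(1)] cw(2)] by simp
    also have "?A * X w * Xi w = ?A"
      using square_mat_simps(4)[OF A cw] Xi(2)[OF w(1)] square_mat_simps(11)[OF A] by simp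
    finally have lhs: "X w * ?A * Xi w = \<beta> (w, u \<otimes> v) \<cdot>\<^sub>m ?A" .
    have c: "X w * (a t \<cdot>\<^sub>m X t) \<in> carrier_mat d d" if "t \<in> T" for t
      by (rule mult_carrier_mat[OF cw(1)]) (use that in simp)
    have "X w * matsum d d T (\<lambda>t. a t \<cdot>\<^sub>m X t) = matsum d d T (\<lambda>t. X w * (a t \<cdot>\<^sub>m X t))"
      by (rule mult_matsum_left[OF cw(1)]) simp
    moreover have "matsum d d T (\<lambda>t. X w * (a t \<cdot>\<^sub>m X t)) * Xi w = matsum d d T (\<lambda>t. X w * (a t \<cdot>\<^sub>m X t) * Xi w)"
      by (rule mult_matsum_right[OF cw(2) c])
    ultimately have "X w * ?A * Xi w = matsum d d T (\<lambda>t. X w * (a t \<cdot>\<^sub>m X t) * Xi w)"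
      by (simp only: Aa)
    then have "\<beta> (w, u \<otimes> v) \<cdot>\<^sub>m ?A = matsum d d T (\<lambda>t. X w * (a t \<cdot>\<^sub>m X t) * Xi w)" by (simp only: lhs)
    moreover have "X w * (a s \<cdot>\<^sub>m X s) * Xi w = (a s * \<beta> (w, s)) \<cdot>\<^sub>m X s" if "s \<in> T" for s
    proof -
      have "X w * (a s \<cdot>\<^sub>m X s) = a s \<cdot>\<^sub>m (X w * X s)"
        by (rule square_mat_simps(6)[OF cw(1) X_carrier[OF that]])
      then have "X w * (a s \<cdot>\<^sub>m X s) * Xi w = a s \<cdot>\<^sub>m (X w * X s * Xi w)"
        using square_mat_simps(5)[OF mult_carrier_mat[OF cw(1) X_carrier[OF that]] cw(2)] by simp
      then show ?thesis using comm[OF that] by (simp add: smult_smult_mat)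
    qed
    ultimately have e: "\<beta> (w, u \<otimes> v) \<cdot>\<^sub>m ?A = matsum d d T (\<lambda>s. (a s * \<beta> (w, s)) \<cdot>\<^sub>m X s)"
      by (auto simp: matsum_def intro!: eq_matI sum.cong)
    have "a t * (\<beta> (w, t) - \<beta> (w, u \<otimes> v)) = 0"
    proof (rule X_independent[OF _ t(1), where a = "\<lambda>s. a s * (\<beta> (w, s) - \<beta> (w, u \<otimes> v))"])
      fix p q assume pq: "p < d" "q < d"
      have "\<beta> (w, u \<otimes> v) * (\<Sum>t\<in>T. a t * X t $$ (p, q)) = (\<beta> (w, u \<otimes> v) \<cdot>\<^sub>m ?A) $$ (p, q)"
        using a[OF pq] pq carrier_matD[OF A] by simp
      also have "\<dots> = (\<Sum>s\<in>T. ((a s * \<beta> (w, s)) \<cdot>\<^sub>m X s) $$ (p, q))"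
        unfolding e by (rule matsum_index[OF pq])
      also have "\<dots> = (\<Sum>s\<in>T. a s * \<beta> (w, s) * X s $$ (p, q))"
        by (rule sum.cong) (use pq in \<open>auto simp: carrier_matD[OF X_carrier]\<close>)
      finally have "(\<Sum>s\<in>T. a s * \<beta> (w, s) * X s $$ (p, q)) - \<beta> (w, u \<otimes> v) * (\<Sum>t\<in>T. a t * X t $$ (p, q)) = 0"
        by simp
      moreover have "a s * (\<beta> (w, s) - b) * y = a s * \<beta> (w, s) * y - b * (a s * y)" for s b y
        by (simp add: algebra_simps)
      ultimately show "(\<Sum>s\<in>T. a s * (\<beta> (w, s) - \<beta> (w, u \<otimes> v)) * X s $$ (p, q)) = 0"
        by (simp only: sum_subtractf sum_distrib_left)
    qed
    then show ?thesis using w by simp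
  qed
  have uv: "u \<otimes> v \<in> T" using u v by simp
  have e: "?A = a (u \<otimes> v) \<cdot>\<^sub>m X (u \<otimes> v)"
  proof (rule eq_matI)
    fix p q assume "p < dim_row (a (u \<otimes> v) \<cdot>\<^sub>m X (u \<otimes> v))" "q < dim_col (a (u \<otimes> v) \<cdot>\<^sub>m X (u \<otimes> v))"
    then have pq: "p < d" "q < d" using uv by auto
    have "?A $$ (p, q) = (\<Sum>t\<in>T. if t = u \<otimes> v then a (u \<otimes> v) * X (u \<otimes> v) $$ (p, q) else 0)"
      unfolding a[OF pq] by (intro sum.cong) (auto simp: zero)
    also have "\<dots> = a (u \<otimes> v) * X (u \<otimes> v) $$ (p, q)" using T_finite uv by simp
    finally show "?A $$ (p, q) = (a (u \<otimes> v) \<cdot>\<^sub>m X (u \<otimes> v)) $$ (p, q)"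
      using pq uv by (metis dim_X index_smult_mat(1))
  qed (use carrier_matD[OF A] uv in \<open>simp_all\<close>)
  have "a (u \<otimes> v) \<noteq> 0"
  proof
    assume "a (u \<otimes> v) = 0"
    then have A0: "?A = 0\<^sub>m d d" unfolding e by (simp only: smult_zero_mat[OF X_carrier[OF uv]])
    obtain B where B: "B \<in> carrier_mat d d" "?A * B = 1\<^sub>m d"
      using rinv_mult[OF X_rinv[OF u] X_rinv[OF v]] by (auto simp only: rinv_def)
    then have "0\<^sub>m d d = (1\<^sub>m d :: 'f mat)" unfolding A0 by simp
    then have "0\<^sub>m d d $$ (0, 0) = (1\<^sub>m d :: 'f mat) $$ (0, 0)" by (rule arg_cong)
    then show False using d_pos by simp
  qed
  then show thesis using that e by blast
qed

end

section \<open>Products, transposes and components of homogeneous matrices\<close>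

context elementary_realization
begin

lemma shift_mult:
  assumes "g \<in> carrier G" "h \<in> carrier G" "x \<in> carrier G" "y \<in> carrier G" "z \<in> carrier G"
  shows "(g \<otimes> x \<otimes> inv y) \<otimes> (h \<otimes> y \<otimes> inv z) = g \<otimes> h \<otimes> x \<otimes> inv z"
proof -
  have c: "y \<otimes> (inv y \<otimes> w) = w" if "w \<in> carrier G" for w
    using assms that by (simp flip: m_assoc)
  show ?thesis using assms by (simp add: m_ac c)
qed

text \<open>The degrees \<open>g x_r y_k^-1\<close> and \<open>h y_k z_s^-1\<close> of two matching
  blocks multiply to \<open>g h x_r z_s^-1\<close>, which does not involve the middle index
  \<open>k\<close>. So all contributions to block \<open>(r, s)\<close> are multiples of one and the
  same \<open>X\<close>.\<close>

lemma homog_mult: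
  assumes A: "A \<in> homog xs ys g" and B: "B \<in> homog ys zs h"
    and car: "set xs \<subseteq> carrier G" "set ys \<subseteq> carrier G" "set zs \<subseteq> carrier G" "g \<in> carrier G" "h \<in> carrier G"
  shows "A * B \<in> homog xs zs (g \<otimes> h)"
proof -
  obtain a where a: "\<And>r s. r < length xs \<Longrightarrow> s < length ys \<Longrightarrow> a r s \<noteq> 0 \<Longrightarrow> g \<otimes> xs ! r \<otimes> inv (ys ! s) \<in> T"
    "\<And>r s p q. r < length xs \<Longrightarrow> s < length ys \<Longrightarrow> p < d \<Longrightarrow> q < d \<Longrightarrow>
       A $$ (r * d + p, s * d + q) = a r s * X (g \<otimes> xs ! r \<otimes> inv (ys ! s)) $$ (p, q)"
    using homogE[OF A] by blast
  obtain b where b: "\<And>r s. r < length ys \<Longrightarrow> s < length zs \<Longrightarrow> b r s \<noteq> 0 \<Longrightarrow> h \<otimes> ys ! r \<otimes> inv (zs ! s) \<in> T"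
    "\<And>r s p q. r < length ys \<Longrightarrow> s < length zs \<Longrightarrow> p < d \<Longrightarrow> q < d \<Longrightarrow>
       B $$ (r * d + p, s * d + q) = b r s * X (h \<otimes> ys ! r \<otimes> inv (zs ! s)) $$ (p, q)"
    using homogE[OF B] by blast
  have AB: "A * B \<in> carrier_mat (length xs * d) (length zs * d)"
    using homog_carrier[OF A] homog_carrier[OF B] by (rule mult_carrier_mat)
  show ?thesis unfolding homog_def
  proof (intro CollectI conjI allI impI AB)
    fix r s assume rs: "r < length xs" "s < length zs"
    let ?w = "g \<otimes> h \<otimes> xs ! r \<otimes> inv (zs ! s)"
    have blk: "\<exists>c. (c \<noteq> 0 \<longrightarrow> ?w \<in> T) \<and> (\<forall>p<d. \<forall>q<d.
        (\<Sum>l<d. A $$ (r * d + p, k * d + l) * B $$ (k * d + l, s * d + q)) = c * X ?w $$ (p, q))"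
      if k: "k < length ys" for k
    proof (cases "a r k = 0 \<or> b k s = 0")
      case True
      then show ?thesis using a(2)[OF rs(1) k] b(2)[OF k rs(2)] by (intro exI[of _ 0]) auto
    next
      case False
      let ?u = "g \<otimes> xs ! r \<otimes> inv (ys ! k)" and ?v = "h \<otimes> ys ! k \<otimes> inv (zs ! s)"
      have uv: "?u \<in> T" "?v \<in> T" using False a(1) b(1) rs k by auto
      have w: "?u \<otimes> ?v = ?w" using car rs k nth_mem by (intro shift_mult) auto
      obtain c where c: "c \<noteq> 0" "X ?u * X ?v = c \<cdot>\<^sub>m X ?w" using X_mult[OF uv] unfolding w by blast
      have wT: "?w \<in> T" using uv w T_mult by metis
      have "(\<Sum>l<d. A $$ (r * d + p, k * d + l) * B $$ (k * d + l, s * d + q)) = a r k * b k s * c * X ?w $$ (p, q)"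
        if pq: "p < d" "q < d" for p q
      proof -
        have "(\<Sum>l<d. A $$ (r * d + p, k * d + l) * B $$ (k * d + l, s * d + q)) =
           (\<Sum>l<d. a r k * b k s * (X ?u $$ (p, l) * X ?v $$ (l, q)))"
          using a(2)[OF rs(1) k] b(2)[OF k rs(2)] pq by (intro sum.cong) (auto simp: mult_ac)
        also have "\<dots> = a r k * b k s * (X ?u * X ?v) $$ (p, q)"
          using index_mult_mat_sum[OF X_carrier[OF uv(1)] X_carrier[OF uv(2)] pq] by (simp add: sum_distrib_left)
        also have "\<dots> = a r k * b k s * c * X ?w $$ (p, q)" unfolding c using pq wT by simp
        finally show ?thesis .
      qed
      then show ?thesis using wT by blast
    qed
    have "\<exists>c. \<forall>k\<in>{..<length ys}. (c k \<noteq> 0 \<longrightarrow> ?w \<in> T) \<and> (\<forall>p<d. \<forall>q<d.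
        (\<Sum>l<d. A $$ (r * d + p, k * d + l) * B $$ (k * d + l, s * d + q)) = c k * X ?w $$ (p, q))"
      by (rule bchoice) (use blk in simp)
    then obtain c where c: "\<And>k. k < length ys \<Longrightarrow> c k \<noteq> 0 \<Longrightarrow> ?w \<in> T"
      "\<And>k p q. k < length ys \<Longrightarrow> p < d \<Longrightarrow> q < d \<Longrightarrow>
        (\<Sum>l<d. A $$ (r * d + p, k * d + l) * B $$ (k * d + l, s * d + q)) = c k * X ?w $$ (p, q)"
      by auto
    show "\<exists>c. (c \<noteq> 0 \<longrightarrow> ?w \<in> T) \<and> (\<forall>p<d. \<forall>q<d. (A * B) $$ (r * d + p, s * d + q) = c * X ?w $$ (p, q))"
    proof (intro exI[of _ "\<Sum>k<length ys. c k"] conjI impI allI)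
      assume "(\<Sum>k<length ys. c k) \<noteq> 0"
      then obtain k where "k < length ys" "c k \<noteq> 0" by (meson lessThan_iff sum.not_neutral_contains_not_neutral)
      then show "?w \<in> T" by (rule c(1))
    next
      fix p q assume pq: "p < d" "q < d"
      have "(A * B) $$ (r * d + p, s * d + q) =
         (\<Sum>l<length ys * d. A $$ (r * d + p, l) * B $$ (l, s * d + q))"
        using homog_carrier[OF A] homog_carrier[OF B] block_index_less[OF rs(1) pq(1)] block_index_less[OF rs(2) pq(2)]
        by (rule index_mult_mat_sum)
      also have "\<dots> = (\<Sum>k<length ys. c k * X ?w $$ (p, q))"
        unfolding sum_lessThan_mult using c(2) pq by (intro sum.cong) auto
      finally show "(A * B) $$ (r * d + p, s * d + q) = (\<Sum>k<length ys. c k) * X ?w $$ (p, q)"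
        by (simp add: sum_distrib_right)
    qed
  qed
qed

text \<open>Transposition exchanges \<open>x_r\<close> and \<open>y_s\<close>, and
  \<open>h x y^-1 = h y^-1 (x^-1)^-1\<close>, so a block keeps its element of \<open>T\<close> once
  both lists are inverted. That \<open>X t\<close> is transposed to a multiple of itself is where
  the elementary 2-group enters.\<close>

lemma homog_transpose:
  assumes A: "A \<in> homog xs ys h"
    and car: "set xs \<subseteq> carrier G" "set ys \<subseteq> carrier G" "h \<in> carrier G"
  shows "transpose_mat A \<in> homog (map (m_inv G) ys) (map (m_inv G) xs) h"
proof -
  obtain a where a: "\<And>r s. r < length xs \<Longrightarrow> s < length ys \<Longrightarrow> a r s \<noteq> 0 \<Longrightarrow> h \<otimes> xs ! r \<otimes> inv (ys ! s) \<in> T"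
    "\<And>r s p q. r < length xs \<Longrightarrow> s < length ys \<Longrightarrow> p < d \<Longrightarrow> q < d \<Longrightarrow>
       A $$ (r * d + p, s * d + q) = a r s * X (h \<otimes> xs ! r \<otimes> inv (ys ! s)) $$ (p, q)"
    using homogE[OF A] by blast
  obtain c where c: "\<And>t. t \<in> T \<Longrightarrow> transpose_mat (X t) = c t \<cdot>\<^sub>m X t" using X_transpose_ex by metis
  have dg: "h \<otimes> map (m_inv G) ys ! s \<otimes> inv (map (m_inv G) xs ! r) = h \<otimes> xs ! r \<otimes> inv (ys ! s)"
    if "r < length xs" "s < length ys" for r s
  proof -
    have "xs ! r \<in> carrier G" "ys ! s \<in> carrier G" using that car nth_mem by blast+
    then show ?thesis using that car by (simp add: m_ac)
  qed
  show ?thesis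
  proof (rule homogI[where a = "\<lambda>s r. a r s * c (h \<otimes> xs ! r \<otimes> inv (ys ! s))"])
    show "transpose_mat A \<in> carrier_mat (length (map (m_inv G) ys) * d) (length (map (m_inv G) xs) * d)"
      using homog_carrier[OF A] by simp
  next
    fix s r assume "s < length (map (m_inv G) ys)" "r < length (map (m_inv G) xs)"
      "a r s * c (h \<otimes> xs ! r \<otimes> inv (ys ! s)) \<noteq> 0"
    then show "h \<otimes> map (m_inv G) ys ! s \<otimes> inv (map (m_inv G) xs ! r) \<in> T" using a(1) dg by auto
  next
    fix s r p q assume "s < length (map (m_inv G) ys)" "r < length (map (m_inv G) xs)" and pq: "p < d" "q < d"
    then have rs: "r < length xs" "s < length ys" by auto
    have "transpose_mat A $$ (s * d + p, r * d + q) = A $$ (r * d + q, s * d + p)"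
      using homog_carrier[OF A] block_index_less[OF rs(1) pq(2)] block_index_less[OF rs(2) pq(1)] by simp
    also have "\<dots> = a r s * X (h \<otimes> xs ! r \<otimes> inv (ys ! s)) $$ (q, p)" by (rule a(2)[OF rs pq(2,1)])
    also have "\<dots> = a r s * c (h \<otimes> xs ! r \<otimes> inv (ys ! s)) * X (h \<otimes> xs ! r \<otimes> inv (ys ! s)) $$ (p, q)"
    proof (cases "a r s = 0")
      case False
      then have "h \<otimes> xs ! r \<otimes> inv (ys ! s) \<in> T" using a(1) rs by blast
      then show ?thesis using arg_cong[OF c, of _ "\<lambda>M. M $$ (p, q)"] pq by simp
    qed simp
    finally show "transpose_mat A $$ (s * d + p, r * d + q) = a r s * c (h \<otimes> xs ! r \<otimes> inv (ys ! s)) *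
       X (h \<otimes> map (m_inv G) ys ! s \<otimes> inv (map (m_inv G) xs ! r)) $$ (p, q)"
      using dg rs by simp
  qed
qed

lemma shift_cancel:
  assumes "h \<in> carrier G" "x \<in> carrier G" "y \<in> carrier G"
  shows "(h \<otimes> x \<otimes> inv y) \<otimes> inv x \<otimes> y = h" "(h \<otimes> inv x \<otimes> y) \<otimes> x \<otimes> inv y = h"
proof -
  have "(h \<otimes> x \<otimes> inv y) \<otimes> inv x \<otimes> y = h \<otimes> (x \<otimes> inv x) \<otimes> (y \<otimes> inv y)"
    using assms by (simp only: m_ac inv_closed m_closed)
  then show "(h \<otimes> x \<otimes> inv y) \<otimes> inv x \<otimes> y = h" using assms by simp
  have "(h \<otimes> inv x \<otimes> y) \<otimes> x \<otimes> inv y = h \<otimes> (x \<otimes> inv x) \<otimes> (y \<otimes> inv y)"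
    using assms by (simp only: m_ac inv_closed m_closed)
  then show "(h \<otimes> inv x \<otimes> y) \<otimes> x \<otimes> inv y = h" using assms by simp
qed

text \<open>Each \<open>d\<close> by \<open>d\<close> block is expanded in the basis. The term with
  \<open>X t\<close> in block \<open>(r, s)\<close> is homogeneous of degree
  \<open>t x_r^-1 y_s\<close>, and \<open>S\<close> collects these degrees.\<close>

lemma homog_decomp:
  assumes M: "M \<in> carrier_mat (length xs * d) (length ys * d)"
    and car: "set xs \<subseteq> carrier G" "set ys \<subseteq> carrier G" "h0 \<in> carrier G"
  obtains S F where "finite S" "S \<subseteq> carrier G" "h0 \<in> S" "\<And>h. F h \<in> homog xs ys h"
    "M = matsum (length xs * d) (length ys * d) S F"
proof -
  have ex: "\<exists>a. \<forall>p<d. \<forall>q<d. M $$ (r * d + p, s * d + q) = (\<Sum>t\<in>T. a t * X t $$ (p, q))" for r s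
  proof -
    let ?M = "mat d d (\<lambda>(p, q). M $$ (r * d + p, s * d + q))"
    obtain a where "\<And>p q. p < d \<Longrightarrow> q < d \<Longrightarrow> ?M $$ (p, q) = (\<Sum>t\<in>T. a t * X t $$ (p, q))"
      using X_span[OF mat_carrier] by blast
    then show ?thesis by (intro exI[of _ a]) simp
  qed
  define a where "a r s = (SOME a. \<forall>p<d. \<forall>q<d. M $$ (r * d + p, s * d + q) = (\<Sum>t\<in>T. a t * X t $$ (p, q)))" for r s
  have a: "M $$ (r * d + p, s * d + q) = (\<Sum>t\<in>T. a r s t * X t $$ (p, q))" if "p < d" "q < d" for r s p q
    using someI_ex[OF ex[of r s]] that unfolding a_def by blast
  \<comment> \<open>The prescribed degree \<open>h0\<close> is put into the index set even if its
    component is zero, so that \<open>homog_right_factor\<close> can refer to that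
    component.\<close>
  define S where "S = insert h0 (\<Union>x\<in>set xs. \<Union>y\<in>set ys. (\<lambda>t. t \<otimes> inv x \<otimes> y) ` T)"
  define c where "c h r s = (let t = h \<otimes> xs ! r \<otimes> inv (ys ! s) in if t \<in> T then a r s t else 0)" for h r s
  define F where "F h = mat (length xs * d) (length ys * d) (\<lambda>(I, J).
      c h (I div d) (J div d) * X (h \<otimes> xs ! (I div d) \<otimes> inv (ys ! (J div d))) $$ (I mod d, J mod d))" for h
  have F: "F h $$ (r * d + p, s * d + q) = c h r s * X (h \<otimes> xs ! r \<otimes> inv (ys ! s)) $$ (p, q)"
    if "r < length xs" "s < length ys" "p < d" "q < d" for h r s p q
    using that block_index_less[of r "length xs" p d] block_index_less[of s "length ys" q d] by (simp add: F_def)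
  show thesis
  proof (rule that[of S F])
    show "finite S" using T_finite by (simp add: S_def)
    show S: "S \<subseteq> carrier G" using car by (auto simp: S_def subset_iff)
    show "h0 \<in> S" by (simp add: S_def)
    show "F h \<in> homog xs ys h" for h
      by (rule homogI[where a = "c h"]) (use F in \<open>auto simp: F_def c_def Let_def split: if_splits\<close>)
    show "M = matsum (length xs * d) (length ys * d) S F"
    proof (rule mat_eq_blockI[OF M matsum_carrier])
      fix r p s q assume r: "r < length xs" "p < d" "s < length ys" "q < d"
      let ?x = "xs ! r" and ?y = "ys ! s"
      let ?f = "\<lambda>h. h \<otimes> ?x \<otimes> inv ?y" and ?g = "\<lambda>t. t \<otimes> inv ?x \<otimes> ?y"
      have xy: "?x \<in> carrier G" "?y \<in> carrier G" using r car nth_mem by blast+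
      have gS: "?g t \<in> S" if "t \<in> T" for t unfolding S_def
        by (intro insertI2 UN_I[of ?x] UN_I[of ?y] imageI nth_mem) (use r that in auto)
      have fg: "?f (?g t) = t" if "t \<in> T" for t using shift_cancel(2)[of t] that xy by simp
      have gf: "?g (?f h) = h" if "h \<in> S" for h using shift_cancel(1)[of h] that xy S by blast
      have "(\<Sum>h\<in>S. F h $$ (r * d + p, s * d + q)) = (\<Sum>h\<in>{h \<in> S. ?f h \<in> T}. F h $$ (r * d + p, s * d + q))"
        using \<open>finite S\<close> r F by (intro sum.mono_neutral_right) (auto simp: c_def)
      also have "\<dots> = (\<Sum>t\<in>T. a r s t * X t $$ (p, q))"
        using gS fg gf r F by (intro sum.reindex_bij_witness[of _ ?g ?f]) (auto simp: c_def)
      finally show "M $$ (r * d + p, s * d + q) = matsum (length xs * d) (length ys * d) S F $$ (r * d + p, s * d + q)"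
        using a[OF r(2,4)] block_index_less[OF r(1,2)] block_index_less[OF r(3,4)] by (simp add: matsum_index)
    qed
  qed
qed

text \<open>In a fixed block distinct degrees belong to distinct elements of \<open>T\<close>, so
  independence of the \<open>X t\<close> makes each summand vanish there. The degree map
  \<open>dg\<close> is separate from the index so that families with degrees shifted by a fixed
  factor can be fed in.\<close>

lemma homog_direct:
  assumes S: "finite S" and dg: "inj_on dg S" "dg ` S \<subseteq> carrier G"
    and F: "\<And>k. k \<in> S \<Longrightarrow> F k \<in> homog xs ys (dg k)"
    and zero: "matsum (length xs * d) (length ys * d) S F = 0\<^sub>m (length xs * d) (length ys * d)"
    and car: "set xs \<subseteq> carrier G" "set ys \<subseteq> carrier G" and k0: "k0 \<in> S"
  shows "F k0 = 0\<^sub>m (length xs * d) (length ys * d)"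
proof (rule mat_eq_blockI)
  show "F k0 \<in> carrier_mat (length xs * d) (length ys * d)" by (rule homog_carrier[OF F[OF k0]])
next
  fix r p s q assume r: "r < length xs" "p < d" "s < length ys" "q < d"
  let ?f = "\<lambda>k. dg k \<otimes> xs ! r \<otimes> inv (ys ! s)"
  have xy: "xs ! r \<in> carrier G" "ys ! s \<in> carrier G" using r car nth_mem by blast+
  have "\<exists>a. \<forall>k\<in>S. (a k \<noteq> 0 \<longrightarrow> ?f k \<in> T) \<and>
      (\<forall>p<d. \<forall>q<d. F k $$ (r * d + p, s * d + q) = a k * X (?f k) $$ (p, q))"
    by (rule bchoice) (use F r in \<open>simp add: homog_def\<close>)
  then obtain a where a: "\<And>k. k \<in> S \<Longrightarrow> a k \<noteq> 0 \<Longrightarrow> ?f k \<in> T"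
    "\<And>k p q. k \<in> S \<Longrightarrow> p < d \<Longrightarrow> q < d \<Longrightarrow> F k $$ (r * d + p, s * d + q) = a k * X (?f k) $$ (p, q)"
    by blast
  define S' where "S' = {k \<in> S. a k \<noteq> 0}"
  have S': "finite S'" "?f ` S' \<subseteq> T" using S a(1) by (auto simp: S'_def)
  have inj: "inj_on ?f S"
  proof (rule inj_onI)
    fix k l assume kl: "k \<in> S" "l \<in> S" "?f k = ?f l"
    then have "dg k = dg l" using shift_cancel(1)[OF _ xy] dg(2) by (metis image_subset_iff)
    then show "k = l" using dg(1) kl by (auto simp: inj_on_def)
  qed
  have "a k0 = 0"
  proof (rule ccontr)
    assume nz: "a k0 \<noteq> 0"
    then have k0': "k0 \<in> S'" "?f k0 \<in> T" using k0 a(1) by (auto simp: S'_def)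
    have "(\<Sum>k\<in>{x \<in> S'. ?f x = ?f k0}. a k) = 0"
    proof (rule X_independent[OF _ k0'(2), where a = "\<lambda>t. \<Sum>k\<in>{x \<in> S'. ?f x = t}. a k"])
      fix p q assume pq: "p < d" "q < d"
      have "(\<Sum>t\<in>T. (\<Sum>k\<in>{x \<in> S'. ?f x = t}. a k) * X t $$ (p, q)) =
          (\<Sum>t\<in>T. \<Sum>k\<in>{x \<in> S'. ?f x = t}. a k * X (?f k) $$ (p, q))"
        by (intro sum.cong refl) (auto simp: sum_distrib_right intro!: sum.cong)
      also have "\<dots> = (\<Sum>k\<in>S'. a k * X (?f k) $$ (p, q))"
        by (rule sum.group[OF S'(1) T_finite S'(2)])
      also have "\<dots> = (\<Sum>k\<in>S. F k $$ (r * d + p, s * d + q))"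
        using S a(2) pq by (intro sum.mono_neutral_cong_left) (auto simp: S'_def)
      also have "\<dots> = 0"
        using arg_cong[OF zero, of "\<lambda>M. M $$ (r * d + p, s * d + q)"] block_index_less[OF r(1) pq(1)]
          block_index_less[OF r(3) pq(2)] by (simp add: matsum_index)
      finally show "(\<Sum>t\<in>T. (\<Sum>k\<in>{x \<in> S'. ?f x = t}. a k) * X t $$ (p, q)) = 0" .
    qed
    moreover have "{x \<in> S'. ?f x = ?f k0} = {k0}"
      using k0' inj by (auto simp: S'_def inj_on_def)
    ultimately show False using nz by simp
  qed
  then show "F k0 $$ (r * d + p, s * d + q) = 0\<^sub>m (length xs * d) (length ys * d) $$ (r * d + p, s * d + q)"
    using a(2)[OF k0] r block_index_less[OF r(1,2)] block_index_less[OF r(3,4)] by simp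
qed simp

lemma homog_unique_degree:
  assumes "M \<in> homog xs ys g" "M \<in> homog xs ys h" "M \<noteq> 0\<^sub>m (length xs * d) (length ys * d)"
    and car: "set xs \<subseteq> carrier G" "set ys \<subseteq> carrier G" "g \<in> carrier G" "h \<in> carrier G"
  shows "g = h"
proof (rule ccontr)
  assume ne: "g \<noteq> h"
  let ?F = "\<lambda>k. if k = g then M else (- 1) \<cdot>\<^sub>m M"
  have "?F g = 0\<^sub>m (length xs * d) (length ys * d)"
  proof (rule homog_direct[where S = "{g, h}" and dg = "\<lambda>k. k" and F = ?F and xs = xs and ys = ys])
    show "matsum (length xs * d) (length ys * d) {g, h} ?F = 0\<^sub>m (length xs * d) (length ys * d)"
      using ne homog_carrier[OF assms(1)] by (intro eq_matI) (auto simp: matsum_def)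
  qed (use assms ne homog_smult in auto)
  then show False using assms by simp
qed

text \<open>Left multiplication by \<open>A\<close> shifts all degrees by \<open>g\<close>. So
  \<open>A\<close> sends the components of \<open>N\<close> of degree other than \<open>h\<close> to
  0, and the left inverse \<open>A'\<close> shows that these components vanish.\<close>

lemma homog_right_factor:
  assumes A: "A \<in> homog xs ys g" and N: "N \<in> carrier_mat (length ys * d) (length zs * d)"
    and AN: "A * N \<in> homog xs zs (g \<otimes> h)"
    and A': "A' \<in> carrier_mat (length ys * d) (length xs * d)" "A' * A = 1\<^sub>m (length ys * d)"
    and car: "set xs \<subseteq> carrier G" "set ys \<subseteq> carrier G" "set zs \<subseteq> carrier G" "g \<in> carrier G" "h \<in> carrier G"
  shows "N \<in> homog ys zs h"
proof -
  let ?n = "length xs * d" and ?m = "length ys * d" and ?l = "length zs * d"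
  obtain S F where S: "finite S" "S \<subseteq> carrier G" "h \<in> S" and F: "\<And>h. F h \<in> homog ys zs h"
    and NS: "N = matsum ?m ?l S F"
    using homog_decomp[OF N car(2,3,5)] by metis
  note Ac = homog_carrier[OF A] and Fc = homog_carrier[OF F]
  \<comment> \<open>\<open>A * N\<close> is subtracted from the summand of its own degree, which
    turns the \<open>D k\<close> into a family of distinct degrees with sum 0.\<close>
  define D where "D k = A * F k + (if k = h then - 1 else 0) \<cdot>\<^sub>m (A * N)" for k
  have AF: "A * F k \<in> homog xs zs (g \<otimes> k)" if "k \<in> S" for k
    by (rule homog_mult[OF A F]) (use car S that in auto)
  have ANc: "A * N \<in> carrier_mat ?n ?l" by (rule mult_carrier_mat[OF Ac N])
  have DF: "D k = A * F k" if "k \<noteq> h" for k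
    unfolding D_def using that ANc mult_carrier_mat[OF Ac Fc, of k] by (simp add: smult_zero_mat[OF ANc])
  have "D k = 0\<^sub>m ?n ?l" if k: "k \<in> S" for k
  proof (rule homog_direct[where S = S and dg = "\<lambda>k. g \<otimes> k" and xs = xs and ys = zs])
    show "inj_on (\<lambda>k. g \<otimes> k) S" using S car by (auto simp: inj_on_def subset_iff)
    show "D k \<in> homog xs zs (g \<otimes> k)" if "k \<in> S" for k
    proof (cases "k = h")
      case True
      then show ?thesis unfolding D_def using AF[OF that] AN by (auto intro: homog_add homog_smult)
    next
      case False
      then show ?thesis using AF[OF that] DF by simp
    qed
    have "A * N = matsum ?n ?l S (\<lambda>k. A * F k)" unfolding NS by (rule mult_matsum_left[OF Ac Fc])
    then have e: "(A * N) $$ (i, j) = (\<Sum>k\<in>S. (A * F k) $$ (i, j))" if "i < ?n" "j < ?l" for i j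
      using that by (simp add: matsum_index)
    show "matsum ?n ?l S D = 0\<^sub>m ?n ?l"
    proof (rule eq_matI)
      fix i j assume "i < dim_row (0\<^sub>m ?n ?l :: 'f mat)" "j < dim_col (0\<^sub>m ?n ?l :: 'f mat)"
      then have ij: "i < ?n" "j < ?l" by auto
      have "matsum ?n ?l S D $$ (i, j) = (\<Sum>k\<in>S. (A * F k) $$ (i, j) + (if k = h then - (A * N) $$ (i, j) else 0))"
        unfolding matsum_index[OF ij] D_def
        using ij carrier_matD[OF ANc] by (intro sum.cong) auto
      also have "\<dots> = 0" using S ij e by (simp add: sum.distrib)
      finally show "matsum ?n ?l S D $$ (i, j) = 0\<^sub>m ?n ?l $$ (i, j)" using ij by simp
    qed (auto simp: matsum_def)
  qed (use S car k in auto)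
  then have Az: "A * F k = 0\<^sub>m ?n ?l" if "k \<in> S" "k \<noteq> h" for k
    using that DF by metis
  have Fz: "F k = 0\<^sub>m ?m ?l" if "k \<in> S" "k \<noteq> h" for k
  proof -
    have "F k = A' * A * F k" using A' Fc[of k] by simp
    also have "\<dots> = A' * (A * F k)" by (rule assoc_mult_mat[OF A'(1) Ac Fc])
    finally show ?thesis using Az[OF that] A' by simp
  qed
  have "N = F h"
  proof (rule eq_matI)
    fix i j assume "i < dim_row (F h)" "j < dim_col (F h)"
    then have ij: "i < ?m" "j < ?l" using Fc[of h] by auto
    have "N $$ (i, j) = (\<Sum>k\<in>S. if k = h then F h $$ (i, j) else 0)"
      unfolding NS matsum_index[OF ij] using Fz ij by (intro sum.cong) auto
    then show "N $$ (i, j) = F h $$ (i, j)" using S by simp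
  qed (use N Fc[of h] in auto)
  then show ?thesis using F by simp
qed

lemma homog_inverse:
  assumes A: "A \<in> homog xs ys g" and len: "length xs = length ys" and "det A \<noteq> 0"
    and car: "set xs \<subseteq> carrier G" "set ys \<subseteq> carrier G" "g \<in> carrier G"
  shows "minv A \<in> homog ys xs (inv g)"
proof -
  have Ac: "A \<in> carrier_mat (length ys * d) (length ys * d)" using homog_carrier[OF A] len by simp
  note i = minv[OF Ac assms(3)]
  have "1\<^sub>m (length xs * d) \<in> homog xs xs (g \<otimes> inv g)" using homog_one[OF car(1)] car by simp
  then show ?thesis
    using homog_right_factor[OF A, of "minv A" xs "inv g" "minv A"] i car len by simp
qed

text \<open>
  The components of an intertwiner of a degree preserving isomorphism are again intertwiners,
  hence all are proportional to it.
\<close>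

lemma homog_intertwiner:
  assumes len: "length xs = length ys" and n: "n = length xs * d"
    and f: "alg_iso n n f" and \<Psi>: "\<Psi> \<in> carrier_mat n n" "det \<Psi> \<noteq> 0"
    and inter: "\<And>W. W \<in> carrier_mat n n \<Longrightarrow> f W * \<Psi> = \<Psi> * W"
    and graded: "\<And>g W. g \<in> carrier G \<Longrightarrow> W \<in> homog xs xs g \<Longrightarrow> f W \<in> homog ys ys g"
    and car: "set xs \<subseteq> carrier G" "set ys \<subseteq> carrier G"
  obtains k where "k \<in> carrier G" "\<Psi> \<in> homog ys xs k"
proof (cases "n = 0")
  case True
  then have "\<Psi> = 0\<^sub>m (length ys * d) (length xs * d)" using \<Psi> len n by (intro eq_matI) auto
  then show ?thesis using homog_zero[of ys xs \<one>] that[of \<one>] by simp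
next
  case False
  have n': "n = length ys * d" using n len by simp
  obtain S F where S: "finite S" "S \<subseteq> carrier G" and F: "\<And>h. F h \<in> homog ys xs h"
    and \<Psi>S: "\<Psi> = matsum n n S F"
    using homog_decomp[of \<Psi> ys xs \<one>, folded n n', OF \<Psi>(1) car(2,1) one_closed] by blast
  have Fc: "F h \<in> carrier_mat n n" for h using homog_carrier[OF F] n n' by metis
  have hom1: "f W * F k = F k * W" if "k \<in> S" "g \<in> carrier G" and W: "W \<in> homog xs xs g" for k g W
  proof -
    have Wc: "W \<in> carrier_mat n n" using homog_carrier[OF W] n by simp
    have fWc: "f W \<in> carrier_mat n n" by (rule alg_isoD(3)[OF f Wc])
    define D where "D k = f W * F k + (- 1) \<cdot>\<^sub>m (F k * W)" for k
    have c: "f W * F k \<in> carrier_mat n n" "F k * W \<in> carrier_mat n n" for k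
      using mult_carrier_mat[OF fWc Fc] mult_carrier_mat[OF Fc Wc] by auto
    have "D k = 0\<^sub>m (length ys * d) (length xs * d)"
    proof (rule homog_direct[where S = S and dg = "\<lambda>k. g \<otimes> k"])
      show "inj_on (\<lambda>k. g \<otimes> k) S" using S that by (auto simp: inj_on_def subset_iff)
      show "D k \<in> homog ys xs (g \<otimes> k)" if "k \<in> S" for k
        unfolding D_def
      proof (rule homog_add)
        show "f W * F k \<in> homog ys xs (g \<otimes> k)"
          by (rule homog_mult[OF graded[OF \<open>g \<in> carrier G\<close> W] F]) (use car S that \<open>g \<in> carrier G\<close> in auto)
        have "F k * W \<in> homog ys xs (k \<otimes> g)"
          by (rule homog_mult[OF F W]) (use car S that \<open>g \<in> carrier G\<close> in auto)
        moreover have "k \<otimes> g = g \<otimes> k" using S that \<open>g \<in> carrier G\<close> by (simp add: m_comm subset_iff)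
        ultimately show "(- 1) \<cdot>\<^sub>m (F k * W) \<in> homog ys xs (g \<otimes> k)" by (simp add: homog_smult)
      qed
      have e: "matsum n n S (\<lambda>k. f W * F k) = matsum n n S (\<lambda>k. F k * W)"
        using inter[OF Wc] mult_matsum_left[OF fWc, of S F n] mult_matsum_right[OF Wc, of S F n] Fc
        by (simp add: \<Psi>S)
      show "matsum (length ys * d) (length xs * d) S D = 0\<^sub>m (length ys * d) (length xs * d)"
      proof (rule eq_matI)
        fix i j assume "i < dim_row (0\<^sub>m (length ys * d) (length xs * d) :: 'f mat)"
          "j < dim_col (0\<^sub>m (length ys * d) (length xs * d) :: 'f mat)"
        then have ij: "i < n" "j < n" using n n' by auto
        have "(\<Sum>k\<in>S. D k $$ (i, j)) = (\<Sum>k\<in>S. (f W * F k) $$ (i, j)) - (\<Sum>k\<in>S. (F k * W) $$ (i, j))"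
          using ij c carrier_matD[OF c(1)] carrier_matD[OF c(2)]
          by (simp add: D_def sum_subtractf[symmetric] del: index_mult_mat)
        also have "\<dots> = 0" using arg_cong[OF e, of "\<lambda>M. M $$ (i, j)"] ij by (simp add: matsum_index)
        finally show "matsum (length ys * d) (length xs * d) S D $$ (i, j) =
            0\<^sub>m (length ys * d) (length xs * d) $$ (i, j)"
          unfolding n[symmetric] n'[symmetric] using ij by (simp add: matsum_index)
      qed (auto simp: matsum_def)
    qed (use S car that in auto)
    then have z: "D k = 0\<^sub>m n n" unfolding n[symmetric] n'[symmetric] .
    show ?thesis
    proof (rule eq_matI)
      fix i j assume "i < dim_row (F k * W)" "j < dim_col (F k * W)"
      then have ij: "i < n" "j < n" using carrier_matD[OF c(2)[of k]] by (simp_all del: index_mult_mat)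
      show "(f W * F k) $$ (i, j) = (F k * W) $$ (i, j)"
        using arg_cong[OF z, of "\<lambda>M. M $$ (i, j)"] ij c carrier_matD[OF c(1)] carrier_matD[OF c(2)]
        by (simp add: D_def del: index_mult_mat)
    qed (simp_all only: carrier_matD[OF c(1)] carrier_matD[OF c(2)])
  qed
  have all: "f W * F k = F k * W" if k: "k \<in> S" and W: "W \<in> carrier_mat n n" for k W
  proof -
    obtain S' H where S': "finite S'" "S' \<subseteq> carrier G" and H: "\<And>h. H h \<in> homog xs xs h"
      and WS: "W = matsum n n S' H"
      using homog_decomp[of W xs xs \<one>, folded n, OF W car(1,1) one_closed] by blast
    have Hc: "H h \<in> carrier_mat n n" for h using homog_carrier[OF H] n by metis
    show ?thesis unfolding WS
    proof (rule matsum_induct[OF S'(1), where P = "\<lambda>W. f W * F k = F k * W"])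
      show "f (0\<^sub>m n n) * F k = F k * 0\<^sub>m n n" using alg_isoD(5)[OF f] Fc[of k] by simp
    next
      fix A B assume AB: "A \<in> carrier_mat n n" "B \<in> carrier_mat n n" "f A * F k = F k * A" "f B * F k = F k * B"
      then show "f (A + B) * F k = F k * (A + B)"
        using linear_on_matD(1)[OF alg_isoD(1)[OF f]] alg_isoD(3)[OF f] Fc[of k]
        by (simp add: square_mat_simps(2,3)[where n = n])
    next
      fix h assume "h \<in> S'"
      then show "H h \<in> carrier_mat n n \<and> f (H h) * F k = F k * H h" using Hc hom1[OF k _ H] S' by auto
    qed
  qed
  note i = minv[OF \<Psi>]
  \<comment> \<open>Schur's argument: both \<Psi> and \<open>F k\<close> intertwine, so
    \<open>minv \<Psi> * F k\<close> commutes with all matrices and is a scalar.\<close>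
  have prp: "\<exists>c. F k = c \<cdot>\<^sub>m \<Psi>" if k: "k \<in> S" for k
  proof -
    have "minv \<Psi> * F k * W = W * (minv \<Psi> * F k)" if W: "W \<in> carrier_mat n n" for W
    proof -
      have fW: "f W \<in> carrier_mat n n" by (rule alg_isoD(3)[OF f W])
      have "minv \<Psi> * F k * W = minv \<Psi> * (f W * F k)"
        using all[OF k W] i Fc[of k] W by (simp add: square_mat_simps(4)[where n = n])
      also have "f W * F k = f W * (\<Psi> * (minv \<Psi> * F k))"
        using square_mat_simps(4)[OF \<Psi>(1) i(1) Fc, symmetric, of k] i(2) square_mat_simps(10)[OF Fc[of k]] by simp
      also have "\<dots> = (f W * \<Psi>) * (minv \<Psi> * F k)"
        by (rule square_mat_simps(4)[symmetric, OF fW \<Psi>(1) mult_carrier_mat[OF i(1) Fc]])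
      also have "\<dots> = \<Psi> * (W * (minv \<Psi> * F k))"
        unfolding inter[OF W] using i W Fc[of k] \<Psi> by (simp add: square_mat_simps(1,4)[where n = n])
      also have "minv \<Psi> * \<dots> = minv \<Psi> * \<Psi> * (W * (minv \<Psi> * F k))"
        by (rule square_mat_simps(4)[symmetric, OF i(1) \<Psi>(1) mult_carrier_mat[OF W mult_carrier_mat[OF i(1) Fc]]])
      also have "\<dots> = W * (minv \<Psi> * F k)"
        using i(3) square_mat_simps(10)[OF mult_carrier_mat[OF W mult_carrier_mat[OF i(1) Fc]]] by simp
      finally show ?thesis .
    qed
    then obtain c where c: "minv \<Psi> * F k = c \<cdot>\<^sub>m 1\<^sub>m n"
      using commuting_mat_scalar[OF mult_carrier_mat[OF i(1) Fc]] by metis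
    have "F k = \<Psi> * minv \<Psi> * F k" using i Fc[of k] by simp
    also have "\<dots> = \<Psi> * (minv \<Psi> * F k)" by (rule assoc_mult_mat[OF \<Psi>(1) i(1) Fc])
    also have "\<dots> = c \<cdot>\<^sub>m \<Psi>" unfolding c using \<Psi> by (simp add: square_mat_simps(6,11)[where n = n])
    finally show ?thesis by blast
  qed
  have "\<exists>k\<in>S. F k \<noteq> 0\<^sub>m n n"
  proof (rule ccontr)
    assume "\<not> ?thesis"
    then have "\<Psi> = 0\<^sub>m n n" unfolding \<Psi>S by (intro eq_matI) (auto simp: matsum_def)
    then have "\<Psi> * minv \<Psi> = 0\<^sub>m n n * minv \<Psi>" by (rule arg_cong)
    then have "(1\<^sub>m n :: 'f mat) = 0\<^sub>m n n" using i(2) square_mat_simps(7)[OF i(1)] by simp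
    then have "(1\<^sub>m n :: 'f mat) $$ (0, 0) = 0\<^sub>m n n $$ (0, 0)" by (rule arg_cong)
    then show False using False by simp
  qed
  then obtain k where k: "k \<in> S" "F k \<noteq> 0\<^sub>m n n" by blast
  then obtain c where c: "F k = c \<cdot>\<^sub>m \<Psi>" using prp by blast
  then have "c \<noteq> 0" using k(2) smult_zero_mat[OF \<Psi>(1)] by auto
  then have "\<Psi> = inverse c \<cdot>\<^sub>m F k" unfolding c by (simp add: smult_smult_mat)
  then have "\<Psi> \<in> homog ys xs k" using F homog_smult by simp
  then show ?thesis using that k S by blast
qed

end

section \<open>Rows and their cosets\<close>

text \<open>One entry for each row of the factor \<open>C\<close>: writing \<open>g_i\<close> out
  \<open>k_i\<close> times replaces the block structure by a list indexed by rows. Up to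
  simultaneous reordering and modulo \<open>T\<close>, the data \<kappa> and \<gamma> become the
  multiset of cosets of this list.\<close>

definition rows_of :: "nat list \<Rightarrow> 'a list \<Rightarrow> 'a list" where
  "rows_of \<kappa> \<gamma> = concat (map2 replicate \<kappa> \<gamma>)"

fun blk :: "nat list \<Rightarrow> nat \<Rightarrow> nat" where
  "blk [] r = 0"
| "blk (k # ks) r = (if r < k then 0 else Suc (blk ks (r - k)))"

lemma rows_of_simps [simp]:
  "rows_of [] \<gamma> = []" "rows_of \<kappa> [] = []" "rows_of (k # \<kappa>) (g # \<gamma>) = replicate k g @ rows_of \<kappa> \<gamma>"
  by (auto simp: rows_of_def)

lemma length_rows_of: "length \<kappa> = length \<gamma> \<Longrightarrow> length (rows_of \<kappa> \<gamma>) = sum_list \<kappa>"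
  by (induction \<kappa> \<gamma> rule: list_induct2) auto

lemma blk_less: "r < sum_list \<kappa> \<Longrightarrow> blk \<kappa> r < length \<kappa>"
  by (induction \<kappa> arbitrary: r) auto

lemma rows_of_nth: "length \<kappa> = length \<gamma> \<Longrightarrow> r < sum_list \<kappa> \<Longrightarrow> rows_of \<kappa> \<gamma> ! r = \<gamma> ! blk \<kappa> r"
  by (induction \<kappa> \<gamma> arbitrary: r rule: list_induct2) (auto simp: nth_append)

lemma set_rows_of_subset: "set (rows_of \<kappa> \<gamma>) \<subseteq> set \<gamma>"
  by (auto simp: rows_of_def set_zip)

lemma rows_of_append:
  "length \<kappa> = length \<gamma> \<Longrightarrow> rows_of (\<kappa> @ \<kappa>') (\<gamma> @ \<gamma>') = rows_of \<kappa> \<gamma> @ rows_of \<kappa>' \<gamma>'"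
  by (induction \<kappa> \<gamma> rule: list_induct2) auto

lemma mset_map_rows_of:
  "length \<kappa> = length \<gamma> \<Longrightarrow> mset (map f (rows_of \<kappa> \<gamma>)) = (\<Sum>(k, g)\<leftarrow>zip \<kappa> \<gamma>. replicate_mset k (f g))"
  by (induction \<kappa> \<gamma> rule: list_induct2) auto

lemma count_map_rows_of:
  assumes "length \<kappa> = length \<gamma>" "distinct (map f \<gamma>)" "i < length \<gamma>"
  shows "count (mset (map f (rows_of \<kappa> \<gamma>))) (f (\<gamma> ! i)) = \<kappa> ! i"
  using assms
proof (induction \<kappa> \<gamma> arbitrary: i rule: list_induct2)
  case (Cons k \<kappa> g \<gamma>)
  have *: "count (mset (map f (rows_of \<kappa> \<gamma>))) (f g) = 0"
    using Cons.prems set_rows_of_subset[of \<kappa> \<gamma>] by (auto simp: count_eq_zero_iff)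
  show ?case
  proof (cases i)
    case 0
    then show ?thesis using * by simp
  next
    case (Suc j)
    then have "f (\<gamma> ! j) \<in> f ` set \<gamma>" using Cons.prems by simp
    moreover have "f g \<notin> f ` set \<gamma>" using Cons.prems by simp
    ultimately have "f (\<gamma> ! j) \<noteq> f g" by metis
    then show ?thesis using Cons Suc by simp
  qed
qed simp

lemma mset_map_rows_of_permute:
  assumes "length \<kappa> = length \<gamma>" "\<sigma> permutes {..<length \<kappa>}"
  shows "mset (map f (rows_of (permute_list \<sigma> \<kappa>) (permute_list \<sigma> \<gamma>))) = mset (map f (rows_of \<kappa> \<gamma>))"
proof -
  have "zip (permute_list \<sigma> \<kappa>) (permute_list \<sigma> \<gamma>) = permute_list \<sigma> (zip \<kappa> \<gamma>)"
    using permute_list_zip[OF assms(2) refl assms(1)] by simp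
  moreover have "mset (permute_list \<sigma> (zip \<kappa> \<gamma>)) = mset (zip \<kappa> \<gamma>)"
    using assms by (intro mset_permute_list) simp
  ultimately have *: "mset (zip (permute_list \<sigma> \<kappa>) (permute_list \<sigma> \<gamma>)) = mset (zip \<kappa> \<gamma>)" by simp
  have len: "length (permute_list \<sigma> \<kappa>) = length (permute_list \<sigma> \<gamma>)" using assms by simp
  have sum: "sum_list (map F zs) = sum_mset (image_mset F (mset zs))" for F :: "nat \<times> 'a \<Rightarrow> 'b multiset" and zs
    by (simp add: sum_mset_sum_list flip: mset_map)
  show ?thesis unfolding mset_map_rows_of[OF len] mset_map_rows_of[OF assms(1)] sum * ..
qed

lemma rows_of_map: "rows_of \<kappa> (map f \<gamma>) = map f (rows_of \<kappa> \<gamma>)"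
  by (induction \<kappa> \<gamma> rule: list_induct2') auto

section \<open>Cosets modulo \<open>T\<close>\<close>

context bichar
begin

text \<open>Congruence modulo \<open>T\<close> is turned into equality of classes, so that
  multisets, \<open>count\<close> and \<open>distinct\<close> can express the conditions on
  \<gamma>.\<close>

definition coset :: "'a \<Rightarrow> 'a set" where "coset x = rcong T `` {x}"

lemma rcong_iff: "(x, y) \<in> rcong T \<longleftrightarrow> x \<in> carrier G \<and> y \<in> carrier G \<and> inv x \<otimes> y \<in> T"
  by (simp add: r_congruent_def)

lemma coset_eq_rcong: "x \<in> carrier G \<Longrightarrow> y \<in> carrier G \<Longrightarrow> coset x = coset y \<longleftrightarrow> (x, y) \<in> rcong T"
  unfolding coset_def
  by (rule eq_equiv_class_iff[OF subgroup.equiv_rcong[OF T_subgroup is_group]])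

lemma coset_eq: "x \<in> carrier G \<Longrightarrow> y \<in> carrier G \<Longrightarrow> coset x = coset y \<longleftrightarrow> inv x \<otimes> y \<in> T"
  by (simp add: coset_eq_rcong rcong_iff)

lemma coset_eq': "x \<in> carrier G \<Longrightarrow> y \<in> carrier G \<Longrightarrow> coset x = coset y \<longleftrightarrow> x \<otimes> inv y \<in> T"
  using coset_eq[of y x] by (auto simp: m_comm)

lemma coset_mult_T: "x \<in> carrier G \<Longrightarrow> t \<in> T \<Longrightarrow> coset (x \<otimes> t) = coset x"
  using coset_eq[of x "x \<otimes> t"] by (simp flip: m_assoc)

lemma coset_mult_cong:
  assumes "x \<in> carrier G" "y \<in> carrier G" "g \<in> carrier G"
  shows "coset (g \<otimes> x) = coset (g \<otimes> y) \<longleftrightarrow> coset x = coset y"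
proof -
  have "(g \<otimes> x) \<otimes> inv (g \<otimes> y) = (g \<otimes> inv g) \<otimes> (x \<otimes> inv y)"
    using assms by (simp only: inv_mult_group m_ac inv_closed m_closed)
  also have "\<dots> = x \<otimes> inv y" using assms by simp
  finally show ?thesis using assms by (simp add: coset_eq')
qed

lemma M_dataD:
  assumes "M_data G T \<beta> \<kappa> \<gamma>"
  shows "length \<kappa> = length \<gamma>" "set \<gamma> \<subseteq> carrier G" "distinct (map coset \<gamma>)" "\<kappa> \<noteq> []" "\<And>n. n \<in> set \<kappa> \<Longrightarrow> 0 < n"
proof -
  show len: "length \<kappa> = length \<gamma>" and c: "set \<gamma> \<subseteq> carrier G" and "\<kappa> \<noteq> []" and "\<And>n. n \<in> set \<kappa> \<Longrightarrow> 0 < n"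
    using assms by (auto simp: M_data_def)
  show "distinct (map coset \<gamma>)"
    unfolding distinct_conv_nth
  proof (intro allI impI)
    fix i j assume ij: "i < length (map coset \<gamma>)" "j < length (map coset \<gamma>)" "i \<noteq> j"
    then have "\<gamma> ! i \<in> carrier G" "\<gamma> ! j \<in> carrier G" using c nth_mem by auto
    moreover have "inv (\<gamma> ! i) \<otimes> \<gamma> ! j \<notin> T" using assms ij by (simp add: M_data_def)
    ultimately show "map coset \<gamma> ! i \<noteq> map coset \<gamma> ! j" using ij by (simp add: coset_eq)
  qed
qed

lemma M_dataI:
  assumes "length \<kappa> = length \<gamma>" "set \<gamma> \<subseteq> carrier G" "distinct (map coset \<gamma>)" "\<kappa> \<noteq> []" "\<And>n. n \<in> set \<kappa> \<Longrightarrow> 0 < n"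
  shows "M_data G T \<beta> \<kappa> \<gamma>"
  unfolding M_data_def
proof (intro conjI ballI allI impI pair)
  fix i j assume ij: "i < length \<gamma>" "j < length \<gamma>" "i \<noteq> j"
  then have "\<gamma> ! i \<in> carrier G" "\<gamma> ! j \<in> carrier G" using assms nth_mem by auto
  moreover have "coset (\<gamma> ! i) \<noteq> coset (\<gamma> ! j)" using assms(3) ij by (auto simp: distinct_conv_nth)
  ultimately show "inv (\<gamma> ! i) \<otimes> \<gamma> ! j \<notin> T" by (simp add: coset_eq)
qed (use assms in auto)

lemma rows_of_carrier: "M_data G T \<beta> \<kappa> \<gamma> \<Longrightarrow> set (rows_of \<kappa> \<gamma>) \<subseteq> carrier G"
  using set_rows_of_subset[of \<kappa> \<gamma>] M_dataD(2) by blast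

lemma rows_of_coset_inj:
  assumes "M_data G T \<beta> \<kappa> \<gamma>" "x \<in> set (rows_of \<kappa> \<gamma>)" "y \<in> set (rows_of \<kappa> \<gamma>)" "coset x = coset y"
  shows "x = y"
proof -
  have "x \<in> set \<gamma>" "y \<in> set \<gamma>" using assms(2,3) set_rows_of_subset[of \<kappa> \<gamma>] by auto
  then show ?thesis using M_dataD(3)[OF assms(1)] assms(4) by (auto simp: distinct_map inj_on_def)
qed

end

section \<open>The homogeneous components of \<open>M_alg\<close>\<close>

text \<open>A list of flags stands in for the index of the block, since an index would have to be
  shifted when the induction removes the first block.\<close>

lemma diag_block_idem:
  assumes "length bs = length \<kappa>"
  shows "diag_block_mat (map (\<lambda>(k, b). if b then 1\<^sub>m k else 0\<^sub>m k k) (zip \<kappa> bs)) =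
    (mat (sum_list \<kappa>) (sum_list \<kappa>) (\<lambda>(r, s). if r = s \<and> bs ! blk \<kappa> r then 1 else 0) :: 'f::field mat)"
  using assms
proof (induction bs \<kappa> rule: list_induct2)
  case Nil
  show ?case by (rule eq_matI) auto
next
  case (Cons b bs k \<kappa>)
  show ?case
    unfolding zip_Cons_Cons list.map diag_block_mat.simps Let_def Cons.IH prod.case
    by (rule eq_matI) (auto split: if_splits)
qed

lemma block_idem_eq:
  assumes "i < length \<kappa>"
  shows "block_idem \<kappa> i = mat (sum_list \<kappa>) (sum_list \<kappa>) (\<lambda>(r, s). if r = s \<and> blk \<kappa> r = i then 1 else (0::'f::field))"
proof -
  let ?bs = "map (\<lambda>j. j = i) [0..<length \<kappa>]"
  have "block_idem \<kappa> i = diag_block_mat (map (\<lambda>(k, b). if b then 1\<^sub>m k else (0\<^sub>m k k :: 'f mat)) (zip \<kappa> ?bs))"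
    unfolding block_idem_def by (intro arg_cong[of _ _ diag_block_mat] nth_equalityI) auto
  also have "\<dots> = mat (sum_list \<kappa>) (sum_list \<kappa>) (\<lambda>(r, s). if r = s \<and> ?bs ! blk \<kappa> r then 1 else 0)"
    by (rule diag_block_idem) simp
  also have "\<dots> = mat (sum_list \<kappa>) (sum_list \<kappa>) (\<lambda>(r, s). if r = s \<and> blk \<kappa> r = i then 1 else 0)"
    by (rule eq_matI) (use blk_less in auto)
  finally show ?thesis .
qed

lemma block_idem_sandwich:
  fixes A :: "'f::field mat"
  assumes A: "A \<in> carrier_mat (sum_list \<kappa>) (sum_list \<kappa>)" and ij: "i < length \<kappa>" "j < length \<kappa>"
  shows "block_idem \<kappa> i * A * block_idem \<kappa> j =
    mat (sum_list \<kappa>) (sum_list \<kappa>) (\<lambda>(r, s). if blk \<kappa> r = i \<and> blk \<kappa> s = j then A $$ (r, s) else 0)"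
proof (rule eq_matI)
  let ?c = "sum_list \<kappa>"
  have e: "block_idem \<kappa> i \<in> carrier_mat ?c ?c" "block_idem \<kappa> j \<in> carrier_mat ?c ?c"
    using ij by (auto simp: block_idem_eq)
  have eA: "block_idem \<kappa> i * A \<in> carrier_mat ?c ?c" by (rule mult_carrier_mat[OF e(1) A])
  fix r s assume "r < dim_row (mat ?c ?c (\<lambda>(r, s). if blk \<kappa> r = i \<and> blk \<kappa> s = j then A $$ (r, s) else 0))"
    "s < dim_col (mat ?c ?c (\<lambda>(r, s). if blk \<kappa> r = i \<and> blk \<kappa> s = j then A $$ (r, s) else 0))"
  then have rs: "r < ?c" "s < ?c" by auto
  have 1: "(block_idem \<kappa> i * A) $$ (r, l) = (if blk \<kappa> r = i then A $$ (r, l) else 0)" if "l < ?c" for l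
  proof -
    have "(block_idem \<kappa> i * A) $$ (r, l) = (\<Sum>k<?c. block_idem \<kappa> i $$ (r, k) * A $$ (k, l))"
      by (rule index_mult_mat_sum[OF e(1) A rs(1) that])
    also have "\<dots> = (\<Sum>k<?c. if k = r then (if blk \<kappa> r = i then A $$ (r, l) else 0) else 0)"
      using rs ij by (intro sum.cong) (auto simp: block_idem_eq)
    finally show ?thesis using rs by simp
  qed
  have "(block_idem \<kappa> i * A * block_idem \<kappa> j) $$ (r, s) = (\<Sum>k<?c. (block_idem \<kappa> i * A) $$ (r, k) * block_idem \<kappa> j $$ (k, s))"
    by (rule index_mult_mat_sum[OF eA e(2) rs])
  also have "\<dots> = (\<Sum>k<?c. if k = s then (if blk \<kappa> r = i \<and> blk \<kappa> s = j then A $$ (r, s) else 0) else 0)"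
    using rs ij 1 by (intro sum.cong) (auto simp: block_idem_eq)
  finally show "(block_idem \<kappa> i * A * block_idem \<kappa> j) $$ (r, s) =
     mat ?c ?c (\<lambda>(r, s). if blk \<kappa> r = i \<and> blk \<kappa> s = j then A $$ (r, s) else 0) $$ (r, s)"
    using rs by simp
qed (use assms in \<open>auto simp: block_idem_eq\<close>)

lemma mat_span_least:
  fixes N :: "'f::field mat set"
  assumes "S \<subseteq> N" "N \<subseteq> carrier_mat n n" "0\<^sub>m n n \<in> N" "\<And>A B. A \<in> N \<Longrightarrow> B \<in> N \<Longrightarrow> A + B \<in> N"
    "\<And>c A. A \<in> N \<Longrightarrow> c \<cdot>\<^sub>m A \<in> N"
  shows "mat_span n S \<subseteq> N"
proof -
  interpret vectorspace class_ring "module_mat TYPE('f) n n" by (rule matrix_vs)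
  have "LinearCombinations.submodule class_ring N (module_mat TYPE('f) n n)"
    by (rule submodule.intro) (use assms module_axioms in \<open>auto simp: module_mat_simps\<close>)
  then show ?thesis unfolding mat_span_def by (rule span_is_subset[OF assms(1)])
qed

lemma mat_span_closed:
  fixes S :: "'f::field mat set"
  assumes S: "S \<subseteq> carrier_mat n n"
  shows "0\<^sub>m n n \<in> mat_span n S" "A \<in> mat_span n S \<Longrightarrow> B \<in> mat_span n S \<Longrightarrow> A + B \<in> mat_span n S"
    "A \<in> S \<Longrightarrow> A \<in> mat_span n S"
proof -
  interpret vectorspace class_ring "module_mat TYPE('f) n n" by (rule matrix_vs)
  have S': "S \<subseteq> carrier (module_mat TYPE('f) n n)" using S by (simp add: module_mat_simps)
  interpret N: LinearCombinations.submodule class_ring "mat_span n S" "module_mat TYPE('f) n n"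
    unfolding mat_span_def by (rule span_is_submodule[OF S'])
  show "0\<^sub>m n n \<in> mat_span n S" using N.zero_closed by (simp add: module_mat_simps)
  show "A \<in> mat_span n S \<Longrightarrow> B \<in> mat_span n S \<Longrightarrow> A + B \<in> mat_span n S"
    using N.m_closed[of A B] by (simp add: module_mat_simps)
  show "A \<in> S \<Longrightarrow> A \<in> mat_span n S" unfolding mat_span_def using in_own_span[OF S'] by blast
qed

context std_realization
begin

lemma gsize_M_alg: "length \<kappa> = length \<gamma> \<Longrightarrow> gsize (M_alg G T \<beta> ab \<kappa> \<gamma>) = length (rows_of \<kappa> \<gamma>) * d"
  by (simp add: M_alg_def Let_def length_rows_of)

text \<open>For a generator in block \<open>(i, j)\<close> with second factor \<open>X t\<close>,
  the degree \<open>g\<close> forces \<open>t = g \<gamma>_i \<gamma>_j^-1\<close>, so membership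
  becomes a condition on single blocks. For the converse inclusion a homogeneous matrix is cut up by
  the idempotents, with one summand \<open>F (i, j)\<close> for each pair of blocks.\<close>

theorem gcomp_M_alg:
  assumes len: "length \<kappa> = length \<gamma>" and car: "set \<gamma> \<subseteq> carrier G" and g: "g \<in> carrier G"
  shows "gcomp (M_alg G T \<beta> ab \<kappa> \<gamma>) g = homog (rows_of \<kappa> \<gamma>) (rows_of \<kappa> \<gamma>) g"
proof -
  let ?c = "sum_list \<kappa>" and ?rows = "rows_of \<kappa> \<gamma>"
  let ?n = "?c * d"
  let ?S = "{kron (block_idem \<kappa> i * A * block_idem \<kappa> j) (X t) | A i j t.
             A \<in> carrier_mat ?c ?c \<and> i < length \<kappa> \<and> j < length \<kappa> \<and> t \<in> T \<and>
             inv (\<gamma> ! i) \<otimes> t \<otimes> (\<gamma> ! j) = g}"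
  have comp: "gcomp (M_alg G T \<beta> ab \<kappa> \<gamma>) g = mat_span ?n ?S"
    by (simp add: M_alg_def Let_def)
  have lr: "length ?rows = ?c" by (rule length_rows_of[OF len])
  have nth: "?rows ! r = \<gamma> ! blk \<kappa> r" if "r < ?c" for r by (rule rows_of_nth[OF len that])
  have \<gamma>c: "\<gamma> ! i \<in> carrier G" if "i < length \<kappa>" for i using car that len nth_mem by auto
  have sand: "block_idem \<kappa> i * A * block_idem \<kappa> j \<in> carrier_mat ?c ?c"
    if "A \<in> carrier_mat ?c ?c" "i < length \<kappa>" "j < length \<kappa>" for A :: "'f mat" and i j
    using that by (simp add: block_idem_sandwich)
  have Sc: "?S \<subseteq> carrier_mat ?n ?n"
    using sand by (auto intro!: kron_carrier)
  have deg: "inv x \<otimes> t \<otimes> y = g \<longleftrightarrow> t = g \<otimes> x \<otimes> inv y"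
    if "x \<in> carrier G" "y \<in> carrier G" "t \<in> carrier G" for x y t
  proof
    assume e: "inv x \<otimes> t \<otimes> y = g"
    have "g \<otimes> x \<otimes> inv y = t \<otimes> (inv x \<otimes> x) \<otimes> (y \<otimes> inv y)"
      unfolding e[symmetric] using that by (simp only: m_ac inv_closed m_closed)
    then show "t = g \<otimes> x \<otimes> inv y" using that by simp
  next
    assume e: "t = g \<otimes> x \<otimes> inv y"
    have "inv x \<otimes> t \<otimes> y = g \<otimes> (inv x \<otimes> x) \<otimes> (inv y \<otimes> y)"
      unfolding e using that g by (simp only: m_ac inv_closed m_closed)
    then show "inv x \<otimes> t \<otimes> y = g" using that g by simp
  qed
  have "mat_span ?n ?S \<subseteq> homog ?rows ?rows g"
  proof (rule mat_span_least)
    show "?S \<subseteq> homog ?rows ?rows g"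
    proof
      fix M assume "M \<in> ?S"
      then obtain A i j t where M: "M = kron (block_idem \<kappa> i * A * block_idem \<kappa> j) (X t)"
        "A \<in> carrier_mat ?c ?c" "i < length \<kappa>" "j < length \<kappa>" "t \<in> T" "inv (\<gamma> ! i) \<otimes> t \<otimes> (\<gamma> ! j) = g" by blast
      have t: "t = g \<otimes> \<gamma> ! i \<otimes> inv (\<gamma> ! j)" using deg[of "\<gamma> ! i" "\<gamma> ! j" t] M \<gamma>c by auto
      let ?E = "block_idem \<kappa> i * A * block_idem \<kappa> j"
      have E: "?E \<in> carrier_mat ?c ?c" using sand M by blast
      have Ei: "?E $$ (r, s) = (if blk \<kappa> r = i \<and> blk \<kappa> s = j then A $$ (r, s) else 0)" if "r < ?c" "s < ?c" for r s
        using that M(2-4) by (simp add: block_idem_sandwich)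
      show "M \<in> homog ?rows ?rows g"
      proof (rule homogI[where a = "\<lambda>r s. ?E $$ (r, s)"])
        show "M \<in> carrier_mat (length ?rows * d) (length ?rows * d)"
          unfolding M(1) lr using E X_carrier[OF M(5)] by (rule kron_carrier)
      next
        fix r s assume "r < length ?rows" "s < length ?rows" "?E $$ (r, s) \<noteq> 0"
        then show "g \<otimes> ?rows ! r \<otimes> inv (?rows ! s) \<in> T"
          using Ei[of r s] t M(5) nth lr by (auto split: if_splits)
      next
        fix r s p q assume rs: "r < length ?rows" "s < length ?rows" and pq: "p < d" "q < d"
        have "M $$ (r * d + p, s * d + q) = ?E $$ (r, s) * X t $$ (p, q)"
          unfolding M(1) by (rule kron_index[OF E X_carrier[OF M(5)]]) (use rs pq lr in auto)
        then show "M $$ (r * d + p, s * d + q) = ?E $$ (r, s) * X (g \<otimes> ?rows ! r \<otimes> inv (?rows ! s)) $$ (p, q)"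
          using Ei[of r s] t rs lr nth by auto
      qed
    qed
    show "homog ?rows ?rows g \<subseteq> carrier_mat ?n ?n" using homog_carrier[of _ ?rows ?rows g] lr by auto
    show "0\<^sub>m ?n ?n \<in> homog ?rows ?rows g" using homog_zero[of ?rows ?rows g] lr by simp
  qed (auto intro: homog_add homog_smult)
  moreover have "M \<in> mat_span ?n ?S" if M: "M \<in> homog ?rows ?rows g" for M
  proof -
    have Mc: "M \<in> carrier_mat ?n ?n" using homog_carrier[OF M] lr by simp
    obtain a where a: "\<And>r s. r < ?c \<Longrightarrow> s < ?c \<Longrightarrow> a r s \<noteq> 0 \<Longrightarrow> g \<otimes> ?rows ! r \<otimes> inv (?rows ! s) \<in> T"
      "\<And>r s p q. r < ?c \<Longrightarrow> s < ?c \<Longrightarrow> p < d \<Longrightarrow> q < d \<Longrightarrow>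
       M $$ (r * d + p, s * d + q) = a r s * X (g \<otimes> ?rows ! r \<otimes> inv (?rows ! s)) $$ (p, q)"
      using homogE[OF M] unfolding lr by blast
    define A where "A = mat ?c ?c (\<lambda>(r, s). a r s)"
    have A: "A \<in> carrier_mat ?c ?c" by (simp add: A_def)
    define t where "t i j = g \<otimes> \<gamma> ! i \<otimes> inv (\<gamma> ! j)" for i j
    define F where "F = (\<lambda>(i, j). if t i j \<in> T then kron (block_idem \<kappa> i * A * block_idem \<kappa> j) (X (t i j)) else 0\<^sub>m ?n ?n)"
    let ?I = "{..<length \<kappa>} \<times> {..<length \<kappa>}"
    have FS: "F h \<in> mat_span ?n ?S" if hI: "h \<in> ?I" for h
    proof -
      obtain i j where h: "h = (i, j)" "i < length \<kappa>" "j < length \<kappa>" using hI by auto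
      show ?thesis
      proof (cases "t i j \<in> T")
        case True
        then have "inv (\<gamma> ! i) \<otimes> t i j \<otimes> \<gamma> ! j = g"
          using deg[of "\<gamma> ! i" "\<gamma> ! j" "t i j"] \<gamma>c h by (auto simp: t_def)
        then have "F h \<in> ?S" using True h A by (auto simp: F_def)
        then show ?thesis by (rule mat_span_closed(3)[OF Sc])
      next
        case False
        then show ?thesis using h mat_span_closed(1)[OF Sc] by (simp add: F_def)
      qed
    qed
    have Fc: "F h \<in> carrier_mat ?n ?n" if "h \<in> ?I" for h
      using that sand[OF A] by (auto simp: F_def intro!: kron_carrier)
    have "matsum ?n ?n ?I F \<in> mat_span ?n ?S"
      by (rule matsum_induct[where P = "\<lambda>M. M \<in> mat_span ?n ?S"])
        (use FS Fc mat_span_closed(1,2)[OF Sc] in auto)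
    also have "matsum ?n ?n ?I F = M"
    proof (rule mat_eq_blockI[OF matsum_carrier Mc])
      fix r p s q assume rs: "r < ?c" "p < d" "s < ?c" "q < d"
      let ?i = "blk \<kappa> r" and ?j = "blk \<kappa> s"
      have ij: "?i < length \<kappa>" "?j < length \<kappa>" using rs blk_less by auto
      have Fh: "F (i, j) $$ (r * d + p, s * d + q) =
          (if (i, j) = (?i, ?j) then M $$ (r * d + p, s * d + q) else 0)"
        if h: "i < length \<kappa>" "j < length \<kappa>" for i j
      proof (cases "t i j \<in> T")
        case True
        have "F (i, j) $$ (r * d + p, s * d + q) = (block_idem \<kappa> i * A * block_idem \<kappa> j) $$ (r, s) * X (t i j) $$ (p, q)"
          using True kron_index[OF sand[OF A h] X_carrier[OF True] rs] by (simp add: F_def)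
        also have "(block_idem \<kappa> i * A * block_idem \<kappa> j) $$ (r, s) = (if (i, j) = (?i, ?j) then a r s else 0)"
          using block_idem_sandwich[OF A h] rs by (auto simp: A_def)
        finally show ?thesis using a(2)[OF rs(1,3,2,4)] nth rs by (auto simp: t_def)
      next
        case False
        then have "(i, j) = (?i, ?j) \<Longrightarrow> a r s = 0" using a(1)[OF rs(1,3)] nth rs by (auto simp: t_def)
        then show ?thesis using False a(2)[OF rs(1,3,2,4)] block_index_less[OF rs(1,2)] block_index_less[OF rs(3,4)]
          by (auto simp: F_def)
      qed
      have "(\<Sum>h\<in>?I. F h $$ (r * d + p, s * d + q)) =
          (\<Sum>h\<in>?I. if h = (?i, ?j) then M $$ (r * d + p, s * d + q) else 0)"
        using Fh by (intro sum.cong) (auto split: if_splits)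
      also have "\<dots> = M $$ (r * d + p, s * d + q)" using ij by (subst sum.delta) auto
      finally show "matsum ?n ?n ?I F $$ (r * d + p, s * d + q) = M $$ (r * d + p, s * d + q)"
        using block_index_less[OF rs(1,2)] block_index_less[OF rs(3,4)] by (simp add: matsum_index)
    qed
    finally show ?thesis .
  qed
  ultimately show ?thesis unfolding comp by blast
qed

end

section \<open>Row multisets of invertible homogeneous matrices\<close>

lemma mset_map_div:
  "mset (map (\<lambda>I. F (I div d)) [0..<c * d]) = repeat_mset d (mset (map F [0..<c]))"
proof (induction c)
  case (Suc c)
  have "map (\<lambda>I. F (I div d)) [c * d..<c * d + d] = replicate d (F c)"
    by (rule nth_equalityI) (auto simp: block_div_mod)
  moreover have "[0..<Suc c * d] = [0..<c * d] @ [c * d..<c * d + d]"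
    using upt_add_eq_append[of 0 "c * d" d] by (simp add: add.commute)
  ultimately have "mset (map (\<lambda>I. F (I div d)) [0..<Suc c * d]) =
      mset (map (\<lambda>I. F (I div d)) [0..<c * d]) + replicate_mset d (F c)" by simp
  also have "\<dots> = repeat_mset d (mset (map F [0..<Suc c]))"
    unfolding Suc.IH by (rule multiset_eqI) (simp add: algebra_simps)
  finally show ?case .
qed simp

text \<open>Some term of the Leibniz expansion is nonzero. The bijection along nonzero entries takes
  the place of a comparison of graded modules.\<close>

lemma det_nonzero_permutation:
  fixes A :: "'f::field mat"
  assumes "A \<in> carrier_mat n n" "det A \<noteq> 0"
  obtains p where "p permutes {0..<n}" "\<And>i. i < n \<Longrightarrow> A $$ (i, p i) \<noteq> 0"
proof -
  have "(\<Sum>p | p permutes {0..<n}. signof p * (\<Prod>i = 0..<n. A $$ (i, p i))) \<noteq> 0"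
    using assms by (simp add: det_def'[OF assms(1)])
  then obtain p where p: "p permutes {0..<n}" "signof p * (\<Prod>i = 0..<n. A $$ (i, p i)) \<noteq> 0"
    by (metis (mono_tags, lifting) mem_Collect_eq sum.neutral)
  then have "(\<Prod>i = 0..<n. A $$ (i, p i)) \<noteq> 0" by auto
  then have "\<forall>i\<in>{0..<n}. A $$ (i, p i) \<noteq> 0" by (subst (asm) prod_zero_iff) auto
  then show thesis using that p by auto
qed

definition diag_sel :: "nat \<Rightarrow> (nat \<Rightarrow> bool) \<Rightarrow> 'f::field mat" where
  "diag_sel n P = mat n n (\<lambda>(i, j). if i = j \<and> P i then 1 else 0)"

lemma diag_sel_carrier [simp]: "diag_sel n P \<in> carrier_mat n n"
  by (simp add: diag_sel_def)

lemma diag_sel_mult: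
  fixes M :: "'f::field mat"
  assumes "M \<in> carrier_mat n m" "i < n" "j < m"
  shows "(diag_sel n P * M) $$ (i, j) = (if P i then M $$ (i, j) else 0)"
proof -
  have "(diag_sel n P * M) $$ (i, j) = (\<Sum>k<n. diag_sel n P $$ (i, k) * M $$ (k, j))"
    by (rule index_mult_mat_sum[OF diag_sel_carrier assms])
  also have "\<dots> = (\<Sum>k<n. if k = i then (if P i then M $$ (i, j) else 0) else 0)"
    using assms by (intro sum.cong) (auto simp: diag_sel_def)
  finally show ?thesis using assms by simp
qed

lemma mult_diag_sel:
  fixes M :: "'f::field mat"
  assumes "M \<in> carrier_mat n m" "i < n" "j < m"
  shows "(M * diag_sel m P) $$ (i, j) = (if P j then M $$ (i, j) else 0)"
proof -
  have "(M * diag_sel m P) $$ (i, j) = (\<Sum>k<m. M $$ (i, k) * diag_sel m P $$ (k, j))"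
    by (rule index_mult_mat_sum[OF assms(1) diag_sel_carrier assms(2,3)])
  also have "\<dots> = (\<Sum>k<m. if k = j then (if P j then M $$ (i, j) else 0) else 0)"
    using assms by (intro sum.cong) (auto simp: diag_sel_def)
  finally show ?thesis using assms by simp
qed

lemma zero_mat_neq_one: "0 < n \<Longrightarrow> 0\<^sub>m n n \<noteq> (1\<^sub>m n :: 'f::field mat)"
  by (metis index_one_mat(1) index_zero_mat(1) zero_neq_one)

context std_realization
begin

lemma homog_nonzero_degree:
  assumes "M \<in> homog xs ys h" "r < length xs" "s < length ys" "p < d" "q < d" "M $$ (r * d + p, s * d + q) \<noteq> 0"
  shows "h \<otimes> xs ! r \<otimes> inv (ys ! s) \<in> T"
proof -
  obtain a where "\<And>r s. r < length xs \<Longrightarrow> s < length ys \<Longrightarrow> a r s \<noteq> 0 \<Longrightarrow> h \<otimes> xs ! r \<otimes> inv (ys ! s) \<in> T"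
    "\<And>r s p q. r < length xs \<Longrightarrow> s < length ys \<Longrightarrow> p < d \<Longrightarrow> q < d \<Longrightarrow>
       M $$ (r * d + p, s * d + q) = a r s * X (h \<otimes> xs ! r \<otimes> inv (ys ! s)) $$ (p, q)"
    using homogE[OF assms(1)] by blast
  from this(1)[OF assms(2,3)] this(2)[OF assms(2-5)] assms(6) show ?thesis by auto
qed

text \<open>A nonzero entry in block \<open>(r, s)\<close> forces \<open>h x_r\<close> and
  \<open>y_s\<close> into the same coset, and a permutation through nonzero entries pairs all scalar
  rows with all scalar columns. This counts every row degree \<open>d\<close> times on either side,
  and the factor \<open>d\<close> cancels.\<close>

theorem homog_mset:
  assumes A: "A \<in> homog xs ys h" and len: "length xs = length ys" and det: "det A \<noteq> 0"
    and car: "set xs \<subseteq> carrier G" "set ys \<subseteq> carrier G" "h \<in> carrier G"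
  shows "mset (map (\<lambda>x. coset (h \<otimes> x)) xs) = mset (map coset ys)"
proof -
  let ?c = "length ys" and ?n = "length ys * d"
  have Ac: "A \<in> carrier_mat ?n ?n" using homog_carrier[OF A] len by simp
  obtain \<sigma> where \<sigma>: "\<sigma> permutes {0..<?n}" and nz: "\<And>i. i < ?n \<Longrightarrow> A $$ (i, \<sigma> i) \<noteq> 0"
    using det_nonzero_permutation[OF Ac det] by blast
  have eq: "coset (h \<otimes> xs ! (I div d)) = coset (ys ! (\<sigma> I div d))" if I: "I < ?n" for I
  proof -
    have J: "\<sigma> I < ?n" using permutes_in_image[OF \<sigma>, of I] I by simp
    obtain r p where r: "r < ?c" "p < d" "I = r * d + p" using block_indexE[OF I] .
    obtain s q where s: "s < ?c" "q < d" "\<sigma> I = s * d + q" using block_indexE[OF J] .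
    have "xs ! r \<in> carrier G" "ys ! s \<in> carrier G" using r s len car nth_mem by (metis subsetD)+
    moreover have "h \<otimes> xs ! r \<otimes> inv (ys ! s) \<in> T"
      by (rule homog_nonzero_degree[OF A _ s(1) r(2) s(2)]) (use nz[OF I] r s len in auto)
    ultimately show ?thesis using r s car by (simp add: coset_eq' block_div_mod)
  qed
  have "repeat_mset d (mset (map (\<lambda>r. coset (h \<otimes> xs ! r)) [0..<?c])) =
      mset (map (\<lambda>I. coset (h \<otimes> xs ! (I div d))) [0..<?n])"
    by (rule mset_map_div[symmetric])
  also have "\<dots> = mset (map (\<lambda>I. coset (ys ! (\<sigma> I div d))) [0..<?n])"
    using eq by (intro arg_cong[of _ _ mset] map_cong) auto
  also have "\<dots> = image_mset (\<lambda>J. coset (ys ! (J div d))) (image_mset \<sigma> (mset_set {0..<?n}))"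
    by (simp add: multiset.map_comp comp_def)
  also have "image_mset \<sigma> (mset_set {0..<?n}) = mset_set {0..<?n}"
    using \<sigma> by (simp add: image_mset_mset_set permutes_inj_on permutes_image)
  also have "image_mset (\<lambda>J. coset (ys ! (J div d))) (mset_set {0..<?n}) = mset (map (\<lambda>J. coset (ys ! (J div d))) [0..<?n])"
    by simp
  also have "\<dots> = repeat_mset d (mset (map (\<lambda>r. coset (ys ! r)) [0..<?c]))"
    by (rule mset_map_div)
  finally have "mset (map (\<lambda>r. coset (h \<otimes> xs ! r)) [0..<?c]) = mset (map (\<lambda>r. coset (ys ! r)) [0..<?c])"
    using d_pos unfolding repeat_mset_cancel1 by (metis less_irrefl)
  moreover have "map (\<lambda>r. coset (h \<otimes> xs ! r)) [0..<?c] = map (\<lambda>x. coset (h \<otimes> x)) xs"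
    "map (\<lambda>r. coset (ys ! r)) [0..<?c] = map coset ys"
    using len by (auto intro!: nth_equalityI)
  ultimately show ?thesis by simp
qed

section \<open>The identity component and the support\<close>

text \<open>Repetitions in \<open>xs\<close> are allowed, as in \<open>rows_of\<close>; only
  different elements of one coset are excluded.\<close>

definition coset_inj :: "'a list \<Rightarrow> bool" where
  "coset_inj xs \<longleftrightarrow> set xs \<subseteq> carrier G \<and> (\<forall>x\<in>set xs. \<forall>y\<in>set xs. coset x = coset y \<longrightarrow> x = y)"

lemma coset_inj_rows_of: "M_data G T \<beta> \<kappa> \<gamma> \<Longrightarrow> coset_inj (rows_of \<kappa> \<gamma>)"
  unfolding coset_inj_def using rows_of_carrier rows_of_coset_inj by blast

text \<open>For the row degrees \<open>xs\<close> these are the elements of degree 1 in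
  \<open>C\<close>: full matrix blocks, one for each distinct entry of \<open>xs\<close>.\<close>

definition block_diag :: "'a list \<Rightarrow> 'f mat \<Rightarrow> bool" where
  "block_diag xs A \<longleftrightarrow> A \<in> carrier_mat (length xs) (length xs) \<and>
     (\<forall>r<length xs. \<forall>s<length xs. A $$ (r, s) \<noteq> 0 \<longrightarrow> xs ! r = xs ! s)"

text \<open>If \<open>u\<close> and \<open>u x_r x_s^-1\<close> lie in \<open>T\<close>, then
  \<open>x_r\<close> and \<open>x_s\<close> share a coset and hence coincide, so the element of
  \<open>T\<close> in that block is \<open>u\<close> itself. All nonzero blocks thus carry the same
  \<open>X u\<close>.\<close>

lemma homog_T_kron:
  assumes inj: "coset_inj xs" and u: "u \<in> T" and M: "M \<in> homog xs xs u"
  obtains A where "block_diag xs A" "M = kron A (X u)"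
proof -
  let ?c = "length xs"
  have xc: "xs ! r \<in> carrier G" if "r < ?c" for r using inj that nth_mem unfolding coset_inj_def by blast
  obtain a where a: "\<And>r s. r < ?c \<Longrightarrow> s < ?c \<Longrightarrow> a r s \<noteq> 0 \<Longrightarrow> u \<otimes> xs ! r \<otimes> inv (xs ! s) \<in> T"
    "\<And>r s p q. r < ?c \<Longrightarrow> s < ?c \<Longrightarrow> p < d \<Longrightarrow> q < d \<Longrightarrow>
       M $$ (r * d + p, s * d + q) = a r s * X (u \<otimes> xs ! r \<otimes> inv (xs ! s)) $$ (p, q)"
    using homogE[OF M] by blast
  have eq: "xs ! r = xs ! s" if rs: "r < ?c" "s < ?c" "a r s \<noteq> 0" for r s
  proof -
    have "inv u \<otimes> (u \<otimes> xs ! r \<otimes> inv (xs ! s)) \<in> T" using a(1)[OF rs] u by simp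
    moreover have "inv u \<otimes> (u \<otimes> xs ! r \<otimes> inv (xs ! s)) = xs ! r \<otimes> inv (xs ! s)"
      using u xc rs by (simp flip: m_assoc)
    ultimately have "coset (xs ! r) = coset (xs ! s)" using xc rs by (simp add: coset_eq')
    then show ?thesis using inj rs nth_mem unfolding coset_inj_def by blast
  qed
  let ?A = "mat ?c ?c (\<lambda>(r, s). a r s)"
  show thesis
  proof (rule that[of ?A])
    show "block_diag xs ?A" using eq by (auto simp: block_diag_def)
    show "M = kron ?A (X u)"
    proof (rule mat_eq_blockI[OF homog_carrier[OF M]])
      show "kron ?A (X u) \<in> carrier_mat (?c * d) (?c * d)" using u by (intro kron_carrier) auto
    next
      fix r p s q assume r: "r < ?c" "p < d" "s < ?c" "q < d"
      have "a r s = 0 \<or> u \<otimes> xs ! r \<otimes> inv (xs ! s) = u"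
        using eq[of r s] r xc[of s] u by (cases "a r s = 0") (auto simp: m_assoc)
      then show "M $$ (r * d + p, s * d + q) = kron ?A (X u) $$ (r * d + p, s * d + q)"
        using a(2)[OF r(1,3,2,4)] kron_index[OF mat_carrier X_carrier[OF u] r] r by auto
    qed
  qed
qed

lemma kron_block_diag_homog:
  assumes A: "block_diag xs A" and u: "u \<in> T" and car: "set xs \<subseteq> carrier G"
  shows "kron A (X u) \<in> homog xs xs u"
proof (rule homogI[where a = "\<lambda>r s. A $$ (r, s)"])
  have Ac: "A \<in> carrier_mat (length xs) (length xs)" using A by (simp add: block_diag_def)
  show "kron A (X u) \<in> carrier_mat (length xs * d) (length xs * d)" by (rule kron_carrier[OF Ac X_carrier[OF u]])
  have eq: "u \<otimes> xs ! r \<otimes> inv (xs ! s) = u" if "r < length xs" "s < length xs" "A $$ (r, s) \<noteq> 0" for r s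
  proof -
    have "xs ! r = xs ! s" "xs ! s \<in> carrier G" using A that car nth_mem by (auto simp: block_diag_def)
    then show ?thesis using u by (simp add: m_assoc)
  qed
  fix r s assume rs: "r < length xs" "s < length xs"
  show "A $$ (r, s) \<noteq> 0 \<Longrightarrow> u \<otimes> xs ! r \<otimes> inv (xs ! s) \<in> T" using eq rs u by simp
  fix p q assume "p < d" "q < d"
  then show "kron A (X u) $$ (r * d + p, s * d + q) = A $$ (r, s) * X (u \<otimes> xs ! r \<otimes> inv (xs ! s)) $$ (p, q)"
    using kron_index[OF Ac X_carrier[OF u], of r p s q] rs eq[of r s] by (cases "A $$ (r, s) = 0") auto
qed

lemma X_nonzero_entry:
  assumes "u \<in> T"
  obtains p q where "p < d" "q < d" "X u $$ (p, q) \<noteq> 0"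
proof (rule ccontr)
  assume "\<not> thesis"
  then have z: "X u = 0\<^sub>m d d" using that assms by (intro eq_matI) auto
  obtain B where B: "B \<in> carrier_mat d d" "X u * B = 1\<^sub>m d" using X_rinv[OF assms] by (auto simp: rinv_def)
  have "0\<^sub>m d d = (1\<^sub>m d :: 'f mat)" using B(2) square_mat_simps(7)[OF B(1)] unfolding z by simp
  then show False using zero_mat_neq_one[OF d_pos] by blast
qed

lemma kron_X_cancel:
  assumes "u \<in> T" "A \<in> carrier_mat c c" "B \<in> carrier_mat c c" "kron A (X u) = kron B (X u)"
  shows "A = B"
proof (rule eq_matI)
  obtain p q where pq: "p < d" "q < d" "X u $$ (p, q) \<noteq> 0" using X_nonzero_entry[OF assms(1)] .
  fix r s assume "r < dim_row B" "s < dim_col B"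
  then have rs: "r < c" "s < c" using assms by auto
  have "A $$ (r, s) * X u $$ (p, q) = B $$ (r, s) * X u $$ (p, q)"
    using kron_index[OF assms(2) X_carrier[OF assms(1)] rs(1) pq(1) rs(2) pq(2)]
      kron_index[OF assms(3) X_carrier[OF assms(1)] rs(1) pq(1) rs(2) pq(2)] assms(4) by metis
  then show "A $$ (r, s) = B $$ (r, s)" using pq by simp
qed (use assms in auto)

definition centralizes :: "'a list \<Rightarrow> 'f mat \<Rightarrow> bool" where
  "centralizes xs M \<longleftrightarrow> (\<forall>N\<in>homog xs xs \<one>. M * N = N * M)"

lemma one_kron_X_homog:
  assumes "u \<in> T" "set xs \<subseteq> carrier G"
  shows "kron (1\<^sub>m (length xs)) (X u) \<in> homog xs xs u"
  by (rule kron_block_diag_homog[OF _ assms]) (auto simp: block_diag_def)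

lemma one_kron_X_centralizes:
  assumes "u \<in> T" "coset_inj xs"
  shows "centralizes xs (kron (1\<^sub>m (length xs)) (X u))"
  unfolding centralizes_def
proof
  fix N assume N: "N \<in> homog xs xs \<one>"
  obtain A where A: "block_diag xs A" "N = kron A (X \<one>)" using homog_T_kron[OF assms(2) T_one N] .
  have Ac: "A \<in> carrier_mat (length xs) (length xs)" using A by (simp add: block_diag_def)
  show "kron (1\<^sub>m (length xs)) (X u) * N = N * kron (1\<^sub>m (length xs)) (X u)"
    unfolding A X_one
    using kron_mult[OF one_carrier_mat Ac X_carrier[OF assms(1)] one_carrier_mat]
      kron_mult[OF Ac one_carrier_mat one_carrier_mat X_carrier[OF assms(1)]]
      square_mat_simps(10,11)[OF Ac] square_mat_simps(10,11)[OF X_carrier[OF assms(1)]] by simp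
qed

lemma one_kron_X_comm:
  assumes "u \<in> T" "v \<in> T"
  shows "kron (1\<^sub>m c) (X u) * kron (1\<^sub>m c) (X v) = \<beta> (u, v) \<cdot>\<^sub>m (kron (1\<^sub>m c) (X v) * kron (1\<^sub>m c) (X u))"
  using kron_mult[OF one_carrier_mat one_carrier_mat X_carrier[OF assms(1)] X_carrier[OF assms(2)], of c]
    kron_mult[OF one_carrier_mat one_carrier_mat X_carrier[OF assms(2)] X_carrier[OF assms(1)], of c]
    X_comm[OF assms] by (simp only: kron_smult)

lemma one_kron_X_rinv: "u \<in> T \<Longrightarrow> rinv (c * d) (kron (1\<^sub>m c) (X u))"
  by (intro rinv_kron rinv_one X_rinv)

text \<open>Centralizing \<open>B \<otimes> 1\<close>, which has degree 1, makes \<open>A\<close>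
  commute with \<open>B\<close>. The commutation of \<open>A \<otimes> X u\<close> with
  \<open>B \<otimes> X v\<close> is then that of \<open>X u\<close> with \<open>X v\<close>, and a
  nonzero product makes the factor unique.\<close>

lemma centralizer_commutation:
  assumes inj: "coset_inj xs" and uv: "u \<in> T" "v \<in> T" and M: "M \<in> homog xs xs u" and N: "N \<in> homog xs xs v"
    and cen: "centralizes xs M" and e: "M * N = x \<cdot>\<^sub>m (N * M)"
    and nz: "N * M \<noteq> 0\<^sub>m (length xs * d) (length xs * d)"
  shows "x = \<beta> (u, v)"
proof -
  let ?c = "length xs"
  have car: "set xs \<subseteq> carrier G" using inj by (simp add: coset_inj_def)
  obtain A where A: "block_diag xs A" "M = kron A (X u)" using homog_T_kron[OF inj uv(1) M] .
  obtain B where B: "block_diag xs B" "N = kron B (X v)" using homog_T_kron[OF inj uv(2) N] .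
  have c: "A \<in> carrier_mat ?c ?c" "B \<in> carrier_mat ?c ?c" using A B by (auto simp: block_diag_def)
  note Xc = X_carrier[OF uv(1)] X_carrier[OF uv(2)]
  have "kron B (X \<one>) \<in> homog xs xs \<one>" by (rule kron_block_diag_homog[OF B(1) T_one car])
  then have "kron A (X u) * kron B (X \<one>) = kron B (X \<one>) * kron A (X u)"
    using cen A by (simp add: centralizes_def)
  then have "kron (A * B) (X u) = kron (B * A) (X u)"
    unfolding X_one kron_mult[OF c Xc(1) one_carrier_mat] kron_mult[OF c(2,1) one_carrier_mat Xc(1)]
    using Xc(1) by simp
  then have AB: "A * B = B * A"
    by (rule kron_X_cancel[OF uv(1) mult_carrier_mat[OF c] mult_carrier_mat[OF c(2,1)]])
  have "M * N = \<beta> (u, v) \<cdot>\<^sub>m (N * M)"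
    unfolding A B kron_mult[OF c Xc] kron_mult[OF c(2,1) Xc(2,1)] X_comm[OF uv] AB by (simp only: kron_smult)
  then have xe: "x \<cdot>\<^sub>m (N * M) = \<beta> (u, v) \<cdot>\<^sub>m (N * M)" using e by simp
  have NM: "N * M \<in> carrier_mat (?c * d) (?c * d)"
    by (rule mult_carrier_mat[OF homog_carrier[OF N] homog_carrier[OF M]])
  then obtain i j where ij: "i < ?c * d" "j < ?c * d" "(N * M) $$ (i, j) \<noteq> 0"
    using nz by (metis (no_types, lifting) carrier_matD eq_matI index_zero_mat)
  have "x * (N * M) $$ (i, j) = \<beta> (u, v) * (N * M) $$ (i, j)"
    using arg_cong[OF xe, of "\<lambda>Z. Z $$ (i, j)"] ij carrier_matD[OF NM] by (simp del: index_mult_mat)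
  then show ?thesis using ij by simp
qed

text \<open>The projection to a single block row has degree 1. Commuting with it forces a nonzero
  entry of \<open>M\<close> into a diagonal block, where \<open>g x_r x_r^-1\<close> is
  \<open>g\<close>.\<close>

lemma centralizer_degree:
  assumes car: "set xs \<subseteq> carrier G" and g: "g \<in> carrier G" and M: "M \<in> homog xs xs g"
    and cen: "centralizes xs M" and nz: "M \<noteq> 0\<^sub>m (length xs * d) (length xs * d)"
  shows "g \<in> T"
proof -
  let ?n = "length xs * d"
  have Mc: "M \<in> carrier_mat ?n ?n" by (rule homog_carrier[OF M])
  then obtain i j where ij: "i < ?n" "j < ?n" "M $$ (i, j) \<noteq> 0"
    using nz by (metis (no_types, lifting) carrier_matD eq_matI index_zero_mat)
  obtain r p where r: "r < length xs" "p < d" "i = r * d + p" using block_indexE[OF ij(1)] .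
  obtain s q where s: "s < length xs" "q < d" "j = s * d + q" using block_indexE[OF ij(2)] .
  let ?Q = "diag_sel ?n (\<lambda>I. I div d = r) :: 'f mat"
  have xc: "xs ! k \<in> carrier G" if "k < length xs" for k using car that nth_mem by blast
  have "?Q \<in> homog xs xs \<one>"
  proof (rule homogI[where a = "\<lambda>k l. if k = l \<and> k = r then 1 else 0"])
    fix k l assume k: "k < length xs" "l < length xs"
    then show "(if k = l \<and> k = r then 1 else 0 :: 'f) \<noteq> 0 \<Longrightarrow> \<one> \<otimes> xs ! k \<otimes> inv (xs ! l) \<in> T"
      using xc by (auto split: if_splits)
    fix p' q' assume "p' < d" "q' < d"
    moreover have "k * d + p' = l * d + q' \<longleftrightarrow> k = l \<and> p' = q'" using calculation by (metis block_div_mod)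
    ultimately show "?Q $$ (k * d + p', l * d + q') =
       (if k = l \<and> k = r then 1 else 0) * X (\<one> \<otimes> xs ! k \<otimes> inv (xs ! l)) $$ (p', q')"
      using k xc block_index_less[of k "length xs" p' d] block_index_less[of l "length xs" q' d]
      by (auto simp: diag_sel_def block_div_mod)
  qed simp
  then have e: "M * ?Q = ?Q * M" using cen by (simp add: centralizes_def)
  have "(M * ?Q) $$ (i, j) = (if j div d = r then M $$ (i, j) else 0)" by (rule mult_diag_sel[OF Mc ij(1,2)])
  moreover have "(?Q * M) $$ (i, j) = (if i div d = r then M $$ (i, j) else 0)" by (rule diag_sel_mult[OF Mc ij(1,2)])
  ultimately have "s = r" using e ij r s by (auto simp: block_div_mod split: if_splits)
  have "g \<otimes> xs ! r \<otimes> inv (xs ! s) \<in> T"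
    by (rule homog_nonzero_degree[OF M r(1) s(1) r(2) s(2)]) (use ij r s in auto)
  then show ?thesis using \<open>s = r\<close> xc[OF r(1)] g by (simp add: m_assoc)
qed

lemma rinv_nonzero: "rinv n A \<Longrightarrow> 0 < n \<Longrightarrow> A \<noteq> 0\<^sub>m n n"
proof
  assume "rinv n A" and n: "0 < n" and A: "A = 0\<^sub>m n n"
  then obtain B where B: "B \<in> carrier_mat n n" "A * B = 1\<^sub>m n" unfolding rinv_def by blast
  then show False using square_mat_simps(7)[OF B(1)] zero_mat_neq_one[OF n] unfolding A by metis
qed

text \<open>
  An anti-automorphism fixes the degrees but reverses the order of the factors, so the
  commutation factors satisfy \<open>\<beta>(u, v) = \<beta>(v, u) = \<beta>(u, v)\<^sup>-\<^sup>1\<close>.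
\<close>

theorem elementary_if_involution:
  assumes inj: "coset_inj xs" and ne: "xs \<noteq> []" and n: "n = length xs * d"
    and \<phi>: "mat_anti_automorphism n \<phi>" and gr: "\<And>g. g \<in> carrier G \<Longrightarrow> \<phi> ` homog xs xs g = homog xs xs g"
  shows "elementary_2_group G T"
  unfolding elementary_2_group_def
proof
  fix t assume t: "t \<in> T"
  let ?c = "length xs"
  have car: "set xs \<subseteq> carrier G" using inj by (simp add: coset_inj_def)
  have n0: "0 < n" using ne d_pos n by simp
  have anti: "\<phi> (A * B) = \<phi> B * \<phi> A" if "A \<in> carrier_mat n n" "B \<in> carrier_mat n n" for A B
    using \<phi> that by (simp add: mat_anti_automorphism_def)
  have lin: "linear_on_mat n \<phi>" and bij: "bij_betw \<phi> (carrier_mat n n) (carrier_mat n n)"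
    using \<phi> by (auto simp: mat_anti_automorphism_def)
  have z: "\<phi> (0\<^sub>m n n) = 0\<^sub>m n n" by (rule linear_on_mat_zero[OF lin]) (use bij in \<open>simp add: bij_betw_def\<close>)
  let ?E = "\<lambda>u. kron (1\<^sub>m ?c) (X u)"
  have E: "?E u \<in> carrier_mat n n" if "u \<in> T" for u unfolding n using that by simp
  have hE: "\<phi> (?E u) \<in> homog xs xs u" if "u \<in> T" for u
    using gr[of u] one_kron_X_homog[OF that car] that by auto
  have cen: "centralizes xs (\<phi> (?E u))" if u: "u \<in> T" for u
    unfolding centralizes_def
  proof
    fix N assume "N \<in> homog xs xs \<one>"
    then obtain N' where N': "N' \<in> homog xs xs \<one>" "N = \<phi> N'" using gr[of \<one>] by blast
    have c: "N' \<in> carrier_mat n n" using homog_carrier[OF N'(1)] n by simp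
    have "?E u * N' = N' * ?E u" using one_kron_X_centralizes[OF u inj] N' by (simp add: centralizes_def)
    then show "\<phi> (?E u) * N = N * \<phi> (?E u)" unfolding N' anti[OF c E[OF u], symmetric] anti[OF E[OF u] c, symmetric] by simp
  qed
  \<comment> \<open>Symmetry together with \<open>\<beta>_swap\<close> makes the square of
    \<open>\<beta> (w, t)\<close> equal to 1. This square is the value at
    \<open>t \<otimes> t\<close>, which nondegeneracy then identifies as the unit.\<close>
  have "\<beta> (w, t \<otimes> t) = 1" if w: "w \<in> T" for w
  proof -
    have c: "?E t * ?E w \<in> carrier_mat n n" "?E w * ?E t \<in> carrier_mat n n"
      by (rule mult_carrier_mat[OF E[OF t] E[OF w]], rule mult_carrier_mat[OF E[OF w] E[OF t]])
    have "\<phi> (?E w * ?E t) = \<phi> (\<beta> (w, t) \<cdot>\<^sub>m (?E t * ?E w))" by (simp only: one_kron_X_comm[OF w t])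
    also have "\<dots> = \<beta> (w, t) \<cdot>\<^sub>m \<phi> (?E t * ?E w)" by (rule linear_on_matD(2)[OF lin c(1)])
    finally have e: "\<phi> (?E t) * \<phi> (?E w) = \<beta> (w, t) \<cdot>\<^sub>m (\<phi> (?E w) * \<phi> (?E t))"
      using anti E t w by simp
    have "?E t * ?E w \<noteq> 0\<^sub>m n n"
      using rinv_nonzero[OF rinv_mult[OF one_kron_X_rinv[OF t] one_kron_X_rinv[OF w]], of ?c] n0 n by simp
    then have "\<phi> (?E t * ?E w) \<noteq> 0\<^sub>m n n" using bij z c(1) unfolding bij_betw_def
      by (metis inj_onD zero_carrier_mat)
    then have nz: "\<phi> (?E w) * \<phi> (?E t) \<noteq> 0\<^sub>m (?c * d) (?c * d)" using anti E t w n by simp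
    have "\<beta> (w, t) = \<beta> (t, w)"
      by (rule centralizer_commutation[OF inj t w hE[OF t] hE[OF w] cen[OF t] e nz])
    then show ?thesis using \<beta>_swap[OF w t] w t by (simp add: \<beta>_mult_right)
  qed
  moreover have "t \<otimes> t \<in> T" using t by simp
  ultimately show "t \<otimes> t = \<one>" using T_nondeg unfolding nondegenerate_on_def by metis
qed

end

text \<open>The test elements \<open>1 \<otimes> X u\<close> have degree \<open>u\<close>, are
  invertible and centralize the component of degree 1, and an isomorphism preserves all this. So
  their images have degree in \<open>T2\<close> and commutation factors given by
  \<open>\<beta>2\<close>. Only one inclusion is stated; the other comes from the inverse
  isomorphism.\<close>

theorem same_bicharacter_if_graded_iso:
  assumes R1: "std_realization G T1 \<beta>1 ab1" and R2: "std_realization G T2 \<beta>2 ab2"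
    and inj1: "std_realization.coset_inj G T1 xs1" and inj2: "std_realization.coset_inj G T2 xs2"
    and ne: "xs1 \<noteq> []" "xs2 \<noteq> []"
    and n: "n1 = length xs1 * D_size G ab1" "n2 = length xs2 * D_size G ab2"
    and f: "alg_iso n1 n2 f"
    and gr: "\<And>g. g \<in> carrier G \<Longrightarrow> f ` std_realization.homog G T1 \<beta>1 ab1 xs1 xs1 g = std_realization.homog G T2 \<beta>2 ab2 xs2 xs2 g"
  shows "T1 \<subseteq> T2" "\<And>u v. u \<in> T1 \<Longrightarrow> v \<in> T1 \<Longrightarrow> \<beta>1 (u, v) = \<beta>2 (u, v)"
proof -
  interpret R1: std_realization G T1 \<beta>1 ab1 by (rule R1)
  interpret R2: std_realization G T2 \<beta>2 ab2 by (rule R2)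
  have car: "set xs1 \<subseteq> carrier G" "set xs2 \<subseteq> carrier G"
    using inj1 inj2 by (auto simp: R1.coset_inj_def R2.coset_inj_def)
  have n0: "0 < n1" using ne R1.d_pos n by simp
  let ?c = "length xs1"
  let ?E = "\<lambda>u. kron (1\<^sub>m ?c) (R1.X u)"
  have E: "?E u \<in> carrier_mat n1 n1" if "u \<in> T1" for u unfolding n using that by simp
  have hE: "f (?E u) \<in> R2.homog xs2 xs2 u" if "u \<in> T1" for u
    using gr[of u] R1.one_kron_X_homog[OF that car(1)] that by auto
  have cen: "R2.centralizes xs2 (f (?E u))" if u: "u \<in> T1" for u
    unfolding R2.centralizes_def
  proof
    fix N assume "N \<in> R2.homog xs2 xs2 \<one>\<^bsub>G\<^esub>"
    then obtain N' where N': "N' \<in> R1.homog xs1 xs1 \<one>\<^bsub>G\<^esub>" "N = f N'" using gr[of "\<one>\<^bsub>G\<^esub>"] by blast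
    have c: "N' \<in> carrier_mat n1 n1" using R1.homog_carrier[OF N'(1)] n by simp
    have "?E u * N' = N' * ?E u" using R1.one_kron_X_centralizes[OF u inj1] N' by (simp add: R1.centralizes_def)
    then show "f (?E u) * N = N * f (?E u)"
      unfolding N' alg_isoD(4)[OF f c E[OF u], symmetric] alg_isoD(4)[OF f E[OF u] c, symmetric] by simp
  qed
  have nz: "f Z \<noteq> 0\<^sub>m n2 n2" if "rinv n1 Z" for Z
  proof -
    have "Z \<noteq> 0\<^sub>m n1 n1" by (rule R1.rinv_nonzero[OF that n0])
    then show ?thesis using alg_isoD(2,5)[OF f] rinv_carrier[OF that] unfolding bij_betw_def
      by (metis inj_onD zero_carrier_mat)
  qed
  have rE: "rinv n1 (?E u)" if "u \<in> T1" for u unfolding n by (rule R1.one_kron_X_rinv[OF that])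
  show sub: "T1 \<subseteq> T2"
  proof
    fix u assume u: "u \<in> T1"
    show "u \<in> T2"
      by (rule R2.centralizer_degree[OF car(2) _ hE[OF u] cen[OF u]]) (use u nz[OF rE[OF u]] n in auto)
  qed
  fix u v assume uv: "u \<in> T1" "v \<in> T1"
  have c: "?E v * ?E u \<in> carrier_mat n1 n1" by (rule mult_carrier_mat[OF E[OF uv(2)] E[OF uv(1)]])
  have "f (?E u * ?E v) = f (\<beta>1 (u, v) \<cdot>\<^sub>m (?E v * ?E u))" by (simp only: R1.one_kron_X_comm[OF uv])
  also have "\<dots> = \<beta>1 (u, v) \<cdot>\<^sub>m f (?E v * ?E u)" by (rule linear_on_matD(2)[OF alg_isoD(1)[OF f] c])
  finally have e: "f (?E u) * f (?E v) = \<beta>1 (u, v) \<cdot>\<^sub>m (f (?E v) * f (?E u))"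
    using alg_isoD(4)[OF f] E uv by simp
  have "f (?E v) * f (?E u) \<noteq> 0\<^sub>m (length xs2 * R2.d) (length xs2 * R2.d)"
    using nz[OF rinv_mult[OF rE[OF uv(2)] rE[OF uv(1)]]] alg_isoD(4)[OF f E[OF uv(2)] E[OF uv(1)]] n by simp
  then show "\<beta>1 (u, v) = \<beta>2 (u, v)"
    by (intro R2.centralizer_commutation[OF inj2 _ _ hE[OF uv(1)] hE[OF uv(2)] cen[OF uv(1)] e]) (use sub uv in auto)
qed

section \<open>Involutions and bilinear forms\<close>

context
  fixes n :: nat and \<Phi> :: "'f::field mat"
  assumes \<Phi>: "\<Phi> \<in> carrier_mat n n" "det \<Phi> \<noteq> 0"
begin

lemma adjoint_map_carrier: "W \<in> carrier_mat n n \<Longrightarrow> adjoint_map \<Phi> W \<in> carrier_mat n n"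
  unfolding adjoint_map_def
  by (intro mult_carrier_mat[of _ n n] minv(1)[OF \<Phi>] \<Phi>) simp

lemma adjoint_map_eq: "W \<in> carrier_mat n n \<Longrightarrow> \<Phi> * adjoint_map \<Phi> W = transpose_mat W * \<Phi>"
proof -
  assume W: "W \<in> carrier_mat n n"
  then have WT: "transpose_mat W \<in> carrier_mat n n" by simp
  note i = minv[OF \<Phi>]
  have "\<Phi> * adjoint_map \<Phi> W = \<Phi> * (minv \<Phi> * (transpose_mat W * \<Phi>))"
    unfolding adjoint_map_def square_mat_simps(4)[OF i(1) WT \<Phi>(1)] ..
  also have "\<dots> = (\<Phi> * minv \<Phi>) * (transpose_mat W * \<Phi>)"
    by (rule square_mat_simps(4)[symmetric, OF \<Phi>(1) i(1) mult_carrier_mat[OF WT \<Phi>(1)]])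
  finally show ?thesis using i(2) square_mat_simps(10)[OF mult_carrier_mat[OF WT \<Phi>(1)]] by simp
qed

lemma left_cancel:
  assumes "A \<in> carrier_mat n n" "B \<in> carrier_mat n n" "\<Phi> * A = \<Phi> * B"
  shows "A = B"
proof -
  note i = minv[OF \<Phi>]
  have "minv \<Phi> * (\<Phi> * A) = minv \<Phi> * (\<Phi> * B)" using assms by simp
  then show ?thesis
    using square_mat_simps(4)[OF i(1) \<Phi>(1) assms(1)] square_mat_simps(4)[OF i(1) \<Phi>(1) assms(2)]
      i(3) square_mat_simps(10)[OF assms(1)] square_mat_simps(10)[OF assms(2)] by simp
qed

lemma right_cancel:
  assumes "A \<in> carrier_mat n n" "B \<in> carrier_mat n n" "A * \<Phi> = B * \<Phi>"
  shows "A = B"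
proof -
  note i = minv[OF \<Phi>]
  have "(A * \<Phi>) * minv \<Phi> = (B * \<Phi>) * minv \<Phi>" using assms by simp
  then show ?thesis
    using square_mat_simps(4)[OF assms(1) \<Phi>(1) i(1)] square_mat_simps(4)[OF assms(2) \<Phi>(1) i(1)]
      i(2) square_mat_simps(11)[OF assms(1)] square_mat_simps(11)[OF assms(2)] by simp
qed

text \<open>The equation \<open>\<Phi> * Z = transpose_mat W * \<Phi>\<close> pins down the adjoint,
  so later identities are checked without handling the inverse of \<Phi>.\<close>

lemma adjoint_map_unique:
  assumes "W \<in> carrier_mat n n" "Z \<in> carrier_mat n n" "\<Phi> * Z = transpose_mat W * \<Phi>"
  shows "Z = adjoint_map \<Phi> W"
  by (rule left_cancel[OF assms(2) adjoint_map_carrier[OF assms(1)]]) (simp add: adjoint_map_eq assms)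

lemma det_nonzero_smult: "\<Phi> = c \<cdot>\<^sub>m A \<Longrightarrow> A \<in> carrier_mat n n \<Longrightarrow> 0 < n \<Longrightarrow> c \<noteq> 0"
proof
  assume c: "\<Phi> = c \<cdot>\<^sub>m A" "A \<in> carrier_mat n n" "0 < n" "c = 0"
  then have "\<Phi> = 0\<^sub>m n n" by (simp add: square_mat_simps(9)[where n = n])
  then have "\<Phi> * minv \<Phi> = 0\<^sub>m n n" using square_mat_simps(7)[OF minv(1)[OF \<Phi>]] by simp
  then show False using minv(2)[OF \<Phi>] zero_mat_neq_one[OF c(3)] by metis
qed

text \<open>If \<open>\<Phi>\<close> and \<open>\<Phi>'\<close> have the same adjoint, then \<open>\<Phi>' \<Phi>\<^sup>-\<^sup>1\<close> is central.\<close>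

lemma adjoint_map_scalar:
  assumes \<Phi>': "\<Phi>' \<in> carrier_mat n n"
    and eq: "\<And>W. W \<in> carrier_mat n n \<Longrightarrow> \<Phi>' * adjoint_map \<Phi> W = transpose_mat W * \<Phi>'"
  obtains c where "\<Phi>' = c \<cdot>\<^sub>m \<Phi>"
proof -
  note i = minv[OF \<Phi>]
  let ?M = "\<Phi>' * minv \<Phi>"
  have M: "?M \<in> carrier_mat n n" by (rule mult_carrier_mat[OF \<Phi>' i(1)])
  have M\<Phi>: "?M * \<Phi> = \<Phi>'" using square_mat_simps(4)[OF \<Phi>' i(1) \<Phi>(1)] i(3) square_mat_simps(11)[OF \<Phi>'] by simp
  have "?M * W = W * ?M" if W: "W \<in> carrier_mat n n" for W
  proof (rule right_cancel[OF mult_carrier_mat[OF M W] mult_carrier_mat[OF W M]])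
    have WT: "transpose_mat W \<in> carrier_mat n n" using W by simp
    have "W * \<Phi> = \<Phi> * adjoint_map \<Phi> (transpose_mat W)" using adjoint_map_eq[OF WT] by simp
    then have "?M * W * \<Phi> = ?M * \<Phi> * adjoint_map \<Phi> (transpose_mat W)"
      using square_mat_simps(4)[OF M W \<Phi>(1)] square_mat_simps(4)[OF M \<Phi>(1) adjoint_map_carrier[OF WT]] by simp
    also have "\<dots> = W * \<Phi>'" unfolding M\<Phi> using eq[OF WT] by simp
    also have "\<dots> = W * ?M * \<Phi>" using square_mat_simps(4)[OF W M \<Phi>(1)] M\<Phi> by simp
    finally show "?M * W * \<Phi> = W * ?M * \<Phi>" .
  qed
  then obtain c where c: "?M = c \<cdot>\<^sub>m 1\<^sub>m n" by (rule commuting_mat_scalar[OF M])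
  have "\<Phi>' = c \<cdot>\<^sub>m \<Phi>" using M\<Phi> unfolding c
    using square_mat_simps(5)[OF one_carrier_mat \<Phi>(1)] square_mat_simps(10)[OF \<Phi>(1)] by simp
  then show thesis by (rule that)
qed

text \<open>Transposing the equation that defines the adjoint of the adjoint of \<open>W\<close>,
  which is \<open>W\<close> again, shows that the transpose of \<Phi> has the same adjoint map as
  \<Phi>. It is therefore a multiple \<open>\<delta>\<close> of \<Phi>, and transposing twice gives
  \<open>\<delta> * \<delta> = 1\<close>.\<close>

lemma involution_symmetry:
  assumes inv: "\<And>W. W \<in> carrier_mat n n \<Longrightarrow> adjoint_map \<Phi> (adjoint_map \<Phi> W) = W" and "0 < n"
  obtains \<delta> where "\<delta> \<in> {1, - 1}" "transpose_mat \<Phi> = \<delta> \<cdot>\<^sub>m \<Phi>"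
proof -
  have \<Phi>T: "transpose_mat \<Phi> \<in> carrier_mat n n" using \<Phi> by simp
  have "transpose_mat \<Phi> * adjoint_map \<Phi> W = transpose_mat W * transpose_mat \<Phi>" if W: "W \<in> carrier_mat n n" for W
  proof -
    let ?Z = "adjoint_map \<Phi> W"
    have Z: "?Z \<in> carrier_mat n n" by (rule adjoint_map_carrier[OF W])
    have "\<Phi> * W = transpose_mat ?Z * \<Phi>" using adjoint_map_eq[OF Z] inv[OF W] by simp
    then have "transpose_mat (\<Phi> * W) = transpose_mat (transpose_mat ?Z * \<Phi>)" by (rule arg_cong)
    moreover have "transpose_mat (\<Phi> * W) = transpose_mat W * transpose_mat \<Phi>" by (rule transpose_mult[OF \<Phi>(1) W])
    moreover have "transpose_mat (transpose_mat ?Z * \<Phi>) = transpose_mat \<Phi> * ?Z"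
      using transpose_mult[of "transpose_mat ?Z" n n \<Phi> n] Z \<Phi> by simp
    ultimately show ?thesis by simp
  qed
  then obtain \<delta> where \<delta>: "transpose_mat \<Phi> = \<delta> \<cdot>\<^sub>m \<Phi>" by (rule adjoint_map_scalar[OF \<Phi>T])
  have "\<Phi> = transpose_mat (transpose_mat \<Phi>)" by simp
  also have "\<dots> = (\<delta> * \<delta>) \<cdot>\<^sub>m \<Phi>" unfolding \<delta> by (simp add: transpose_smult \<delta> smult_smult_mat)
  finally have e: "\<Phi> = (\<delta> * \<delta>) \<cdot>\<^sub>m \<Phi>" .
  have "\<exists>i<n. \<exists>j<n. \<Phi> $$ (i, j) \<noteq> 0"
  proof (rule ccontr)
    assume "\<not> ?thesis"
    then have "\<Phi> = 0 \<cdot>\<^sub>m 1\<^sub>m n" using \<Phi> by (intro eq_matI) auto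
    then show False using det_nonzero_smult[of 0 "1\<^sub>m n"] \<open>0 < n\<close> by simp
  qed
  then obtain i j where ij: "i < n" "j < n" "\<Phi> $$ (i, j) \<noteq> 0" by blast
  have "1 * \<Phi> $$ (i, j) = ((\<delta> * \<delta>) \<cdot>\<^sub>m \<Phi>) $$ (i, j)"
    unfolding mult_1_left by (rule arg_cong[OF e])
  also have "\<dots> = (\<delta> * \<delta>) * \<Phi> $$ (i, j)" using ij \<Phi> by simp
  finally have "\<delta> * \<delta> = 1" using mult_right_cancel[OF ij(3)] by metis
  then have "\<delta> \<in> {1, - 1}" by (simp add: square_eq_1_iff)
  then show thesis using \<delta> by (rule that)
qed

lemma adjoint_map_involution:
  assumes sym: "transpose_mat \<Phi> = \<delta> \<cdot>\<^sub>m \<Phi>" and \<delta>: "\<delta> * \<delta> = 1"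
  shows "mat_involution n (adjoint_map \<Phi>)"
proof -
  let ?\<phi> = "adjoint_map \<Phi>"
  have invol: "?\<phi> (?\<phi> W) = W" if W: "W \<in> carrier_mat n n" for W
  proof (rule adjoint_map_unique[symmetric, OF adjoint_map_carrier[OF W] W])
    let ?Z = "?\<phi> W"
    have Z: "?Z \<in> carrier_mat n n" by (rule adjoint_map_carrier[OF W])
    then have ZT: "transpose_mat ?Z \<in> carrier_mat n n" by simp
    have "transpose_mat (\<Phi> * ?Z) = transpose_mat (transpose_mat W * \<Phi>)" unfolding adjoint_map_eq[OF W] ..
    then have "transpose_mat ?Z * transpose_mat \<Phi> = transpose_mat \<Phi> * W"
      using transpose_mult[OF \<Phi>(1) Z] transpose_mult[of "transpose_mat W" n n \<Phi> n] \<Phi> W by simp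
    then have "\<delta> \<cdot>\<^sub>m (transpose_mat ?Z * \<Phi>) = \<delta> \<cdot>\<^sub>m (\<Phi> * W)"
      unfolding sym square_mat_simps(6)[OF ZT \<Phi>(1)] square_mat_simps(5)[OF \<Phi>(1) W] .
    then have "\<delta> \<cdot>\<^sub>m (\<delta> \<cdot>\<^sub>m (transpose_mat ?Z * \<Phi>)) = \<delta> \<cdot>\<^sub>m (\<delta> \<cdot>\<^sub>m (\<Phi> * W))" by simp
    then show "\<Phi> * W = transpose_mat ?Z * \<Phi>" unfolding smult_smult_mat \<delta> by simp
  qed
  have anti: "?\<phi> (A * B) = ?\<phi> B * ?\<phi> A" if A: "A \<in> carrier_mat n n" and B: "B \<in> carrier_mat n n" for A B
  proof (rule adjoint_map_unique[symmetric, OF mult_carrier_mat[OF A B] mult_carrier_mat[OF adjoint_map_carrier[OF B] adjoint_map_carrier[OF A]]])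
    have t: "transpose_mat A \<in> carrier_mat n n" "transpose_mat B \<in> carrier_mat n n" using A B by auto
    have "\<Phi> * (?\<phi> B * ?\<phi> A) = \<Phi> * ?\<phi> B * ?\<phi> A"
      by (rule square_mat_simps(4)[symmetric, OF \<Phi>(1) adjoint_map_carrier[OF B] adjoint_map_carrier[OF A]])
    also have "\<dots> = transpose_mat B * (\<Phi> * ?\<phi> A)"
      unfolding adjoint_map_eq[OF B] by (rule square_mat_simps(4)[OF t(2) \<Phi>(1) adjoint_map_carrier[OF A]])
    also have "\<dots> = transpose_mat B * transpose_mat A * \<Phi>"
      unfolding adjoint_map_eq[OF A] by (rule square_mat_simps(4)[symmetric, OF t(2,1) \<Phi>(1)])
    also have "\<dots> = transpose_mat (A * B) * \<Phi>" unfolding transpose_mult[OF A B] ..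
    finally show "\<Phi> * (?\<phi> B * ?\<phi> A) = transpose_mat (A * B) * \<Phi>" .
  qed
  have lin: "linear_on_mat n ?\<phi>"
    unfolding linear_on_mat_def
  proof (intro conjI ballI allI)
    fix A B :: "'f mat" assume A: "A \<in> carrier_mat n n" and B: "B \<in> carrier_mat n n"
    show "?\<phi> (A + B) = ?\<phi> A + ?\<phi> B"
    proof (rule adjoint_map_unique[symmetric])
      show "\<Phi> * (?\<phi> A + ?\<phi> B) = transpose_mat (A + B) * \<Phi>"
        using square_mat_simps(3)[OF \<Phi>(1) adjoint_map_carrier[OF A] adjoint_map_carrier[OF B]]
          square_mat_simps(2)[of "transpose_mat A" n "transpose_mat B" \<Phi>] A B \<Phi>
        by (simp add: adjoint_map_eq transpose_add[of _ n n])
    qed (use A B adjoint_map_carrier in auto)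
  next
    fix c and A :: "'f mat" assume A: "A \<in> carrier_mat n n"
    show "?\<phi> (c \<cdot>\<^sub>m A) = c \<cdot>\<^sub>m ?\<phi> A"
    proof (rule adjoint_map_unique[symmetric])
      show "\<Phi> * (c \<cdot>\<^sub>m ?\<phi> A) = transpose_mat (c \<cdot>\<^sub>m A) * \<Phi>"
        using square_mat_simps(6)[OF \<Phi>(1) adjoint_map_carrier[OF A]]
          square_mat_simps(5)[of "transpose_mat A" n \<Phi>] A \<Phi>
        by (simp add: adjoint_map_eq transpose_smult)
    qed (use A adjoint_map_carrier in auto)
  qed
  have "bij_betw ?\<phi> (carrier_mat n n) (carrier_mat n n)"
    by (rule bij_betw_byWitness[where f' = ?\<phi>]) (use invol adjoint_map_carrier in auto)
  then show ?thesis unfolding mat_involution_def mat_anti_automorphism_def using lin anti invol by blast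
qed

text \<open>A matrix with the same adjoint map is a multiple of \<Phi> and shares its symmetry. As
  \<open>inv_sgn\<close> asks for an orthogonal form first, the skew case has to exclude one: a
  matrix that is symmetric and skew vanishes because 2 is nonzero.\<close>

lemma inv_sgn_adjoint:
  assumes sym: "transpose_mat \<Phi> = \<delta> \<cdot>\<^sub>m \<Phi>" and \<delta>: "\<delta> \<in> {1, - 1}" and two: "(2::'f) \<noteq> 0" and "0 < n"
    and \<phi>: "\<And>W. W \<in> carrier_mat n n \<Longrightarrow> \<phi> W = adjoint_map \<Phi> W"
  shows "inv_sgn n \<phi> = \<delta>"
proof (cases "\<delta> = 1")
  case True
  then have "orthogonal_involution n \<phi>"
    unfolding orthogonal_involution_def using \<Phi> sym \<phi> by (intro bexI[of _ \<Phi>]) (auto simp: invertible_mat_iff_det)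
  then show ?thesis using True by (simp add: inv_sgn_def)
next
  case False
  then have \<delta>: "\<delta> = - 1" using \<delta> by auto
  have "\<not> orthogonal_involution n \<phi>"
  proof
    assume "orthogonal_involution n \<phi>"
    then obtain \<Phi>' where \<Phi>': "\<Phi>' \<in> carrier_mat n n" "invertible_mat \<Phi>'" "transpose_mat \<Phi>' = \<Phi>'"
      "\<And>W. W \<in> carrier_mat n n \<Longrightarrow> \<phi> W = adjoint_map \<Phi>' W" unfolding orthogonal_involution_def by blast
    have d': "det \<Phi>' \<noteq> 0" using \<Phi>' by (simp add: invertible_mat_iff_det)
    have "\<Phi>' * adjoint_map \<Phi> W = transpose_mat W * \<Phi>'" if "W \<in> carrier_mat n n" for W
      using Submission.adjoint_map_eq[OF \<Phi>'(1) d' that] \<Phi>'(4)[OF that] \<phi>[OF that] by simp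
    then obtain c where c: "\<Phi>' = c \<cdot>\<^sub>m \<Phi>" by (rule adjoint_map_scalar[OF \<Phi>'(1)])
    then have "transpose_mat \<Phi>' = (- 1) \<cdot>\<^sub>m \<Phi>'" by (simp add: transpose_smult sym \<delta> smult_smult_mat)
    then have e: "\<Phi>' = (- 1) \<cdot>\<^sub>m \<Phi>'" unfolding \<Phi>'(3) .
    have "\<Phi>' = 0 \<cdot>\<^sub>m 1\<^sub>m n"
    proof (rule eq_matI)
      fix i j assume "i < dim_row (0 \<cdot>\<^sub>m 1\<^sub>m n :: 'f mat)" "j < dim_col (0 \<cdot>\<^sub>m 1\<^sub>m n :: 'f mat)"
      then have ij: "i < n" "j < n" by auto
      have "\<Phi>' $$ (i, j) = ((- 1) \<cdot>\<^sub>m \<Phi>') $$ (i, j)" by (rule arg_cong[OF e])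
      also have "\<dots> = - (\<Phi>' $$ (i, j))" using ij \<Phi>'(1) by simp
      finally have "\<Phi>' $$ (i, j) + \<Phi>' $$ (i, j) = 0" by (rule eq_neg_iff_add_eq_0[THEN iffD1])
      then have "2 * \<Phi>' $$ (i, j) = 0" by (simp only: mult_2)
      then show "\<Phi>' $$ (i, j) = (0 \<cdot>\<^sub>m 1\<^sub>m n) $$ (i, j)" using two ij by simp
    qed (use \<Phi>' in auto)
    then show False using Submission.det_nonzero_smult[OF \<Phi>'(1) d', of 0 "1\<^sub>m n"] \<open>0 < n\<close> by simp
  qed
  moreover have "transpose_mat \<Phi> = - \<Phi>" unfolding sym \<delta> by (rule eq_matI) auto
  then have "symplectic_involution n \<phi>"
    unfolding symplectic_involution_def using \<Phi> \<phi> invertible_mat_iff_det[OF \<Phi>(1)] by blast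
  ultimately show ?thesis using \<delta> by (simp add: inv_sgn_def)
qed

end

section \<open>Graded involutions as adjoint maps of homogeneous matrices\<close>

context elementary_realization
begin

lemma map_inv_inv: "set xs \<subseteq> carrier G \<Longrightarrow> map (m_inv G) (map (m_inv G) xs) = xs"
  by (simp add: map_idI subset_iff)

lemma map_inv_carrier: "set xs \<subseteq> carrier G \<Longrightarrow> set (map (m_inv G) xs) \<subseteq> carrier G"
  by auto

text \<open>Following \<phi> by transposition gives an automorphism that takes a degree for
  \<open>xs\<close> to the same degree for the inverted list. Its Skolem--Noether matrix \<Psi> is
  thus a homogeneous intertwiner between the two lists, and \<Phi> is the transpose of
  \<Psi>.\<close>

theorem involution_form:
  assumes car: "set xs \<subseteq> carrier G" and n: "n = length xs * d" "0 < n"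
    and \<phi>: "mat_involution n \<phi>" and gr: "\<And>g. g \<in> carrier G \<Longrightarrow> \<phi> ` homog xs xs g = homog xs xs g"
  obtains \<Phi> h \<delta> where "h \<in> carrier G" "\<Phi> \<in> homog (map (m_inv G) xs) xs h" "det \<Phi> \<noteq> 0"
    "transpose_mat \<Phi> = \<delta> \<cdot>\<^sub>m \<Phi>" "\<delta> \<in> {1, - 1}" "\<And>W. W \<in> carrier_mat n n \<Longrightarrow> \<phi> W = adjoint_map \<Phi> W"
    "inv_sgn n \<phi> = \<delta>"
proof -
  have anti: "\<phi> (A * B) = \<phi> B * \<phi> A" if "A \<in> carrier_mat n n" "B \<in> carrier_mat n n" for A B
    using \<phi> that by (simp add: mat_involution_def mat_anti_automorphism_def)
  have lin: "linear_on_mat n \<phi>" and bij: "bij_betw \<phi> (carrier_mat n n) (carrier_mat n n)"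
    using \<phi> by (auto simp: mat_involution_def mat_anti_automorphism_def)
  have \<phi>c: "\<phi> A \<in> carrier_mat n n" if "A \<in> carrier_mat n n" for A using bij that by (auto simp: bij_betw_def)
  let ?f = "\<lambda>A. transpose_mat (\<phi> A)" and ?ys = "map (m_inv G) xs"
  have tbij: "bij_betw transpose_mat (carrier_mat n n) (carrier_mat n n :: 'f mat set)"
    by (rule bij_betw_byWitness[where f' = transpose_mat]) auto
  have f: "alg_iso n n ?f"
    unfolding alg_iso_def linear_on_mat_def
  proof (intro conjI ballI allI)
    show "bij_betw ?f (carrier_mat n n) (carrier_mat n n)"
      using bij_betw_trans[OF bij tbij] by (simp add: comp_def)
  next
    fix A B :: "'f mat" assume AB: "A \<in> carrier_mat n n" "B \<in> carrier_mat n n"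
    show "?f (A + B) = ?f A + ?f B"
      using linear_on_matD(1)[OF lin AB] transpose_add[OF \<phi>c[OF AB(1)] \<phi>c[OF AB(2)]] by simp
    show "?f (A * B) = ?f A * ?f B"
      using anti[OF AB] transpose_mult[OF \<phi>c[OF AB(2)] \<phi>c[OF AB(1)]] by simp
  next
    fix c and A :: "'f mat" assume "A \<in> carrier_mat n n"
    then show "?f (c \<cdot>\<^sub>m A) = c \<cdot>\<^sub>m ?f A" using linear_on_matD(2)[OF lin] by (simp add: transpose_smult)
  qed
  obtain \<Psi> where \<Psi>: "\<Psi> \<in> carrier_mat n n" "det \<Psi> \<noteq> 0" "\<And>W. W \<in> carrier_mat n n \<Longrightarrow> ?f W * \<Psi> = \<Psi> * W"
    using skolem_noether[OF f n(2)] by blast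
  have graded: "?f W \<in> homog ?ys ?ys g" if g: "g \<in> carrier G" and W: "W \<in> homog xs xs g" for g W
    by (rule homog_transpose[OF _ car car g]) (use gr[OF g] W in blast)
  obtain h where h: "h \<in> carrier G" "\<Psi> \<in> homog ?ys xs h"
    using homog_intertwiner[OF _ n(1) f \<Psi>(1,2,3) graded car map_inv_carrier[OF car]] by auto
  let ?\<Phi> = "transpose_mat \<Psi>"
  have \<Phi>: "?\<Phi> \<in> carrier_mat n n" "det ?\<Phi> \<noteq> 0" using \<Psi> by (auto simp: det_transpose)
  have hom: "?\<Phi> \<in> homog ?ys xs h"
    using homog_transpose[OF h(2) map_inv_carrier[OF car] car h(1)] map_inv_inv[OF car] by simp
  have adj: "\<phi> W = adjoint_map ?\<Phi> W" if W: "W \<in> carrier_mat n n" for W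
  proof (rule adjoint_map_unique[OF \<Phi> W \<phi>c[OF W]])
    have "transpose_mat (?f W * \<Psi>) = transpose_mat (\<Psi> * W)" using \<Psi>(3)[OF W] by simp
    then show "?\<Phi> * \<phi> W = transpose_mat W * ?\<Phi>"
      using transpose_mult[OF \<Psi>(1) W] transpose_mult[of "?f W" n n \<Psi> n] \<Psi>(1) \<phi>c[OF W] by simp
  qed
  have "adjoint_map ?\<Phi> (adjoint_map ?\<Phi> W) = W" if W: "W \<in> carrier_mat n n" for W
  proof -
    have "\<phi> (\<phi> W) = W" using \<phi> W by (simp add: mat_involution_def)
    then show ?thesis using adj[OF \<phi>c[OF W]] unfolding adj[OF W] by simp
  qed
  then obtain \<delta> where \<delta>: "\<delta> \<in> {1, - 1}" "transpose_mat ?\<Phi> = \<delta> \<cdot>\<^sub>m ?\<Phi>"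
    by (rule involution_symmetry[OF \<Phi> _ n(2)])
  show thesis
    by (rule that[OF h(1) hom \<Phi>(2) \<delta>(2,1) adj]) (use inv_sgn_adjoint[OF \<Phi> \<delta>(2,1) two n(2) adj] in auto)
qed

lemma adjoint_map_homog:
  assumes car: "set xs \<subseteq> carrier G" and \<Phi>: "\<Phi> \<in> homog (map (m_inv G) xs) xs h" "det \<Phi> \<noteq> 0"
    and h: "h \<in> carrier G" and g: "g \<in> carrier G" and W: "W \<in> homog xs xs g"
  shows "adjoint_map \<Phi> W \<in> homog xs xs g"
proof -
  note car' = map_inv_carrier[OF car]
  have "minv \<Phi> \<in> homog xs (map (m_inv G) xs) (inv h)"
    by (rule homog_inverse[OF \<Phi>(1) _ \<Phi>(2) car' car h]) simp
  moreover have "transpose_mat W \<in> homog (map (m_inv G) xs) (map (m_inv G) xs) g"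
    by (rule homog_transpose[OF W car car g])
  ultimately have "minv \<Phi> * transpose_mat W \<in> homog xs (map (m_inv G) xs) (inv h \<otimes> g)"
    by (rule homog_mult[OF _ _ car car' car']) (use h g in auto)
  then have "minv \<Phi> * transpose_mat W * \<Phi> \<in> homog xs xs (inv h \<otimes> g \<otimes> h)"
    by (rule homog_mult[OF _ \<Phi>(1) car car' car]) (use h g in auto)
  moreover have "inv h \<otimes> g \<otimes> h = g"
    using h g by (simp add: m_comm[of "inv h" g] m_assoc)
  ultimately show ?thesis by (simp add: adjoint_map_def)
qed

theorem adjoint_graded_involution:
  assumes car: "set xs \<subseteq> carrier G" and \<Phi>: "\<Phi> \<in> homog (map (m_inv G) xs) xs h" "det \<Phi> \<noteq> 0"
    "transpose_mat \<Phi> = \<delta> \<cdot>\<^sub>m \<Phi>" "\<delta> \<in> {1, - 1}" and h: "h \<in> carrier G"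
  shows "mat_involution (length xs * d) (adjoint_map \<Phi>)"
    "g \<in> carrier G \<Longrightarrow> adjoint_map \<Phi> ` homog xs xs g = homog xs xs g"
proof -
  have \<Phi>c: "\<Phi> \<in> carrier_mat (length xs * d) (length xs * d)" using homog_carrier[OF \<Phi>(1)] by simp
  show inv: "mat_involution (length xs * d) (adjoint_map \<Phi>)"
    by (rule adjoint_map_involution[OF \<Phi>c \<Phi>(2,3)]) (use \<Phi>(4) in auto)
  assume g: "g \<in> carrier G"
  show "adjoint_map \<Phi> ` homog xs xs g = homog xs xs g"
  proof
    show "adjoint_map \<Phi> ` homog xs xs g \<subseteq> homog xs xs g"
      using adjoint_map_homog[OF car \<Phi>(1,2) h g] by blast
    show "homog xs xs g \<subseteq> adjoint_map \<Phi> ` homog xs xs g"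
    proof
      fix W assume W: "W \<in> homog xs xs g"
      have "adjoint_map \<Phi> (adjoint_map \<Phi> W) = W"
        using inv homog_carrier[OF W] by (simp add: mat_involution_def)
      then show "W \<in> adjoint_map \<Phi> ` homog xs xs g"
        using adjoint_map_homog[OF car \<Phi>(1,2) h g W] by (metis imageI)
    qed
  qed
qed

end

section \<open>Graded congruence and isomorphism\<close>

lemma mult_eq_lift:
  fixes A B C D U :: "'f::field mat"
  assumes "A \<in> carrier_mat n n" "B \<in> carrier_mat n n" "C \<in> carrier_mat n n" "D \<in> carrier_mat n n" "U \<in> carrier_mat n n"
    and "A * B = C * D"
  shows "A * (B * U) = C * (D * U)"
  using square_mat_simps(4)[OF assms(1,2,5)] square_mat_simps(4)[OF assms(3,4,5)] assms(6) by simp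

lemma nonzero_if_det_nonzero:
  fixes A :: "'f::field mat"
  assumes "A \<in> carrier_mat n n" "det A \<noteq> 0" "0 < n"
  shows "A \<noteq> 0\<^sub>m n n"
proof
  assume "A = 0\<^sub>m n n"
  then have "A = 0 \<cdot>\<^sub>m 1\<^sub>m n" by (simp add: square_mat_simps(9)[OF one_carrier_mat])
  then show False using det_nonzero_smult[OF assms(1,2) _ one_carrier_mat assms(3)] by blast
qed

lemma congruence_transpose:
  fixes \<Phi> \<Psi> :: "'f::field mat"
  assumes c: "\<Psi> \<in> carrier_mat n n" "\<Phi> \<in> carrier_mat n n" and sym: "transpose_mat \<Phi> = \<delta> \<cdot>\<^sub>m \<Phi>"
  shows "transpose_mat (transpose_mat \<Psi> * \<Phi> * \<Psi>) = \<delta> \<cdot>\<^sub>m (transpose_mat \<Psi> * \<Phi> * \<Psi>)"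
proof -
  have T: "transpose_mat \<Psi> \<in> carrier_mat n n" using c by simp
  note T\<Phi> = mult_carrier_mat[OF T c(2)]
  have "transpose_mat (transpose_mat \<Psi> * \<Phi> * \<Psi>) = transpose_mat \<Psi> * (transpose_mat \<Phi> * \<Psi>)"
    using transpose_mult[OF T\<Phi> c(1)] transpose_mult[OF T c(2)] by simp
  also have "\<dots> = \<delta> \<cdot>\<^sub>m (transpose_mat \<Psi> * (\<Phi> * \<Psi>))"
    unfolding sym square_mat_simps(5)[OF c(2,1)] square_mat_simps(6)[OF T mult_carrier_mat[OF c(2,1)]] ..
  also have "transpose_mat \<Psi> * (\<Phi> * \<Psi>) = transpose_mat \<Psi> * \<Phi> * \<Psi>"
    by (rule square_mat_simps(4)[symmetric, OF T c(2,1)])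
  finally show ?thesis .
qed

context
  fixes n :: nat and \<Psi> \<Phi>1 \<Phi>2 :: "'f::field mat"
  assumes \<Psi>: "\<Psi> \<in> carrier_mat n n" "det \<Psi> \<noteq> 0" and \<Phi>1: "\<Phi>1 \<in> carrier_mat n n" "det \<Phi>1 \<noteq> 0"
    and \<Phi>2: "\<Phi>2 \<in> carrier_mat n n" "det \<Phi>2 \<noteq> 0" and cong: "transpose_mat \<Psi> * \<Phi>2 * \<Psi> = \<Phi>1"
begin

lemma conjugation_alg_iso: "alg_iso n n (\<lambda>A. \<Psi> * A * minv \<Psi>)"
proof -
  note i = minv[OF \<Psi>]
  let ?f = "\<lambda>A. \<Psi> * A * minv \<Psi>" and ?g = "\<lambda>A. minv \<Psi> * A * \<Psi>"
  have gf: "?g (?f A) = A" if A: "A \<in> carrier_mat n n" for A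
  proof -
    have "?g (?f A) = (minv \<Psi> * \<Psi>) * (A * (minv \<Psi> * \<Psi>))"
      using i(1) \<Psi>(1) A by (simp only: square_mat_simps(1,4)[where n = n])
    then show ?thesis using i(3) square_mat_simps(10,11)[OF A] by simp
  qed
  have fg: "?f (?g A) = A" if A: "A \<in> carrier_mat n n" for A
  proof -
    have "?f (?g A) = (\<Psi> * minv \<Psi>) * (A * (\<Psi> * minv \<Psi>))"
      using i(1) \<Psi>(1) A by (simp only: square_mat_simps(1,4)[where n = n])
    then show ?thesis using i(2) square_mat_simps(10,11)[OF A] by simp
  qed
  have fc: "?f A \<in> carrier_mat n n" if "A \<in> carrier_mat n n" for A
    using i(1) \<Psi>(1) that by (simp only: square_mat_simps(1)[where n = n])
  have gc: "?g A \<in> carrier_mat n n" if "A \<in> carrier_mat n n" for A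
    using i(1) \<Psi>(1) that by (simp only: square_mat_simps(1)[where n = n])
  show ?thesis
    unfolding alg_iso_def linear_on_mat_def
  proof (intro conjI ballI allI)
    show "bij_betw ?f (carrier_mat n n) (carrier_mat n n)"
      by (rule bij_betw_byWitness[where f' = ?g]) (use gf fg fc gc in blast)+
  next
    fix A B :: "'f mat" assume A: "A \<in> carrier_mat n n" and B: "B \<in> carrier_mat n n"
    show "?f (A + B) = ?f A + ?f B"
      using i(1) \<Psi>(1) A B by (simp only: square_mat_simps(1,2,3)[where n = n])
    have "?f A * ?f B = \<Psi> * (A * (minv \<Psi> * \<Psi> * (B * minv \<Psi>)))"
      using i(1) \<Psi>(1) A B by (simp only: square_mat_simps(1,4)[where n = n])
    also have "\<dots> = \<Psi> * (A * (B * minv \<Psi>))"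
      unfolding i(3) square_mat_simps(10)[OF mult_carrier_mat[OF B i(1)]] ..
    also have "\<dots> = ?f (A * B)"
      using i(1) \<Psi>(1) A B by (simp only: square_mat_simps(1,4)[where n = n])
    finally show "?f (A * B) = ?f A * ?f B" ..
  next
    fix c and A :: "'f mat" assume A: "A \<in> carrier_mat n n"
    show "?f (c \<cdot>\<^sub>m A) = c \<cdot>\<^sub>m ?f A"
      using i(1) \<Psi>(1) A by (simp only: square_mat_simps(1,5,6)[where n = n])
  qed
qed

text \<open>Congruence by \<Psi> is a change of basis for the bilinear forms. It is used in the
  rearranged shapes \<open>K1\<close> and \<open>K2\<close>, which leave the inverses of
  \<open>\<Phi>1\<close> and \<open>\<Phi>2\<close> out of the computation.\<close>

lemma conjugation_adjoint:
  assumes A: "A \<in> carrier_mat n n"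
  shows "\<Psi> * adjoint_map \<Phi>1 A * minv \<Psi> = adjoint_map \<Phi>2 (\<Psi> * A * minv \<Psi>)"
proof -
  note i = minv[OF \<Psi>]
  let ?T = "transpose_mat" and ?I = "minv \<Psi>" and ?Z = "adjoint_map \<Phi>1 A"
  have Z: "?Z \<in> carrier_mat n n" by (rule adjoint_map_carrier[OF \<Phi>1 A])
  have t: "?T \<Psi> \<in> carrier_mat n n" "?T ?I \<in> carrier_mat n n" "?T A \<in> carrier_mat n n" using \<Psi> i A by auto
  have one: "?T ?I * ?T \<Psi> = 1\<^sub>m n" using transpose_mult[OF \<Psi>(1) i(1)] i(2) by simp
  have K1: "\<Phi>2 * \<Psi> = ?T ?I * \<Phi>1"
  proof -
    have "?T ?I * \<Phi>1 = ?T ?I * ?T \<Psi> * (\<Phi>2 * \<Psi>)"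
      unfolding cong[symmetric] using t \<Phi>2(1) \<Psi>(1) by (simp only: square_mat_simps(1,4)[where n = n])
    then show ?thesis unfolding one using square_mat_simps(10)[OF mult_carrier_mat[OF \<Phi>2(1) \<Psi>(1)]] by simp
  qed
  have K2: "\<Phi>1 * ?I = ?T \<Psi> * \<Phi>2"
  proof -
    have "\<Phi>1 * ?I = ?T \<Psi> * (\<Phi>2 * (\<Psi> * ?I))"
      unfolding cong[symmetric] using t \<Phi>2(1) \<Psi>(1) i(1) by (simp only: square_mat_simps(1,4)[where n = n])
    then show ?thesis unfolding i(2) square_mat_simps(11)[OF \<Phi>2(1)] .
  qed
  have fA: "\<Psi> * A * ?I \<in> carrier_mat n n" and fZ: "\<Psi> * ?Z * ?I \<in> carrier_mat n n"
    using i(1) \<Psi>(1) A Z by (simp_all only: square_mat_simps(1)[where n = n])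
  show ?thesis
  proof (rule adjoint_map_unique[OF \<Phi>2 fA fZ])
    have "\<Phi>2 * (\<Psi> * ?Z * ?I) = \<Phi>2 * (\<Psi> * (?Z * ?I))"
      unfolding square_mat_simps(4)[OF \<Psi>(1) Z i(1)] ..
    also have "\<dots> = ?T ?I * (\<Phi>1 * (?Z * ?I))"
      by (rule mult_eq_lift[OF \<Phi>2(1) \<Psi>(1) t(2) \<Phi>1(1) mult_carrier_mat[OF Z i(1)] K1])
    also have "\<Phi>1 * (?Z * ?I) = ?T A * (\<Phi>1 * ?I)"
      by (rule mult_eq_lift[OF \<Phi>1(1) Z t(3) \<Phi>1(1) i(1) adjoint_map_eq[OF \<Phi>1 A]])
    also have "?T ?I * (?T A * (\<Phi>1 * ?I)) = ?T ?I * (?T A * ?T \<Psi>) * \<Phi>2"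
      unfolding K2 using t \<Phi>2(1) by (simp only: square_mat_simps(1,4)[where n = n])
    also have "?T ?I * (?T A * ?T \<Psi>) = ?T (\<Psi> * A * ?I)"
      using transpose_mult[OF mult_carrier_mat[OF \<Psi>(1) A] i(1)] transpose_mult[OF \<Psi>(1) A] by simp
    finally show "\<Phi>2 * (\<Psi> * ?Z * ?I) = ?T (\<Psi> * A * ?I) * \<Phi>2" .
  qed
qed

end

context elementary_realization
begin

text \<open>Converse to \<open>homog_mset\<close>: \<sigma> matches rows of equal coset, and block
  \<open>(r, \<sigma> r)\<close> is filled with the \<open>X t\<close> whose \<open>t\<close> is
  dictated by the degree \<open>k\<close>. Equality of the cosets is what puts this \<open>t\<close>
  into \<open>T\<close>. The inverse carries \<open>Xi t\<close> in the transposed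
  positions.\<close>

lemma homog_monomial:
  assumes car: "set xs \<subseteq> carrier G" "set ys \<subseteq> carrier G" "k \<in> carrier G"
    and ms: "mset (map (\<lambda>y. coset (k \<otimes> y)) ys) = mset (map coset xs)"
  obtains \<Psi> where "\<Psi> \<in> homog ys xs k" "det \<Psi> \<noteq> 0"
proof -
  have len: "length ys = length xs" using arg_cong[OF ms, of size] by simp
  let ?c = "length xs"
  obtain \<sigma> where \<sigma>: "\<sigma> permutes {..<length (map coset xs)}" "permute_list \<sigma> (map coset xs) = map (\<lambda>y. coset (k \<otimes> y)) ys"
    using mset_eq_permutation[OF ms] by metis
  have \<sigma>p: "\<sigma> permutes {..<?c}" using \<sigma>(1) by simp
  have \<sigma>l: "\<sigma> r < ?c" if "r < ?c" for r using permutes_in_image[OF \<sigma>p, of r] that by simp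
  define t where "t r = k \<otimes> ys ! r \<otimes> inv (xs ! \<sigma> r)" for r
  have tT: "t r \<in> T" if r: "r < ?c" for r
  proof -
    have "coset (k \<otimes> ys ! r) = map (\<lambda>y. coset (k \<otimes> y)) ys ! r" using r len by simp
    also have "\<dots> = coset (xs ! \<sigma> r)"
      unfolding \<sigma>(2)[symmetric] using permute_list_nth[OF \<sigma>(1), of r] r \<sigma>l[OF r] by simp
    finally have e: "coset (k \<otimes> ys ! r) = coset (xs ! \<sigma> r)" .
    have "ys ! r \<in> carrier G" "xs ! \<sigma> r \<in> carrier G" using r \<sigma>l[OF r] len car nth_mem by (metis subsetD)+
    then show ?thesis using e car by (simp add: coset_eq' t_def)
  qed
  let ?n = "?c * d"
  define \<Psi> where "\<Psi> = mat ?n ?n (\<lambda>(I, J). if J div d = \<sigma> (I div d) then X (t (I div d)) $$ (I mod d, J mod d) else 0)"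
  define N where "N = mat ?n ?n (\<lambda>(J, I). if J div d = \<sigma> (I div d) then Xi (t (I div d)) $$ (J mod d, I mod d) else 0)"
  have \<Psi>c: "\<Psi> \<in> carrier_mat ?n ?n" and Nc: "N \<in> carrier_mat ?n ?n" by (auto simp: \<Psi>_def N_def)
  have \<Psi>i: "\<Psi> $$ (r * d + p, s * d + q) = (if s = \<sigma> r then X (t r) $$ (p, q) else 0)"
    if "r < ?c" "p < d" "s < ?c" "q < d" for r p s q
    using that block_index_less[of r ?c p d] block_index_less[of s ?c q d] by (simp add: \<Psi>_def)
  have Ni: "N $$ (s * d + q, r * d + p) = (if s = \<sigma> r then Xi (t r) $$ (q, p) else 0)"
    if "r < ?c" "p < d" "s < ?c" "q < d" for r p s q
    using that block_index_less[of r ?c p d] block_index_less[of s ?c q d] by (simp add: N_def)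
  have "\<Psi> * N = 1\<^sub>m ?n"
  proof (rule mat_eq_blockI[OF mult_carrier_mat[OF \<Psi>c Nc] one_carrier_mat])
    fix r p r' q assume r: "r < ?c" "p < d" "r' < ?c" "q < d"
    have "(\<Psi> * N) $$ (r * d + p, r' * d + q) = (\<Sum>J<?n. \<Psi> $$ (r * d + p, J) * N $$ (J, r' * d + q))"
      by (rule index_mult_mat_sum[OF \<Psi>c Nc block_index_less[OF r(1,2)] block_index_less[OF r(3,4)]])
    also have "\<dots> = (\<Sum>s<?c. if s = \<sigma> r then (if r = r' then 1\<^sub>m d $$ (p, q) else 0) else 0)"
      unfolding sum_lessThan_mult
    proof (rule sum.cong[OF refl])
      fix s assume "s \<in> {..<?c}"
      then have s: "s < ?c" by simp
      have "\<sigma> r = \<sigma> r' \<longleftrightarrow> r = r'" using permutes_inj[OF \<sigma>p] by (auto simp: inj_def)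
      then have "(\<Sum>l<d. \<Psi> $$ (r * d + p, s * d + l) * N $$ (s * d + l, r' * d + q)) =
          (if s = \<sigma> r \<and> r = r' then (\<Sum>l<d. X (t r) $$ (p, l) * Xi (t r) $$ (l, q)) else 0)"
        using r s \<Psi>i[OF r(1,2) s] Ni[OF r(3,4) s] by auto
      also have "(\<Sum>l<d. X (t r) $$ (p, l) * Xi (t r) $$ (l, q)) = (X (t r) * Xi (t r)) $$ (p, q)"
        by (rule index_mult_mat_sum[symmetric, OF X_carrier[OF tT[OF r(1)]] Xi(1)[OF tT[OF r(1)]] r(2,4)])
      also have "X (t r) * Xi (t r) = 1\<^sub>m d" by (rule Xi(2)[OF tT[OF r(1)]])
      finally show "(\<Sum>l<d. \<Psi> $$ (r * d + p, s * d + l) * N $$ (s * d + l, r' * d + q)) =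
          (if s = \<sigma> r then (if r = r' then 1\<^sub>m d $$ (p, q) else 0) else 0)" by simp
    qed
    also have "\<dots> = (if r = r' then 1\<^sub>m d $$ (p, q) else 0)" using \<sigma>l[OF r(1)] by simp
    also have "\<dots> = 1\<^sub>m ?n $$ (r * d + p, r' * d + q)"
    proof -
      have "r * d + p = r' * d + q \<longleftrightarrow> r = r' \<and> p = q" using r by (metis block_div_mod)
      then show ?thesis using r block_index_less[OF r(1,2)] block_index_less[OF r(3,4)] by auto
    qed
    finally show "(\<Psi> * N) $$ (r * d + p, r' * d + q) = 1\<^sub>m ?n $$ (r * d + p, r' * d + q)" .
  qed
  then have "det \<Psi> \<noteq> 0" by (rule det_nonzeroI(1)[OF \<Psi>c Nc])
  moreover have "\<Psi> \<in> homog ys xs k"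
  proof (rule homogI[where a = "\<lambda>r s. if s = \<sigma> r then 1 else 0"])
    show "\<Psi> \<in> carrier_mat (length ys * d) (length xs * d)" using \<Psi>c len by simp
  next
    fix r s assume "r < length ys" "s < length xs" "(if s = \<sigma> r then 1 else 0 :: 'f) \<noteq> 0"
    then show "k \<otimes> ys ! r \<otimes> inv (xs ! s) \<in> T" using tT[of r] len by (auto simp: t_def split: if_splits)
  next
    fix r s p q assume "r < length ys" "s < length xs" "p < d" "q < d"
    then show "\<Psi> $$ (r * d + p, s * d + q) = (if s = \<sigma> r then 1 else 0) * X (k \<otimes> ys ! r \<otimes> inv (xs ! s)) $$ (p, q)"
      using \<Psi>i[of r p s q] len by (auto simp: t_def)
  qed
  ultimately show thesis using that by blast
qed

lemma homog_peval:
  assumes car: "set xs \<subseteq> carrier G" and B: "B \<in> homog xs xs \<one>"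
  shows "peval (length xs * d) B p \<in> homog xs xs \<one>"
proof (rule peval_induct[OF homog_carrier[OF B], where P = "\<lambda>M. M \<in> homog xs xs \<one>"])
  fix A assume "A \<in> homog xs xs \<one>"
  then have "A * B \<in> homog xs xs (\<one> \<otimes> \<one>)" using B by (rule homog_mult) (use car in auto)
  then show "A * B \<in> homog xs xs \<one>" by simp
qed (use car in \<open>auto intro: homog_zero homog_one homog_add homog_smult\<close>)

text \<open>The transpose contributes the degree \<open>k\<close> a second time. This is the source
  of the factor \<open>g \<otimes> g\<close> in the equivalence of data.\<close>

lemma congruence_homog:
  assumes car: "set xs \<subseteq> carrier G" "set ys \<subseteq> carrier G" "k \<in> carrier G" "h \<in> carrier G"
    and \<Psi>: "\<Psi> \<in> homog ys xs k" and \<Phi>: "\<Phi> \<in> homog (map (m_inv G) ys) ys h"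
  shows "transpose_mat \<Psi> * \<Phi> * \<Psi> \<in> homog (map (m_inv G) xs) xs (k \<otimes> h \<otimes> k)"
proof -
  have "transpose_mat \<Psi> \<in> homog (map (m_inv G) xs) (map (m_inv G) ys) k"
    by (rule homog_transpose[OF \<Psi> car(2,1,3)])
  then have "transpose_mat \<Psi> * \<Phi> \<in> homog (map (m_inv G) xs) ys (k \<otimes> h)"
    using \<Phi> by (rule homog_mult) (use car in auto)
  then show ?thesis using \<Psi> by (rule homog_mult) (use car in auto)
qed

lemma conjugation_homog:
  assumes car: "set xs \<subseteq> carrier G" "set ys \<subseteq> carrier G" "k \<in> carrier G" "g \<in> carrier G"
    and len: "length ys = length xs" and \<Psi>: "\<Psi> \<in> homog ys xs k" "det \<Psi> \<noteq> 0"
  shows "(\<lambda>A. \<Psi> * A * minv \<Psi>) ` homog xs xs g = homog ys ys g"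
proof -
  have i: "minv \<Psi> \<in> homog xs ys (inv k)" by (rule homog_inverse[OF \<Psi>(1) len \<Psi>(2) car(2,1,3)])
  have kg: "k \<otimes> g \<otimes> inv k = g" "inv k \<otimes> g \<otimes> k = g"
    using car by (simp_all add: m_comm[of _ g] m_assoc)
  have c: "\<Psi> \<in> carrier_mat (length xs * d) (length xs * d)" using homog_carrier[OF \<Psi>(1)] len by simp
  note inv = minv[OF c \<Psi>(2)]
  show ?thesis
  proof
    show "(\<lambda>A. \<Psi> * A * minv \<Psi>) ` homog xs xs g \<subseteq> homog ys ys g"
    proof
      fix M assume "M \<in> (\<lambda>A. \<Psi> * A * minv \<Psi>) ` homog xs xs g"
      then obtain A where A: "A \<in> homog xs xs g" "M = \<Psi> * A * minv \<Psi>" by blast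
      have "\<Psi> * A \<in> homog ys xs (k \<otimes> g)" using \<Psi>(1) A(1) by (rule homog_mult) (use car in auto)
      then have "\<Psi> * A * minv \<Psi> \<in> homog ys ys (k \<otimes> g \<otimes> inv k)" using i by (rule homog_mult) (use car in auto)
      then show "M \<in> homog ys ys g" using A kg by simp
    qed
    show "homog ys ys g \<subseteq> (\<lambda>A. \<Psi> * A * minv \<Psi>) ` homog xs xs g"
    proof
      fix M assume M: "M \<in> homog ys ys g"
      have "minv \<Psi> * M \<in> homog xs ys (inv k \<otimes> g)" using i M by (rule homog_mult) (use car in auto)
      then have A: "minv \<Psi> * M * \<Psi> \<in> homog xs xs (inv k \<otimes> g \<otimes> k)" using \<Psi>(1) by (rule homog_mult) (use car in auto)
      have Mc: "M \<in> carrier_mat (length xs * d) (length xs * d)" using homog_carrier[OF M] len by simp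
      have "\<Psi> * (minv \<Psi> * M * \<Psi>) * minv \<Psi> = (\<Psi> * minv \<Psi>) * (M * (\<Psi> * minv \<Psi>))"
        using c inv(1) Mc by (simp only: square_mat_simps(1,4)[where n = "length xs * d"])
      also have "\<dots> = M" using inv(2) square_mat_simps(10,11)[OF Mc] by simp
      finally show "M \<in> (\<lambda>A. \<Psi> * A * minv \<Psi>) ` homog xs xs g" using A kg by (metis imageI)
    qed
  qed
qed

theorem graded_inv_isomorphicI:
  assumes car: "set xs \<subseteq> carrier G" "set ys \<subseteq> carrier G" "k \<in> carrier G" and len: "length ys = length xs"
    and R1: "gsize R1 = length xs * d" "\<And>g. g \<in> carrier G \<Longrightarrow> gcomp R1 g = homog xs xs g"
      "\<And>W. W \<in> carrier_mat (length xs * d) (length xs * d) \<Longrightarrow> \<phi>1 W = adjoint_map \<Phi>1 W"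
    and R2: "gsize R2 = length ys * d" "\<And>g. g \<in> carrier G \<Longrightarrow> gcomp R2 g = homog ys ys g"
      "\<And>W. W \<in> carrier_mat (length ys * d) (length ys * d) \<Longrightarrow> \<phi>2 W = adjoint_map \<Phi>2 W"
    and \<Phi>1: "\<Phi>1 \<in> homog (map (m_inv G) xs) xs h1" "det \<Phi>1 \<noteq> 0"
    and \<Phi>2: "\<Phi>2 \<in> homog (map (m_inv G) ys) ys h2" "det \<Phi>2 \<noteq> 0"
    and \<Psi>: "\<Psi> \<in> homog ys xs k" "det \<Psi> \<noteq> 0" "transpose_mat \<Psi> * \<Phi>2 * \<Psi> = \<Phi>1"
  shows "graded_inv_isomorphic G (R1, \<phi>1) (R2, \<phi>2)"
proof -
  let ?n = "length xs * d"
  let ?f = "\<lambda>A. \<Psi> * A * minv \<Psi>"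
  have c: "\<Psi> \<in> carrier_mat ?n ?n" "\<Phi>1 \<in> carrier_mat ?n ?n" "\<Phi>2 \<in> carrier_mat ?n ?n"
    using homog_carrier[OF \<Psi>(1)] homog_carrier[OF \<Phi>1(1)] homog_carrier[OF \<Phi>2(1)] len by auto
  have iso: "alg_iso ?n ?n ?f"
    by (rule conjugation_alg_iso[OF c(1) \<Psi>(2) c(2) \<Phi>1(2) c(3) \<Phi>2(2) \<Psi>(3)])
  have "\<phi>1 A = inv_into (carrier_mat ?n ?n) ?f (\<phi>2 (?f A))" if A: "A \<in> carrier_mat ?n ?n" for A
  proof -
    have e: "\<phi>2 (?f A) = ?f (\<phi>1 A)"
      using R2(3)[of "?f A"] R1(3)[OF A] len alg_isoD(3)[OF iso A]
        conjugation_adjoint[OF c(1) \<Psi>(2) c(2) \<Phi>1(2) c(3) \<Phi>2(2) \<Psi>(3) A] by simp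
    have c1: "\<phi>1 A \<in> carrier_mat ?n ?n" using R1(3)[OF A] adjoint_map_carrier[OF c(2) \<Phi>1(2) A] by simp
    show ?thesis unfolding e
      by (rule inv_into_f_f[OF bij_betw_imp_inj_on[OF alg_isoD(2)[OF iso]] c1, symmetric])
  qed
  then show ?thesis
    unfolding graded_inv_isomorphic_def Let_def fst_conv snd_conv R1(1) R2(1) len
    using iso conjugation_homog[OF car _ len \<Psi>(1,2)] R1(2) R2(2)
    by (intro exI[of _ ?f]) (auto simp: alg_iso_def)
qed

text \<open>The Skolem--Noether matrix \<Psi> of the isomorphism is homogeneous of some degree
  \<open>k\<close>. The form pulled back along \<Psi> has the same adjoint map as
  \<open>\<Phi>1\<close> and is a multiple of it: degrees and symmetries can be compared, and
  \<open>homog_mset\<close> for \<Psi> matches the rows.\<close>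

theorem graded_inv_isomorphicD:
  assumes car: "set xs \<subseteq> carrier G" "set ys \<subseteq> carrier G" and ne: "xs \<noteq> []"
    and R1: "gsize R1 = length xs * d" "\<And>g. g \<in> carrier G \<Longrightarrow> gcomp R1 g = homog xs xs g"
    and R2: "gsize R2 = length ys * d" "\<And>g. g \<in> carrier G \<Longrightarrow> gcomp R2 g = homog ys ys g"
    and \<Phi>1: "\<Phi>1 \<in> homog (map (m_inv G) xs) xs h1" "det \<Phi>1 \<noteq> 0" "transpose_mat \<Phi>1 = \<delta>1 \<cdot>\<^sub>m \<Phi>1" "h1 \<in> carrier G"
    and \<Phi>2: "\<Phi>2 \<in> homog (map (m_inv G) ys) ys h2" "det \<Phi>2 \<noteq> 0" "transpose_mat \<Phi>2 = \<delta>2 \<cdot>\<^sub>m \<Phi>2" "h2 \<in> carrier G"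
    and iso: "graded_inv_isomorphic G (R1, adjoint_map \<Phi>1) (R2, adjoint_map \<Phi>2)"
  obtains k where "k \<in> carrier G" "h1 = k \<otimes> h2 \<otimes> k" "\<delta>1 = \<delta>2"
    "mset (map (\<lambda>y. coset (k \<otimes> y)) ys) = mset (map coset xs)"
proof -
  let ?n = "length xs * d"
  obtain f where f: "alg_iso ?n (length ys * d) f" and gr: "\<And>g. g \<in> carrier G \<Longrightarrow> f ` homog xs xs g = homog ys ys g"
    and comm: "\<And>A. A \<in> carrier_mat ?n ?n \<Longrightarrow> adjoint_map \<Phi>1 A = inv_into (carrier_mat ?n ?n) f (adjoint_map \<Phi>2 (f A))"
    using iso R1 R2 unfolding graded_inv_isomorphic_def Let_def fst_conv snd_conv alg_iso_def by auto
  have "length ys * d = ?n" by (rule alg_iso_size[OF f, symmetric])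
  then have len: "length ys = length xs" using d_pos by (metis less_irrefl mult_cancel2)
  then have f: "alg_iso ?n ?n f" using f by simp
  have n0: "0 < ?n" using ne d_pos by simp
  obtain \<Psi> where \<Psi>: "\<Psi> \<in> carrier_mat ?n ?n" "det \<Psi> \<noteq> 0" "\<And>W. W \<in> carrier_mat ?n ?n \<Longrightarrow> f W * \<Psi> = \<Psi> * W"
    using skolem_noether[OF f n0] by blast
  have "f W \<in> homog ys ys g" if "g \<in> carrier G" "W \<in> homog xs xs g" for g W using gr that by blast
  then obtain k where k: "k \<in> carrier G" "\<Psi> \<in> homog ys xs k"
    using homog_intertwiner[OF len[symmetric] refl f \<Psi> _ car] by blast
  have ms: "mset (map (\<lambda>y. coset (k \<otimes> y)) ys) = mset (map coset xs)"
    by (rule homog_mset[OF k(2) len \<Psi>(2) car(2,1) k(1)])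
  have c: "\<Phi>1 \<in> carrier_mat ?n ?n" "\<Phi>2 \<in> carrier_mat ?n ?n"
    using homog_carrier[OF \<Phi>1(1)] homog_carrier[OF \<Phi>2(1)] len by auto
  let ?\<Phi> = "transpose_mat \<Psi> * \<Phi>2 * \<Psi>"
  have \<Psi>T: "transpose_mat \<Psi> \<in> carrier_mat ?n ?n" using \<Psi> by simp
  have \<Phi>: "?\<Phi> \<in> homog (map (m_inv G) xs) xs (k \<otimes> h2 \<otimes> k)"
    by (rule congruence_homog[OF car k(1) \<Phi>2(4) k(2) \<Phi>2(1)])
  have \<Phi>c: "?\<Phi> \<in> carrier_mat ?n ?n" using homog_carrier[OF \<Phi>] by simp
  have "?\<Phi> * adjoint_map \<Phi>1 W = transpose_mat W * ?\<Phi>" if W: "W \<in> carrier_mat ?n ?n" for W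
  proof -
    let ?Z = "adjoint_map \<Phi>1 W"
    have fW: "f W \<in> carrier_mat ?n ?n" by (rule alg_isoD(3)[OF f W])
    have Z: "?Z \<in> carrier_mat ?n ?n" by (rule adjoint_map_carrier[OF c(1) \<Phi>1(2) W])
    have A2: "adjoint_map \<Phi>2 (f W) \<in> carrier_mat ?n ?n" by (rule adjoint_map_carrier[OF c(2) \<Phi>2(2) fW])
    then have fZ: "f ?Z = adjoint_map \<Phi>2 (f W)"
      unfolding comm[OF W] using alg_isoD(2)[OF f] by (simp add: bij_betw_def f_inv_into_f)
    have t: "transpose_mat (f W) \<in> carrier_mat ?n ?n" "transpose_mat W \<in> carrier_mat ?n ?n" using fW W by auto
    have "?\<Phi> * ?Z = transpose_mat \<Psi> * (\<Phi>2 * (\<Psi> * ?Z))"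
      using \<Psi>T c(2) \<Psi>(1) Z by (simp only: square_mat_simps(1,4)[where n = ?n])
    also have "\<Psi> * ?Z = adjoint_map \<Phi>2 (f W) * \<Psi>" using \<Psi>(3)[OF Z] fZ by simp
    also have "\<Phi>2 * (adjoint_map \<Phi>2 (f W) * \<Psi>) = transpose_mat (f W) * (\<Phi>2 * \<Psi>)"
      by (rule mult_eq_lift[OF c(2) A2 t(1) c(2) \<Psi>(1) adjoint_map_eq[OF c(2) \<Phi>2(2) fW]])
    also have "transpose_mat \<Psi> * (transpose_mat (f W) * (\<Phi>2 * \<Psi>)) = transpose_mat W * (transpose_mat \<Psi> * (\<Phi>2 * \<Psi>))"
    proof (rule mult_eq_lift[OF \<Psi>T t(1) t(2) \<Psi>T mult_carrier_mat[OF c(2) \<Psi>(1)]])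
      show "transpose_mat \<Psi> * transpose_mat (f W) = transpose_mat W * transpose_mat \<Psi>"
        using arg_cong[OF \<Psi>(3)[OF W], of transpose_mat] transpose_mult[OF fW \<Psi>(1)] transpose_mult[OF \<Psi>(1) W] by simp
    qed
    also have "transpose_mat \<Psi> * (\<Phi>2 * \<Psi>) = ?\<Phi>" by (rule square_mat_simps(4)[symmetric, OF \<Psi>T c(2) \<Psi>(1)])
    finally show ?thesis .
  qed
  then obtain z where z: "?\<Phi> = z \<cdot>\<^sub>m \<Phi>1" by (rule adjoint_map_scalar[OF c(1) \<Phi>1(2) \<Phi>c])
  have det: "det ?\<Phi> \<noteq> 0"
    using \<Psi>(2) \<Phi>2(2) det_mult[OF mult_carrier_mat[OF \<Psi>T c(2)] \<Psi>(1)] det_mult[OF \<Psi>T c(2)] det_transpose[OF \<Psi>(1)] by simp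
  have nz: "?\<Phi> \<noteq> 0\<^sub>m ?n ?n" by (rule nonzero_if_det_nonzero[OF \<Phi>c det n0])
  have "?\<Phi> \<in> homog (map (m_inv G) xs) xs h1" unfolding z by (rule homog_smult[OF \<Phi>1(1)])
  then have h: "h1 = k \<otimes> h2 \<otimes> k"
    by (rule homog_unique_degree[OF _ \<Phi> _ map_inv_carrier[OF car(1)] car(1)]) (use nz \<Phi>1 \<Phi>2 k in auto)
  have "\<delta>2 \<cdot>\<^sub>m ?\<Phi> = transpose_mat ?\<Phi>" by (rule congruence_transpose[symmetric, OF \<Psi>(1) c(2) \<Phi>2(3)])
  also have "\<dots> = \<delta>1 \<cdot>\<^sub>m ?\<Phi>" unfolding z by (simp add: transpose_smult \<Phi>1(3) smult_smult_mat mult.commute)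
  finally have e: "\<delta>2 \<cdot>\<^sub>m ?\<Phi> = \<delta>1 \<cdot>\<^sub>m ?\<Phi>" .
  obtain i j where ij: "i < ?n" "j < ?n" "?\<Phi> $$ (i, j) \<noteq> 0"
    using nz \<Phi>c by (metis (no_types, lifting) carrier_matD eq_matI index_zero_mat)
  have "\<delta>2 * ?\<Phi> $$ (i, j) = \<delta>1 * ?\<Phi> $$ (i, j)"
    using arg_cong[OF e, of "\<lambda>M. M $$ (i, j)"] ij carrier_matD[OF \<Phi>c] by (simp del: index_mult_mat)
  then have "\<delta>1 = \<delta>2" using ij by simp
  then show thesis using that[OF k(1) h _ ms] by blast
qed

end

locale closed_realization = elementary_realization G T \<beta> ab
  for G (structure) and T :: "'a set" and \<beta> :: "'a \<times> 'a \<Rightarrow> 'f::alg_closed_field" and ab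
begin

theorem graded_congruence:
  assumes car: "set xs \<subseteq> carrier G" "set ys \<subseteq> carrier G" "k \<in> carrier G" "h2 \<in> carrier G"
    and \<Phi>1: "\<Phi>1 \<in> homog (map (m_inv G) xs) xs h1" "det \<Phi>1 \<noteq> 0" "transpose_mat \<Phi>1 = \<delta> \<cdot>\<^sub>m \<Phi>1"
    and \<Phi>2: "\<Phi>2 \<in> homog (map (m_inv G) ys) ys h2" "det \<Phi>2 \<noteq> 0" "transpose_mat \<Phi>2 = \<delta> \<cdot>\<^sub>m \<Phi>2"
    and \<delta>: "\<delta> \<in> {1, - 1}" and h: "h1 = k \<otimes> h2 \<otimes> k"
    and ms: "mset (map (\<lambda>y. coset (k \<otimes> y)) ys) = mset (map coset xs)"
  obtains \<Psi> where "\<Psi> \<in> homog ys xs k" "det \<Psi> \<noteq> 0" "transpose_mat \<Psi> * \<Phi>2 * \<Psi> = \<Phi>1"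
proof -
  have len: "length ys = length xs" using arg_cong[OF ms, of size] by simp
  let ?n = "length xs * d"
  have \<delta>1: "\<delta> * \<delta> = 1" using \<delta> by auto
  obtain M where M: "M \<in> homog ys xs k" "det M \<noteq> 0" using homog_monomial[OF car(1,2,3) ms] .
  let ?\<Phi> = "transpose_mat M * \<Phi>2 * M"
  have Mc: "M \<in> carrier_mat ?n ?n" and \<Phi>2c: "\<Phi>2 \<in> carrier_mat ?n ?n" and \<Phi>1c: "\<Phi>1 \<in> carrier_mat ?n ?n"
    using homog_carrier[OF M(1)] homog_carrier[OF \<Phi>2(1)] homog_carrier[OF \<Phi>1(1)] len by auto
  have MTc: "transpose_mat M \<in> carrier_mat ?n ?n" using Mc by simp
  have \<Phi>: "?\<Phi> \<in> homog (map (m_inv G) xs) xs h1"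
    unfolding h by (rule congruence_homog[OF car M(1) \<Phi>2(1)])
  have \<Phi>c: "?\<Phi> \<in> carrier_mat ?n ?n" using homog_carrier[OF \<Phi>] by simp
  have det: "det ?\<Phi> \<noteq> 0"
    using M(2) \<Phi>2(2) det_mult[OF mult_carrier_mat[OF MTc \<Phi>2c] Mc] det_mult[OF MTc \<Phi>2c] det_transpose[OF Mc] by simp
  have sym: "transpose_mat ?\<Phi> = \<delta> \<cdot>\<^sub>m ?\<Phi>" by (rule congruence_transpose[OF Mc \<Phi>2c \<Phi>2(3)])
  note i = minv[OF \<Phi>c det]
  let ?B = "minv ?\<Phi> * \<Phi>1"
  have Bc: "?B \<in> carrier_mat ?n ?n" by (rule mult_carrier_mat[OF i(1) \<Phi>1c])
  have \<Phi>B: "?\<Phi> * ?B = \<Phi>1"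
    using square_mat_simps(4)[OF \<Phi>c i(1) \<Phi>1c] i(2) square_mat_simps(10)[OF \<Phi>1c] by simp
  have h1: "h1 \<in> carrier G" unfolding h using car by simp
  \<comment> \<open>Both \<open>?\<Phi>\<close> and \<open>\<Phi>1\<close> have degree
    \<open>h1\<close>, so the factor \<open>?B\<close> between them has degree 1, and so has every
    polynomial in it.\<close>
  have B: "?B \<in> homog xs xs \<one>"
    by (rule homog_right_factor[OF \<Phi> _ _ _ _ map_inv_carrier[OF car(1)] car(1,1), where A' = "minv ?\<Phi>"])
      (use Bc \<Phi>B \<Phi>1(1) i h1 in simp_all)
  obtain p where p: "transpose_mat (peval ?n ?B p) * ?\<Phi> * peval ?n ?B p = \<Phi>1"
    using congruent_via_sqrt[OF two \<Phi>c det sym \<Phi>1c \<Phi>1(2,3) \<delta>1 Bc \<Phi>B] .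
  let ?S = "peval ?n ?B p"
  have S: "?S \<in> homog xs xs \<one>" by (rule homog_peval[OF car(1) B])
  have Sc: "?S \<in> carrier_mat ?n ?n" by (rule homog_carrier[OF S])
  have STc: "transpose_mat ?S \<in> carrier_mat ?n ?n" using Sc by simp
  have e: "transpose_mat (M * ?S) * \<Phi>2 * (M * ?S) = \<Phi>1"
    unfolding transpose_mult[OF Mc Sc]
    using p Mc Sc STc MTc \<Phi>2c by (simp only: square_mat_simps(1,4)[where n = ?n])
  have "M * ?S \<in> homog ys xs (k \<otimes> \<one>)" using M(1) S by (rule homog_mult) (use car in auto)
  then have 1: "M * ?S \<in> homog ys xs k" using car by simp
  have MSc: "M * ?S \<in> carrier_mat ?n ?n" by (rule mult_carrier_mat[OF Mc Sc])
  have "det (M * ?S) \<noteq> 0"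
  proof
    assume "det (M * ?S) = 0"
    then have "det (transpose_mat (M * ?S) * \<Phi>2 * (M * ?S)) = 0"
      using det_mult[of "transpose_mat (M * ?S) * \<Phi>2" ?n "M * ?S"] MSc \<Phi>2c by simp
    then show False using e \<Phi>1(2) by simp
  qed
  with 1 e that show thesis by blast
qed

end

section \<open>Data of the form (1)\<close>

definition row_block :: "'a form1 \<Rightarrow> nat \<Rightarrow> 'a list" where
  "row_block F i =
     (if i \<le> f_l F then replicate (f_q F i) (f_g F i)
      else if i \<le> f_m F then replicate (2 * f_q F i) (f_g F i)
      else replicate (f_q F i) (f_g' F i) @ replicate (f_q F i) (f_g'' F i))"

definition form_rows :: "'a form1 \<Rightarrow> 'a list" where
  "form_rows F = rows_of (form_kappa F) (form_gamma F)"

lemma rows_of_map_map: "rows_of (map q is) (map g is) = concat (map (\<lambda>i. replicate (q i) (g i)) is)"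
  by (induction "is") auto

lemma rows_of_concat_pairs:
  "rows_of (concat (map (\<lambda>i. [q i, q i]) is)) (concat (map (\<lambda>i. [g i, g' i]) is)) =
   concat (map (\<lambda>i. replicate (q i) (g i) @ replicate (q i) (g' i)) is)"
  by (induction "is") auto

lemma upt_append: "i \<le> j \<Longrightarrow> j \<le> k \<Longrightarrow> [i..<k] = [i..<j] @ [j..<k]"
  by (metis le_Suc_ex upt_add_eq_append)

lemma upt_split3:
  assumes "l \<le> m" "m \<le> k"
  shows "[1..<Suc k] = [1..<Suc l] @ [Suc l..<Suc m] @ [Suc m..<Suc k]"
  using assms upt_append[of 1 "Suc l" "Suc m"] upt_append[of 1 "Suc m" "Suc k"] by simp

lemma form_gamma_split:
  assumes "f_l F \<le> f_m F"
  shows "form_gamma F = map (f_g F) [1..<Suc (f_l F)] @ map (f_g F) [Suc (f_l F)..<Suc (f_m F)] @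
     concat (map (\<lambda>i. [f_g' F i, f_g'' F i]) [Suc (f_m F)..<Suc (f_k F)])"
  using assms upt_append[of 1 "Suc (f_l F)" "Suc (f_m F)"] unfolding form_gamma_def
  by (simp flip: map_append)

text \<open>Regroups the rows by the index \<open>i\<close>, the two halves of a pair next to each
  other, in the order of the diagonal blocks of \<open>Phi_mat\<close>.\<close>

lemma form_rows_eq:
  assumes "f_l F \<le> f_m F" "f_m F \<le> f_k F"
  shows "form_rows F = concat (map (row_block F) [1..<Suc (f_k F)])"
proof -
  have "form_rows F = rows_of (map (f_q F) [1..<Suc (f_l F)]) (map (f_g F) [1..<Suc (f_l F)]) @
     rows_of (map (\<lambda>i. 2 * f_q F i) [Suc (f_l F)..<Suc (f_m F)]) (map (f_g F) [Suc (f_l F)..<Suc (f_m F)]) @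
     rows_of (concat (map (\<lambda>i. [f_q F i, f_q F i]) [Suc (f_m F)..<Suc (f_k F)]))
       (concat (map (\<lambda>i. [f_g' F i, f_g'' F i]) [Suc (f_m F)..<Suc (f_k F)]))"
    unfolding form_rows_def form_kappa_def form_gamma_split[OF assms(1)]
    by (subst rows_of_append, simp, subst rows_of_append, simp, rule refl)
  also have "\<dots> = concat (map (row_block F) [1..<Suc (f_l F)]) @ concat (map (row_block F) [Suc (f_l F)..<Suc (f_m F)]) @
      concat (map (row_block F) [Suc (f_m F)..<Suc (f_k F)])"
    unfolding rows_of_map_map rows_of_concat_pairs
    by (intro arg_cong2[of _ _ _ _ "(@)"] arg_cong[of _ _ concat] map_cong refl)
      (use assms in \<open>auto simp: row_block_def\<close>)
  also have "\<dots> = concat (map (row_block F) [1..<Suc (f_k F)])"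
    unfolding upt_split3[OF assms] by simp
  finally show ?thesis .
qed

lemma mset_form_rows:
  assumes "f_l F \<le> f_m F" "f_m F \<le> f_k F"
  shows "mset (map f (form_rows F)) = (\<Sum>i\<in>{1..f_k F}. mset (map f (row_block F i)))"
proof -
  have "mset (map f (concat (map B is))) = (\<Sum>i\<leftarrow>is. mset (map f (B i)))" for B :: "nat \<Rightarrow> _" and "is"
    by (induction "is") auto
  then have "mset (map f (form_rows F)) = (\<Sum>i\<leftarrow>[1..<Suc (f_k F)]. mset (map f (row_block F i)))"
    by (simp only: form_rows_eq[OF assms])
  also have "\<dots> = (\<Sum>i\<in>set [1..<Suc (f_k F)]. mset (map f (row_block F i)))"
    by (rule sum_list_distinct_conv_sum_set) simp
  also have "set [1..<Suc (f_k F)] = {1..f_k F}" by auto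
  finally show ?thesis .
qed

lemma length_form: "f_l F \<le> f_m F \<Longrightarrow> f_m F \<le> f_k F \<Longrightarrow> length (form_kappa F) = length (form_gamma F)"
  unfolding form_gamma_split by (simp add: form_kappa_def length_concat comp_def)

lemma set_form_gamma:
  "set (form_gamma F) = f_g F ` {1..f_m F} \<union> f_g' F ` {Suc (f_m F)..f_k F} \<union> f_g'' F ` {Suc (f_m F)..f_k F}"
  unfolding form_gamma_def by auto

lemma f_k_pos:
  assumes "f_l F \<le> f_m F" "f_m F \<le> f_k F" "form_kappa F \<noteq> []"
  shows "0 < f_k F"
  using assms by (cases "f_k F") (auto simp: form_kappa_def)

section \<open>The matrix \<open>Phi_mat\<close>\<close>

lemma S_mat_carrier [simp]: "S_mat q c \<in> carrier_mat (2 * q) (2 * q)"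
  by (simp add: S_mat_def mult_2)

lemma S_mat_index:
  assumes "r < 2 * q" "s < 2 * q"
  shows "S_mat q c $$ (r, s) = (if r < q then (if s = r + q then 1 else 0) else (if r = s + q then (c::'f::field) else 0))"
  using assms unfolding S_mat_def by (subst index_mat_four_block) auto

lemma S_mat_transpose:
  assumes "c * c = (1::'f::field)"
  shows "transpose_mat (S_mat q c) = c \<cdot>\<^sub>m S_mat q c"
proof (rule eq_matI)
  fix r s assume "r < dim_row (c \<cdot>\<^sub>m S_mat q c)" "s < dim_col (c \<cdot>\<^sub>m S_mat q c)"
  then have rs: "r < 2 * q" "s < 2 * q" using carrier_matD[OF S_mat_carrier[of q c]] by auto
  then show "transpose_mat (S_mat q c) $$ (r, s) = (c \<cdot>\<^sub>m S_mat q c) $$ (r, s)"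
    using assms by (auto simp: carrier_matD[OF S_mat_carrier] S_mat_index)
qed (auto simp: carrier_matD[OF S_mat_carrier])

lemma S_mat_rinv:
  assumes "c * c = (1::'f::field)"
  shows "rinv (2 * q) (S_mat q c)"
proof -
  have "S_mat q c * transpose_mat (S_mat q c) = 1\<^sub>m (2 * q)"
  proof (rule eq_matI)
    fix r s assume "r < dim_row (1\<^sub>m (2 * q) :: 'f mat)" "s < dim_col (1\<^sub>m (2 * q) :: 'f mat)"
    then have rs: "r < 2 * q" "s < 2 * q" by auto
    define r' where "r' = (if r < q then r + q else r - q)"
    have r': "r' < 2 * q" using rs by (auto simp: r'_def)
    have "(S_mat q c * transpose_mat (S_mat q c)) $$ (r, s) =
        (\<Sum>k<2 * q. S_mat q c $$ (r, k) * transpose_mat (S_mat q c) $$ (k, s))"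
      by (rule index_mult_mat_sum[OF S_mat_carrier _ rs]) simp
    also have "\<dots> = (\<Sum>k<2 * q. if k = r' then (if r = s then 1 else 0) else 0)"
      using rs assms by (intro sum.cong refl) (auto simp: carrier_matD[OF S_mat_carrier] S_mat_index r'_def)
    finally show "(S_mat q c * transpose_mat (S_mat q c)) $$ (r, s) = 1\<^sub>m (2 * q) $$ (r, s)" using rs r' by simp
  qed (auto simp: carrier_matD[OF S_mat_carrier])
  then show ?thesis unfolding rinv_def by (intro conjI bexI[of _ "transpose_mat (S_mat q c)"]) auto
qed

lemma rinv_det: "rinv n A \<Longrightarrow> det A \<noteq> 0"
  unfolding rinv_def using det_nonzeroI(1) by blast

context std_realization
begin

lemma kron_homog:
  assumes A: "A \<in> carrier_mat (length xs) (length ys)" and t: "t \<in> T"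
    and deg: "\<And>r s. r < length xs \<Longrightarrow> s < length ys \<Longrightarrow> A $$ (r, s) \<noteq> 0 \<Longrightarrow> h \<otimes> xs ! r \<otimes> inv (ys ! s) = t"
  shows "kron A (X t) \<in> homog xs ys h"
proof (rule homogI[where a = "\<lambda>r s. A $$ (r, s)"])
  show "kron A (X t) \<in> carrier_mat (length xs * d) (length ys * d)" by (rule kron_carrier[OF A X_carrier[OF t]])
  show "\<And>r s. r < length xs \<Longrightarrow> s < length ys \<Longrightarrow> A $$ (r, s) \<noteq> 0 \<Longrightarrow> h \<otimes> xs ! r \<otimes> inv (ys ! s) \<in> T"
    using deg t by simp
  fix r s p q assume rs: "r < length xs" "s < length ys" "p < d" "q < d"
  show "kron A (X t) $$ (r * d + p, s * d + q) = A $$ (r, s) * X (h \<otimes> xs ! r \<otimes> inv (ys ! s)) $$ (p, q)"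
    using kron_index[OF A X_carrier[OF t] rs(1,3,2,4)] deg[OF rs(1,2)] by (cases "A $$ (r, s) = 0") auto
qed

text \<open>A zero block is homogeneous of every degree, with coefficient 0, so no condition relates
  \<open>xs\<close> to \<open>ys'\<close> or \<open>xs'\<close> to \<open>ys\<close>.\<close>

lemma four_block_homog:
  assumes A: "A \<in> homog xs ys h" and B: "B \<in> homog xs' ys' h"
  shows "four_block_mat A (0\<^sub>m (length xs * d) (length ys' * d)) (0\<^sub>m (length xs' * d) (length ys * d)) B
    \<in> homog (xs @ xs') (ys @ ys') h"
proof -
  let ?M = "four_block_mat A (0\<^sub>m (length xs * d) (length ys' * d)) (0\<^sub>m (length xs' * d) (length ys * d)) B"
  note c = homog_carrier[OF A] homog_carrier[OF B]
  have M: "?M \<in> carrier_mat (length (xs @ xs') * d) (length (ys @ ys') * d)"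
    using four_block_carrier_mat[OF c] by (simp add: add_mult_distrib)
  show ?thesis unfolding homog_def
  proof (intro CollectI conjI M allI impI)
    fix r s assume rs: "r < length (xs @ xs')" "s < length (ys @ ys')"
    have lt: "r * d + p < length xs * d \<longleftrightarrow> r < length xs" "s * d + p < length ys * d \<longleftrightarrow> s < length ys" if "p < d" for p
    proof -
      have *: "a * d + p < b * d \<longleftrightarrow> a < b" for a b
      proof
        assume lt: "a * d + p < b * d"
        show "a < b"
        proof (rule ccontr)
          assume "\<not> a < b"
          then have "b * d \<le> a * d" by (intro mult_le_mono1) simp
          then show False using lt by linarith
        qed
      qed (simp add: block_index_less that)
      show "r * d + p < length xs * d \<longleftrightarrow> r < length xs" "s * d + p < length ys * d \<longleftrightarrow> s < length ys" by (rule *)+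
    qed
    have ix: "?M $$ (r * d + p, s * d + q) =
       (if r < length xs then if s < length ys then A $$ (r * d + p, s * d + q) else 0
        else if s < length ys then 0 else B $$ ((r - length xs) * d + p, (s - length ys) * d + q))"
      if pq: "p < d" "q < d" for p q
    proof -
      have less: "r * d + p < length xs * d + length xs' * d" "s * d + q < length ys * d + length ys' * d"
        using block_index_less[OF rs(1) pq(1)] block_index_less[OF rs(2) pq(2)] by (simp_all add: add_mult_distrib)
      have sub: "\<not> r < length xs \<Longrightarrow> r * d + p - length xs * d = (r - length xs) * d + p"
        "\<not> s < length ys \<Longrightarrow> s * d + q - length ys * d = (s - length ys) * d + q"
        by (simp_all add: diff_mult_distrib mult_le_mono1)
      have b: "\<not> r < length xs \<Longrightarrow> (r - length xs) * d + p < length xs' * d"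
         "\<not> s < length ys \<Longrightarrow> (s - length ys) * d + q < length ys' * d"
        using rs pq by (auto intro!: block_index_less)
      show ?thesis
        using less c by (subst index_mat_four_block) (auto simp: lt[OF pq(1)] lt[OF pq(2)] sub b)
    qed
    let ?P = "\<lambda>a. (a \<noteq> 0 \<longrightarrow> h \<otimes> (xs @ xs') ! r \<otimes> inv ((ys @ ys') ! s) \<in> T) \<and>
       (\<forall>p<d. \<forall>q<d. ?M $$ (r * d + p, s * d + q) = a * X (h \<otimes> (xs @ xs') ! r \<otimes> inv ((ys @ ys') ! s)) $$ (p, q))"
    consider "r < length xs" "s < length ys" | "\<not> r < length xs" "\<not> s < length ys"
      | "r < length xs \<longleftrightarrow> \<not> s < length ys" by blast
    then show "\<exists>a. ?P a"
    proof cases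
      case 1
      then show ?thesis using A ix unfolding homog_def by (simp add: nth_append)
    next
      case 2
      then have "r - length xs < length xs'" "s - length ys < length ys'" using rs by auto
      then show ?thesis using B ix 2 unfolding homog_def by (simp add: nth_append)
    next
      case 3
      then show ?thesis using ix by (intro exI[of _ 0]) auto
    qed
  qed
qed

lemma diag_block_homog:
  assumes "\<And>i. i \<in> set is \<Longrightarrow> P i \<in> homog (xs i) (ys i) h"
  shows "diag_block_mat (map P is) \<in> homog (concat (map xs is)) (concat (map ys is)) h"
  using assms
proof (induction "is")
  case Nil
  show ?case by (rule homogI[where a = "\<lambda>_ _. 0"]) auto
next
  case (Cons i "is")
  have A: "P i \<in> homog (xs i) (ys i) h" and B: "diag_block_mat (map P is) \<in> homog (concat (map xs is)) (concat (map ys is)) h"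
    using Cons by auto
  then show ?case using four_block_homog[OF A B] homog_carrier[OF A] homog_carrier[OF B]
    by (simp add: Let_def)
qed

end

lemma diag_block_det_transpose:
  fixes P :: "nat \<Rightarrow> 'f::field mat"
  assumes "\<And>i. i \<in> set is \<Longrightarrow> P i \<in> carrier_mat (n i) (n i) \<and> det (P i) \<noteq> 0 \<and> transpose_mat (P i) = \<delta> \<cdot>\<^sub>m P i"
  shows "diag_block_mat (map P is) \<in> carrier_mat (\<Sum>i\<leftarrow>is. n i) (\<Sum>i\<leftarrow>is. n i) \<and>
    det (diag_block_mat (map P is)) \<noteq> 0 \<and> transpose_mat (diag_block_mat (map P is)) = \<delta> \<cdot>\<^sub>m diag_block_mat (map P is)"
  using assms
proof (induction "is")
  case Nil
  have "det (0\<^sub>m 0 0 :: 'f mat) = 1" by (simp add: det_dim_zero)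
  then show ?case by (auto intro!: eq_matI)
next
  case (Cons i "is")
  let ?D = "diag_block_mat (map P is)" and ?k = "\<Sum>i\<leftarrow>is. n i"
  have A: "P i \<in> carrier_mat (n i) (n i)" "det (P i) \<noteq> 0" "transpose_mat (P i) = \<delta> \<cdot>\<^sub>m P i" using Cons.prems by auto
  have D: "?D \<in> carrier_mat ?k ?k" "det ?D \<noteq> 0" "transpose_mat ?D = \<delta> \<cdot>\<^sub>m ?D" using Cons by auto
  have eq: "diag_block_mat (map P (i # is)) = four_block_mat (P i) (0\<^sub>m (n i) ?k) (0\<^sub>m ?k (n i)) ?D"
    using A D by (simp add: Let_def)
  have "det (four_block_mat (P i) (0\<^sub>m (n i) ?k) (0\<^sub>m ?k (n i)) ?D) = det (P i) * det ?D"
    by (rule det_four_block_mat_lower_left_zero[OF A(1) _ refl D(1)]) simp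
  moreover have "transpose_mat (four_block_mat (P i) (0\<^sub>m (n i) ?k) (0\<^sub>m ?k (n i)) ?D) =
     four_block_mat (transpose_mat (P i)) (transpose_mat (0\<^sub>m ?k (n i))) (transpose_mat (0\<^sub>m (n i) ?k)) (transpose_mat ?D)"
    by (rule transpose_four_block_mat) (use A D in auto)
  moreover have "four_block_mat (\<delta> \<cdot>\<^sub>m P i) (transpose_mat (0\<^sub>m ?k (n i))) (transpose_mat (0\<^sub>m (n i) ?k)) (\<delta> \<cdot>\<^sub>m ?D) =
     \<delta> \<cdot>\<^sub>m four_block_mat (P i) (0\<^sub>m (n i) ?k) (0\<^sub>m ?k (n i)) ?D"
    using A D by (intro eq_matI) auto
  ultimately show ?case unfolding eq using A D four_block_carrier_mat[OF A(1) D(1)] by simp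
qed

context elementary_realization
begin

text \<open>\<open>X t\<close> has a nonzero entry, so the scalar in the description operator is
  unique; its existence comes from \<open>T\<close> being an elementary 2-group.\<close>

lemma beta_sign:
  assumes t: "t \<in> T"
  shows "transpose_mat (X t) = beta_sign G \<beta> ab t \<cdot>\<^sub>m X t" "beta_sign G \<beta> ab t \<in> {1, - 1}"
proof -
  obtain c where c: "c \<in> {1, - 1}" "transpose_mat (X t) = c \<cdot>\<^sub>m X t" using X_transpose_ex[OF t] by blast
  have "beta_sign G \<beta> ab t = c"
    unfolding beta_sign_def
  proof (rule the_equality)
    show "transpose_mat (X t) = c \<cdot>\<^sub>m X t" by (rule c(2))
  next
    fix c' assume c': "transpose_mat (X t) = c' \<cdot>\<^sub>m X t"
    obtain p q where pq: "p < d" "q < d" "X t $$ (p, q) \<noteq> 0" using X_nonzero_entry[OF t] .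
    have "(c' \<cdot>\<^sub>m X t) $$ (p, q) = (c \<cdot>\<^sub>m X t) $$ (p, q)" using c' c(2) by simp
    then show "c' = c" using pq t by simp
  qed
  with c show "transpose_mat (X t) = beta_sign G \<beta> ab t \<cdot>\<^sub>m X t" "beta_sign G \<beta> ab t \<in> {1, - 1}" by auto
qed

lemma square_shift:
  assumes "g \<in> carrier G" "g' \<in> carrier G" "t \<in> carrier G" "g \<otimes> g' \<otimes> t = h"
  shows "h \<otimes> inv g \<otimes> inv g' = t"
proof -
  have "h \<otimes> inv g \<otimes> inv g' = t \<otimes> (g \<otimes> inv g) \<otimes> (g' \<otimes> inv g')"
    unfolding assms(4)[symmetric] using assms(1-3) by (simp only: m_ac inv_closed m_closed)
  then show ?thesis using assms(1-3) by simp
qed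

context
  fixes F :: "'a form1" and \<tau> :: "nat \<Rightarrow> 'a" and \<delta> :: 'f
  assumes data: "M_star_data G T \<beta> ab F \<tau> \<delta>"
begin

lemma form_bounds: "f_l F \<le> f_m F" "f_m F \<le> f_k F"
  and form_M_data: "M_data G T \<beta> (form_kappa F) (form_gamma F)"
  and form_q: "\<And>i. i \<in> {1..f_k F} \<Longrightarrow> 0 < f_q F i" "\<And>i. i \<in> {1..f_l F} \<Longrightarrow> odd (f_q F i)"
  and form_\<tau>: "\<And>i. i \<in> {1..f_m F} \<Longrightarrow> \<tau> i \<in> T"
  and form_\<delta>: "\<delta> \<in> {1, - 1}" "\<And>i. i \<in> {1..f_l F} \<Longrightarrow> beta_sign G \<beta> ab (\<tau> i) = \<delta>"
  using data by (auto simp: M_star_data_def is_form1_def Let_def)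

lemma form_carrier:
  "\<And>i. i \<in> {1..f_m F} \<Longrightarrow> f_g F i \<in> carrier G"
  "\<And>i. i \<in> {Suc (f_m F)..f_k F} \<Longrightarrow> f_g' F i \<in> carrier G"
  "\<And>i. i \<in> {Suc (f_m F)..f_k F} \<Longrightarrow> f_g'' F i \<in> carrier G"
  using M_dataD(2)[OF form_M_data] unfolding set_form_gamma by auto

lemma form_k: "0 < f_k F"
  using f_k_pos[OF form_bounds] M_dataD(4)[OF form_M_data] by blast

text \<open>The common value of the products in \<open>M_star_data\<close>, which turns out to be
  the degree of \<open>Phi_mat\<close>. Index 1 serves as representative: it is a self-paired
  component if there is any, and a pair otherwise.\<close>

definition form_degree :: 'a where
  "form_degree = (if 1 \<le> f_m F then f_g F 1 \<otimes> f_g F 1 \<otimes> \<tau> 1 else f_g' F 1 \<otimes> f_g'' F 1)"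

lemma form_degree_eq:
  "\<And>i. i \<in> {1..f_m F} \<Longrightarrow> f_g F i \<otimes> f_g F i \<otimes> \<tau> i = form_degree"
  "\<And>i. i \<in> {Suc (f_m F)..f_k F} \<Longrightarrow> f_g' F i \<otimes> f_g'' F i = form_degree"
proof -
  let ?p = "\<lambda>i. if i \<le> f_m F then f_g F i \<otimes> f_g F i \<otimes> \<tau> i else f_g' F i \<otimes> f_g'' F i"
  have p: "?p i = ?p 1" if "i \<in> {1..f_k F}" for i
  proof -
    have "\<forall>i\<in>{1..f_k F}. \<forall>j\<in>{1..f_k F}. ?p i = ?p j" using data unfolding M_star_data_def Let_def by blast
    then show ?thesis using that form_k by (metis One_nat_def Suc_leI atLeastAtMost_iff order_refl)
  qed
  show "f_g F i \<otimes> f_g F i \<otimes> \<tau> i = form_degree" if "i \<in> {1..f_m F}" for i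
    using p[of i] that form_bounds unfolding form_degree_def by auto
  show "f_g' F i \<otimes> f_g'' F i = form_degree" if "i \<in> {Suc (f_m F)..f_k F}" for i
    using p[of i] that unfolding form_degree_def by auto
qed

lemma form_degree_carrier: "form_degree \<in> carrier G"
proof (cases "1 \<le> f_m F")
  case True
  then show ?thesis using form_degree_eq(1)[of 1] form_carrier(1)[of 1] form_\<tau>[of 1] by (auto simp: form_degree_def)
next
  case False
  then show ?thesis using form_carrier(2,3)[of 1] form_k by (auto simp: form_degree_def)
qed

lemma form_rows_carrier: "set (form_rows F) \<subseteq> carrier G"
  unfolding form_rows_def by (rule rows_of_carrier[OF form_M_data])

text \<open>All three kinds of blocks are \<open>A \<otimes> X t\<close> with \<open>A\<close>
  invertible and the transpose of \<open>A\<close> equal to \<delta> times the sign of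
  \<open>t\<close> times \<open>A\<close>. Transposing \<open>X t\<close> contributes this sign once
  more, so it cancels. For a pair \<open>t\<close> is the unit, and the off-diagonal shape of
  \<open>S_mat\<close> meets only positions where \<open>h g'^-1 g''^-1 = 1\<close>.\<close>

lemma Phi_block:
  assumes i: "i \<in> {1..f_k F}"
  shows "Phi_block G \<beta> ab F \<tau> \<delta> i \<in> homog (map (m_inv G) (row_block F i)) (row_block F i) form_degree"
    "det (Phi_block G \<beta> ab F \<tau> \<delta> i) \<noteq> 0"
    "transpose_mat (Phi_block G \<beta> ab F \<tau> \<delta> i) = \<delta> \<cdot>\<^sub>m Phi_block G \<beta> ab F \<tau> \<delta> i"
proof -
  let ?P = "Phi_block G \<beta> ab F \<tau> \<delta> i" and ?rb = "row_block F i" and ?h = form_degree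
  have dd: "\<delta> * \<delta> = 1" using form_\<delta> by auto
  have "\<exists>n A t. ?P = kron A (X t) \<and> rinv n A \<and> length ?rb = n \<and> t \<in> T \<and>
      (\<forall>r<n. \<forall>s<n. A $$ (r, s) \<noteq> 0 \<longrightarrow> ?h \<otimes> inv (?rb ! r) \<otimes> inv (?rb ! s) = t) \<and>
      transpose_mat A = (\<delta> * beta_sign G \<beta> ab t) \<cdot>\<^sub>m A"
  proof (cases "i \<le> f_m F")
    case True
    then have im: "i \<in> {1..f_m F}" using i by simp
    have g: "f_g F i \<in> carrier G" and t: "\<tau> i \<in> T" using form_carrier(1)[OF im] form_\<tau>[OF im] by auto
    have deg: "?h \<otimes> inv (f_g F i) \<otimes> inv (f_g F i) = \<tau> i"
      by (rule square_shift[OF g g _ form_degree_eq(1)[OF im]]) (use t in simp)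
    note bs = beta_sign(2)[OF t]
    show ?thesis
    proof (cases "i \<le> f_l F")
      case True
      then have b: "beta_sign G \<beta> ab (\<tau> i) = \<delta>" using form_\<delta>(2) i by auto
      show ?thesis
        by (rule exI[of _ "f_q F i"], rule exI[of _ "1\<^sub>m (f_q F i)"], rule exI[of _ "\<tau> i"])
          (use True deg t b dd in \<open>auto simp: Phi_block_def row_block_def\<close>)
    next
      case False
      have m1: "\<delta> * beta_sign G \<beta> ab (\<tau> i) = (if beta_sign G \<beta> ab (\<tau> i) = \<delta> then 1 else - 1)"
        using bs form_\<delta>(1) dd by auto
      show ?thesis
        by (rule exI[of _ "2 * f_q F i"],
            rule exI[of _ "if beta_sign G \<beta> ab (\<tau> i) = \<delta> then 1\<^sub>m (2 * f_q F i) else S_mat (f_q F i) (- 1)"],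
            rule exI[of _ "\<tau> i"])
          (use False \<open>i \<le> f_m F\<close> deg t m1 S_mat_rinv[of "- 1 :: 'f" "f_q F i"] S_mat_transpose[of "- 1 :: 'f" "f_q F i"]
            in \<open>auto simp: Phi_block_def row_block_def\<close>)
    qed
  next
    case False
    then have im: "i \<in> {Suc (f_m F)..f_k F}" using i by simp
    note g = form_carrier(2,3)[OF im]
    have deg: "?h \<otimes> inv (f_g' F i) \<otimes> inv (f_g'' F i) = \<one>" "?h \<otimes> inv (f_g'' F i) \<otimes> inv (f_g' F i) = \<one>"
      using form_degree_eq(2)[OF im] g m_comm[OF g] form_degree_carrier
        square_shift[OF g one_closed] square_shift[OF g(2,1) one_closed] by simp_all
    have b: "beta_sign G \<beta> ab \<one> = 1"
    proof -
      have e: "(1\<^sub>m d :: 'f mat) = beta_sign G \<beta> ab \<one> \<cdot>\<^sub>m 1\<^sub>m d"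
        using beta_sign(1)[OF T_one] unfolding X_one transpose_one .
      have "(1\<^sub>m d :: 'f mat) $$ (0, 0) = (beta_sign G \<beta> ab \<one> \<cdot>\<^sub>m 1\<^sub>m d) $$ (0, 0)" by (rule arg_cong[OF e])
      then show ?thesis using d_pos by simp
    qed
    have len: "length ?rb = 2 * f_q F i" using False form_bounds by (simp add: row_block_def)
    have nz: "?h \<otimes> inv (?rb ! r) \<otimes> inv (?rb ! s) = \<one>"
      if "r < 2 * f_q F i" "s < 2 * f_q F i" "S_mat (f_q F i) \<delta> $$ (r, s) \<noteq> 0" for r s
      using that deg False form_bounds
      by (auto simp: S_mat_index row_block_def nth_append split: if_splits)
    show ?thesis
      by (rule exI[of _ "2 * f_q F i"], rule exI[of _ "S_mat (f_q F i) \<delta>"], rule exI[of _ \<one>])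
        (use False form_bounds len nz b S_mat_rinv[OF dd] S_mat_transpose[OF dd] in \<open>auto simp: Phi_block_def\<close>)
  qed
  then obtain n A t where A: "?P = kron A (X t)" "rinv n A" "length ?rb = n" "t \<in> T"
    "\<And>r s. r < n \<Longrightarrow> s < n \<Longrightarrow> A $$ (r, s) \<noteq> 0 \<Longrightarrow> ?h \<otimes> inv (?rb ! r) \<otimes> inv (?rb ! s) = t"
    "transpose_mat A = (\<delta> * beta_sign G \<beta> ab t) \<cdot>\<^sub>m A" by blast
  show "?P \<in> homog (map (m_inv G) ?rb) ?rb ?h"
    unfolding A(1) by (rule kron_homog[OF _ A(4)]) (use rinv_carrier[OF A(2)] A(3,5) in auto)
  show "det ?P \<noteq> 0" unfolding A(1) by (rule rinv_det[OF rinv_kron[OF A(2) X_rinv[OF A(4)]]])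
  have b2: "beta_sign G \<beta> ab t * beta_sign G \<beta> ab t = 1" using beta_sign(2)[OF A(4)] by auto
  show "transpose_mat ?P = \<delta> \<cdot>\<^sub>m ?P"
    unfolding A(1) kron_transpose A(6) beta_sign(1)[OF A(4)] kron_smult smult_smult_mat
    by (simp add: mult_ac b2)
qed

theorem Phi_mat_form:
  shows "Phi_mat G \<beta> ab F \<tau> \<delta> \<in> homog (map (m_inv G) (form_rows F)) (form_rows F) form_degree"
    "det (Phi_mat G \<beta> ab F \<tau> \<delta>) \<noteq> 0"
    "transpose_mat (Phi_mat G \<beta> ab F \<tau> \<delta>) = \<delta> \<cdot>\<^sub>m Phi_mat G \<beta> ab F \<tau> \<delta>"
proof -
  have "Phi_mat G \<beta> ab F \<tau> \<delta> \<in> homog (concat (map (\<lambda>i. map (m_inv G) (row_block F i)) [1..<Suc (f_k F)]))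
      (concat (map (row_block F) [1..<Suc (f_k F)])) form_degree"
    unfolding Phi_mat_def by (rule diag_block_homog) (use Phi_block(1) in auto)
  then show "Phi_mat G \<beta> ab F \<tau> \<delta> \<in> homog (map (m_inv G) (form_rows F)) (form_rows F) form_degree"
    unfolding form_rows_eq[OF form_bounds] by (simp add: map_concat comp_def)
  have c: "Phi_block G \<beta> ab F \<tau> \<delta> i \<in> carrier_mat (length (row_block F i) * d) (length (row_block F i) * d)"
    if "i \<in> {1..f_k F}" for i using homog_carrier[OF Phi_block(1)[OF that]] by simp
  have "Phi_block G \<beta> ab F \<tau> \<delta> i \<in> carrier_mat (length (row_block F i) * d) (length (row_block F i) * d) \<and>
      det (Phi_block G \<beta> ab F \<tau> \<delta> i) \<noteq> 0 \<and>
      transpose_mat (Phi_block G \<beta> ab F \<tau> \<delta> i) = \<delta> \<cdot>\<^sub>m Phi_block G \<beta> ab F \<tau> \<delta> i"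
    if "i \<in> set [1..<Suc (f_k F)]" for i
  proof -
    have "i \<in> {1..f_k F}" using that by auto
    then show ?thesis using c Phi_block(2,3) by blast
  qed
  from diag_block_det_transpose[of "[1..<Suc (f_k F)]" "Phi_block G \<beta> ab F \<tau> \<delta>"
      "\<lambda>i. length (row_block F i) * d" \<delta>, OF this]
  have "det (diag_block_mat (map (Phi_block G \<beta> ab F \<tau> \<delta>) [1..<Suc (f_k F)])) \<noteq> 0 \<and>
    transpose_mat (diag_block_mat (map (Phi_block G \<beta> ab F \<tau> \<delta>) [1..<Suc (f_k F)])) =
     \<delta> \<cdot>\<^sub>m diag_block_mat (map (Phi_block G \<beta> ab F \<tau> \<delta>) [1..<Suc (f_k F)])"
    by blast
  then show "det (Phi_mat G \<beta> ab F \<tau> \<delta>) \<noteq> 0"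
    "transpose_mat (Phi_mat G \<beta> ab F \<tau> \<delta>) = \<delta> \<cdot>\<^sub>m Phi_mat G \<beta> ab F \<tau> \<delta>"
    unfolding Phi_mat_def by auto
qed

end

end

section \<open>Labelled components and the equivalence of data\<close>

text \<open>Positive multiplicity makes the label of component \<open>i\<close> occur on the other
  side, and as labels are distinct there, the number of occurrences is the multiplicity of one
  component.\<close>

lemma rows_match:
  assumes len: "length \<kappa> = length \<gamma>" "length \<kappa>' = length \<gamma>'"
    and dist: "distinct (map f \<gamma>)" "distinct (map f' \<gamma>')"
    and ms: "mset (map f (rows_of \<kappa> \<gamma>)) = mset (map f' (rows_of \<kappa>' \<gamma>'))"
    and pos: "\<And>n. n \<in> set \<kappa> \<Longrightarrow> 0 < n" and i: "i < length \<gamma>"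
  obtains j where "j < length \<gamma>'" "f' (\<gamma>' ! j) = f (\<gamma> ! i)" "\<kappa>' ! j = \<kappa> ! i"
proof -
  have c: "count (mset (map f' (rows_of \<kappa>' \<gamma>'))) (f (\<gamma> ! i)) = \<kappa> ! i"
    unfolding ms[symmetric] by (rule count_map_rows_of[OF len(1) dist(1) i])
  then have "0 < count (mset (map f' (rows_of \<kappa>' \<gamma>'))) (f (\<gamma> ! i))"
    using pos[of "\<kappa> ! i"] i len by simp
  then have "f (\<gamma> ! i) \<in> set (map f' (rows_of \<kappa>' \<gamma>'))"
    by (metis count_greater_zero_iff set_mset_mset)
  then obtain x where x: "x \<in> set (rows_of \<kappa>' \<gamma>')" "f (\<gamma> ! i) = f' x"
    unfolding set_map by (rule imageE)
  have "x \<in> set \<gamma>'" by (rule subsetD[OF set_rows_of_subset x(1)])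
  then obtain j where j: "j < length \<gamma>'" "x = \<gamma>' ! j" unfolding in_set_conv_nth by blast
  have e: "f' (\<gamma>' ! j) = f (\<gamma> ! i)" using x(2) j(2) by simp
  have "\<kappa>' ! j = \<kappa> ! i" using count_map_rows_of[OF len(2) dist(2) j(1)] c unfolding e by simp
  with that[OF j(1) e] show thesis .
qed

text \<open>Names for the components of \<gamma> that do not depend on positions: tag 0 for
  \<open>g_i\<close>, tags 1 and 2 for \<open>g_i'\<close> and \<open>g_i''\<close>, listed in the
  order of \<open>form_gamma\<close>.\<close>

definition labels :: "'a form1 \<Rightarrow> (nat \<times> nat) list" where
  "labels F = map (\<lambda>i. (i, 0)) [1..<Suc (f_m F)] @
     concat (map (\<lambda>i. [(i, 1), (i, 2)]) [Suc (f_m F)..<Suc (f_k F)])"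

definition label_val :: "'a form1 \<Rightarrow> nat \<times> nat \<Rightarrow> 'a" where
  "label_val F = (\<lambda>(i, e). if e = 0 then f_g F i else if e = 1 then f_g' F i else f_g'' F i)"

definition label_mult :: "'a form1 \<Rightarrow> nat \<times> nat \<Rightarrow> nat" where
  "label_mult F = (\<lambda>(i, e). if i \<le> f_l F then f_q F i else if i \<le> f_m F then 2 * f_q F i else f_q F i)"

text \<open>\<open>3 - e\<close> exchanges the tags 1 and 2, so the self-paired components are the
  fixed points.\<close>

fun label_dual :: "nat \<times> nat \<Rightarrow> nat \<times> nat" where
  "label_dual (i, e) = (i, if e = 0 then 0 else 3 - e)"

lemma set_labels: "set (labels F) = {1..f_m F} \<times> {0} \<union> {Suc (f_m F)..f_k F} \<times> {1, 2}"
  unfolding labels_def by auto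

lemma form_gamma_labels: "form_gamma F = map (label_val F) (labels F)"
  unfolding form_gamma_def labels_def
  by (simp add: map_concat comp_def label_val_def)

lemma form_kappa_labels:
  assumes "f_l F \<le> f_m F"
  shows "form_kappa F = map (label_mult F) (labels F)"
proof -
  have "[1..<Suc (f_m F)] = [1..<Suc (f_l F)] @ [Suc (f_l F)..<Suc (f_m F)]" using assms by (intro upt_append) auto
  moreover have "map (f_q F) [1..<Suc (f_l F)] = map (\<lambda>i. label_mult F (i, 0)) [1..<Suc (f_l F)]"
    "map (\<lambda>i. 2 * f_q F i) [Suc (f_l F)..<Suc (f_m F)] = map (\<lambda>i. label_mult F (i, 0)) [Suc (f_l F)..<Suc (f_m F)]"
    by (rule map_cong; auto simp: label_mult_def)+
  moreover have "map (\<lambda>i. [f_q F i, f_q F i]) [Suc (f_m F)..<Suc (f_k F)] =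
      map (\<lambda>i. [label_mult F (i, 1), label_mult F (i, 2)]) [Suc (f_m F)..<Suc (f_k F)]"
    by (rule map_cong) (use assms in \<open>auto simp: label_mult_def\<close>)
  ultimately show ?thesis
    unfolding form_kappa_def labels_def by (simp only: map_append map_map map_concat comp_def list.map append_assoc)
qed

lemma label_dual_in: "a \<in> set (labels F) \<Longrightarrow> label_dual a \<in> set (labels F)"
  unfolding set_labels by auto

lemma label_dual_fixed: "a \<in> set (labels F) \<Longrightarrow> label_dual a = a \<longleftrightarrow> snd a = 0"
  unfolding set_labels by auto

context elementary_realization
begin

text \<open>Elements of \<open>T\<close> have trivial square. Hence the squares in the equations for
  \<tau> depend only on cosets, although these equations are exact.\<close>

lemma square_coset:
  assumes "x \<in> carrier G" "y \<in> carrier G" "coset x = coset y"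
  shows "x \<otimes> x = y \<otimes> y"
proof -
  let ?u = "inv x \<otimes> y"
  have u: "?u \<in> T" using assms by (simp add: coset_eq)
  have "y = x \<otimes> ?u" using assms by (simp flip: m_assoc)
  then have "y \<otimes> y = x \<otimes> x \<otimes> (?u \<otimes> ?u)" using assms u by (metis (no_types) T_carrier m_assoc m_comm m_closed)
  also have "?u \<otimes> ?u = \<one>" using elem u by (simp add: elementary_2_group_def)
  finally show ?thesis using assms by simp
qed

lemma label_val_carrier:
  assumes "M_star_data G T \<beta> ab F \<tau> \<delta>" "a \<in> set (labels F)"
  shows "label_val F a \<in> carrier G"
  using assms(2) M_dataD(2)[OF form_M_data[OF assms(1)]] unfolding form_gamma_labels by auto

lemma label_inj:
  assumes "M_star_data G T \<beta> ab F \<tau> \<delta>" "a \<in> set (labels F)" "b \<in> set (labels F)"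
    "coset (label_val F a) = coset (label_val F b)"
  shows "a = b"
proof -
  have "inj_on (\<lambda>a. coset (label_val F a)) (set (labels F))"
    using M_dataD(3)[OF form_M_data[OF assms(1)]] unfolding form_gamma_labels
    by (simp add: distinct_map comp_def)
  then show ?thesis using assms by (auto simp: inj_on_def)
qed

text \<open>The equations \<open>g_i^2 t_i = h\<close> and \<open>g_i' g_i'' = h\<close> both say
  that the partner of \<open>g\<close> is \<open>h g^-1\<close> modulo \<open>T\<close>. So the
  pairing can be recovered from \<open>h\<close> and the cosets.\<close>

lemma label_dual_coset:
  assumes d: "M_star_data G T \<beta> ab F \<tau> \<delta>" and a: "a \<in> set (labels F)"
  shows "coset (label_val F (label_dual a)) = coset (form_degree F \<tau> \<otimes> inv (label_val F a))"
proof -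
  note c = form_carrier[OF d] and e = form_degree_eq[OF d]
  obtain i k where ik: "a = (i, k)" by (cases a)
  consider "i \<in> {1..f_m F}" "k = 0" | "i \<in> {Suc (f_m F)..f_k F}" "k = 1" | "i \<in> {Suc (f_m F)..f_k F}" "k = 2"
    using a unfolding set_labels ik by auto
  then show ?thesis
  proof cases
    case 1
    note g = c(1)[OF 1(1)] and t = form_\<tau>[OF d 1(1)]
    have "form_degree F \<tau> \<otimes> inv (f_g F i) = f_g F i \<otimes> \<tau> i \<otimes> (f_g F i \<otimes> inv (f_g F i))"
      unfolding e(1)[OF 1(1), symmetric] using g t by (simp only: m_ac inv_closed m_closed T_carrier)
    also have "\<dots> = f_g F i \<otimes> \<tau> i" using g t by simp
    finally show ?thesis using coset_mult_T[OF g t] 1 ik by (simp add: label_val_def)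
  next
    case 2
    note g = c(2,3)[OF 2(1)]
    have "form_degree F \<tau> \<otimes> inv (f_g' F i) = f_g'' F i \<otimes> (f_g' F i \<otimes> inv (f_g' F i))"
      unfolding e(2)[OF 2(1), symmetric] using g by (simp only: m_ac inv_closed m_closed)
    then show ?thesis using g 2 ik by (simp add: label_val_def)
  next
    case 3
    note g = c(2,3)[OF 3(1)]
    have "form_degree F \<tau> \<otimes> inv (f_g'' F i) = f_g' F i \<otimes> (f_g'' F i \<otimes> inv (f_g'' F i))"
      unfolding e(2)[OF 3(1), symmetric] using g by (simp only: m_ac inv_closed m_closed)
    then show ?thesis using g 3 ik by (simp add: label_val_def)
  qed
qed

lemma form1_equiv_imp_mset:
  assumes d1: "M_star_data G T \<beta> ab F1 \<tau>1 \<delta>1" and d2: "M_star_data G T \<beta> ab F2 \<tau>2 \<delta>2"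
    and eq: "form1_equiv G T F1 \<tau>1 F2 \<tau>2"
  obtains k where "k \<in> carrier G" "form_degree F1 \<tau>1 = k \<otimes> form_degree F2 \<tau>2 \<otimes> k"
    "mset (map (\<lambda>y. coset (k \<otimes> y)) (form_rows F2)) = mset (map coset (form_rows F1))"
proof -
  show thesis using eq unfolding form1_equiv_def
  proof (elim conjE bexE exE, goal_cases)
  case (1 g \<pi>)
  note lmk = 1(1-3) and g = 1(4) and \<pi> = 1(5) and im = 1(6-8) and \<tau> = 1(12)
  note q = 1(9)[rule_format] and gg = 1(10)[rule_format] and pairs = 1(11)[rule_format]
  note b1 = form_bounds[OF d1] and c1 = form_carrier[OF d1] and b2 = form_bounds[OF d2] and c2 = form_carrier[OF d2]
  let ?h1 = "form_degree F1 \<tau>1" and ?h2 = "form_degree F2 \<tau>2"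
  note h1 = form_degree_carrier[OF d1] and h2 = form_degree_carrier[OF d2]
  have imm: "\<pi> i \<in> {1..f_m F1}" if "i \<in> {1..f_m F1}" for i
  proof (cases "i \<le> f_l F1")
    case True
    then have "\<pi> i \<in> {1..f_l F1}" using that im(1) by auto
    then show ?thesis using b1 by auto
  next
    case False
    then have "\<pi> i \<in> {Suc (f_l F1)..f_m F1}" using that im(2) by auto
    then show ?thesis by auto
  qed
  have rc: "coset (inv g \<otimes> y) = coset x" if "(y, x \<otimes> g) \<in> rcong T" "x \<in> carrier G" for x y
  proof -
    have y: "y \<in> carrier G" using that by (simp add: rcong_iff)
    have "coset y = coset (x \<otimes> g)" using that y g by (simp add: coset_eq_rcong)
    then have "coset (inv g \<otimes> y) = coset (inv g \<otimes> (x \<otimes> g))" using that y g by (simp add: coset_mult_cong)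
    also have "inv g \<otimes> (x \<otimes> g) = x" using that(2) g by (simp add: m_comm[of x g]) (simp flip: m_assoc)
    finally show ?thesis .
  qed
  \<comment> \<open>For \<open>m > 0\<close> equal \<open>t_i\<close> and squares that depend only
    on cosets suffice. For \<open>m = 0\<close> the extra clause of the equivalence is used at one
    index, the product being the same for all pairs of one set of data.\<close>
  have h21: "?h2 = ?h1 \<otimes> (g \<otimes> g)"
  proof (cases "0 < f_m F1")
    case True
    then have 1: "1 \<in> {1..f_m F1}" by simp
    let ?x = "f_g F2 1" and ?y = "f_g F1 (\<pi> 1)"
    note p1 = imm[OF 1] and x = c2(1)[of 1] and y = c1(1)[OF imm[OF 1]]
    have x: "?x \<in> carrier G" using x 1 lmk by simp
    have t: "\<tau>2 1 = \<tau>1 (\<pi> 1)" "\<tau>1 (\<pi> 1) \<in> T" using \<tau> True 1 form_\<tau>[OF d1 p1] by auto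
    have "coset ?x = coset (?y \<otimes> g)" using gg[OF 1] x y g by (simp add: coset_eq_rcong)
    then have "?x \<otimes> ?x = (?y \<otimes> g) \<otimes> (?y \<otimes> g)" using x y g by (intro square_coset) auto
    then have "?h2 = (?y \<otimes> g) \<otimes> (?y \<otimes> g) \<otimes> \<tau>1 (\<pi> 1)"
      using form_degree_eq(1)[OF d2, of 1] 1 lmk t by simp
    also have "\<dots> = ?y \<otimes> ?y \<otimes> \<tau>1 (\<pi> 1) \<otimes> (g \<otimes> g)" using y g t(2) by (simp only: m_ac m_closed T_carrier)
    also have "?y \<otimes> ?y \<otimes> \<tau>1 (\<pi> 1) = ?h1" by (rule form_degree_eq(1)[OF d1 p1])
    finally show ?thesis .
  next
    case False
    then obtain i where i: "i \<in> {1..f_k F1}" "f_g' F2 i \<otimes> f_g'' F2 i = f_g' F1 (\<pi> i) \<otimes> f_g'' F1 (\<pi> i) \<otimes> (g \<otimes> g)"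
      using \<tau> by auto
    have "\<pi> i \<in> {Suc (f_m F1)..f_k F1}" "i \<in> {Suc (f_m F2)..f_k F2}" using im(3) i False lmk by auto
    then show ?thesis using i(2) form_degree_eq(2)[OF d1, of "\<pi> i"] form_degree_eq(2)[OF d2, of i] by simp
  qed
  show thesis
  \<comment> \<open>The equivalence translates the first data by \<open>g\<close> to the second,
    whereas \<open>k\<close> carries rows of the second back to the first.\<close>
  proof (rule that[of "inv g"])
    show "inv g \<in> carrier G" using g by simp
    have "inv g \<otimes> ?h2 \<otimes> inv g = ?h1 \<otimes> (inv g \<otimes> g) \<otimes> (inv g \<otimes> g)"
      unfolding h21 using g h1 by (simp only: m_ac m_closed inv_closed)
    then show "?h1 = inv g \<otimes> ?h2 \<otimes> inv g" using g h1 by simp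
    have blk: "mset (map (\<lambda>y. coset (inv g \<otimes> y)) (row_block F2 i)) = mset (map coset (row_block F1 (\<pi> i)))"
      if i: "i \<in> {1..f_k F1}" for i
    proof -
      consider "i \<in> {1..f_l F1}" | "i \<in> {Suc (f_l F1)..f_m F1}" | "i \<in> {Suc (f_m F1)..f_k F1}" using i by fastforce
      then show ?thesis
      proof cases
        case 1
        then have p: "\<pi> i \<in> {1..f_l F1}" "i \<in> {1..f_m F1}" using imageI[OF 1, of \<pi>, unfolded im(1)] b1 by auto
        note p = p(1) imm[OF p(2)] p(2)
        have "coset (inv g \<otimes> f_g F2 i) = coset (f_g F1 (\<pi> i))" by (rule rc[OF gg[OF p(3)] c1(1)[OF p(2)]])
        then show ?thesis using 1 p lmk q[OF i] by (simp add: row_block_def)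
      next
        case 2
        then have p: "\<pi> i \<in> {Suc (f_l F1)..f_m F1}" "\<pi> i \<in> {1..f_m F1}" "i \<in> {1..f_m F1}"
          using imageI[OF 2, of \<pi>, unfolded im(2)] by auto
        have "coset (inv g \<otimes> f_g F2 i) = coset (f_g F1 (\<pi> i))" by (rule rc[OF gg[OF p(3)] c1(1)[OF p(2)]])
        then show ?thesis using 2 p lmk q[OF i] by (simp add: row_block_def)
      next
        case 3
        have p: "\<pi> i \<in> {Suc (f_m F1)..f_k F1}" using imageI[OF 3, of \<pi>] unfolding im(3) .
        have "coset (inv g \<otimes> f_g' F2 i) = coset (f_g' F1 (\<pi> i)) \<and> coset (inv g \<otimes> f_g'' F2 i) = coset (f_g'' F1 (\<pi> i)) \<or>
          coset (inv g \<otimes> f_g' F2 i) = coset (f_g'' F1 (\<pi> i)) \<and> coset (inv g \<otimes> f_g'' F2 i) = coset (f_g' F1 (\<pi> i))"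
          using pairs[OF 3] rc c1(2,3)[OF p] by blast
        then show ?thesis using 3 p lmk q[OF i] b1 b2 by (auto simp: row_block_def add.commute)
      qed
    qed
    have "mset (map (\<lambda>y. coset (inv g \<otimes> y)) (form_rows F2)) =
       (\<Sum>i\<in>{1..f_k F1}. mset (map (\<lambda>y. coset (inv g \<otimes> y)) (row_block F2 i)))"
      unfolding mset_form_rows[OF b2] lmk ..
    also have "\<dots> = (\<Sum>i\<in>{1..f_k F1}. mset (map coset (row_block F1 (\<pi> i))))"
      by (rule sum.cong[OF refl blk])
    also have "\<dots> = (\<Sum>i\<in>{1..f_k F1}. mset (map coset (row_block F1 i)))"
      using sum.permute[OF \<pi>, of "\<lambda>i. mset (map coset (row_block F1 i))"] by (simp add: comp_def)
    also have "\<dots> = mset (map coset (form_rows F1))" unfolding mset_form_rows[OF b1] ..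
    finally show "mset (map (\<lambda>y. coset (inv g \<otimes> y)) (form_rows F2)) = mset (map coset (form_rows F1))" .
  qed
qed
qed

text \<open>Matching the labels of both data by their cosets commutes with \<open>label_dual\<close>.\<close>

lemma mset_imp_form1_equiv:
  assumes d1: "M_star_data G T \<beta> ab F1 \<tau>1 \<delta>1" and d2: "M_star_data G T \<beta> ab F2 \<tau>2 \<delta>2"
    and k: "k \<in> carrier G" and h: "form_degree F1 \<tau>1 = k \<otimes> form_degree F2 \<tau>2 \<otimes> k"
    and ms: "mset (map (\<lambda>y. coset (k \<otimes> y)) (form_rows F2)) = mset (map coset (form_rows F1))"
  shows "form1_equiv G T F1 \<tau>1 F2 \<tau>2"
proof -
  let ?h1 = "form_degree F1 \<tau>1" and ?h2 = "form_degree F2 \<tau>2"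
  let ?L1 = "labels F1" and ?L2 = "labels F2" and ?v1 = "label_val F1" and ?v2 = "label_val F2"
  note b1 = form_bounds[OF d1] and b2 = form_bounds[OF d2]
  note h1 = form_degree_carrier[OF d1] and h2 = form_degree_carrier[OF d2]
  note v1 = label_val_carrier[OF d1] and v2 = label_val_carrier[OF d2]
  note kap1 = form_kappa_labels[OF b1(1)] and kap2 = form_kappa_labels[OF b2(1)]
  \<comment> \<open>The matching is a relation on labels. It is shown to be a bijection compatible
    with multiplicities and with \<open>label_dual\<close> before a permutation of the indices is
    extracted from it.\<close>
  define mt where "mt a b \<longleftrightarrow> a \<in> set ?L2 \<and> b \<in> set ?L1 \<and> coset (k \<otimes> ?v2 a) = coset (?v1 b)" for a b
  have dist1: "distinct (map coset (form_gamma F1))" by (rule M_dataD(3)[OF form_M_data[OF d1]])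
  have dist2: "distinct (map (\<lambda>y. coset (k \<otimes> y)) (form_gamma F2))"
  proof -
    have "distinct (map coset (form_gamma F2))" by (rule M_dataD(3)[OF form_M_data[OF d2]])
    moreover have "inj_on (\<lambda>y. coset (k \<otimes> y)) (set (form_gamma F2))"
      if "inj_on coset (set (form_gamma F2))"
    proof (rule inj_onI)
      fix x y assume xy: "x \<in> set (form_gamma F2)" "y \<in> set (form_gamma F2)" "coset (k \<otimes> x) = coset (k \<otimes> y)"
      then have "x \<in> carrier G" "y \<in> carrier G" using M_dataD(2)[OF form_M_data[OF d2]] by auto
      then have "coset x = coset y" using xy k by (simp add: coset_mult_cong)
      then show "x = y" using that xy by (auto simp: inj_on_def)
    qed
    ultimately show ?thesis by (simp add: distinct_map)
  qed
  have pos1: "0 < n" if "n \<in> set (form_kappa F1)" for n by (rule M_dataD(5)[OF form_M_data[OF d1] that])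
  have pos2: "0 < n" if "n \<in> set (form_kappa F2)" for n by (rule M_dataD(5)[OF form_M_data[OF d2] that])
  have to1: "\<exists>b. mt a b \<and> label_mult F1 b = label_mult F2 a" if a: "a \<in> set ?L2" for a
  proof -
    obtain i where i: "i < length ?L2" "a = ?L2 ! i" using a unfolding in_set_conv_nth by blast
    obtain j where "j < length (form_gamma F1)" "coset (form_gamma F1 ! j) = coset (k \<otimes> form_gamma F2 ! i)"
      "form_kappa F1 ! j = form_kappa F2 ! i"
      by (rule rows_match[OF length_form[OF b2] length_form[OF b1] dist2 dist1 ms[unfolded form_rows_def] pos2, of i])
        (use i in \<open>auto simp: form_gamma_labels\<close>)
    then have "mt a (?L1 ! j) \<and> label_mult F1 (?L1 ! j) = label_mult F2 a"
      using i a by (auto simp: form_gamma_labels kap1 kap2 mt_def)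
    then show ?thesis by blast
  qed
  have to2: "\<exists>a. mt a b" if b: "b \<in> set ?L1" for b
  proof -
    obtain i where i: "i < length ?L1" "b = ?L1 ! i" using b unfolding in_set_conv_nth by blast
    obtain j where "j < length (form_gamma F2)" "coset (k \<otimes> form_gamma F2 ! j) = coset (form_gamma F1 ! i)"
      "form_kappa F2 ! j = form_kappa F1 ! i"
      by (rule rows_match[OF length_form[OF b1] length_form[OF b2] dist1 dist2 ms[unfolded form_rows_def, symmetric] pos1, of i])
        (use i in \<open>auto simp: form_gamma_labels\<close>)
    then have "mt (?L2 ! j) b" using i b by (auto simp: form_gamma_labels mt_def)
    then show ?thesis by blast
  qed
  have uniq1: "b = b'" if "mt a b" "mt a b'" for a b b'
    using that label_inj[OF d1] by (auto simp: mt_def)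
  have uniq2: "a = a'" if "mt a b" "mt a' b" for a a' b
  proof -
    have "coset (k \<otimes> ?v2 a) = coset (k \<otimes> ?v2 a')" "?v2 a \<in> carrier G" "?v2 a' \<in> carrier G"
      using that v2 by (auto simp: mt_def)
    then have "coset (?v2 a) = coset (?v2 a')" using k by (simp add: coset_mult_cong)
    then show ?thesis using label_inj[OF d2] that by (auto simp: mt_def)
  qed
  \<comment> \<open>Here the relation between the two degrees enters: translation by
    \<open>k\<close> turns \<open>h2 x^-1\<close> into \<open>h1 (k x)^-1\<close>.\<close>
  have dual: "mt (label_dual a) (label_dual b)" if m: "mt a b" for a b
  proof -
    have ab: "a \<in> set ?L2" "b \<in> set ?L1" and e: "coset (k \<otimes> ?v2 a) = coset (?v1 b)" using m by (auto simp: mt_def)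
    note ca = v2[OF ab(1)] and cb = v1[OF ab(2)] and ca' = v2[OF label_dual_in[OF ab(1)]]
    have "(k \<otimes> ?v2 a) \<otimes> inv (?v1 b) \<in> T" using e ca cb k by (simp add: coset_eq')
    moreover have "(k \<otimes> (?h2 \<otimes> inv (?v2 a))) \<otimes> inv (?h1 \<otimes> inv (?v1 b)) = inv ((k \<otimes> ?v2 a) \<otimes> inv (?v1 b))"
    proof -
      have "(k \<otimes> (?h2 \<otimes> inv (?v2 a))) \<otimes> inv (?h1 \<otimes> inv (?v1 b)) =
         (inv k \<otimes> inv (?v2 a) \<otimes> ?v1 b) \<otimes> (k \<otimes> inv k) \<otimes> (?h2 \<otimes> inv ?h2)"
        unfolding h using ca cb k h2 by (simp only: inv_mult inv_inv m_ac m_closed inv_closed)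
      also have "\<dots> = inv ((k \<otimes> ?v2 a) \<otimes> inv (?v1 b))"
        using ca cb k h2 by (simp add: inv_mult)
      finally show ?thesis .
    qed
    ultimately have "coset (k \<otimes> (?h2 \<otimes> inv (?v2 a))) = coset (?h1 \<otimes> inv (?v1 b))"
      using ca cb k h1 h2 by (simp add: coset_eq')
    moreover have "coset (k \<otimes> ?v2 (label_dual a)) = coset (k \<otimes> (?h2 \<otimes> inv (?v2 a)))"
      using label_dual_coset[OF d2 ab(1)] ca' ca h2 k by (simp add: coset_mult_cong)
    ultimately show ?thesis using label_dual_coset[OF d1 ab(2)] label_dual_in[OF ab(1)] label_dual_in[OF ab(2)]
      by (simp add: mt_def)
  qed
  have fixed: "snd a = 0 \<longleftrightarrow> snd b = 0" if m: "mt a b" for a b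
  proof -
    have ab: "a \<in> set ?L2" "b \<in> set ?L1" using m by (auto simp: mt_def)
    have "label_dual a = a \<longleftrightarrow> label_dual b = b" using dual[OF m] m uniq1 uniq2 by metis
    then show ?thesis using label_dual_fixed ab by metis
  qed
  have mult: "label_mult F1 b = label_mult F2 a" if m: "mt a b" for a b
    using to1[of a] uniq1[OF m] m by (auto simp: mt_def)
  \<comment> \<open>\<open>e i\<close> is the tag of the label that represents index
    \<open>i\<close>: 0 for a self-paired component, 1 for the first member of a pair.\<close>
  define e where "e i = (if i \<le> f_m F2 then 0 else 1 :: nat)" for i
  have eL: "(i, e i) \<in> set ?L2" if "i \<in> {1..f_k F2}" for i using that unfolding set_labels e_def by auto
  define \<pi> where "\<pi> i = (if i \<in> {1..f_k F2} then fst (SOME b. mt (i, e i) b) else i)" for i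
  have \<pi>: "\<exists>b. mt (i, e i) b \<and> fst b = \<pi> i" if i: "i \<in> {1..f_k F2}" for i
  proof -
    have "\<exists>b. mt (i, e i) b" using to1[OF eL[OF i]] by blast
    then have "mt (i, e i) (SOME b. mt (i, e i) b)" by (rule someI_ex)
    then show ?thesis using i by (intro exI[of _ "SOME b. mt (i, e i) b"]) (simp add: \<pi>_def)
  qed
  have \<pi>m: "mt (i, 0) (\<pi> i, 0)" "\<pi> i \<in> {1..f_m F1}" if i: "i \<in> {1..f_m F2}" for i
  proof -
    have ik: "i \<in> {1..f_k F2}" using i b2 by auto
    obtain b where b: "mt (i, e i) b" "fst b = \<pi> i" using \<pi>[OF ik] by blast
    have "snd b = 0" using fixed[OF b(1)] i by (simp add: e_def)
    then have "b = (\<pi> i, 0)" using b(2) by (cases b) auto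
    then show "mt (i, 0) (\<pi> i, 0)" using b(1) i by (simp add: e_def)
    then show "\<pi> i \<in> {1..f_m F1}" unfolding mt_def set_labels by auto
  qed
  have \<pi>p: "(mt (i, 1) (\<pi> i, 1) \<and> mt (i, 2) (\<pi> i, 2)) \<or> (mt (i, 1) (\<pi> i, 2) \<and> mt (i, 2) (\<pi> i, 1))"
    "\<pi> i \<in> {Suc (f_m F1)..f_k F1}" if i: "i \<in> {Suc (f_m F2)..f_k F2}" for i
  proof -
    have ik: "i \<in> {1..f_k F2}" using i by auto
    obtain b where b: "mt (i, e i) b" "fst b = \<pi> i" using \<pi>[OF ik] by blast
    have m: "mt (i, 1) b" using b(1) i by (simp add: e_def)
    then have "snd b \<noteq> 0" using fixed[OF m] by simp
    moreover have "b \<in> set ?L1" using m by (simp add: mt_def)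
    ultimately have bb: "b = (\<pi> i, 1) \<or> b = (\<pi> i, 2)" "\<pi> i \<in> {Suc (f_m F1)..f_k F1}"
      using b(2) unfolding set_labels by auto
    have "mt (i, 2) (label_dual b)" using dual[OF m] by simp
    then show "(mt (i, 1) (\<pi> i, 1) \<and> mt (i, 2) (\<pi> i, 2)) \<or> (mt (i, 1) (\<pi> i, 2) \<and> mt (i, 2) (\<pi> i, 1))"
      using m bb(1) by auto
    show "\<pi> i \<in> {Suc (f_m F1)..f_k F1}" by (rule bb(2))
  qed
  \<comment> \<open>Among self-paired components those of the first group are recognized by odd
    multiplicity, since the others occur \<open>2 q_i\<close> times. So \<pi> respects the boundary
    between the two groups.\<close>
  have parity: "i \<le> f_l F2 \<longleftrightarrow> \<pi> i \<le> f_l F1" "f_q F2 i = f_q F1 (\<pi> i)" if i: "i \<in> {1..f_m F2}" for i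
  proof -
    note m = \<pi>m[OF i]
    have e: "label_mult F1 (\<pi> i, 0) = label_mult F2 (i, 0)" by (rule mult[OF m(1)])
    have o1: "\<pi> i \<le> f_l F1 \<Longrightarrow> odd (f_q F1 (\<pi> i))" using form_q(2)[OF d1, of "\<pi> i"] m(2) by auto
    have o2: "i \<le> f_l F2 \<Longrightarrow> odd (f_q F2 i)" using form_q(2)[OF d2, of i] i by auto
    have e1: "label_mult F1 (\<pi> i, 0) = (if \<pi> i \<le> f_l F1 then f_q F1 (\<pi> i) else 2 * f_q F1 (\<pi> i))"
      using m(2) by (simp add: label_mult_def)
    have e2: "label_mult F2 (i, 0) = (if i \<le> f_l F2 then f_q F2 i else 2 * f_q F2 i)"
      using i by (simp add: label_mult_def)
    show "i \<le> f_l F2 \<longleftrightarrow> \<pi> i \<le> f_l F1" using e o1 o2 unfolding e1 e2 by (auto split: if_splits) (metis dvd_triv_left)+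
    then show "f_q F2 i = f_q F1 (\<pi> i)" using e unfolding e1 e2 by (auto split: if_splits)
  qed
  have qp: "f_q F2 i = f_q F1 (\<pi> i)" if i: "i \<in> {Suc (f_m F2)..f_k F2}" for i
  proof -
    have "label_mult F1 (\<pi> i, 1) = label_mult F2 (i, 1) \<or> label_mult F1 (\<pi> i, 2) = label_mult F2 (i, 1)"
      using \<pi>p(1)[OF i] mult by blast
    then show ?thesis using i \<pi>p(2)[OF i] b1 b2 by (auto simp: label_mult_def)
  qed
  have inj: "inj_on \<pi> {1..f_k F2}"
  proof (rule inj_onI)
    fix i j assume ij: "i \<in> {1..f_k F2}" "j \<in> {1..f_k F2}" "\<pi> i = \<pi> j"
    show "i = j"
    proof (cases "i \<in> {1..f_m F2}")
      case True
      then have "\<pi> j \<in> {1..f_m F1}" using \<pi>m(2) ij by metis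
      then have "j \<in> {1..f_m F2}" using \<pi>p(2)[of j] ij by force
      then have "mt (j, 0) (\<pi> i, 0)" using \<pi>m(1) ij by metis
      then show ?thesis using uniq2[OF \<pi>m(1)[OF True]] by auto
    next
      case False
      then have i: "i \<in> {Suc (f_m F2)..f_k F2}" using ij by auto
      then have "\<pi> j \<in> {Suc (f_m F1)..f_k F1}" using \<pi>p(2) ij by metis
      then have "j \<in> {Suc (f_m F2)..f_k F2}" using \<pi>m(2)[of j] ij by force
      from \<pi>p(1)[OF this] \<pi>p(1)[OF i] ij(3) show ?thesis using uniq2 by (metis Pair_inject)
    qed
  qed
  have im1: "\<pi> ` {1..f_l F2} = {1..f_l F1}" and im2: "\<pi> ` {Suc (f_l F2)..f_m F2} = {Suc (f_l F1)..f_m F1}"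
  proof -
    have surj: "\<exists>i\<in>{1..f_m F2}. \<pi> i = j" if j: "j \<in> {1..f_m F1}" for j
    proof -
      have "(j, 0) \<in> set ?L1" using j unfolding set_labels by auto
      then obtain a where a: "mt a (j, 0)" using to2 by blast
      then have "snd a = 0" using fixed by simp
      moreover have "a \<in> set ?L2" using a by (simp add: mt_def)
      ultimately obtain i where i: "a = (i, 0)" "i \<in> {1..f_m F2}" unfolding set_labels by auto
      have "(\<pi> i, 0) = (j, 0 :: nat)" by (rule uniq1[OF \<pi>m(1)[OF i(2)]]) (use a i in simp)
      then show ?thesis using i by auto
    qed
    show "\<pi> ` {1..f_l F2} = {1..f_l F1}"
    proof
      show "\<pi> ` {1..f_l F2} \<subseteq> {1..f_l F1}"
      proof
        fix j assume "j \<in> \<pi> ` {1..f_l F2}"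
        then obtain i where i: "i \<in> {1..f_l F2}" "j = \<pi> i" by blast
        then have "i \<in> {1..f_m F2}" using b2 by auto
        then show "j \<in> {1..f_l F1}" using parity(1)[of i] \<pi>m(2)[of i] i by auto
      qed
      show "{1..f_l F1} \<subseteq> \<pi> ` {1..f_l F2}"
      proof
        fix j assume j: "j \<in> {1..f_l F1}"
        then obtain i where i: "i \<in> {1..f_m F2}" "\<pi> i = j" using surj[of j] b1 by auto
        then show "j \<in> \<pi> ` {1..f_l F2}" using parity(1)[OF i(1)] j by auto
      qed
    qed
    show "\<pi> ` {Suc (f_l F2)..f_m F2} = {Suc (f_l F1)..f_m F1}"
    proof
      show "\<pi> ` {Suc (f_l F2)..f_m F2} \<subseteq> {Suc (f_l F1)..f_m F1}"
      proof
        fix j assume "j \<in> \<pi> ` {Suc (f_l F2)..f_m F2}"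
        then obtain i where i: "i \<in> {Suc (f_l F2)..f_m F2}" "j = \<pi> i" by blast
        then have "i \<in> {1..f_m F2}" by auto
        then show "j \<in> {Suc (f_l F1)..f_m F1}" using parity(1)[of i] \<pi>m(2)[of i] i by auto
      qed
      show "{Suc (f_l F1)..f_m F1} \<subseteq> \<pi> ` {Suc (f_l F2)..f_m F2}"
      proof
        fix j assume j: "j \<in> {Suc (f_l F1)..f_m F1}"
        then obtain i where i: "i \<in> {1..f_m F2}" "\<pi> i = j" using surj[of j] by auto
        then have "i \<in> {Suc (f_l F2)..f_m F2}" using parity(1)[OF i(1)] j by auto
        then show "j \<in> \<pi> ` {Suc (f_l F2)..f_m F2}" using i by blast
      qed
    qed
  qed
  have im3: "\<pi> ` {Suc (f_m F2)..f_k F2} = {Suc (f_m F1)..f_k F1}"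
  proof
    show "\<pi> ` {Suc (f_m F2)..f_k F2} \<subseteq> {Suc (f_m F1)..f_k F1}" using \<pi>p(2) by blast
    show "{Suc (f_m F1)..f_k F1} \<subseteq> \<pi> ` {Suc (f_m F2)..f_k F2}"
    proof
      fix j assume j: "j \<in> {Suc (f_m F1)..f_k F1}"
      then have "(j, 1) \<in> set ?L1" unfolding set_labels by auto
      then obtain a where a: "mt a (j, 1)" using to2 by blast
      then have "snd a \<noteq> 0" using fixed by simp
      moreover have "a \<in> set ?L2" using a by (simp add: mt_def)
      ultimately obtain i where i: "a = (i, 1) \<or> a = (i, 2)" "i \<in> {Suc (f_m F2)..f_k F2}" unfolding set_labels by auto
      have "\<pi> i = j" using \<pi>p(1)[OF i(2)] a i(1) uniq1 by (metis Pair_inject)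
      then show "j \<in> \<pi> ` {Suc (f_m F2)..f_k F2}" using i by blast
    qed
  qed
  \<comment> \<open>The parameters agree because \<pi> maps the three index intervals bijectively
    onto those of the first data.\<close>
  have l: "f_l F1 = f_l F2"
    using card_image[OF inj_on_subset[OF inj, of "{1..f_l F2}"]] im1 b2 by auto
  moreover have "card {Suc (f_l F1)..f_m F1} = card {Suc (f_l F2)..f_m F2}"
    using card_image[OF inj_on_subset[OF inj, of "{Suc (f_l F2)..f_m F2}"]] im2 b2 by auto
  ultimately have m: "f_m F1 = f_m F2" using b1 b2 by auto
  moreover have "card {Suc (f_m F1)..f_k F1} = card {Suc (f_m F2)..f_k F2}"
    using card_image[OF inj_on_subset[OF inj, of "{Suc (f_m F2)..f_k F2}"]] im3 by auto
  ultimately have kk: "f_k F1 = f_k F2" using b1 b2 by auto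
  have perm: "\<pi> permutes {1..f_k F1}"
  proof (rule bij_imp_permutes)
    have "{1..f_k F2} = {1..f_l F2} \<union> {Suc (f_l F2)..f_m F2} \<union> {Suc (f_m F2)..f_k F2}" using b2 by auto
    then have "\<pi> ` {1..f_k F2} = \<pi> ` {1..f_l F2} \<union> \<pi> ` {Suc (f_l F2)..f_m F2} \<union> \<pi> ` {Suc (f_m F2)..f_k F2}"
      by (simp only: image_Un)
    also have "\<dots> = {1..f_k F1}" unfolding im1 im2 im3 using b1 by auto
    finally show "bij_betw \<pi> {1..f_k F1} {1..f_k F1}" using inj kk by (simp add: bij_betw_def)
    show "\<pi> x = x" if "x \<notin> {1..f_k F1}" for x
      unfolding \<pi>_def kk[symmetric] by (rule if_not_P) (rule that)
  qed
  let ?g = "inv k"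
  have g: "?g \<in> carrier G" using k by simp
  have rc: "(?v2 a, ?v1 b \<otimes> ?g) \<in> rcong T" if mm: "mt a b" for a b
  proof -
    have c: "?v2 a \<in> carrier G" "?v1 b \<in> carrier G" using mm v1 v2 by (auto simp: mt_def)
    have "coset (?g \<otimes> (k \<otimes> ?v2 a)) = coset (?g \<otimes> ?v1 b)" using mm c k by (simp add: mt_def coset_mult_cong)
    moreover have "?g \<otimes> (k \<otimes> ?v2 a) = ?v2 a" using c k by (simp flip: m_assoc)
    ultimately show ?thesis using c k by (simp add: coset_eq_rcong m_comm)
  qed
  have h2': "?h2 = ?h1 \<otimes> (?g \<otimes> ?g)"
  proof -
    have "?h1 \<otimes> (?g \<otimes> ?g) = ?h2 \<otimes> (k \<otimes> inv k) \<otimes> (k \<otimes> inv k)"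
      unfolding h using k h2 by (simp only: m_ac m_closed inv_closed)
    then show ?thesis using k h2 by simp
  qed
  \<comment> \<open>Both degree equations are exact, and by \<open>square_coset\<close> the squares
    agree up to \<open>?g \<otimes> ?g\<close>; after cancellation the factors in \<open>T\<close>
    are equal and not merely congruent.\<close>
  have \<tau>: "\<tau>2 i = \<tau>1 (\<pi> i)" if i: "i \<in> {1..f_m F1}" for i
  proof -
    have i2: "i \<in> {1..f_m F2}" using i m by simp
    let ?x = "f_g F2 i" and ?y = "f_g F1 (\<pi> i)"
    note c = form_carrier(1)[OF d2 i2] form_carrier(1)[OF d1 \<pi>m(2)[OF i2]]
    note t = form_\<tau>[OF d2 i2] form_\<tau>[OF d1 \<pi>m(2)[OF i2]]
    have "(?x, ?y \<otimes> ?g) \<in> rcong T" using rc[OF \<pi>m(1)[OF i2]] by (simp add: label_val_def)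
    then have "coset ?x = coset (?y \<otimes> ?g)" using c k by (simp add: coset_eq_rcong)
    then have "?x \<otimes> ?x = (?y \<otimes> ?g) \<otimes> (?y \<otimes> ?g)" using c k by (intro square_coset) auto
    also have "\<dots> = ?y \<otimes> ?y \<otimes> (?g \<otimes> ?g)" using c g by (simp only: m_ac m_closed)
    finally have xx: "?x \<otimes> ?x = ?y \<otimes> ?y \<otimes> (?g \<otimes> ?g)" .
    have "?x \<otimes> ?x \<otimes> \<tau>2 i = ?y \<otimes> ?y \<otimes> \<tau>1 (\<pi> i) \<otimes> (?g \<otimes> ?g)"
      using form_degree_eq(1)[OF d2 i2] form_degree_eq(1)[OF d1 \<pi>m(2)[OF i2]] h2' by simp
    also have "\<dots> = ?x \<otimes> ?x \<otimes> \<tau>1 (\<pi> i)" unfolding xx using c g t by (simp only: m_ac m_closed T_carrier)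
    finally show ?thesis using c t by (simp add: m_assoc)
  qed
  have pairs: "(f_g' F2 i, f_g' F1 (\<pi> i) \<otimes> ?g) \<in> rcong T \<and> (f_g'' F2 i, f_g'' F1 (\<pi> i) \<otimes> ?g) \<in> rcong T \<or>
           (f_g' F2 i, f_g'' F1 (\<pi> i) \<otimes> ?g) \<in> rcong T \<and> (f_g'' F2 i, f_g' F1 (\<pi> i) \<otimes> ?g) \<in> rcong T"
    if i: "i \<in> {Suc (f_m F1)..f_k F1}" for i
  proof -
    have "i \<in> {Suc (f_m F2)..f_k F2}" using i m kk by simp
    from \<pi>p(1)[OF this] show ?thesis
      using rc[of "(i, 1)" "(\<pi> i, 1)"] rc[of "(i, 2)" "(\<pi> i, 2)"] rc[of "(i, 1)" "(\<pi> i, 2)"] rc[of "(i, 2)" "(\<pi> i, 1)"]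
      by (auto simp: label_val_def)
  qed
  have last: "if 0 < f_m F1 then \<forall>i\<in>{1..f_m F1}. \<tau>2 i = \<tau>1 (\<pi> i)
         else \<exists>i\<in>{1..f_k F1}. f_g' F2 i \<otimes> f_g'' F2 i = f_g' F1 (\<pi> i) \<otimes> f_g'' F1 (\<pi> i) \<otimes> (?g \<otimes> ?g)"
  proof (cases "0 < f_m F1")
    case True
    then show ?thesis using \<tau> by simp
  next
    case False
    then have i: "1 \<in> {Suc (f_m F2)..f_k F2}" using m kk form_k[OF d1] by auto
    then have "f_g' F2 1 \<otimes> f_g'' F2 1 = f_g' F1 (\<pi> 1) \<otimes> f_g'' F1 (\<pi> 1) \<otimes> (?g \<otimes> ?g)"
      using form_degree_eq(2)[OF d2 i] form_degree_eq(2)[OF d1 \<pi>p(2)[OF i]] h2' by simp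
    then show ?thesis using False form_k[OF d1] by (auto intro!: bexI[of _ 1])
  qed
  have q: "f_q F2 i = f_q F1 (\<pi> i)" if i: "i \<in> {1..f_k F1}" for i
    using parity(2)[of i] qp[of i] i m kk by (cases "i \<le> f_m F2") auto
  have gg: "(f_g F2 i, f_g F1 (\<pi> i) \<otimes> ?g) \<in> rcong T" if i: "i \<in> {1..f_m F1}" for i
    using rc[OF \<pi>m(1)[of i]] i m by (simp add: label_val_def)
  show ?thesis
    unfolding form1_equiv_def
    by (intro conjI l m kk bexI[OF _ g] exI[of _ \<pi>] perm ballI q gg pairs last)
      (use im1 im2 im3 l m kk in auto)
qed

end

section \<open>From an involution of the components to data of the form (1)\<close>

lemma map_upt_shift:
  assumes "\<And>i. i < length zs \<Longrightarrow> f (a + i) = g (zs ! i)" "b = a + length zs"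
  shows "map f [a..<b] = map g zs"
  by (rule nth_equalityI) (use assms in auto)

lemma distinct_concat_pairs:
  assumes "distinct zs" "\<And>z. z \<in> set zs \<Longrightarrow> z < \<iota> z \<and> \<iota> (\<iota> z) = (z::nat)"
  shows "distinct (concat (map (\<lambda>z. [z, \<iota> z]) zs))"
  using assms
proof (induction zs)
  case (Cons z zs)
  have z: "z < \<iota> z" "\<iota> (\<iota> z) = z" using Cons.prems(2)[of z] by auto
  have w: "w < \<iota> w" "\<iota> (\<iota> w) = w" if "w \<in> set zs" for w using Cons.prems(2)[of w] that by auto
  have "z \<noteq> w \<and> z \<noteq> \<iota> w \<and> \<iota> z \<noteq> w \<and> \<iota> z \<noteq> \<iota> w" if "w \<in> set zs" for w
    using z w[OF that] Cons.prems(1) that by (metis distinct.simps(2) not_less_iff_gr_or_eq)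
  moreover have "z \<noteq> \<iota> z" using z(1) by simp
  moreover have "distinct (concat (map (\<lambda>z. [z, \<iota> z]) zs))" using Cons by auto
  ultimately show ?case by (auto simp del: distinct_concat_iff)
qed simp

text \<open>The indices are listed as fixed points of \<iota> with odd multiplicity, fixed points
  with even multiplicity, and finally the smaller member of each 2-cycle followed by its partner.
  This is the order of \<open>form_kappa\<close>, and \<open>e i\<close> remembers the original
  index of component \<open>i\<close>.\<close>

lemma involution_form1:
  fixes \<kappa> :: "nat list" and \<gamma> :: "'a list"
  assumes len: "length \<gamma> = length \<kappa>" and pos: "\<And>n. n \<in> set \<kappa> \<Longrightarrow> 0 < n"
    and \<iota>: "\<And>i. i < length \<kappa> \<Longrightarrow> \<iota> i < length \<kappa> \<and> \<iota> (\<iota> i) = i \<and> \<kappa> ! (\<iota> i) = \<kappa> ! i"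
  obtains F e where "reordering_of F \<kappa> \<gamma>" "f_l F \<le> f_m F" "f_m F \<le> f_k F"
    "\<And>i. i \<in> {1..f_k F} \<Longrightarrow> 0 < f_q F i" "\<And>i. i \<in> {1..f_l F} \<Longrightarrow> odd (f_q F i)"
    "\<And>i. i \<in> {1..f_k F} \<Longrightarrow> e i < length \<kappa>"
    "\<And>i. i \<in> {1..f_m F} \<Longrightarrow> \<iota> (e i) = e i \<and> f_g F i = \<gamma> ! e i"
    "\<And>i. i \<in> {1..f_l F} \<Longrightarrow> f_q F i = \<kappa> ! e i"
    "\<And>i. i \<in> {Suc (f_m F)..f_k F} \<Longrightarrow> f_g' F i = \<gamma> ! e i \<and> f_g'' F i = \<gamma> ! \<iota> (e i)"
proof -
  let ?s = "length \<kappa>"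
  define o1 where "o1 = filter (\<lambda>i. \<iota> i = i \<and> odd (\<kappa> ! i)) [0..<?s]"
  define o2 where "o2 = filter (\<lambda>i. \<iota> i = i \<and> even (\<kappa> ! i)) [0..<?s]"
  define o3 where "o3 = filter (\<lambda>i. i < \<iota> i) [0..<?s]"
  let ?o = "o1 @ o2 @ o3"
  let ?l = "length o1" and ?m = "length o1 + length o2" and ?k = "length o1 + length o2 + length o3"
  \<comment> \<open>Components of a \<open>form1\<close> are counted from 1, list positions from
    0.\<close>
  define e where "e i = ?o ! (i - 1)" for i
  \<comment> \<open>The multiplicity is halved in the second group because \<open>form_kappa\<close>
    doubles it there.\<close>
  define F :: "'a form1" where "F = \<lparr>f_l = ?l, f_m = ?m, f_k = ?k,
     f_q = (\<lambda>i. if ?l < i \<and> i \<le> ?m then \<kappa> ! e i div 2 else \<kappa> ! e i),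
     f_g = (\<lambda>i. \<gamma> ! e i), f_g' = (\<lambda>i. \<gamma> ! e i), f_g'' = (\<lambda>i. \<gamma> ! \<iota> (e i))\<rparr>"
  have F: "f_l F = ?l" "f_m F = ?m" "f_k F = ?k" "f_g F i = \<gamma> ! e i" "f_g' F i = \<gamma> ! e i" "f_g'' F i = \<gamma> ! \<iota> (e i)"
    "f_q F i = (if ?l < i \<and> i \<le> ?m then \<kappa> ! e i div 2 else \<kappa> ! e i)" for i
    by (auto simp: F_def)
  have e1: "e (1 + i) = o1 ! i" if "i < ?l" for i using that by (simp add: e_def nth_append)
  have e2: "e (Suc ?l + i) = o2 ! i" if "i < length o2" for i using that by (simp add: e_def nth_append)
  have e3: "e (Suc ?m + i) = o3 ! i" if "i < length o3" for i using that by (simp add: e_def nth_append)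
  have in1: "e i \<in> set o1" if "i \<in> {1..?l}" for i
    using that e1[of "i - 1"] nth_mem[of "i - 1" o1] by auto
  have in2: "e i \<in> set o2" if "i \<in> {Suc ?l..?m}" for i
  proof -
    have "i - Suc ?l < length o2" "Suc ?l + (i - Suc ?l) = i" using that by auto
    then show ?thesis using e2[of "i - Suc ?l"] by (metis nth_mem)
  qed
  have in3: "e i \<in> set o3" if "i \<in> {Suc ?m..?k}" for i
  proof -
    have "i - Suc ?m < length o3" "Suc ?m + (i - Suc ?m) = i" using that by auto
    then show ?thesis using e3[of "i - Suc ?m"] by (metis nth_mem)
  qed
  have range: "i \<in> {1..?l} \<or> i \<in> {Suc ?l..?m} \<or> i \<in> {Suc ?m..?k}" if "i \<in> {1..?k}" for i using that by auto
  have es: "e i < ?s" if "i \<in> {1..?k}" for i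
    using range[OF that] in1[of i] in2[of i] in3[of i] by (auto simp: o1_def o2_def o3_def)
  define ord where "ord = o1 @ o2 @ concat (map (\<lambda>j. [j, \<iota> j]) o3)"
  have so: "set ord = {..<?s}"
  proof
    show "set ord \<subseteq> {..<?s}" using \<iota> by (auto simp: ord_def o1_def o2_def o3_def)
    show "{..<?s} \<subseteq> set ord"
    proof
      fix i assume "i \<in> {..<?s}"
      then have i: "i < ?s" "\<iota> i < ?s" "\<iota> (\<iota> i) = i" using \<iota> by auto
      consider "\<iota> i = i" | "i < \<iota> i" | "\<iota> i < i" by linarith
      then show "i \<in> set ord"
      proof cases
        case 1
        then show ?thesis using i by (auto simp: ord_def o1_def o2_def)
      next
        case 2
        then have "i \<in> set o3" using i by (auto simp: o3_def)
        then show ?thesis by (auto simp: ord_def)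
      next
        case 3
        then have "\<iota> i \<in> set o3" using i by (auto simp: o3_def)
        then have "set [\<iota> i, \<iota> (\<iota> i)] \<subseteq> set (concat (map (\<lambda>j. [j, \<iota> j]) o3))"
          unfolding set_concat set_map by blast
        then have "i \<in> set (concat (map (\<lambda>j. [j, \<iota> j]) o3))" by (simp add: i(3))
        then show ?thesis by (simp add: ord_def)
      qed
    qed
  qed
  have d3: "distinct (concat (map (\<lambda>j. [j, \<iota> j]) o3))"
    by (rule distinct_concat_pairs) (use \<iota> in \<open>auto simp: o3_def\<close>)
  have nofix: "\<iota> j \<noteq> j" if "j \<in> set (concat (map (\<lambda>j. [j, \<iota> j]) o3))" for j
    using that \<iota> by (auto simp: o3_def)
  have "set o1 \<inter> set o2 = {}" "\<And>j. j \<in> set o1 \<union> set o2 \<Longrightarrow> \<iota> j = j" by (auto simp: o1_def o2_def)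
  moreover from this(2) have "(set o1 \<union> set o2) \<inter> set (concat (map (\<lambda>j. [j, \<iota> j]) o3)) = {}"
    using nofix by blast
  moreover have "distinct o1" "distinct o2" by (auto simp: o1_def o2_def)
  ultimately have dist: "distinct ord" using d3 unfolding ord_def distinct_append set_append by blast
  have lord: "length ord = ?s" using distinct_card[OF dist] so by simp
  define \<sigma> where "\<sigma> i = (if i < ?s then ord ! i else i)" for i
  have perm: "\<sigma> permutes {..<?s}"
  proof (rule bij_imp_permutes)
    have "bij_betw (\<lambda>i. ord ! i) {..<?s} {..<?s}" by (rule bij_betw_nth[OF dist]) (use lord so in auto)
    then show "bij_betw \<sigma> {..<?s} {..<?s}" by (rule bij_betw_cong[THEN iffD1, rotated]) (simp add: \<sigma>_def)
  qed (simp add: \<sigma>_def)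
  have pl: "permute_list \<sigma> zs = map (\<lambda>j. zs ! j) ord" if "length zs = ?s" for zs :: "'z list"
    unfolding permute_list_def by (rule nth_equalityI) (use that lord in \<open>auto simp: \<sigma>_def\<close>)
  have kap: "form_kappa F = permute_list \<sigma> \<kappa>"
  proof -
    have "map (f_q F) [1..<Suc (f_l F)] = map (\<lambda>j. \<kappa> ! j) o1"
      by (rule map_upt_shift) (use F e1 in auto)
    moreover have "map (\<lambda>i. 2 * f_q F i) [Suc (f_l F)..<Suc (f_m F)] = map (\<lambda>j. \<kappa> ! j) o2"
    proof (rule map_upt_shift)
      fix i assume i: "i < length o2"
      then have "even (\<kappa> ! (o2 ! i))" using nth_mem[OF i] by (auto simp: o2_def)
      then show "2 * f_q F (Suc (f_l F) + i) = \<kappa> ! (o2 ! i)" using F(1,7) e2[OF i] i by simp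
    qed (use F in simp)
    moreover have "map (\<lambda>i. [f_q F i, f_q F i]) [Suc (f_m F)..<Suc (f_k F)] = map (\<lambda>j. [\<kappa> ! j, \<kappa> ! (\<iota> j)]) o3"
    proof (rule map_upt_shift)
      fix i assume i: "i < length o3"
      then have "o3 ! i < ?s" using nth_mem[OF i] by (auto simp: o3_def)
      then show "[f_q F (Suc (f_m F) + i), f_q F (Suc (f_m F) + i)] = [\<kappa> ! (o3 ! i), \<kappa> ! \<iota> (o3 ! i)]"
        using F(2,7) e3[OF i] \<iota> by simp
    qed (use F in simp)
    ultimately show ?thesis
      unfolding form_kappa_def pl[OF refl] ord_def by (simp add: map_concat comp_def)
  qed
  have gam: "form_gamma F = permute_list \<sigma> \<gamma>"
  proof -
    have "map (f_g F) [1..<Suc (f_m F)] = map (\<lambda>j. \<gamma> ! j) (o1 @ o2)"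
      by (rule map_upt_shift) (use F in \<open>auto simp: e_def nth_append\<close>)
    moreover have "map (\<lambda>i. [f_g' F i, f_g'' F i]) [Suc (f_m F)..<Suc (f_k F)] = map (\<lambda>j. [\<gamma> ! j, \<gamma> ! (\<iota> j)]) o3"
      by (rule map_upt_shift) (use F e3 in auto)
    ultimately show ?thesis
      unfolding form_gamma_def pl[OF len] ord_def by (simp add: map_concat comp_def)
  qed
  show thesis
  proof (rule that[of F e])
    show "reordering_of F \<kappa> \<gamma>" unfolding reordering_of_def using perm kap gam by blast
    show "f_l F \<le> f_m F" "f_m F \<le> f_k F" using F by auto
    show "odd (f_q F i)" "f_q F i = \<kappa> ! e i" if "i \<in> {1..f_l F}" for i
      using in1[of i] that F by (auto simp: o1_def)
    show "\<iota> (e i) = e i \<and> f_g F i = \<gamma> ! e i" if "i \<in> {1..f_m F}" for i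
      using in1[of i] in2[of i] range[of i] that F by (auto simp: o1_def o2_def)
    show "f_g' F i = \<gamma> ! e i \<and> f_g'' F i = \<gamma> ! \<iota> (e i)" if "i \<in> {Suc (f_m F)..f_k F}" for i using F by simp
    show "e i < length \<kappa>" if "i \<in> {1..f_k F}" for i using es that F by simp
    show "0 < f_q F i" if i: "i \<in> {1..f_k F}" for i
    proof -
      have "0 < \<kappa> ! e i" using es[of i] i F pos nth_mem by auto
      moreover have "even (\<kappa> ! e i)" if "?l < i" "i \<le> ?m" using in2[of i] that by (auto simp: o2_def)
      ultimately show ?thesis unfolding F(7) using dvd_imp_le[of 2 "\<kappa> ! e i"] by (auto simp: div_greater_zero_iff)
    qed
  qed
qed

context elementary_realization
begin

definition dual_g :: "'a \<Rightarrow> 'a form1 \<Rightarrow> 'a form1" where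
  "dual_g h F = F\<lparr>f_g'' := (\<lambda>i. h \<otimes> inv (f_g' F i))\<rparr>"

lemma dual_g_simps [simp]: "f_l (dual_g h F) = f_l F" "f_m (dual_g h F) = f_m F" "f_k (dual_g h F) = f_k F"
  "f_q (dual_g h F) = f_q F" "f_g (dual_g h F) = f_g F" "f_g' (dual_g h F) = f_g' F"
  "f_g'' (dual_g h F) i = h \<otimes> inv (f_g' F i)"
  by (auto simp: dual_g_def)

text \<open>Replacing \<open>g''\<close> by \<open>h g'\<^sup>-\<^sup>1\<close> turns congruences modulo \<open>T\<close> into the equations of \<open>M_star_data\<close>.\<close>

lemma adjust_form:
  assumes F: "is_form1 G T \<beta> F" and h: "h \<in> carrier G" and \<delta>: "\<delta> \<in> {1, - 1}"
    and \<tau>: "\<And>i. i \<in> {1..f_m F} \<Longrightarrow> h \<otimes> inv (f_g F i) \<otimes> inv (f_g F i) \<in> T"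
    and sgn: "\<And>i. i \<in> {1..f_l F} \<Longrightarrow> beta_sign G \<beta> ab (h \<otimes> inv (f_g F i) \<otimes> inv (f_g F i)) = \<delta>"
    and pairs: "\<And>i. i \<in> {Suc (f_m F)..f_k F} \<Longrightarrow> coset (f_g'' F i) = coset (h \<otimes> inv (f_g' F i))"
  defines "\<tau> \<equiv> \<lambda>i. h \<otimes> inv (f_g F i) \<otimes> inv (f_g F i)"
  shows "M_star_data G T \<beta> ab (dual_g h F) \<tau> \<delta>" "form_degree (dual_g h F) \<tau> = h"
    "form_kappa (dual_g h F) = form_kappa F"
    "list_all2 (\<lambda>x y. (x, y) \<in> rcong T) (form_gamma (dual_g h F)) (form_gamma F)"
    "map coset (form_gamma (dual_g h F)) = map coset (form_gamma F)"
proof -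
  let ?F = "dual_g h F"
  have b: "f_l F \<le> f_m F" "f_m F \<le> f_k F" and M: "M_data G T \<beta> (form_kappa F) (form_gamma F)"
    and q: "\<And>i. i \<in> {1..f_k F} \<Longrightarrow> 0 < f_q F i" "\<And>i. i \<in> {1..f_l F} \<Longrightarrow> odd (f_q F i)"
    using F by (auto simp: is_form1_def)
  note MD = M_dataD[OF M]
  have gc: "\<And>i. i \<in> {1..f_m F} \<Longrightarrow> f_g F i \<in> carrier G"
    "\<And>i. i \<in> {Suc (f_m F)..f_k F} \<Longrightarrow> f_g' F i \<in> carrier G"
    "\<And>i. i \<in> {Suc (f_m F)..f_k F} \<Longrightarrow> f_g'' F i \<in> carrier G"
    using MD(2) unfolding set_form_gamma by auto
  show kap: "form_kappa ?F = form_kappa F" by (simp add: form_kappa_def)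
  have lab: "labels ?F = labels F" by (simp add: labels_def)
  have vc: "label_val ?F a \<in> carrier G \<and> label_val F a \<in> carrier G \<and> coset (label_val ?F a) = coset (label_val F a)"
    if "a \<in> set (labels F)" for a
    using that gc pairs h unfolding set_labels by (auto simp: label_val_def)
  show "list_all2 (\<lambda>x y. (x, y) \<in> rcong T) (form_gamma ?F) (form_gamma F)"
    unfolding form_gamma_labels lab list.rel_map
  proof (rule list.rel_refl_strong)
    show "(label_val ?F a, label_val F a) \<in> rcong T" if "a \<in> set (labels F)" for a
      using vc[OF that] coset_eq_rcong by blast
  qed
  show gcos: "map coset (form_gamma ?F) = map coset (form_gamma F)"
    unfolding form_gamma_labels lab using vc by simp
  have M': "M_data G T \<beta> (form_kappa ?F) (form_gamma ?F)"
  proof (rule M_dataI)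
    show "length (form_kappa ?F) = length (form_gamma ?F)" by (rule length_form) (use b in auto)
    show "set (form_gamma ?F) \<subseteq> carrier G" unfolding form_gamma_labels lab using vc by auto
    show "distinct (map coset (form_gamma ?F))" unfolding gcos by (rule MD(3))
  qed (use kap MD in auto)
  have deg1: "f_g F i \<otimes> f_g F i \<otimes> \<tau> i = h" if i: "i \<in> {1..f_m F}" for i
  proof -
    have "f_g F i \<otimes> f_g F i \<otimes> \<tau> i = h \<otimes> (f_g F i \<otimes> inv (f_g F i)) \<otimes> (f_g F i \<otimes> inv (f_g F i))"
      unfolding \<tau>_def using gc(1)[OF i] h by (simp only: m_ac m_closed inv_closed)
    then show ?thesis using gc(1)[OF i] h by simp
  qed
  have deg2: "f_g' F i \<otimes> (h \<otimes> inv (f_g' F i)) = h" if i: "i \<in> {Suc (f_m F)..f_k F}" for i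
  proof -
    have "f_g' F i \<otimes> (h \<otimes> inv (f_g' F i)) = h \<otimes> (f_g' F i \<otimes> inv (f_g' F i))"
      using gc(2)[OF i] h by (simp only: m_ac m_closed inv_closed)
    then show ?thesis using gc(2)[OF i] h by simp
  qed
  show data: "M_star_data G T \<beta> ab ?F \<tau> \<delta>"
    unfolding M_star_data_def is_form1_def Let_def
  proof (intro conjI elem M' \<delta> ballI)
    show "f_l ?F \<le> f_m ?F" "f_m ?F \<le> f_k ?F" using b by auto
    show "\<And>i. i \<in> {1..f_k ?F} \<Longrightarrow> 0 < f_q ?F i" "\<And>i. i \<in> {1..f_l ?F} \<Longrightarrow> odd (f_q ?F i)" using q by auto
    show "\<And>i. i \<in> {1..f_m ?F} \<Longrightarrow> \<tau> i \<in> T" unfolding \<tau>_def using assms(4) by simp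
    show "\<And>i. i \<in> {1..f_l ?F} \<Longrightarrow> beta_sign G \<beta> ab (\<tau> i) = \<delta>" unfolding \<tau>_def using sgn by simp
    have p: "(if i \<le> f_m ?F then f_g ?F i \<otimes> f_g ?F i \<otimes> \<tau> i else f_g' ?F i \<otimes> f_g'' ?F i) = h"
      if "i \<in> {1..f_k ?F}" for i
      using that deg1[of i] deg2[of i] by auto
    show "(if i \<le> f_m ?F then f_g ?F i \<otimes> f_g ?F i \<otimes> \<tau> i else f_g' ?F i \<otimes> f_g'' ?F i) =
       (if j \<le> f_m ?F then f_g ?F j \<otimes> f_g ?F j \<otimes> \<tau> j else f_g' ?F j \<otimes> f_g'' ?F j)"
      if "i \<in> {1..f_k ?F}" "j \<in> {1..f_k ?F}" for i j
      unfolding p[OF that(1)] p[OF that(2)] ..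
  qed
  show "form_degree ?F \<tau> = h"
    unfolding form_degree_def[OF data]
    using deg1[of 1] deg2[of 1] form_k[OF data] by auto
qed

text \<open>
  With the opposite sign the coefficients of \<open>\<Phi>\<close> on a self-paired component would form an
  invertible skew-symmetric matrix of odd size.
\<close>

lemma odd_block_sign:
  assumes M: "M_data G T \<beta> \<kappa> \<gamma>" and h: "h \<in> carrier G"
    and \<Phi>: "\<Phi> \<in> homog (map (m_inv G) (rows_of \<kappa> \<gamma>)) (rows_of \<kappa> \<gamma>) h" "det \<Phi> \<noteq> 0"
      "transpose_mat \<Phi> = \<delta> \<cdot>\<^sub>m \<Phi>" "\<delta> \<in> {1, - 1}"
    and i: "i < length \<gamma>" "coset (\<gamma> ! i) = coset (h \<otimes> inv (\<gamma> ! i))" "odd (\<kappa> ! i)"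
  shows "beta_sign G \<beta> ab (h \<otimes> inv (\<gamma> ! i) \<otimes> inv (\<gamma> ! i)) = \<delta>"
proof (rule ccontr)
  assume neq: "beta_sign G \<beta> ab (h \<otimes> inv (\<gamma> ! i) \<otimes> inv (\<gamma> ! i)) \<noteq> \<delta>"
  let ?rows = "rows_of \<kappa> \<gamma>" and ?x = "\<gamma> ! i"
  let ?c = "length ?rows"
  let ?t = "h \<otimes> inv ?x \<otimes> inv ?x"
  note MD = M_dataD[OF M]
  have rc: "set ?rows \<subseteq> carrier G" by (rule rows_of_carrier[OF M])
  have x: "?x \<in> carrier G" using MD(2) i nth_mem by blast
  have rcr: "?rows ! r \<in> carrier G" if "r < ?c" for r using rc that nth_mem by blast
  have t: "?t \<in> T" using coset_eq'[of "h \<otimes> inv ?x" ?x] i x h by simp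
  have inj: "inj_on coset (set \<gamma>)" using MD(3) by (simp add: distinct_map)
  \<comment> \<open>The rows of component \<open>i\<close>. As this component is self-paired, \<Phi>
    has no nonzero coefficient from these rows to other columns, so the coefficients with both
    indices in \<open>cls\<close> are invertible on their own.\<close>
  define cls where "cls = {r. r < ?c \<and> ?rows ! r = ?x}"
  have card: "card cls = \<kappa> ! i"
  proof -
    have cnt: "count (mset (map coset ?rows)) (coset ?x) = \<kappa> ! i"
      by (rule count_map_rows_of[OF MD(1,3) i(1)])
    have "count (mset (map coset ?rows)) (coset ?x) = length (filter ((=) (coset ?x)) (map coset ?rows))"
      unfolding count_mset count_list_eq_length_filter ..
    also have "\<dots> = card {r. r < ?c \<and> coset ?x = map coset ?rows ! r}" by (simp add: length_filter_conv_card)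
    also have "{r. r < ?c \<and> coset ?x = map coset ?rows ! r} = cls"
    proof -
      have iff: "coset ?x = coset (?rows ! r) \<longleftrightarrow> ?rows ! r = ?x" if r: "r < ?c" for r
      proof
        assume e: "coset ?x = coset (?rows ! r)"
        have "?rows ! r \<in> set \<gamma>" by (rule subsetD[OF set_rows_of_subset nth_mem[OF r]])
        moreover have "?x \<in> set \<gamma>" using i by simp
        ultimately show "?rows ! r = ?x" using inj e by (metis inj_onD)
      qed simp
      show ?thesis unfolding cls_def by (intro Collect_cong conj_cong[OF refl]) (simp only: nth_map iff)
    qed
    finally show ?thesis using cnt by simp
  qed
  have fin: "finite cls" by (simp add: cls_def)
  let ?ys = "map (m_inv G) ?rows" and ?N = "?c * d"
  have \<Phi>c: "\<Phi> \<in> carrier_mat ?N ?N" using homog_carrier[OF \<Phi>(1)] by simp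
  note inv = minv[OF \<Phi>c \<Phi>(2)]
  have N: "minv \<Phi> \<in> homog ?rows ?ys (inv h)"
    by (rule homog_inverse[OF \<Phi>(1) _ \<Phi>(2) map_inv_carrier[OF rc] rc h]) simp
  obtain a where a: "\<And>r s. r < length ?ys \<Longrightarrow> s < ?c \<Longrightarrow> a r s \<noteq> 0 \<Longrightarrow> h \<otimes> ?ys ! r \<otimes> inv (?rows ! s) \<in> T"
    "\<And>r s p q. r < length ?ys \<Longrightarrow> s < ?c \<Longrightarrow> p < d \<Longrightarrow> q < d \<Longrightarrow>
       \<Phi> $$ (r * d + p, s * d + q) = a r s * X (h \<otimes> ?ys ! r \<otimes> inv (?rows ! s)) $$ (p, q)"
    using homogE[OF \<Phi>(1)] by blast
  obtain b where b: "\<And>r s. r < ?c \<Longrightarrow> s < length ?ys \<Longrightarrow> b r s \<noteq> 0 \<Longrightarrow> inv h \<otimes> ?rows ! r \<otimes> inv (?ys ! s) \<in> T"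
    "\<And>r s p q. r < ?c \<Longrightarrow> s < length ?ys \<Longrightarrow> p < d \<Longrightarrow> q < d \<Longrightarrow>
       minv \<Phi> $$ (r * d + p, s * d + q) = b r s * X (inv h \<otimes> ?rows ! r \<otimes> inv (?ys ! s)) $$ (p, q)"
    using homogE[OF N] by blast
  have ax: "\<Phi> $$ (r * d + p, s * d + q) = a r s * X ?t $$ (p, q)" if "r \<in> cls" "s \<in> cls" "p < d" "q < d" for r s p q
    using a(2)[of r s p q] that by (simp add: cls_def)
  have a0: "a r s = 0" if r: "r \<in> cls" and s: "s < ?c" "s \<notin> cls" for r s
  proof (rule ccontr)
    assume "a r s \<noteq> 0"
    then have "h \<otimes> inv ?x \<otimes> inv (?rows ! s) \<in> T" using a(1)[of r s] r s by (simp add: cls_def)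
    then have "coset (h \<otimes> inv ?x) = coset (?rows ! s)" using x h rcr[OF s(1)] by (simp add: coset_eq')
    then have e: "coset ?x = coset (?rows ! s)" using i by simp
    have "?rows ! s \<in> set \<gamma>" by (rule subsetD[OF set_rows_of_subset nth_mem[OF s(1)]])
    moreover have "?x \<in> set \<gamma>" using i by simp
    ultimately have "?rows ! s = ?x" using inj e by (metis inj_onD)
    then show False using s by (simp add: cls_def)
  qed
  have it: "inv h \<otimes> ?x \<otimes> ?x = ?t"
  proof -
    have "inv ?t = inv h \<otimes> ?x \<otimes> ?x" using h x by (simp add: inv_mult)
    then show ?thesis using T_inv_self[OF t] by simp
  qed
  have bx: "minv \<Phi> $$ (r * d + p, s * d + q) = b r s * X ?t $$ (p, q)" if "r \<in> cls" "s \<in> cls" "p < d" "q < d" for r s p q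
    using b(2)[of r s p q] that it x by (simp add: cls_def)
  \<comment> \<open>On \<open>cls\<close> the blocks of \<Phi> and of its inverse carry the same
    \<open>X ?t\<close>, because \<open>?t\<close> is its own inverse; the product of two such
    blocks is a scalar multiple of the identity.\<close>
  obtain c where c: "c \<noteq> 0" "X ?t * X ?t = c \<cdot>\<^sub>m X (?t \<otimes> ?t)" using X_mult[OF t t] .
  have "?t \<otimes> ?t = \<one>" using elem t by (simp add: elementary_2_group_def)
  then have tt: "X ?t * X ?t = c \<cdot>\<^sub>m 1\<^sub>m d" using c(2) by simp
  have AB: "(\<Sum>s\<in>cls. a r s * (c * b s r')) = (if r = r' then 1 else 0)" if r: "r \<in> cls" "r' \<in> cls" for r r'
  proof -
    have rr: "r < ?c" "r' < ?c" using r by (auto simp: cls_def)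
    have "(if r = r' then 1 else 0 :: 'f) = 1\<^sub>m ?N $$ (r * d + 0, r' * d + 0)"
      using block_index_less[OF rr(1) d_pos] block_index_less[OF rr(2) d_pos] d_pos by auto
    also have "\<dots> = (\<Phi> * minv \<Phi>) $$ (r * d + 0, r' * d + 0)" using inv by simp
    also have "\<dots> = (\<Sum>l<?N. \<Phi> $$ (r * d + 0, l) * minv \<Phi> $$ (l, r' * d + 0))"
      by (rule index_mult_mat_sum[OF \<Phi>c inv(1) block_index_less[OF rr(1) d_pos] block_index_less[OF rr(2) d_pos]])
    also have "\<dots> = (\<Sum>s<?c. if s \<in> cls then a r s * (c * b s r') else 0)"
      unfolding sum_lessThan_mult
    proof (rule sum.cong[OF refl])
      fix s assume "s \<in> {..<?c}"
      then have s: "s < ?c" by simp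
      show "(\<Sum>l<d. \<Phi> $$ (r * d + 0, s * d + l) * minv \<Phi> $$ (s * d + l, r' * d + 0)) =
         (if s \<in> cls then a r s * (c * b s r') else 0)"
      proof (cases "s \<in> cls")
        case True
        have "(\<Sum>l<d. \<Phi> $$ (r * d + 0, s * d + l) * minv \<Phi> $$ (s * d + l, r' * d + 0)) =
           (\<Sum>l<d. a r s * b s r' * (X ?t $$ (0, l) * X ?t $$ (l, 0)))"
          using ax[OF r(1) True d_pos] bx[OF True r(2) _ d_pos] by (intro sum.cong) (auto simp: mult_ac)
        also have "\<dots> = a r s * b s r' * (X ?t * X ?t) $$ (0, 0)"
          using index_mult_mat_sum[OF X_carrier[OF t] X_carrier[OF t] d_pos d_pos] by (simp add: sum_distrib_left)
        also have "\<dots> = a r s * (c * b s r')" unfolding tt using d_pos by simp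
        finally show ?thesis using True by simp
      next
        case False
        have "\<Phi> $$ (r * d + 0, s * d + l) = 0" if "l < d" for l
          using a(2)[of r s 0 l] a0[OF r(1) s False] rr s that d_pos by simp
        then show ?thesis using False by (auto intro!: sum.neutral)
      qed
    qed
    also have "\<dots> = (\<Sum>s\<in>{..<?c} \<inter> cls. a r s * (c * b s r'))"
      by (simp add: sum.inter_restrict)
    also have "{..<?c} \<inter> cls = cls" by (auto simp: cls_def)
    finally show ?thesis by simp
  qed
  \<comment> \<open>\<Phi> has symmetry \<delta> and \<open>X ?t\<close> has symmetry
    \<open>- \<delta>\<close>, so the coefficients must be skew.\<close>
  have skew: "a s r = - a r s" if rs: "r \<in> cls" "s \<in> cls" for r s
  proof -
    obtain p q where pq: "p < d" "q < d" "X ?t $$ (p, q) \<noteq> 0" using X_nonzero_entry[OF t] .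
    have rr: "r < ?c" "s < ?c" using rs by (auto simp: cls_def)
    note bl = block_index_less[OF rr(1) pq(1)] block_index_less[OF rr(2) pq(2)]
    have bsd: "beta_sign G \<beta> ab ?t = - \<delta>" using beta_sign(2)[OF t] neq \<Phi>(4) by auto
    have "transpose_mat (X ?t) $$ (p, q) = (beta_sign G \<beta> ab ?t \<cdot>\<^sub>m X ?t) $$ (p, q)"
      using beta_sign(1)[OF t] by simp
    then have Xqp: "X ?t $$ (q, p) = - \<delta> * X ?t $$ (p, q)" unfolding bsd using pq t by simp
    have "transpose_mat \<Phi> $$ (r * d + p, s * d + q) = (\<delta> \<cdot>\<^sub>m \<Phi>) $$ (r * d + p, s * d + q)" using \<Phi>(3) by simp
    then have "\<Phi> $$ (s * d + q, r * d + p) = \<delta> * \<Phi> $$ (r * d + p, s * d + q)" using bl \<Phi>c by simp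
    then have "a s r * (- \<delta> * X ?t $$ (p, q)) = \<delta> * (a r s * X ?t $$ (p, q))"
      using ax[OF rs(2,1) pq(2,1)] ax[OF rs pq(1,2)] Xqp by simp
    moreover have "(\<delta> * z) * y = (\<delta> * z) * (- w)" if "y * (- \<delta> * z) = \<delta> * (w * z)" for y z w :: 'f
      using arg_cong[OF that, of uminus] by (simp add: mult_ac)
    ultimately have "(\<delta> * X ?t $$ (p, q)) * a s r = (\<delta> * X ?t $$ (p, q)) * (- a r s)" by blast
    moreover have "\<delta> * X ?t $$ (p, q) \<noteq> 0" using pq \<Phi>(4) by auto
    ultimately show ?thesis by (rule mult_left_cancel[THEN iffD1, rotated])
  qed
  let ?n = "\<kappa> ! i"
  obtain e where e: "bij_betw e {0..<?n} cls" using ex_bij_betw_nat_finite[OF fin] card by auto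
  have ec: "e k \<in> cls" if "k < ?n" for k using bij_betwE[OF e] that by simp
  define A where "A = mat ?n ?n (\<lambda>(k, l). a (e k) (e l))"
  define B where "B = mat ?n ?n (\<lambda>(k, l). c * b (e k) (e l))"
  have Ac: "A \<in> carrier_mat ?n ?n" and Bc: "B \<in> carrier_mat ?n ?n" by (auto simp: A_def B_def)
  have "A * B = 1\<^sub>m ?n"
  proof (rule eq_matI)
    fix k l assume "k < dim_row (1\<^sub>m ?n :: 'f mat)" "l < dim_col (1\<^sub>m ?n :: 'f mat)"
    then have kl: "k < ?n" "l < ?n" by auto
    have "(A * B) $$ (k, l) = (\<Sum>m\<in>{0..<?n}. a (e k) (e m) * (c * b (e m) (e l)))"
      using index_mult_mat_sum[OF Ac Bc kl] kl by (simp add: A_def B_def atLeast0LessThan)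
    also have "\<dots> = (\<Sum>s\<in>cls. a (e k) s * (c * b s (e l)))"
      by (rule sum.reindex_bij_betw[OF e])
    also have "\<dots> = (if e k = e l then 1 else 0)" by (rule AB[OF ec[OF kl(1)] ec[OF kl(2)]])
    also have "e k = e l \<longleftrightarrow> k = l" using kl by (simp add: inj_on_eq_iff[OF bij_betw_imp_inj_on[OF e]])
    finally show "(A * B) $$ (k, l) = 1\<^sub>m ?n $$ (k, l)" using kl by simp
  qed (use Ac Bc in auto)
  then have detA: "det A \<noteq> 0" by (rule det_nonzeroI(1)[OF Ac Bc])
  have AT: "transpose_mat A = (- 1) \<cdot>\<^sub>m A"
  proof (rule eq_matI)
    fix k l assume "k < dim_row ((- 1) \<cdot>\<^sub>m A)" "l < dim_col ((- 1) \<cdot>\<^sub>m A)"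
    then have kl: "k < ?n" "l < ?n" using Ac by auto
    show "transpose_mat A $$ (k, l) = ((- 1) \<cdot>\<^sub>m A) $$ (k, l)"
      using kl skew[OF ec[OF kl(1)] ec[OF kl(2)]] by (simp add: A_def)
  qed (use Ac in auto)
  \<comment> \<open>The determinant of a skew matrix of odd size equals its own negative.\<close>
  have "det A = det (transpose_mat A)" by (rule det_transpose[symmetric, OF Ac])
  also have "\<dots> = (- 1) ^ ?n * det A" unfolding AT det_smult using Ac by simp
  also have "\<dots> = - det A" using i(3) by simp
  finally have "det A + det A = 0" by (rule eq_neg_iff_add_eq_0[THEN iffD1])
  then have "2 * det A = 0" by (simp only: mult_2)
  then show False using two detA by simp
qed

text \<open>Applied to \<Phi>, \<open>homog_mset\<close> says that \<open>g \<mapsto> h g^-1\<close>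
  permutes the cosets with their multiplicities. The map is involutive because
  \<open>h (h g^-1)^-1 = g\<close>, and distinctness of the cosets makes the chosen index
  unique.\<close>

lemma component_involution:
  assumes M: "M_data G T \<beta> \<kappa> \<gamma>" and h: "h \<in> carrier G"
    and \<Phi>: "\<Phi> \<in> homog (map (m_inv G) (rows_of \<kappa> \<gamma>)) (rows_of \<kappa> \<gamma>) h" "det \<Phi> \<noteq> 0"
  obtains \<iota> where "\<And>i. i < length \<kappa> \<Longrightarrow> \<iota> i < length \<kappa> \<and> \<iota> (\<iota> i) = i \<and> \<kappa> ! (\<iota> i) = \<kappa> ! i"
    "\<And>i. i < length \<kappa> \<Longrightarrow> coset (\<gamma> ! \<iota> i) = coset (h \<otimes> inv (\<gamma> ! i))"
proof -
  let ?rows = "rows_of \<kappa> \<gamma>"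
  note MD = M_dataD[OF M]
  let ?f = "\<lambda>x. coset (h \<otimes> inv x)"
  have rc: "set ?rows \<subseteq> carrier G" by (rule rows_of_carrier[OF M])
  have inv_coset: "coset x = coset y" if "x \<in> carrier G" "y \<in> carrier G" "?f x = ?f y" for x y
  proof -
    have "coset (inv x) = coset (inv y)" using that h by (simp add: coset_mult_cong)
    then have "inv x \<otimes> y \<in> T" using that coset_eq'[of "inv x" "inv y"] by simp
    then show ?thesis using that coset_eq[of x y] by simp
  qed
  have ms: "mset (map ?f ?rows) = mset (map coset ?rows)"
    using homog_mset[OF \<Phi>(1) _ \<Phi>(2) map_inv_carrier[OF rc] rc h] by (simp add: comp_def)
  have dist: "distinct (map ?f \<gamma>)"
    unfolding distinct_map
  proof
    show "distinct \<gamma>" using MD(3) by (simp add: distinct_map)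
    show "inj_on ?f (set \<gamma>)"
    proof (rule inj_onI)
      fix x y assume xy: "x \<in> set \<gamma>" "y \<in> set \<gamma>" "?f x = ?f y"
      then have "coset x = coset y" using inv_coset MD(2) by blast
      then show "x = y" using xy MD(3) by (auto simp: distinct_map inj_on_def)
    qed
  qed
  have ex: "\<exists>j. j < length \<kappa> \<and> coset (\<gamma> ! j) = ?f (\<gamma> ! i) \<and> \<kappa> ! j = \<kappa> ! i" if i: "i < length \<kappa>" for i
    using rows_match[OF MD(1,1) dist MD(3) ms MD(5), of i] i MD(1) by metis
  define \<iota> where "\<iota> i = (SOME j. j < length \<kappa> \<and> coset (\<gamma> ! j) = ?f (\<gamma> ! i) \<and> \<kappa> ! j = \<kappa> ! i)" for i
  have \<iota>: "\<iota> i < length \<kappa> \<and> coset (\<gamma> ! \<iota> i) = ?f (\<gamma> ! i) \<and> \<kappa> ! \<iota> i = \<kappa> ! i" if "i < length \<kappa>" for i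
    unfolding \<iota>_def by (rule someI_ex[OF ex[OF that]])
  have gc: "\<gamma> ! i \<in> carrier G" if "i < length \<kappa>" for i using MD(1,2) that nth_mem by (metis subsetD)
  have invol: "\<iota> (\<iota> i) = i" if i: "i < length \<kappa>" for i
  proof -
    let ?j = "\<iota> i"
    have j: "?j < length \<kappa>" using \<iota>[OF i] by blast
    have c: "\<gamma> ! i \<in> carrier G" "\<gamma> ! ?j \<in> carrier G" using gc i j by auto
    have "\<gamma> ! ?j \<otimes> inv (h \<otimes> inv (\<gamma> ! i)) \<in> T" using \<iota>[OF i] c h by (simp add: coset_eq')
    then have "\<gamma> ! i \<otimes> inv (h \<otimes> inv (\<gamma> ! ?j)) \<in> T" using c h by (simp add: inv_mult m_ac)
    then have "coset (\<gamma> ! i) = ?f (\<gamma> ! ?j)" using c h by (simp add: coset_eq')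
    then have "coset (\<gamma> ! \<iota> ?j) = coset (\<gamma> ! i)" using \<iota>[OF j] by simp
    moreover have "\<iota> ?j < length \<gamma>" "i < length \<gamma>" using \<iota>[OF j] i MD(1) by auto
    ultimately show ?thesis using MD(3) by (metis distinct_conv_nth length_map nth_map)
  qed
  show thesis by (rule that[of \<iota>]) (use \<iota> invol in auto)
qed

text \<open>The sign condition on the first group comes from \<open>odd_block_sign\<close>. The
  representatives in \<gamma> are only reordered here, so the relation within a pair holds just
  modulo \<open>T\<close>.\<close>

theorem form_of_involution:
  assumes M: "M_data G T \<beta> \<kappa> \<gamma>" and h: "h \<in> carrier G"
    and \<Phi>: "\<Phi> \<in> homog (map (m_inv G) (rows_of \<kappa> \<gamma>)) (rows_of \<kappa> \<gamma>) h" "det \<Phi> \<noteq> 0"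
      "transpose_mat \<Phi> = \<delta> \<cdot>\<^sub>m \<Phi>" "\<delta> \<in> {1, - 1}"
  obtains F where "is_form1 G T \<beta> F" "reordering_of F \<kappa> \<gamma>"
    "\<And>i. i \<in> {1..f_m F} \<Longrightarrow> h \<otimes> inv (f_g F i) \<otimes> inv (f_g F i) \<in> T"
    "\<And>i. i \<in> {1..f_l F} \<Longrightarrow> beta_sign G \<beta> ab (h \<otimes> inv (f_g F i) \<otimes> inv (f_g F i)) = \<delta>"
    "\<And>i. i \<in> {Suc (f_m F)..f_k F} \<Longrightarrow> coset (f_g'' F i) = coset (h \<otimes> inv (f_g' F i))"
proof -
  note MD = M_dataD[OF M]
  obtain \<iota> where \<iota>: "\<And>i. i < length \<kappa> \<Longrightarrow> \<iota> i < length \<kappa> \<and> \<iota> (\<iota> i) = i \<and> \<kappa> ! (\<iota> i) = \<kappa> ! i"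
    "\<And>i. i < length \<kappa> \<Longrightarrow> coset (\<gamma> ! \<iota> i) = coset (h \<otimes> inv (\<gamma> ! i))"
    using component_involution[OF M h \<Phi>(1,2)] by blast
  obtain F e where F: "reordering_of F \<kappa> \<gamma>" "f_l F \<le> f_m F" "f_m F \<le> f_k F"
    "\<And>i. i \<in> {1..f_k F} \<Longrightarrow> 0 < f_q F i" "\<And>i. i \<in> {1..f_l F} \<Longrightarrow> odd (f_q F i)"
    "\<And>i. i \<in> {1..f_k F} \<Longrightarrow> e i < length \<kappa>"
    "\<And>i. i \<in> {1..f_m F} \<Longrightarrow> \<iota> (e i) = e i \<and> f_g F i = \<gamma> ! e i"
    "\<And>i. i \<in> {1..f_l F} \<Longrightarrow> f_q F i = \<kappa> ! e i"
    "\<And>i. i \<in> {Suc (f_m F)..f_k F} \<Longrightarrow> f_g' F i = \<gamma> ! e i \<and> f_g'' F i = \<gamma> ! \<iota> (e i)"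
    using involution_form1[OF MD(1)[symmetric] MD(5) \<iota>(1)] by blast
  obtain \<sigma> where \<sigma>: "\<sigma> permutes {..<length \<kappa>}" "form_kappa F = permute_list \<sigma> \<kappa>" "form_gamma F = permute_list \<sigma> \<gamma>"
    using F(1) unfolding reordering_of_def by blast
  have \<sigma>g: "\<sigma> permutes {..<length \<gamma>}" "\<sigma> permutes {..<length (map coset \<gamma>)}" using \<sigma>(1) MD(1) by auto
  have MF: "M_data G T \<beta> (form_kappa F) (form_gamma F)"
  proof (rule M_dataI)
    show "length (form_kappa F) = length (form_gamma F)" unfolding \<sigma> using MD(1) by simp
    show "set (form_gamma F) \<subseteq> carrier G" unfolding \<sigma> using MD(2) set_permute_list[OF \<sigma>g(1)] by simp
    have "map coset (form_gamma F) = permute_list \<sigma> (map coset \<gamma>)"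
      unfolding \<sigma> by (rule permute_list_map[symmetric, OF \<sigma>g(1)])
    then show "distinct (map coset (form_gamma F))" using MD(3) distinct_permute_list[OF \<sigma>g(2)] by simp
    show "form_kappa F \<noteq> []" unfolding \<sigma>(2) using MD(4) by (metis length_0_conv length_permute_list)
    show "\<And>n. n \<in> set (form_kappa F) \<Longrightarrow> 0 < n" unfolding \<sigma>(2) using MD(5) set_permute_list[OF \<sigma>(1)] by simp
  qed
  have self: "e i < length \<gamma>" "coset (\<gamma> ! e i) = coset (h \<otimes> inv (\<gamma> ! e i))" "\<gamma> ! e i \<in> carrier G" if i: "i \<in> {1..f_m F}" for i
  proof -
    have "e i < length \<kappa>" using F(6)[of i] F(3) i by auto
    then show "e i < length \<gamma>" "coset (\<gamma> ! e i) = coset (h \<otimes> inv (\<gamma> ! e i))" "\<gamma> ! e i \<in> carrier G"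
      using \<iota>(2)[of "e i"] F(7)[OF i] MD(1,2) by auto
  qed
  show thesis
  proof (rule that[of F])
    show "is_form1 G T \<beta> F" unfolding is_form1_def using F(2-5) MF by blast
    show "h \<otimes> inv (f_g F i) \<otimes> inv (f_g F i) \<in> T" if i: "i \<in> {1..f_m F}" for i
      using self[OF i] F(7)[OF i] h coset_eq'[of "h \<otimes> inv (\<gamma> ! e i)" "\<gamma> ! e i"] by simp
    show "beta_sign G \<beta> ab (h \<otimes> inv (f_g F i) \<otimes> inv (f_g F i)) = \<delta>" if i: "i \<in> {1..f_l F}" for i
    proof -
      have im: "i \<in> {1..f_m F}" using i F(2) by auto
      show ?thesis using odd_block_sign[OF M h \<Phi> self(1,2)[OF im]] F(5,8)[OF i] F(7)[OF im] by simp
    qed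
    show "coset (f_g'' F i) = coset (h \<otimes> inv (f_g' F i))" if i: "i \<in> {Suc (f_m F)..f_k F}" for i
    proof -
      have "e i < length \<kappa>" using F(6)[of i] i by auto
      then show ?thesis using \<iota>(2)[of "e i"] F(9)[OF i] by simp
    qed
  qed (rule F(1))
qed

end

section \<open>The classification\<close>

lemma (in std_realization) M_alg_rows:
  assumes M: "M_data G T \<beta> \<kappa> \<gamma>"
  shows "gsize (M_alg G T \<beta> ab \<kappa> \<gamma>) = length (rows_of \<kappa> \<gamma>) * d"
    "g \<in> carrier G \<Longrightarrow> gcomp (M_alg G T \<beta> ab \<kappa> \<gamma>) g = homog (rows_of \<kappa> \<gamma>) (rows_of \<kappa> \<gamma>) g"
    "set (rows_of \<kappa> \<gamma>) \<subseteq> carrier G" "rows_of \<kappa> \<gamma> \<noteq> []"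
proof -
  note MD = M_dataD[OF M]
  show "gsize (M_alg G T \<beta> ab \<kappa> \<gamma>) = length (rows_of \<kappa> \<gamma>) * d" by (rule gsize_M_alg[OF MD(1)])
  show "gcomp (M_alg G T \<beta> ab \<kappa> \<gamma>) g = homog (rows_of \<kappa> \<gamma>) (rows_of \<kappa> \<gamma>) g" if "g \<in> carrier G"
    by (rule gcomp_M_alg[OF MD(1,2) that])
  show "set (rows_of \<kappa> \<gamma>) \<subseteq> carrier G" by (rule rows_of_carrier[OF M])
  have l: "0 < length \<kappa>" using MD(4) by simp
  have 0: "0 < length \<gamma>" "0 < \<kappa> ! 0" using l MD(1) MD(5)[OF nth_mem[OF l]] by auto
  show "rows_of \<kappa> \<gamma> \<noteq> []"
  proof
    assume "rows_of \<kappa> \<gamma> = []"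
    then have "count (mset (map coset (rows_of \<kappa> \<gamma>))) (coset (\<gamma> ! 0)) = 0" by simp
    then show False using count_map_rows_of[OF MD(1,3) 0(1)] 0(2) by simp
  qed
qed

context elementary_realization
begin

text \<open>
  The common content of admissibility and of the normal form of an involution: \<open>h\<close> is the degree of
  the matrix of the form.
\<close>

definition paired_by :: "'a \<Rightarrow> 'f \<Rightarrow> 'a form1 \<Rightarrow> bool" where
  "paired_by h \<delta> F \<longleftrightarrow> h \<in> carrier G \<and> \<delta> \<in> {1, - 1} \<and>
     (\<forall>i\<in>{1..f_m F}. h \<otimes> inv (f_g F i) \<otimes> inv (f_g F i) \<in> T) \<and>
     (\<forall>i\<in>{1..f_l F}. beta_sign G \<beta> ab (h \<otimes> inv (f_g F i) \<otimes> inv (f_g F i)) = \<delta>) \<and>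
     (\<forall>i\<in>{Suc (f_m F)..f_k F}. coset (f_g'' F i) = coset (h \<otimes> inv (f_g' F i)))"

lemma paired_byD:
  assumes "paired_by h \<delta> F"
  shows "h \<in> carrier G" "\<delta> \<in> {1, - 1}"
    "\<And>i. i \<in> {1..f_m F} \<Longrightarrow> h \<otimes> inv (f_g F i) \<otimes> inv (f_g F i) \<in> T"
    "\<And>i. i \<in> {1..f_l F} \<Longrightarrow> beta_sign G \<beta> ab (h \<otimes> inv (f_g F i) \<otimes> inv (f_g F i)) = \<delta>"
    "\<And>i. i \<in> {Suc (f_m F)..f_k F} \<Longrightarrow> coset (f_g'' F i) = coset (h \<otimes> inv (f_g' F i))"
  using assms unfolding paired_by_def by blast+

lemma is_form1_carrier:
  assumes "is_form1 G T \<beta> F"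
  shows "\<And>i. i \<in> {1..f_m F} \<Longrightarrow> f_g F i \<in> carrier G"
    "\<And>i. i \<in> {Suc (f_m F)..f_k F} \<Longrightarrow> f_g' F i \<in> carrier G"
    "\<And>i. i \<in> {Suc (f_m F)..f_k F} \<Longrightarrow> f_g'' F i \<in> carrier G"
    "f_l F \<le> f_m F" "f_m F \<le> f_k F" "0 < f_k F"
proof -
  have M: "M_data G T \<beta> (form_kappa F) (form_gamma F)" and b: "f_l F \<le> f_m F" "f_m F \<le> f_k F"
    using assms by (auto simp: is_form1_def)
  show "\<And>i. i \<in> {1..f_m F} \<Longrightarrow> f_g F i \<in> carrier G"
    "\<And>i. i \<in> {Suc (f_m F)..f_k F} \<Longrightarrow> f_g' F i \<in> carrier G"
    "\<And>i. i \<in> {Suc (f_m F)..f_k F} \<Longrightarrow> f_g'' F i \<in> carrier G"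
    using M_dataD(2)[OF M] unfolding set_form_gamma by auto
  show "f_l F \<le> f_m F" "f_m F \<le> f_k F" by (rule b)+
  show "0 < f_k F" using f_k_pos[OF b] M_dataD(4)[OF M] by blast
qed

lemma star_admissibleI:
  assumes F: "is_form1 G T \<beta> F" and p: "paired_by h \<delta> F"
  shows "star_admissible G T \<beta> ab F"
proof -
  note c = is_form1_carrier[OF F] and p = paired_byD[OF p]
  let ?p = "\<lambda>i. if i \<le> f_m F then f_g F i \<otimes> f_g F i else f_g' F i \<otimes> f_g'' F i"
  let ?t = "\<lambda>i. h \<otimes> inv (f_g F i) \<otimes> inv (f_g F i)"
  have pc: "?p i \<in> carrier G \<and> coset (?p i) = coset h" if i: "i \<in> {1..f_k F}" for i
  proof (cases "i \<le> f_m F")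
    case True
    then have i: "i \<in> {1..f_m F}" using i by simp
    have "h \<otimes> inv (f_g F i \<otimes> f_g F i) = ?t i" using c(1)[OF i] p(1) by (simp add: inv_mult m_assoc)
    then have "coset h = coset (f_g F i \<otimes> f_g F i)" using p(3)[OF i] c(1)[OF i] p(1) by (simp add: coset_eq')
    then show ?thesis using True c(1)[OF i] by simp
  next
    case False
    then have i: "i \<in> {Suc (f_m F)..f_k F}" using i by simp
    note g = c(2,3)[OF i]
    have "coset (f_g' F i \<otimes> f_g'' F i) = coset (f_g' F i \<otimes> (h \<otimes> inv (f_g' F i)))"
      using p(5)[OF i] g p(1) by (simp add: coset_mult_cong)
    also have "f_g' F i \<otimes> (h \<otimes> inv (f_g' F i)) = h \<otimes> (f_g' F i \<otimes> inv (f_g' F i))"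
      using g p(1) by (simp only: m_ac m_closed inv_closed)
    also have "\<dots> = h" using g p(1) by simp
    finally show ?thesis using False g by simp
  qed
  have eq: "f_g F i \<otimes> f_g F i \<otimes> ?t i = h" if i: "i \<in> {1..f_l F}" for i
  proof -
    have g: "f_g F i \<in> carrier G" using c(1)[of i] c(4) i by auto
    have "f_g F i \<otimes> f_g F i \<otimes> ?t i = h \<otimes> (f_g F i \<otimes> inv (f_g F i)) \<otimes> (f_g F i \<otimes> inv (f_g F i))"
      using g p(1) by (simp only: m_ac m_closed inv_closed)
    then show ?thesis using g p(1) by simp
  qed
  show ?thesis
    unfolding star_admissible_def Let_def
  proof (intro conjI ballI exI[of _ ?t])
    show "(?p i, ?p j) \<in> rcong T" if ij: "i \<in> {1..f_k F}" "j \<in> {1..f_k F}" for i j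
      using pc[OF ij(1)] pc[OF ij(2)] coset_eq_rcong[of "?p i" "?p j"] by metis
    show "?t i \<in> T" if "i \<in> {1..f_l F}" for i using p(3)[of i] c(4) that by simp
    show "f_g F i \<otimes> f_g F i \<otimes> ?t i = f_g F j \<otimes> f_g F j \<otimes> ?t j" if "i \<in> {1..f_l F}" "j \<in> {1..f_l F}" for i j
      by (simp only: eq[OF that(1)] eq[OF that(2)])
    show "beta_sign G \<beta> ab (?t i) = beta_sign G \<beta> ab (?t j)" if "i \<in> {1..f_l F}" "j \<in> {1..f_l F}" for i j
      by (simp only: p(4)[OF that(1)] p(4)[OF that(2)])
  qed
qed

lemma star_admissibleD:
  assumes F: "is_form1 G T \<beta> F" and s: "star_admissible G T \<beta> ab F"
  obtains h \<delta> where "paired_by h \<delta> F"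
proof -
  note c = is_form1_carrier[OF F]
  let ?p = "\<lambda>i. if i \<le> f_m F then f_g F i \<otimes> f_g F i else f_g' F i \<otimes> f_g'' F i"
  obtain t where t: "\<And>i. i \<in> {1..f_l F} \<Longrightarrow> t i \<in> T"
    and te: "\<And>i j. i \<in> {1..f_l F} \<Longrightarrow> j \<in> {1..f_l F} \<Longrightarrow>
           f_g F i \<otimes> f_g F i \<otimes> t i = f_g F j \<otimes> f_g F j \<otimes> t j \<and>
           beta_sign G \<beta> ab (t i) = beta_sign G \<beta> ab (t j)"
    using s unfolding star_admissible_def by blast
  have cong: "\<And>i j. i \<in> {1..f_k F} \<Longrightarrow> j \<in> {1..f_k F} \<Longrightarrow> (?p i, ?p j) \<in> rcong T"
    using s unfolding star_admissible_def Let_def by blast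
  have pcar: "?p i \<in> carrier G" if "i \<in> {1..f_k F}" for i using cong[OF that that] rcong_iff by blast
  have one: "1 \<in> {1..f_k F}" using c(6) by simp
  \<comment> \<open>If the first group is not empty, the exact common value \<open>g_1^2 t_1\<close>
    has to be taken, since the signs of the \<open>t_i\<close> depend on it. Otherwise any
    representative of the common coset serves, and the sign is set to 1.\<close>
  define h where "h = (if 0 < f_l F then f_g F 1 \<otimes> f_g F 1 \<otimes> t 1 else ?p 1)"
  define \<delta> where "\<delta> = (if 0 < f_l F then beta_sign G \<beta> ab (t 1) else 1)"
  have hp: "h \<in> carrier G" "coset h = coset (?p 1)"
  proof -
    have "h \<in> carrier G \<and> coset h = coset (?p 1)"
    proof (cases "0 < f_l F")
      case True
      then have 1: "1 \<in> {1..f_l F}" "1 \<in> {1..f_m F}" using c(4) by auto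
      then show ?thesis using t[OF 1(1)] c(1)[OF 1(2)] True by (simp add: h_def coset_mult_T)
    qed (use pcar[OF one] in \<open>simp add: h_def\<close>)
    then show "h \<in> carrier G" "coset h = coset (?p 1)" by auto
  qed
  have hi: "coset h = coset (?p i)" if i: "i \<in> {1..f_k F}" for i
    using hp(2) cong[OF one i] coset_eq_rcong[OF pcar[OF one] pcar[OF i]] by simp
  have tl: "h \<otimes> inv (f_g F i) \<otimes> inv (f_g F i) = t i" if i: "i \<in> {1..f_l F}" for i
  proof -
    have g: "f_g F i \<in> carrier G" "t i \<in> carrier G" using c(1)[of i] c(4) i t[OF i] by auto
    have "h = f_g F i \<otimes> f_g F i \<otimes> t i" using te[OF i, of 1] i unfolding h_def by auto
    then have "h \<otimes> inv (f_g F i) \<otimes> inv (f_g F i) = t i \<otimes> (f_g F i \<otimes> inv (f_g F i)) \<otimes> (f_g F i \<otimes> inv (f_g F i))"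
      using g by (simp only: m_ac m_closed inv_closed)
    then show ?thesis using g by simp
  qed
  have "paired_by h \<delta> F"
    unfolding paired_by_def
  proof (intro conjI ballI hp(1))
    show "\<delta> \<in> {1, - 1}" using beta_sign(2)[OF t, of 1] by (auto simp: \<delta>_def)
    show "h \<otimes> inv (f_g F i) \<otimes> inv (f_g F i) \<in> T" if i: "i \<in> {1..f_m F}" for i
    proof -
      have "coset h = coset (f_g F i \<otimes> f_g F i)" using hi[of i] i c(5) by simp
      then have "h \<otimes> inv (f_g F i \<otimes> f_g F i) \<in> T" using hp(1) c(1)[OF i] by (simp add: coset_eq')
      then show ?thesis using hp(1) c(1)[OF i] by (simp add: inv_mult m_assoc)
    qed
    show "beta_sign G \<beta> ab (h \<otimes> inv (f_g F i) \<otimes> inv (f_g F i)) = \<delta>" if i: "i \<in> {1..f_l F}" for i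
      unfolding tl[OF i] \<delta>_def using te[OF i, of 1] i by auto
    show "coset (f_g'' F i) = coset (h \<otimes> inv (f_g' F i))" if i: "i \<in> {Suc (f_m F)..f_k F}" for i
    proof -
      note g = c(2,3)[OF i]
      have "coset h = coset (f_g' F i \<otimes> f_g'' F i)" using hi[of i] i by simp
      then have "coset (inv (f_g' F i) \<otimes> h) = coset (inv (f_g' F i) \<otimes> (f_g' F i \<otimes> f_g'' F i))"
        using g hp(1) by (simp add: coset_mult_cong)
      also have "inv (f_g' F i) \<otimes> (f_g' F i \<otimes> f_g'' F i) = f_g'' F i" using g by (simp flip: m_assoc)
      finally show ?thesis using g hp(1) by (simp add: m_comm)
    qed
  qed
  then show thesis by (rule that)
qed

text \<open>\<open>dual_g\<close> moves components only within their cosets, so the rows agree with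
  those of \<kappa> and \<gamma> as a multiset of cosets. The factor \<one> is the trivial
  translation, in the shape that \<open>homog_monomial\<close> and \<open>graded_congruence\<close>
  expect.\<close>

lemma paired_star_data:
  assumes F: "is_form1 G T \<beta> F" and p: "paired_by h \<delta> F" and r: "reordering_of F \<kappa> \<gamma>" and M: "M_data G T \<beta> \<kappa> \<gamma>"
  defines "\<tau> \<equiv> \<lambda>i. h \<otimes> inv (f_g F i) \<otimes> inv (f_g F i)"
  shows "M_star_data G T \<beta> ab (dual_g h F) \<tau> \<delta>" "form_degree (dual_g h F) \<tau> = h"
    "reordering_mod G T (dual_g h F) \<kappa> \<gamma>"
    "mset (map (\<lambda>y. coset (\<one> \<otimes> y)) (form_rows (dual_g h F))) = mset (map coset (rows_of \<kappa> \<gamma>))"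
proof -
  note a = adjust_form[OF F paired_byD[OF p], folded \<tau>_def]
  show data: "M_star_data G T \<beta> ab (dual_g h F) \<tau> \<delta>" by (rule a(1))
  show "form_degree (dual_g h F) \<tau> = h" by (rule a(2))
  obtain \<sigma> where \<sigma>: "\<sigma> permutes {..<length \<kappa>}" "form_kappa F = permute_list \<sigma> \<kappa>" "form_gamma F = permute_list \<sigma> \<gamma>"
    using r unfolding reordering_of_def by blast
  show "reordering_mod G T (dual_g h F) \<kappa> \<gamma>"
    unfolding reordering_mod_def by (intro exI[of _ \<sigma>] conjI) (use \<sigma> a(3,4) in simp_all)
  have "map coset (form_rows (dual_g h F)) = rows_of (form_kappa (dual_g h F)) (map coset (form_gamma (dual_g h F)))"
    by (simp only: form_rows_def rows_of_map)
  also have "\<dots> = rows_of (form_kappa F) (map coset (form_gamma F))"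
    by (rule arg_cong2[where f = rows_of]; rule a; assumption)
  also have "\<dots> = map coset (rows_of (permute_list \<sigma> \<kappa>) (permute_list \<sigma> \<gamma>))"
    by (simp only: \<sigma>(2,3) rows_of_map)
  finally have "map coset (form_rows (dual_g h F)) = map coset (rows_of (permute_list \<sigma> \<kappa>) (permute_list \<sigma> \<gamma>))" .
  moreover have "map (\<lambda>y. coset (\<one> \<otimes> y)) (form_rows (dual_g h F)) = map coset (form_rows (dual_g h F))"
    using form_rows_carrier[OF data] by (intro map_cong refl) auto
  ultimately show "mset (map (\<lambda>y. coset (\<one> \<otimes> y)) (form_rows (dual_g h F))) = mset (map coset (rows_of \<kappa> \<gamma>))"
    using mset_map_rows_of_permute[OF M_dataD(1)[OF M] \<sigma>(1), of coset] by simp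
qed

text \<open>\<open>Phi_mat\<close> belongs to the adjusted representatives, while the algebra is
  built from the given \<kappa> and \<gamma>. A monomial matrix of degree 1 pulls the form back to
  the given rows, and the adjoint map of the result is the involution.\<close>

lemma graded_involution_if_admissible:
  assumes M: "M_data G T \<beta> \<kappa> \<gamma>" and F: "is_form1 G T \<beta> F" and r: "reordering_of F \<kappa> \<gamma>"
    and s: "star_admissible G T \<beta> ab F"
  shows "\<exists>\<phi>. graded_involution G (M_alg G T \<beta> ab \<kappa> \<gamma>) \<phi>"
proof -
  obtain h \<delta> where p: "paired_by h \<delta> F" using star_admissibleD[OF F s] .
  note pd = paired_byD[OF p]
  let ?F = "dual_g h F" and ?\<tau> = "\<lambda>i. h \<otimes> inv (f_g F i) \<otimes> inv (f_g F i)" and ?xs = "rows_of \<kappa> \<gamma>"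
  note D = paired_star_data[OF F p r M]
  note R = M_alg_rows[OF M]
  let ?\<Phi> = "Phi_mat G \<beta> ab ?F ?\<tau> \<delta>" and ?n = "length ?xs * d"
  note \<Phi> = Phi_mat_form[OF D(1), unfolded D(2)]
  have yc: "set (form_rows ?F) \<subseteq> carrier G" by (rule form_rows_carrier[OF D(1)])
  have len: "length (form_rows ?F) = length ?xs" using arg_cong[OF D(4), of size] by simp
  obtain \<Psi> where \<Psi>: "\<Psi> \<in> homog (form_rows ?F) ?xs \<one>" "det \<Psi> \<noteq> 0"
    using homog_monomial[OF R(3) yc one_closed D(4)] .
  have c: "\<Psi> \<in> carrier_mat ?n ?n" "?\<Phi> \<in> carrier_mat ?n ?n"
    using homog_carrier[OF \<Psi>(1)] homog_carrier[OF \<Phi>(1)] len by simp_all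
  let ?\<Theta> = "transpose_mat \<Psi> * ?\<Phi> * \<Psi>"
  have "\<one> \<otimes> h \<otimes> \<one> = h" using pd(1) by simp
  then have \<Theta>: "?\<Theta> \<in> homog (map (m_inv G) ?xs) ?xs h"
    using congruence_homog[OF R(3) yc one_closed pd(1) \<Psi>(1) \<Phi>(1)] by simp
  have "det ?\<Theta> = det \<Psi> * det ?\<Phi> * det \<Psi>"
    using c by (simp add: det_mult[of _ ?n] det_transpose[of _ ?n])
  then have det: "det ?\<Theta> \<noteq> 0" using \<Psi>(2) \<Phi>(2) by simp
  note gi = adjoint_graded_involution[OF R(3) \<Theta> det congruence_transpose[OF c \<Phi>(3)] pd(2,1)]
  have "graded_involution G (M_alg G T \<beta> ab \<kappa> \<gamma>) (adjoint_map ?\<Theta>)"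
    unfolding graded_involution_def R(1) using gi R(2) by simp
  then show ?thesis by blast
qed

end

context closed_realization
begin

text \<open>One extraction serves both the existence criterion and the normal form; the sign is
  written as \<open>inv_sgn\<close> so that it is read off \<phi>.\<close>

lemma involution_data:
  assumes M: "M_data G T \<beta> \<kappa> \<gamma>" and \<phi>: "graded_involution G (M_alg G T \<beta> ab \<kappa> \<gamma>) \<phi>"
  obtains \<Phi> h F where "is_form1 G T \<beta> F" "reordering_of F \<kappa> \<gamma>"
    "paired_by h (inv_sgn (gsize (M_alg G T \<beta> ab \<kappa> \<gamma>)) \<phi>) F"
    "\<Phi> \<in> homog (map (m_inv G) (rows_of \<kappa> \<gamma>)) (rows_of \<kappa> \<gamma>) h" "det \<Phi> \<noteq> 0"
    "transpose_mat \<Phi> = inv_sgn (gsize (M_alg G T \<beta> ab \<kappa> \<gamma>)) \<phi> \<cdot>\<^sub>m \<Phi>"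
    "\<And>W. W \<in> carrier_mat (length (rows_of \<kappa> \<gamma>) * d) (length (rows_of \<kappa> \<gamma>) * d) \<Longrightarrow> \<phi> W = adjoint_map \<Phi> W"
proof -
  let ?xs = "rows_of \<kappa> \<gamma>"
  let ?n = "length ?xs * d"
  note R = M_alg_rows[OF M]
  have inv: "mat_involution ?n \<phi>" and gr: "\<And>g. g \<in> carrier G \<Longrightarrow> \<phi> ` homog ?xs ?xs g = homog ?xs ?xs g"
    using \<phi> R(1,2) unfolding graded_involution_def by auto
  have n0: "0 < ?n" using R(4) d_pos by simp
  obtain \<Phi> h \<delta> where h: "h \<in> carrier G" and \<Phi>: "\<Phi> \<in> homog (map (m_inv G) ?xs) ?xs h" "det \<Phi> \<noteq> 0"
    "transpose_mat \<Phi> = \<delta> \<cdot>\<^sub>m \<Phi>" "\<delta> \<in> {1, - 1}"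
    and adj: "\<And>W. W \<in> carrier_mat ?n ?n \<Longrightarrow> \<phi> W = adjoint_map \<Phi> W" and sgn: "inv_sgn ?n \<phi> = \<delta>"
    by (rule involution_form[OF R(3) refl n0 inv gr]) (assumption | (rule that; assumption))+
  obtain F where F: "is_form1 G T \<beta> F" "reordering_of F \<kappa> \<gamma>"
    "\<And>i. i \<in> {1..f_m F} \<Longrightarrow> h \<otimes> inv (f_g F i) \<otimes> inv (f_g F i) \<in> T"
    "\<And>i. i \<in> {1..f_l F} \<Longrightarrow> beta_sign G \<beta> ab (h \<otimes> inv (f_g F i) \<otimes> inv (f_g F i)) = \<delta>"
    "\<And>i. i \<in> {Suc (f_m F)..f_k F} \<Longrightarrow> coset (f_g'' F i) = coset (h \<otimes> inv (f_g' F i))"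
    by (rule form_of_involution[OF M h \<Phi>]) (rule that; assumption)
  have "paired_by h \<delta> F" unfolding paired_by_def using h \<Phi>(4) F(3-5) by blast
  then show thesis using that[OF F(1,2) _ \<Phi>(1,2) _ adj] \<Phi>(3) sgn R(1) by simp
qed

lemma involution_isomorphic_M_star:
  assumes M: "M_data G T \<beta> \<kappa> \<gamma>" and \<phi>: "graded_involution G (M_alg G T \<beta> ab \<kappa> \<gamma>) \<phi>"
  shows "\<exists>F \<tau> \<delta>. \<delta> = inv_sgn (gsize (M_alg G T \<beta> ab \<kappa> \<gamma>)) \<phi> \<and>
     reordering_mod G T F \<kappa> \<gamma> \<and> M_star_data G T \<beta> ab F \<tau> \<delta> \<and>
     graded_inv_isomorphic G (M_alg G T \<beta> ab \<kappa> \<gamma>, \<phi>) (M_star G T \<beta> ab F \<tau> \<delta>)"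
proof -
  define \<delta> where "\<delta> = inv_sgn (gsize (M_alg G T \<beta> ab \<kappa> \<gamma>)) \<phi>"
  let ?xs = "rows_of \<kappa> \<gamma>"
  let ?n = "length ?xs * d"
  obtain \<Phi> h F where F: "is_form1 G T \<beta> F" "reordering_of F \<kappa> \<gamma>" and p: "paired_by h \<delta> F"
    and \<Phi>: "\<Phi> \<in> homog (map (m_inv G) ?xs) ?xs h" "det \<Phi> \<noteq> 0" "transpose_mat \<Phi> = \<delta> \<cdot>\<^sub>m \<Phi>"
    and adj: "\<And>W. W \<in> carrier_mat ?n ?n \<Longrightarrow> \<phi> W = adjoint_map \<Phi> W"
    by (rule involution_data[OF M \<phi>, folded \<delta>_def]) (rule that; assumption)
  note pd = paired_byD[OF p]
  let ?F = "dual_g h F" and ?\<tau> = "\<lambda>i. h \<otimes> inv (f_g F i) \<otimes> inv (f_g F i)"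
  note D = paired_star_data[OF F(1) p F(2) M]
  note R = M_alg_rows[OF M]
  note R' = M_alg_rows[OF form_M_data[OF D(1)], folded form_rows_def]
  note \<Phi>' = Phi_mat_form[OF D(1), unfolded D(2)]
  have len: "length (form_rows ?F) = length ?xs" using arg_cong[OF D(4), of size] by simp
  have h1: "h = \<one> \<otimes> h \<otimes> \<one>" using pd(1) by simp
  obtain \<Psi> where \<Psi>: "\<Psi> \<in> homog (form_rows ?F) ?xs \<one>" "det \<Psi> \<noteq> 0"
      "transpose_mat \<Psi> * Phi_mat G \<beta> ab ?F ?\<tau> \<delta> * \<Psi> = \<Phi>"
    by (rule graded_congruence[OF R(3) R'(3) one_closed pd(1) \<Phi> \<Phi>' pd(2) h1 D(4)])
  have "graded_inv_isomorphic G (M_alg G T \<beta> ab \<kappa> \<gamma>, \<phi>) (M_star G T \<beta> ab ?F ?\<tau> \<delta>)"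
    unfolding M_star_def
    by (rule graded_inv_isomorphicI[OF R(3) R'(3) one_closed len R(1,2) adj R'(1,2) refl \<Phi>(1,2) \<Phi>'(1,2) \<Psi>])
  then show ?thesis using D(1,3) \<delta>_def by blast
qed

text \<open>Both sides amount to equal signs and the existence of a \<open>k\<close> with
  \<open>h1 = k h2 k\<close> that matches the cosets of the rows.\<close>

lemma M_star_isomorphic_iff:
  assumes d1: "M_star_data G T \<beta> ab F1 \<tau>1 \<delta>1" and d2: "M_star_data G T \<beta> ab F2 \<tau>2 \<delta>2"
  shows "graded_inv_isomorphic G (M_star G T \<beta> ab F1 \<tau>1 \<delta>1) (M_star G T \<beta> ab F2 \<tau>2 \<delta>2) \<longleftrightarrow>
    form1_equiv G T F1 \<tau>1 F2 \<tau>2 \<and> \<delta>1 = \<delta>2"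
proof -
  note R1 = M_alg_rows[OF form_M_data[OF d1], folded form_rows_def]
  note R2 = M_alg_rows[OF form_M_data[OF d2], folded form_rows_def]
  note P1 = Phi_mat_form[OF d1] and P2 = Phi_mat_form[OF d2]
  note h1 = form_degree_carrier[OF d1] and h2 = form_degree_carrier[OF d2]
  show ?thesis
  proof
    assume i: "graded_inv_isomorphic G (M_star G T \<beta> ab F1 \<tau>1 \<delta>1) (M_star G T \<beta> ab F2 \<tau>2 \<delta>2)"
    obtain k where k: "k \<in> carrier G" "form_degree F1 \<tau>1 = k \<otimes> form_degree F2 \<tau>2 \<otimes> k" "\<delta>1 = \<delta>2"
      "mset (map (\<lambda>y. coset (k \<otimes> y)) (form_rows F2)) = mset (map coset (form_rows F1))"
      by (rule graded_inv_isomorphicD[OF R1(3) R2(3) R1(4) R1(1,2) R2(1,2) P1 h1 P2 h2 i[unfolded M_star_def]])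
    show "form1_equiv G T F1 \<tau>1 F2 \<tau>2 \<and> \<delta>1 = \<delta>2"
      using mset_imp_form1_equiv[OF d1 d2 k(1,2,4)] k(3) by blast
  next
    assume e: "form1_equiv G T F1 \<tau>1 F2 \<tau>2 \<and> \<delta>1 = \<delta>2"
    then obtain k where k: "k \<in> carrier G" "form_degree F1 \<tau>1 = k \<otimes> form_degree F2 \<tau>2 \<otimes> k"
      "mset (map (\<lambda>y. coset (k \<otimes> y)) (form_rows F2)) = mset (map coset (form_rows F1))"
      using form1_equiv_imp_mset[OF d1 d2] by blast
    have len: "length (form_rows F2) = length (form_rows F1)" using arg_cong[OF k(3), of size] by simp
    have P2': "transpose_mat (Phi_mat G \<beta> ab F2 \<tau>2 \<delta>2) = \<delta>1 \<cdot>\<^sub>m Phi_mat G \<beta> ab F2 \<tau>2 \<delta>2" using P2(3) e by simp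
    obtain \<Psi> where \<Psi>: "\<Psi> \<in> homog (form_rows F2) (form_rows F1) k" "det \<Psi> \<noteq> 0"
      "transpose_mat \<Psi> * Phi_mat G \<beta> ab F2 \<tau>2 \<delta>2 * \<Psi> = Phi_mat G \<beta> ab F1 \<tau>1 \<delta>1"
      by (rule graded_congruence[OF R1(3) R2(3) k(1) h2 P1 P2(1,2) P2' form_\<delta>(1)[OF d1] k(2,3)])
    show "graded_inv_isomorphic G (M_star G T \<beta> ab F1 \<tau>1 \<delta>1) (M_star G T \<beta> ab F2 \<tau>2 \<delta>2)"
      unfolding M_star_def
      by (rule graded_inv_isomorphicI[OF R1(3) R2(3) k(1) len R1(1,2) refl R2(1,2) refl P1(1,2) P2(1,2) \<Psi>])
  qed
qed

end

lemma same_bichar_if_M_star_isomorphic: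
  fixes G (structure)
  assumes R1: "std_realization G T1 \<beta>1 ab1" and R2: "std_realization G T2 \<beta>2 ab2"
    and M: "M_data G T1 \<beta>1 \<kappa>1 \<gamma>1" "M_data G T2 \<beta>2 \<kappa>2 \<gamma>2"
    and iso: "graded_inv_isomorphic G (M_alg G T1 \<beta>1 ab1 \<kappa>1 \<gamma>1, \<phi>1) (M_alg G T2 \<beta>2 ab2 \<kappa>2 \<gamma>2, \<phi>2)"
  shows "T1 = T2" "\<beta>1 = \<beta>2"
proof -
  interpret R1: std_realization G T1 \<beta>1 ab1 by (rule R1)
  interpret R2: std_realization G T2 \<beta>2 ab2 by (rule R2)
  note A1 = R1.M_alg_rows[OF M(1)] and A2 = R2.M_alg_rows[OF M(2)]
  let ?n1 = "length (rows_of \<kappa>1 \<gamma>1) * R1.d" and ?n2 = "length (rows_of \<kappa>2 \<gamma>2) * R2.d"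
  let ?H1 = "R1.homog (rows_of \<kappa>1 \<gamma>1) (rows_of \<kappa>1 \<gamma>1)" and ?H2 = "R2.homog (rows_of \<kappa>2 \<gamma>2) (rows_of \<kappa>2 \<gamma>2)"
  obtain f where f: "alg_iso ?n1 ?n2 f" and gr: "\<And>g. g \<in> carrier G \<Longrightarrow> f ` ?H1 g = ?H2 g"
    using iso A1(1,2) A2(1,2) unfolding graded_inv_isomorphic_def Let_def fst_conv snd_conv alg_iso_def by auto
  have gr': "inv_into (carrier_mat ?n1 ?n1) f ` ?H2 g = ?H1 g" if "g \<in> carrier G" for g
    unfolding gr[OF that, symmetric]
    by (rule inv_into_image_cancel) (use alg_isoD(2)[OF f] R1.homog_carrier in \<open>auto simp: bij_betw_def\<close>)
  note i1 = R1.coset_inj_rows_of[OF M(1)] and i2 = R2.coset_inj_rows_of[OF M(2)]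
  note s1 = same_bicharacter_if_graded_iso[OF R1 R2 i1 i2 A1(4) A2(4) refl refl f gr]
  note s2 = same_bicharacter_if_graded_iso[OF R2 R1 i2 i1 A2(4) A1(4) refl refl alg_iso_inv[OF f] gr']
  show T: "T1 = T2" using s1(1) s2(1) by blast
  \<comment> \<open>Bicharacters are extensional, so agreement on the common
    \<open>T \<times> T\<close> is equality of functions.\<close>
  have "\<beta>1 \<in> T1 \<times> T1 \<rightarrow>\<^sub>E - {0}" "\<beta>2 \<in> T1 \<times> T1 \<rightarrow>\<^sub>E - {0}"
    using R1.T_alt R2.T_alt T by (auto simp: alternating_bicharacter_def)
  then show "\<beta>1 = \<beta>2" by (rule PiE_ext) (use s1(2) in auto)
qed

theorem corollary2p15:
  fixes G :: "('g, 'x) monoid_scheme"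
    and std :: "'g set \<Rightarrow> ('g \<times> 'g \<Rightarrow> 'f::alg_closed_field) \<Rightarrow> ('g \<times> 'g) list"
  assumes "comm_group G"
    and "CHAR('f) \<noteq> 2"
    and "\<And>T \<beta>. finite_bichar_pair G T \<beta> \<Longrightarrow> standard_generators G T \<beta> (std T \<beta>)"
  shows
    "(\<forall>T \<beta> \<kappa> \<gamma>. M_data G T \<beta> \<kappa> \<gamma> \<longrightarrow>
        ((\<exists>\<phi>. graded_involution G (M_alg G T \<beta> (std T \<beta>) \<kappa> \<gamma>) \<phi>) \<longleftrightarrow>
         elementary_2_group G T \<and>
         (\<exists>F. is_form1 G T \<beta> F \<and> reordering_of F \<kappa> \<gamma> \<and> star_admissible G T \<beta> (std T \<beta>) F))) \<and>
     (\<forall>T \<beta> \<kappa> \<gamma> \<phi>. M_data G T \<beta> \<kappa> \<gamma> \<longrightarrow>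
        graded_involution G (M_alg G T \<beta> (std T \<beta>) \<kappa> \<gamma>) \<phi> \<longrightarrow>
        (\<exists>F \<tau> \<delta>. \<delta> = inv_sgn (gsize (M_alg G T \<beta> (std T \<beta>) \<kappa> \<gamma>)) \<phi> \<and>
           reordering_mod G T F \<kappa> \<gamma> \<and> M_star_data G T \<beta> (std T \<beta>) F \<tau> \<delta> \<and>
           graded_inv_isomorphic G (M_alg G T \<beta> (std T \<beta>) \<kappa> \<gamma>, \<phi>)
             (M_star G T \<beta> (std T \<beta>) F \<tau> \<delta>))) \<and>
     (\<forall>T1 \<beta>1 F1 \<tau>1 \<delta>1 T2 \<beta>2 F2 \<tau>2 \<delta>2.
        M_star_data G T1 \<beta>1 (std T1 \<beta>1) F1 \<tau>1 \<delta>1 \<longrightarrow>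
        M_star_data G T2 \<beta>2 (std T2 \<beta>2) F2 \<tau>2 \<delta>2 \<longrightarrow>
        (graded_inv_isomorphic G (M_star G T1 \<beta>1 (std T1 \<beta>1) F1 \<tau>1 \<delta>1)
           (M_star G T2 \<beta>2 (std T2 \<beta>2) F2 \<tau>2 \<delta>2) \<longleftrightarrow>
         T1 = T2 \<and> \<beta>1 = \<beta>2 \<and> form1_equiv G T1 F1 \<tau>1 F2 \<tau>2 \<and> \<delta>1 = \<delta>2))"
proof -
  interpret comm_group G by (rule assms(1))
  \<comment> \<open>Characteristic 0 is included: among the divisors of 2, characteristic 1 does not
    occur for a field and 2 is excluded.\<close>
  have "\<not> CHAR('f) dvd 2"
  proof
    assume "CHAR('f) dvd 2"
    then have "CHAR('f) = 1 \<or> CHAR('f) = 2" using two_is_prime_nat by (auto simp: prime_nat_iff)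
    then show False using assms(2) by simp
  qed
  then have two: "(2::'f) \<noteq> 0" using of_nat_eq_0_iff_char_dvd[of 2, where 'a = 'f] by simp
  have std: "std_realization G T \<beta> (std T \<beta>)" if "finite_bichar_pair G T \<beta>" for T \<beta>
    by (intro std_realization.intro bichar.intro bichar_axioms.intro std_realization_axioms.intro
      assms(1) that assms(3))
  have closed: "closed_realization G T \<beta> (std T \<beta>)" if "finite_bichar_pair G T \<beta>" "elementary_2_group G T" for T \<beta>
    by (intro closed_realization.intro elementary_realization.intro elementary_realization_axioms.intro
      std that two)
  have pair: "finite_bichar_pair G T \<beta>" if "M_data G T \<beta> \<kappa> \<gamma>" for T and \<beta> :: "'g \<times> 'g \<Rightarrow> 'f" and \<kappa> \<gamma>
    using that by (simp add: M_data_def)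
  \<comment> \<open>This comes before \<open>closed_realization\<close> can be interpreted, since
    that locale assumes \<open>T\<close> to be elementary; the argument runs in
    \<open>std_realization\<close>.\<close>
  have elem: "elementary_2_group G T"
    if M: "M_data G T \<beta> \<kappa> \<gamma>" and \<phi>: "graded_involution G (M_alg G T \<beta> (std T \<beta>) \<kappa> \<gamma>) \<phi>" for T \<beta> \<kappa> \<gamma> \<phi>
  proof -
    interpret R: std_realization G T \<beta> "std T \<beta>" by (rule std[OF pair[OF M]])
    note A = R.M_alg_rows[OF M]
    show ?thesis
      by (rule R.elementary_if_involution[OF R.coset_inj_rows_of[OF M] A(4) refl, of \<phi>])
        (use \<phi> A(1,2) in \<open>auto simp: graded_involution_def mat_involution_def\<close>)
  qed
  have exists: "(\<exists>\<phi>. graded_involution G (M_alg G T \<beta> (std T \<beta>) \<kappa> \<gamma>) \<phi>) \<longleftrightarrow>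
      elementary_2_group G T \<and>
      (\<exists>F. is_form1 G T \<beta> F \<and> reordering_of F \<kappa> \<gamma> \<and> star_admissible G T \<beta> (std T \<beta>) F)"
    (is "?L \<longleftrightarrow> ?E \<and> ?A") if M: "M_data G T \<beta> \<kappa> \<gamma>" for T \<beta> \<kappa> \<gamma>
  proof
    assume ?L
    then obtain \<phi> where \<phi>: "graded_involution G (M_alg G T \<beta> (std T \<beta>) \<kappa> \<gamma>) \<phi>" by blast
    have E: ?E by (rule elem[OF M \<phi>])
    interpret R: closed_realization G T \<beta> "std T \<beta>" by (rule closed[OF pair[OF M] E])
    show "?E \<and> ?A" by (rule R.involution_data[OF M \<phi>]) (use E R.star_admissibleI in blast)
  next
    assume EA: "?E \<and> ?A"
    then interpret R: closed_realization G T \<beta> "std T \<beta>" using closed[OF pair[OF M]] by blast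
    show ?L using EA R.graded_involution_if_admissible[OF M] by blast
  qed
  have normal_form: "\<exists>F \<tau> \<delta>. \<delta> = inv_sgn (gsize (M_alg G T \<beta> (std T \<beta>) \<kappa> \<gamma>)) \<phi> \<and>
      reordering_mod G T F \<kappa> \<gamma> \<and> M_star_data G T \<beta> (std T \<beta>) F \<tau> \<delta> \<and>
      graded_inv_isomorphic G (M_alg G T \<beta> (std T \<beta>) \<kappa> \<gamma>, \<phi>) (M_star G T \<beta> (std T \<beta>) F \<tau> \<delta>)"
    if M: "M_data G T \<beta> \<kappa> \<gamma>" and \<phi>: "graded_involution G (M_alg G T \<beta> (std T \<beta>) \<kappa> \<gamma>) \<phi>" for T \<beta> \<kappa> \<gamma> \<phi>
    by (rule closed_realization.involution_isomorphic_M_star[OF closed[OF pair[OF M] elem[OF M \<phi>]] M \<phi>])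
  have iso: "graded_inv_isomorphic G (M_star G T1 \<beta>1 (std T1 \<beta>1) F1 \<tau>1 \<delta>1) (M_star G T2 \<beta>2 (std T2 \<beta>2) F2 \<tau>2 \<delta>2) \<longleftrightarrow>
      T1 = T2 \<and> \<beta>1 = \<beta>2 \<and> form1_equiv G T1 F1 \<tau>1 F2 \<tau>2 \<and> \<delta>1 = \<delta>2"
    (is "?I \<longleftrightarrow> _")
    if d: "M_star_data G T1 \<beta>1 (std T1 \<beta>1) F1 \<tau>1 \<delta>1" "M_star_data G T2 \<beta>2 (std T2 \<beta>2) F2 \<tau>2 \<delta>2"
    for T1 \<beta>1 F1 \<tau>1 \<delta>1 T2 \<beta>2 F2 \<tau>2 \<delta>2
  proof -
    have M: "M_data G T1 \<beta>1 (form_kappa F1) (form_gamma F1)" "M_data G T2 \<beta>2 (form_kappa F2) (form_gamma F2)"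
      and e: "elementary_2_group G T1"
      using d by (auto simp: M_star_data_def is_form1_def)
    note iff = closed_realization.M_star_isomorphic_iff[OF closed[OF pair[OF M(1)] e] d(1)]
    have same: "T1 = T2 \<and> \<beta>1 = \<beta>2" if ?I
      using same_bichar_if_M_star_isomorphic[OF std[OF pair[OF M(1)]] std[OF pair[OF M(2)]] M]
        that[unfolded M_star_def] by blast
    show ?thesis
    proof
      assume i: ?I
      then have s: "T1 = T2" "\<beta>1 = \<beta>2" using same by auto
      show "T1 = T2 \<and> \<beta>1 = \<beta>2 \<and> form1_equiv G T1 F1 \<tau>1 F2 \<tau>2 \<and> \<delta>1 = \<delta>2"
        using iff[of F2 \<tau>2 \<delta>2] d(2) i s by simp
    next
      assume "T1 = T2 \<and> \<beta>1 = \<beta>2 \<and> form1_equiv G T1 F1 \<tau>1 F2 \<tau>2 \<and> \<delta>1 = \<delta>2"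
      then have s: "T1 = T2" "\<beta>1 = \<beta>2" "form1_equiv G T1 F1 \<tau>1 F2 \<tau>2" "\<delta>1 = \<delta>2" by auto
      show ?I using iff[of F2 \<tau>2 \<delta>2] d(2) s(3) unfolding s(1,2,4) by blast
    qed
  qed
  show ?thesis by (intro conjI allI impI exists normal_form iso)
qed

end
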